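(* Let $A$ be a normed $K$-algebra and let $U$ be a normed right $A$-module which is flat as an abstract $A$-module. Let $(C^\bullet,\partial)$ be an exact cochain complex of left normed $A$-modules with strict morphisms, which is bounded above. (i) If the unit ball $U^\circ$ is flat over $A^\circ$, then $U\widehat{\otimes}_AC^\bullet$ is also exact. (ii) More generally, if $\operatorname{Tor}_s^{A^\circ}(U^\circ,(C^i)^\circ)$ has bounded $\pi$-torsion for each $s\ge0$ and each $i$, then $U\widehat{\otimes}_AC^\bullet$ is exact.
   Context: $K$ is a discretely valued field of mixed characteristic $(0,p)$ with discrete valuation ring $R$ and uniformizer $\pi$. All (semi-)norms are non-archimedean. For a semi-normed $K$-vector space $V$, $V^\circ$ is the set of elements of semi-norm $\le1$ and $\widehat V$ the completion. A normed $K$-algebra is unital, not necessarily commutative, with submultiplicative norm. A normed left $A$-module is a normed $K$-vector space $M$ with an $A$-module structure such that $|am|\le|a|\cdot|m|$; similarly for right modules. Morphisms are continuous (bounded) and $A$-linear. For a normed right module $M$ and normed left module $N$, $M\otimes_AN$ carries the tensor product semi-norm $\|x\|=\inf\max_i|m_i|\cdot|n_i|$ over all expressions $x=\sum_im_i\otimes n_i$, and $M\widehat{\otimes}_AN$ is its completion. A continuous linear map $\phi:G\to H$ of semi-normed $K$-vector spaces is strict if the natural map $G/\ker\phi\to\phi(G)$ is a homeomorphism, with quotient and subspace semi-norms respectively. An $R$-module has bounded $\pi$-torsion if some fixed power of $\pi$ annihilates all its elements that are killed by some power of $\pi$. *)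

theory Defs
  imports
    "HOL-Algebra.Module"
    "HOL-Algebra.QuotRing"
    "HOL-Algebra.Free_Abelian_Groups"
    "HOL-Analysis.Abstract_Topology"
    "HOL-Computational_Algebra.Primes"
begin

section \<open>Discretely valued fields of mixed characteristic\<close>

definition has_char :: "('r, 'z) ring_scheme \<Rightarrow> nat \<Rightarrow> bool"
  where "has_char R n \<longleftrightarrow> (\<forall>m::nat. [m] \<cdot>\<^bsub>R\<^esub> \<one>\<^bsub>R\<^esub> = \<zero>\<^bsub>R\<^esub> \<longleftrightarrow> n dvd m)"

locale valued_field = field K for K :: "('k, 'z) ring_scheme" (structure) +
  fixes av :: "'k \<Rightarrow> real"
  assumes av_nonneg: "x \<in> carrier K \<Longrightarrow> 0 \<le> av x"
    and av_eq_0_iff: "x \<in> carrier K \<Longrightarrow> av x = 0 \<longleftrightarrow> x = \<zero>"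
    and av_mult: "\<lbrakk>x \<in> carrier K; y \<in> carrier K\<rbrakk> \<Longrightarrow> av (x \<otimes> y) = av x * av y"
    and av_add: "\<lbrakk>x \<in> carrier K; y \<in> carrier K\<rbrakk> \<Longrightarrow> av (x \<oplus> y) \<le> max (av x) (av y)"

definition valuation_ring :: "('k, 'z) ring_scheme \<Rightarrow> ('k \<Rightarrow> real) \<Rightarrow> ('k, 'z) ring_scheme"
  where "valuation_ring K av = K\<lparr>carrier := {x \<in> carrier K. av x \<le> 1}\<rparr>"

locale mixed_char_dvf = valued_field K av
  for K :: "('k, 'z) ring_scheme" (structure) and av :: "'k \<Rightarrow> real" +
  fixes \<pi> :: 'k and p :: nat
  assumes uniformizer_closed: "\<pi> \<in> carrier K"
    and uniformizer_nonzero: "\<pi> \<noteq> \<zero>"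
    and uniformizer_lt_1: "av \<pi> < 1"
    and value_group: "\<lbrakk>x \<in> carrier K; x \<noteq> \<zero>\<rbrakk> \<Longrightarrow> \<exists>n::int. av x = av \<pi> powi n"
    and prime_p: "prime p"
    and field_char: "has_char K 0"
    and residue_char: "has_char (valuation_ring K av Quot {x \<in> carrier K. av x < 1}) p"

section \<open>Modules over a not necessarily commutative ring\<close>

text \<open>The library's module locale is confined to commutative rings; we reuse its record. For a right
  module, \<open>a \<odot> x\<close> stands for the right action of \<open>a\<close> on \<open>x\<close>.\<close>

locale left_module = R?: ring R + M?: abelian_group M
  for R :: "('a, 'y) ring_scheme" (structure) and M :: "('a, 'm, 'z) module_scheme" (structure) +
  assumes act_closed: "\<lbrakk>a \<in> carrier R; x \<in> carrier M\<rbrakk> \<Longrightarrow> a \<odot>\<^bsub>M\<^esub> x \<in> carrier M"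
    and act_add_ring: "\<lbrakk>a \<in> carrier R; b \<in> carrier R; x \<in> carrier M\<rbrakk> \<Longrightarrow>
      (a \<oplus>\<^bsub>R\<^esub> b) \<odot>\<^bsub>M\<^esub> x = a \<odot>\<^bsub>M\<^esub> x \<oplus>\<^bsub>M\<^esub> b \<odot>\<^bsub>M\<^esub> x"
    and act_add: "\<lbrakk>a \<in> carrier R; x \<in> carrier M; y \<in> carrier M\<rbrakk> \<Longrightarrow>
      a \<odot>\<^bsub>M\<^esub> (x \<oplus>\<^bsub>M\<^esub> y) = a \<odot>\<^bsub>M\<^esub> x \<oplus>\<^bsub>M\<^esub> a \<odot>\<^bsub>M\<^esub> y"
    and act_mult: "\<lbrakk>a \<in> carrier R; b \<in> carrier R; x \<in> carrier M\<rbrakk> \<Longrightarrow>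
      (a \<otimes>\<^bsub>R\<^esub> b) \<odot>\<^bsub>M\<^esub> x = a \<odot>\<^bsub>M\<^esub> (b \<odot>\<^bsub>M\<^esub> x)"
    and act_one: "x \<in> carrier M \<Longrightarrow> \<one>\<^bsub>R\<^esub> \<odot>\<^bsub>M\<^esub> x = x"

locale right_module = R?: ring R + M?: abelian_group M
  for R :: "('a, 'y) ring_scheme" (structure) and M :: "('a, 'm, 'z) module_scheme" (structure) +
  assumes act_closed: "\<lbrakk>a \<in> carrier R; x \<in> carrier M\<rbrakk> \<Longrightarrow> a \<odot>\<^bsub>M\<^esub> x \<in> carrier M"
    and act_add_ring: "\<lbrakk>a \<in> carrier R; b \<in> carrier R; x \<in> carrier M\<rbrakk> \<Longrightarrow>
      (a \<oplus>\<^bsub>R\<^esub> b) \<odot>\<^bsub>M\<^esub> x = a \<odot>\<^bsub>M\<^esub> x \<oplus>\<^bsub>M\<^esub> b \<odot>\<^bsub>M\<^esub> x"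
    and act_add: "\<lbrakk>a \<in> carrier R; x \<in> carrier M; y \<in> carrier M\<rbrakk> \<Longrightarrow>
      a \<odot>\<^bsub>M\<^esub> (x \<oplus>\<^bsub>M\<^esub> y) = a \<odot>\<^bsub>M\<^esub> x \<oplus>\<^bsub>M\<^esub> a \<odot>\<^bsub>M\<^esub> y"
    and act_mult: "\<lbrakk>a \<in> carrier R; b \<in> carrier R; x \<in> carrier M\<rbrakk> \<Longrightarrow>
      (a \<otimes>\<^bsub>R\<^esub> b) \<odot>\<^bsub>M\<^esub> x = b \<odot>\<^bsub>M\<^esub> (a \<odot>\<^bsub>M\<^esub> x)"
    and act_one: "x \<in> carrier M \<Longrightarrow> \<one>\<^bsub>R\<^esub> \<odot>\<^bsub>M\<^esub> x = x"

definition left_hom ::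
    "('a, 'y) ring_scheme \<Rightarrow> ('a, 'm, 'z) module_scheme \<Rightarrow> ('a, 'n, 'w) module_scheme \<Rightarrow> ('m \<Rightarrow> 'n) set"
  where "left_hom R M N =
    {f \<in> carrier M \<rightarrow> carrier N.
      (\<forall>x\<in>carrier M. \<forall>y\<in>carrier M. f (x \<oplus>\<^bsub>M\<^esub> y) = f x \<oplus>\<^bsub>N\<^esub> f y) \<and>
      (\<forall>a\<in>carrier R. \<forall>x\<in>carrier M. f (a \<odot>\<^bsub>M\<^esub> x) = a \<odot>\<^bsub>N\<^esub> f x)}"

text \<open>The fields \<open>mult\<close> and \<open>one\<close>, which the module record inherits from the ring record, play no
  role for modules.\<close>

definition quot_module :: "('r, 'm, 'z) module_scheme \<Rightarrow> 'm set \<Rightarrow> ('r, 'm set) module"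
  where "quot_module M W =
    \<lparr>carrier = a_rcosets\<^bsub>M\<^esub> W, monoid.mult = undefined, one = undefined,
     ring.zero = W, add = set_add M,
     smult = (\<lambda>r X. W <+>\<^bsub>M\<^esub> (\<lambda>x. r \<odot>\<^bsub>M\<^esub> x) ` X)\<rparr>"

text \<open>The map into the quotient of \<open>N\<close> by \<open>W\<close> which \<open>f\<close> induces on cosets; for an \<open>f\<close> that respects
  cosets, all members of the union coincide.\<close>

definition quot_map :: "('r, 'n, 'z) module_scheme \<Rightarrow> 'n set \<Rightarrow> ('m \<Rightarrow> 'n) \<Rightarrow> 'm set \<Rightarrow> 'n set"
  where "quot_map N W f X = (\<Union>x\<in>X. W +>\<^bsub>N\<^esub> f x)"

definition exact_cochain :: "(int \<Rightarrow> ('r, 'm, 'z) module_scheme) \<Rightarrow> (int \<Rightarrow> 'm \<Rightarrow> 'm) \<Rightarrow> bool"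
  where "exact_cochain C d \<longleftrightarrow>
    (\<forall>i. d (i - 1) ` carrier (C (i - 1)) = a_kernel (C i) (C (i + 1)) (d i))"

definition bounded_above_cochain :: "(int \<Rightarrow> ('r, 'm, 'z) module_scheme) \<Rightarrow> bool"
  where "bounded_above_cochain C \<longleftrightarrow> (\<exists>n. \<forall>i>n. carrier (C i) = {\<zero>\<^bsub>C i\<^esub>})"

definition bounded_torsion :: "('k, 'y) ring_scheme \<Rightarrow> 'k \<Rightarrow> ('k, 'm, 'z) module_scheme \<Rightarrow> bool"
  where "bounded_torsion K \<pi> M \<longleftrightarrow>
    (\<exists>n::nat. \<forall>x\<in>carrier M.
      (\<exists>m::nat. (\<pi> [^]\<^bsub>K\<^esub> m) \<odot>\<^bsub>M\<^esub> x = \<zero>\<^bsub>M\<^esub>) \<longrightarrow> (\<pi> [^]\<^bsub>K\<^esub> n) \<odot>\<^bsub>M\<^esub> x = \<zero>\<^bsub>M\<^esub>)"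

section \<open>Tensor products over an algebra\<close>

text \<open>An algebra \<open>A\<close> is a ring together with the scalar multiplication \<open>k \<odot> a\<close>; the tensor
  product of a right and a left \<open>A\<close>-module is the quotient of the free abelian group on pairs by the
  usual relations, with \<open>k\<close> acting as \<open>k (u \<otimes> n) = (u (k 1)) \<otimes> n\<close>.\<close>

definition tensor_free ::
    "('k, 'a, 'y) module_scheme \<Rightarrow> ('a, 'u, 'z) module_scheme \<Rightarrow> ('a, 'n, 'w) module_scheme \<Rightarrow>
      ('k, ('u \<times> 'n) \<Rightarrow>\<^sub>0 int) module"
  where "tensor_free A U N =
    \<lparr>carrier = carrier (free_Abelian_group (carrier U \<times> carrier N)),
     monoid.mult = undefined, one = undefined, ring.zero = 0, add = (+),
     smult = (\<lambda>k. frag_extend (\<lambda>(u, n). frag_of ((k \<odot>\<^bsub>A\<^esub> \<one>\<^bsub>A\<^esub>) \<odot>\<^bsub>U\<^esub> u, n)))\<rparr>"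

definition tensor_relations ::
    "('k, 'a, 'y) module_scheme \<Rightarrow> ('a, 'u, 'z) module_scheme \<Rightarrow> ('a, 'n, 'w) module_scheme \<Rightarrow>
      (('u \<times> 'n) \<Rightarrow>\<^sub>0 int) set"
  where "tensor_relations A U N = generate (free_Abelian_group (carrier U \<times> carrier N))
    ({frag_of (u \<oplus>\<^bsub>U\<^esub> u', n) - frag_of (u, n) - frag_of (u', n) | u u' n.
        u \<in> carrier U \<and> u' \<in> carrier U \<and> n \<in> carrier N} \<union>
     {frag_of (u, n \<oplus>\<^bsub>N\<^esub> n') - frag_of (u, n) - frag_of (u, n') | u n n'.
        u \<in> carrier U \<and> n \<in> carrier N \<and> n' \<in> carrier N} \<union>
     {frag_of (a \<odot>\<^bsub>U\<^esub> u, n) - frag_of (u, a \<odot>\<^bsub>N\<^esub> n) | a u n.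
        a \<in> carrier A \<and> u \<in> carrier U \<and> n \<in> carrier N})"

definition tensor ::
    "('k, 'a, 'y) module_scheme \<Rightarrow> ('a, 'u, 'z) module_scheme \<Rightarrow> ('a, 'n, 'w) module_scheme \<Rightarrow>
      ('k, (('u \<times> 'n) \<Rightarrow>\<^sub>0 int) set) module"
  where "tensor A U N = quot_module (tensor_free A U N) (tensor_relations A U N)"

definition pure_tensor ::
    "('k, 'a, 'y) module_scheme \<Rightarrow> ('a, 'u, 'z) module_scheme \<Rightarrow> ('a, 'n, 'w) module_scheme \<Rightarrow>
      'u \<Rightarrow> 'n \<Rightarrow> (('u \<times> 'n) \<Rightarrow>\<^sub>0 int) set"
  where "pure_tensor A U N u n = tensor_relations A U N +>\<^bsub>tensor_free A U N\<^esub> frag_of (u, n)"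

text \<open>\<open>tensor_map A U N g\<close> is the map \<open>id \<otimes> g\<close> into the tensor product of \<open>U\<close> and \<open>N\<close>, where \<open>N\<close>
  is the codomain of \<open>g\<close>.\<close>

definition tensor_map ::
    "('k, 'a, 'y) module_scheme \<Rightarrow> ('a, 'u, 'z) module_scheme \<Rightarrow> ('a, 'n, 'w) module_scheme \<Rightarrow>
      ('m \<Rightarrow> 'n) \<Rightarrow> (('u \<times> 'm) \<Rightarrow>\<^sub>0 int) set \<Rightarrow> (('u \<times> 'n) \<Rightarrow>\<^sub>0 int) set"
  where "tensor_map A U N g = quot_map (tensor_free A U N) (tensor_relations A U N)
    (frag_extend (\<lambda>(u, m). frag_of (u, g m)))"

text \<open>HOL cannot quantify over the modules in all types, so flatness refers to the modules whose
  elements come from a universe type \<open>'n\<close>. The notion does not depend on \<open>'n\<close> as soon as \<open>'a\<close>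
  embeds into \<open>'n\<close>: the inclusions of the left ideals into the ring, which decide flatness, are then
  available in \<open>'n\<close> up to isomorphism.\<close>

definition flat_right_module ::
    "'n itself \<Rightarrow> ('k, 'a, 'y) module_scheme \<Rightarrow> ('a, 'u, 'z) module_scheme \<Rightarrow> bool"
  where "flat_right_module _ A U \<longleftrightarrow>
    right_module A U \<and>
    (\<forall>(N :: ('a, 'n) module) (N' :: ('a, 'n) module) g.
      left_module A N \<and> left_module A N' \<and> g \<in> left_hom A N N' \<and> inj_on g (carrier N) \<longrightarrow>
      inj_on (tensor_map A U N' g) (carrier (tensor A U N)))"

section \<open>Tor\<close>

definition free_module :: "('a, 'y) ring_scheme \<Rightarrow> 'b set \<Rightarrow> ('a, 'b \<Rightarrow> 'a) module"
  where "free_module R B =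
    \<lparr>carrier = {f. (\<forall>b. f b \<in> carrier R) \<and> (\<forall>b. b \<notin> B \<longrightarrow> f b = \<zero>\<^bsub>R\<^esub>) \<and> finite {b. f b \<noteq> \<zero>\<^bsub>R\<^esub>}},
     monoid.mult = undefined, one = undefined,
     ring.zero = (\<lambda>_. \<zero>\<^bsub>R\<^esub>), add = (\<lambda>f g b. f b \<oplus>\<^bsub>R\<^esub> g b),
     smult = (\<lambda>a f b. a \<otimes>\<^bsub>R\<^esub> f b)\<rparr>"

definition linear_extension ::
    "('a, 'y) ring_scheme \<Rightarrow> ('a, 'm, 'z) module_scheme \<Rightarrow> ('b \<Rightarrow> 'm) \<Rightarrow> ('b \<Rightarrow> 'a) \<Rightarrow> 'm"
  where "linear_extension R M g f = (\<Oplus>\<^bsub>M\<^esub>b\<in>{b. f b \<noteq> \<zero>\<^bsub>R\<^esub>}. f b \<odot>\<^bsub>M\<^esub> g b)"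

text \<open>The canonical free resolution \<open>\<dots> \<rightarrow> F\<^sub>1 \<rightarrow> F\<^sub>0 \<rightarrow> M\<close> of a left module \<open>M\<close>: the module \<open>F\<^sub>0\<close> is free
  on the elements of \<open>M\<close>, and \<open>F\<^sub>n\<^sub>+\<^sub>1\<close> is free on the formal expressions \<open>\<Sum> a\<^sub>j b\<^sub>j\<close> in the basis
  elements \<open>b\<^sub>j\<close> of \<open>F\<^sub>n\<close> whose value lies in the kernel of the preceding map. The basis elements of all
  \<open>F\<^sub>n\<close> live in the single type \<open>syzygy\<close>, with \<open>Rel [(a\<^sub>1, b\<^sub>1), \<dots>]\<close> the formal expression above.\<close>

datatype ('a, 'm) syzygy = Gen 'm | Rel "('a \<times> ('a, 'm) syzygy) list"

primrec combination :: "('a, 'y) ring_scheme \<Rightarrow> ('a \<times> 'b) list \<Rightarrow> 'b \<Rightarrow> 'a"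
  where
    "combination R [] = (\<lambda>_. \<zero>\<^bsub>R\<^esub>)"
  | "combination R (ab # w) =
      (\<lambda>c. (if c = snd ab then fst ab else \<zero>\<^bsub>R\<^esub>) \<oplus>\<^bsub>R\<^esub> combination R w c)"

definition resolution_aug ::
    "('a, 'y) ring_scheme \<Rightarrow> ('a, 'm, 'z) module_scheme \<Rightarrow> (('a, 'm) syzygy \<Rightarrow> 'a) \<Rightarrow> 'm"
  where "resolution_aug R M =
    linear_extension R M (\<lambda>b. case b of Gen m \<Rightarrow> m | Rel _ \<Rightarrow> \<zero>\<^bsub>M\<^esub>)"

definition resolution_diff ::
    "('a, 'y) ring_scheme \<Rightarrow> (('a, 'm) syzygy \<Rightarrow> 'a) \<Rightarrow> (('a, 'm) syzygy \<Rightarrow> 'a)"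
  where "resolution_diff R =
    linear_extension R (free_module R UNIV)
      (\<lambda>b. case b of Gen _ \<Rightarrow> (\<lambda>_. \<zero>\<^bsub>R\<^esub>) | Rel w \<Rightarrow> combination R w)"

primrec resolution_basis ::
    "('a, 'y) ring_scheme \<Rightarrow> ('a, 'm, 'z) module_scheme \<Rightarrow> nat \<Rightarrow> ('a, 'm) syzygy set"
  where
    "resolution_basis R M 0 = Gen ` carrier M"
  | "resolution_basis R M (Suc n) =
      {Rel w | w. set w \<subseteq> carrier R \<times> resolution_basis R M n \<and>
        (if n = 0 then resolution_aug R M (combination R w) = \<zero>\<^bsub>M\<^esub>
         else resolution_diff R (combination R w) = (\<lambda>_. \<zero>\<^bsub>R\<^esub>))}"

definition resolution ::
    "('a, 'y) ring_scheme \<Rightarrow> ('a, 'm, 'z) module_scheme \<Rightarrow> nat \<Rightarrow> ('a, ('a, 'm) syzygy \<Rightarrow> 'a) module"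
  where "resolution R M n = free_module R (resolution_basis R M n)"

text \<open>\<open>tor_diff A U M n\<close> is \<open>id \<otimes> d\<close> from \<open>U \<otimes> F\<^sub>n\<^sub>+\<^sub>1\<close> to \<open>U \<otimes> F\<^sub>n\<close>.\<close>

definition tor_diff ::
    "('k, 'a, 'y) module_scheme \<Rightarrow> ('a, 'u, 'z) module_scheme \<Rightarrow> ('a, 'm, 'w) module_scheme \<Rightarrow> nat \<Rightarrow>
      (('u \<times> (('a, 'm) syzygy \<Rightarrow> 'a)) \<Rightarrow>\<^sub>0 int) set \<Rightarrow> (('u \<times> (('a, 'm) syzygy \<Rightarrow> 'a)) \<Rightarrow>\<^sub>0 int) set"
  where "tor_diff A U M n = tensor_map A U (resolution A M n) (resolution_diff A)"

primrec tor_cycles ::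
    "('k, 'a, 'y) module_scheme \<Rightarrow> ('a, 'u, 'z) module_scheme \<Rightarrow> ('a, 'm, 'w) module_scheme \<Rightarrow> nat \<Rightarrow>
      (('u \<times> (('a, 'm) syzygy \<Rightarrow> 'a)) \<Rightarrow>\<^sub>0 int) set set"
  where
    "tor_cycles A U M 0 = carrier (tensor A U (resolution A M 0))"
  | "tor_cycles A U M (Suc n) =
      a_kernel (tensor A U (resolution A M (Suc n))) (tensor A U (resolution A M n)) (tor_diff A U M n)"

definition Tor ::
    "('k, 'a, 'y) module_scheme \<Rightarrow> ('a, 'u, 'z) module_scheme \<Rightarrow> ('a, 'm, 'w) module_scheme \<Rightarrow> nat \<Rightarrow>
      ('k, (('u \<times> (('a, 'm) syzygy \<Rightarrow> 'a)) \<Rightarrow>\<^sub>0 int) set set) module"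
  where "Tor A U M n =
    quot_module ((tensor A U (resolution A M n))\<lparr>carrier := tor_cycles A U M n\<rparr>)
      (tor_diff A U M n ` carrier (tensor A U (resolution A M (Suc n))))"

section \<open>Normed spaces, algebras and modules\<close>

record ('r, 'm) normed_module = "('r, 'm) module" +
  nrm :: "'m \<Rightarrow> real" (\<open>\<parallel>_\<parallel>\<index>\<close>)

definition with_norm :: "('r, 'm, 'z) module_scheme \<Rightarrow> ('m \<Rightarrow> real) \<Rightarrow> ('r, 'm) normed_module"
  where "with_norm M f =
    \<lparr>carrier = carrier M, monoid.mult = monoid.mult M, one = \<one>\<^bsub>M\<^esub>, ring.zero = \<zero>\<^bsub>M\<^esub>, add = ring.add M,
     smult = module.smult M,
     nrm = f\<rparr>"

definition unit_ball :: "('r, 'm, 'z) normed_module_scheme \<Rightarrow> ('r, 'm, 'z) normed_module_scheme"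
  where "unit_ball V = V\<lparr>carrier := {x \<in> carrier V. \<parallel>x\<parallel>\<^bsub>V\<^esub> \<le> 1}\<rparr>"

locale normed_space = K?: valued_field K av + V?: Module.module K V
  for K :: "('k, 'y) ring_scheme" (structure) and av :: "'k \<Rightarrow> real"
    and V :: "('k, 'v, 'z) normed_module_scheme" (structure) +
  assumes nrm_nonneg: "x \<in> carrier V \<Longrightarrow> 0 \<le> \<parallel>x\<parallel>\<^bsub>V\<^esub>"
    and nrm_eq_0_iff: "x \<in> carrier V \<Longrightarrow> \<parallel>x\<parallel>\<^bsub>V\<^esub> = 0 \<longleftrightarrow> x = \<zero>\<^bsub>V\<^esub>"
    and nrm_add: "\<lbrakk>x \<in> carrier V; y \<in> carrier V\<rbrakk> \<Longrightarrow> \<parallel>x \<oplus>\<^bsub>V\<^esub> y\<parallel>\<^bsub>V\<^esub> \<le> max \<parallel>x\<parallel>\<^bsub>V\<^esub> \<parallel>y\<parallel>\<^bsub>V\<^esub>"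
    and nrm_smult: "\<lbrakk>k \<in> carrier K; x \<in> carrier V\<rbrakk> \<Longrightarrow> \<parallel>k \<odot>\<^bsub>V\<^esub> x\<parallel>\<^bsub>V\<^esub> = av k * \<parallel>x\<parallel>\<^bsub>V\<^esub>"

text \<open>The condition \<open>nrm_one\<close> makes the unit ball of \<open>A\<close> a unital ring, as is needed to speak of
  flatness and Tor over it. For a nonzero algebra it amounts to \<open>\<parallel>\<one>\<parallel> = 1\<close>.\<close>

locale normed_algebra = normed_space K av A + A?: ring A
  for K :: "('k, 'y) ring_scheme" (structure) and av :: "'k \<Rightarrow> real"
    and A :: "('k, 'a, 'z) normed_module_scheme" (structure) +
  assumes smult_mult_left: "\<lbrakk>k \<in> carrier K; a \<in> carrier A; b \<in> carrier A\<rbrakk> \<Longrightarrow>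
      (k \<odot>\<^bsub>A\<^esub> a) \<otimes>\<^bsub>A\<^esub> b = k \<odot>\<^bsub>A\<^esub> (a \<otimes>\<^bsub>A\<^esub> b)"
    and smult_mult_right: "\<lbrakk>k \<in> carrier K; a \<in> carrier A; b \<in> carrier A\<rbrakk> \<Longrightarrow>
      a \<otimes>\<^bsub>A\<^esub> (k \<odot>\<^bsub>A\<^esub> b) = k \<odot>\<^bsub>A\<^esub> (a \<otimes>\<^bsub>A\<^esub> b)"
    and nrm_mult: "\<lbrakk>a \<in> carrier A; b \<in> carrier A\<rbrakk> \<Longrightarrow> \<parallel>a \<otimes>\<^bsub>A\<^esub> b\<parallel>\<^bsub>A\<^esub> \<le> \<parallel>a\<parallel>\<^bsub>A\<^esub> * \<parallel>b\<parallel>\<^bsub>A\<^esub>"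
    and nrm_one: "\<parallel>\<one>\<^bsub>A\<^esub>\<parallel>\<^bsub>A\<^esub> \<le> 1"

text \<open>The vector space underlying an \<open>A\<close>-module, by restriction of scalars along \<open>k \<mapsto> k 1\<close>.\<close>

definition restrict_scalars ::
    "('k, 'a, 'y) module_scheme \<Rightarrow> ('a, 'm, 'z) normed_module_scheme \<Rightarrow> ('k, 'm) normed_module"
  where "restrict_scalars A M =
    \<lparr>carrier = carrier M, monoid.mult = monoid.mult M, one = \<one>\<^bsub>M\<^esub>, ring.zero = \<zero>\<^bsub>M\<^esub>, add = ring.add M,
     smult = (\<lambda>k x. (k \<odot>\<^bsub>A\<^esub> \<one>\<^bsub>A\<^esub>) \<odot>\<^bsub>M\<^esub> x), nrm = nrm M\<rparr>"

definition normed_left_module ::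
    "('k, 'x) ring_scheme \<Rightarrow> ('k \<Rightarrow> real) \<Rightarrow> ('k, 'a, 'y) normed_module_scheme \<Rightarrow>
      ('a, 'm, 'z) normed_module_scheme \<Rightarrow> bool"
  where "normed_left_module K av A M \<longleftrightarrow>
    left_module A M \<and> normed_space K av (restrict_scalars A M) \<and>
    (\<forall>a\<in>carrier A. \<forall>x\<in>carrier M. \<parallel>a \<odot>\<^bsub>M\<^esub> x\<parallel>\<^bsub>M\<^esub> \<le> \<parallel>a\<parallel>\<^bsub>A\<^esub> * \<parallel>x\<parallel>\<^bsub>M\<^esub>)"

definition normed_right_module ::
    "('k, 'x) ring_scheme \<Rightarrow> ('k \<Rightarrow> real) \<Rightarrow> ('k, 'a, 'y) normed_module_scheme \<Rightarrow>
      ('a, 'm, 'z) normed_module_scheme \<Rightarrow> bool"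
  where "normed_right_module K av A M \<longleftrightarrow>
    right_module A M \<and> normed_space K av (restrict_scalars A M) \<and>
    (\<forall>a\<in>carrier A. \<forall>x\<in>carrier M. \<parallel>a \<odot>\<^bsub>M\<^esub> x\<parallel>\<^bsub>M\<^esub> \<le> \<parallel>a\<parallel>\<^bsub>A\<^esub> * \<parallel>x\<parallel>\<^bsub>M\<^esub>)"

definition bounded_left_hom ::
    "('a, 'y) ring_scheme \<Rightarrow> ('a, 'm, 'z) normed_module_scheme \<Rightarrow> ('a, 'n, 'w) normed_module_scheme \<Rightarrow>
      ('m \<Rightarrow> 'n) set"
  where "bounded_left_hom A M N =
    {f \<in> left_hom A M N. \<exists>c::real. \<forall>x\<in>carrier M. \<parallel>f x\<parallel>\<^bsub>N\<^esub> \<le> c * \<parallel>x\<parallel>\<^bsub>M\<^esub>}"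

section \<open>Strict maps\<close>

definition quot_normed :: "('r, 'm, 'z) normed_module_scheme \<Rightarrow> 'm set \<Rightarrow> ('r, 'm set) normed_module"
  where "quot_normed V W = with_norm (quot_module V W) (\<lambda>X. Inf (nrm V ` X))"

definition seminorm_topology :: "('r, 'm, 'z) normed_module_scheme \<Rightarrow> 'm topology"
  where "seminorm_topology V = topology (\<lambda>S. S \<subseteq> carrier V \<and>
    (\<forall>x\<in>S. \<exists>e>0. \<forall>y\<in>carrier V. \<parallel>y \<ominus>\<^bsub>V\<^esub> x\<parallel>\<^bsub>V\<^esub> < e \<longrightarrow> y \<in> S))"

lemma openin_seminorm_topology:
  "openin (seminorm_topology V) S \<longleftrightarrow> S \<subseteq> carrier V \<and>
    (\<forall>x\<in>S. \<exists>e>0. \<forall>y\<in>carrier V. \<parallel>y \<ominus>\<^bsub>V\<^esub> x\<parallel>\<^bsub>V\<^esub> < e \<longrightarrow> y \<in> S)"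
proof -
  let ?P = "\<lambda>S. S \<subseteq> carrier V \<and>
    (\<forall>x\<in>S. \<exists>e>0. \<forall>y\<in>carrier V. \<parallel>y \<ominus>\<^bsub>V\<^esub> x\<parallel>\<^bsub>V\<^esub> < e \<longrightarrow> y \<in> S)"
  have "?P (S \<inter> T)" if S: "?P S" and T: "?P T" for S T
  proof (intro conjI ballI)
    fix x assume x: "x \<in> S \<inter> T"
    obtain e where e: "e > 0" "\<forall>y\<in>carrier V. \<parallel>y \<ominus>\<^bsub>V\<^esub> x\<parallel>\<^bsub>V\<^esub> < e \<longrightarrow> y \<in> S"
      using S x by blast
    obtain e' where e': "e' > 0" "\<forall>y\<in>carrier V. \<parallel>y \<ominus>\<^bsub>V\<^esub> x\<parallel>\<^bsub>V\<^esub> < e' \<longrightarrow> y \<in> T"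
      using T x by blast
    show "\<exists>e>0. \<forall>y\<in>carrier V. \<parallel>y \<ominus>\<^bsub>V\<^esub> x\<parallel>\<^bsub>V\<^esub> < e \<longrightarrow> y \<in> S \<inter> T"
      using e e' by (intro exI[of _ "min e e'"]) auto
  qed (use S in blast)
  moreover have "?P (\<Union>\<K>)" if "\<forall>S\<in>\<K>. ?P S" for \<K>
  proof (intro conjI ballI)
    fix x assume "x \<in> \<Union>\<K>"
    then obtain S where "S \<in> \<K>" "x \<in> S" by blast
    with that show "\<exists>e>0. \<forall>y\<in>carrier V. \<parallel>y \<ominus>\<^bsub>V\<^esub> x\<parallel>\<^bsub>V\<^esub> < e \<longrightarrow> y \<in> \<Union>\<K>"
      by (meson UnionI)
  qed (use that in blast)
  ultimately have "istopology ?P"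
    unfolding istopology_def by blast
  then show ?thesis
    by (simp add: seminorm_topology_def)
qed

definition strict_map ::
    "('r, 'm, 'z) normed_module_scheme \<Rightarrow> ('r, 'n, 'w) normed_module_scheme \<Rightarrow> ('m \<Rightarrow> 'n) \<Rightarrow> bool"
  where "strict_map G H \<phi> \<longleftrightarrow>
    homeomorphic_map
      (seminorm_topology (quot_normed G (a_kernel G H \<phi>)))
      (seminorm_topology (H\<lparr>carrier := \<phi> ` carrier G\<rparr>))
      (\<lambda>X. the_elem (\<phi> ` X))"

section \<open>Completed tensor products\<close>

text \<open>The completion of a semi-normed space is the space of its Cauchy sequences, with semi-norm
  \<open>lim \<parallel>x\<^sub>n\<parallel>\<close>, modulo the null sequences.\<close>

definition cauchy_space :: "('r, 'm, 'z) normed_module_scheme \<Rightarrow> ('r, nat \<Rightarrow> 'm) normed_module"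
  where "cauchy_space V =
    \<lparr>carrier = {x. (\<forall>n. x n \<in> carrier V) \<and>
       (\<forall>e>0. \<exists>n0. \<forall>m\<ge>n0. \<forall>n\<ge>n0. \<parallel>x m \<ominus>\<^bsub>V\<^esub> x n\<parallel>\<^bsub>V\<^esub> < e)},
     monoid.mult = undefined, one = undefined,
     ring.zero = (\<lambda>_. \<zero>\<^bsub>V\<^esub>), add = (\<lambda>x y n. x n \<oplus>\<^bsub>V\<^esub> y n),
     smult = (\<lambda>r x n. r \<odot>\<^bsub>V\<^esub> x n), nrm = (\<lambda>x. lim (\<lambda>n. \<parallel>x n\<parallel>\<^bsub>V\<^esub>))\<rparr>"

definition null_sequences :: "('r, 'm, 'z) normed_module_scheme \<Rightarrow> (nat \<Rightarrow> 'm) set"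
  where "null_sequences V = {x. (\<forall>n. x n \<in> carrier V) \<and> (\<lambda>n. \<parallel>x n\<parallel>\<^bsub>V\<^esub>) \<longlonglongrightarrow> 0}"

definition completion :: "('r, 'm, 'z) normed_module_scheme \<Rightarrow> ('r, (nat \<Rightarrow> 'm) set) normed_module"
  where "completion V = quot_normed (cauchy_space V) (null_sequences V)"

text \<open>\<open>completion_map W f\<close> is the map into the completion of \<open>W\<close> induced by \<open>f\<close>.\<close>

definition completion_map ::
    "('r, 'n, 'z) normed_module_scheme \<Rightarrow> ('m \<Rightarrow> 'n) \<Rightarrow> (nat \<Rightarrow> 'm) set \<Rightarrow> (nat \<Rightarrow> 'n) set"
  where "completion_map W f = quot_map (cauchy_space W) (null_sequences W) (\<lambda>x. f \<circ> x)"

definition tensor_seminorm ::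
    "('k, 'a, 'y) module_scheme \<Rightarrow> ('a, 'u, 'z) normed_module_scheme \<Rightarrow>
      ('a, 'n, 'w) normed_module_scheme \<Rightarrow> (('u \<times> 'n) \<Rightarrow>\<^sub>0 int) set \<Rightarrow> real"
  where "tensor_seminorm A U N x =
    Inf {Max (insert 0 ((\<lambda>i. \<parallel>u i\<parallel>\<^bsub>U\<^esub> * \<parallel>n i\<parallel>\<^bsub>N\<^esub>) ` {..<r})) | (r::nat) u n.
      (\<forall>i<r. u i \<in> carrier U \<and> n i \<in> carrier N) \<and>
      x = (\<Oplus>\<^bsub>tensor A U N\<^esub>i\<in>{..<r}. pure_tensor A U N (u i) (n i))}"

definition normed_tensor ::
    "('k, 'a, 'y) module_scheme \<Rightarrow> ('a, 'u, 'z) normed_module_scheme \<Rightarrow>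
      ('a, 'n, 'w) normed_module_scheme \<Rightarrow> ('k, (('u \<times> 'n) \<Rightarrow>\<^sub>0 int) set) normed_module"
  where "normed_tensor A U N = with_norm (tensor A U N) (tensor_seminorm A U N)"

definition completed_tensor ::
    "('k, 'a, 'y) module_scheme \<Rightarrow> ('a, 'u, 'z) normed_module_scheme \<Rightarrow>
      ('a, 'n, 'w) normed_module_scheme \<Rightarrow> ('k, (nat \<Rightarrow> (('u \<times> 'n) \<Rightarrow>\<^sub>0 int) set) set) normed_module"
  where "completed_tensor A U N = completion (normed_tensor A U N)"

definition completed_tensor_map ::
    "('k, 'a, 'y) module_scheme \<Rightarrow> ('a, 'u, 'z) normed_module_scheme \<Rightarrow>
      ('a, 'n, 'w) normed_module_scheme \<Rightarrow> ('m \<Rightarrow> 'n) \<Rightarrow>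
      (nat \<Rightarrow> (('u \<times> 'm) \<Rightarrow>\<^sub>0 int) set) set \<Rightarrow> (nat \<Rightarrow> (('u \<times> 'n) \<Rightarrow>\<^sub>0 int) set) set"
  where "completed_tensor_map A U N g = completion_map (normed_tensor A U N) (tensor_map A U N g)"

end

theory Submission
  imports Defs
begin

text \<open>
  Exactness is preserved by completion if it holds with bounds: there is a constant \<open>c\<close> such that
  every cycle of norm at most \<open>r\<close> is the boundary of an element of norm at most \<open>c r\<close>. The limit of a
  Cauchy sequence of cycles is then a boundary, because the successive differences can be lifted to
  elements that tend to \<open>0\<close>, and in a non-archimedean group such elements sum up to a Cauchy sequence
  (\<open>completion_exact\<close>, \<open>exact_completed_tensor\<close>). What has to be proved is therefore that \<open>U \<otimes> C\<close> is
  strictly exact (\<open>strictly_exact_at\<close>).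

  A bound on a tensor is a statement about unit balls. Since the powers of \<open>\<pi>\<close> have arbitrarily large
  and arbitrarily small absolute values, an element of norm at most \<open>r\<close> becomes, after multiplication
  by a scalar of absolute value about \<open>1 / r\<close>, a tensor of elements of the unit balls (\<open>integralize\<close>).
  Conversely, a relation that holds over \<open>A\<close> holds over the unit ball of \<open>A\<close> after multiplication by a
  power of \<open>\<pi>\<close> (\<open>clear_denominators\<close>), but this power depends on the relation.

  If the unit ball of \<open>U\<close> is flat, take a cycle in the tensor product of the unit balls of \<open>U\<close> and \<open>C\<^sup>i\<close>.
  A high power of \<open>\<pi>\<close> times \<open>d\<close> has the same kernel as \<open>d\<close> and maps the cycle to \<open>0\<close> already over the unit
  balls. By flatness the cycle comes from the unit ball of the kernel of \<open>d\<close>, with no loss in the norm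
  whatever the power of \<open>\<pi>\<close> was, and strictness of \<open>d\<close> lifts the unit ball of the kernel
  (\<open>strictly_exact_of_flat_unit_ball\<close>).

  If the Tor groups have bounded torsion, consider the canonical free resolution of the unit ball of
  \<open>C\<^sup>i\<close>. After inverting \<open>\<pi>\<close> it is a strict resolution of \<open>C\<^sup>i\<close>. Tensored with \<open>U\<close> it is exact, because \<open>U\<close> is
  flat over \<open>A\<close>; so over the unit balls every cycle becomes a boundary after multiplication by some
  power of \<open>\<pi>\<close>. Its class in Tor is torsion, hence a power of \<open>\<pi>\<close> that does not depend on the cycle is
  enough, and this is strict exactness (\<open>strict_tensor_resolution\<close>).

  The resolutions of the individual \<open>C\<^sup>i\<close> form no double complex in general, because the maps that lift \<open>d\<close>
  compose to zero only up to homotopy. They are the pieces of a twisted total complex \<open>P\<close> that maps to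
  \<open>C\<close>; as \<open>C\<close> is bounded above, it can be built from the top downwards (\<open>ex_twisted\<close>). Let \<open>P\<close> consist of
  the resolutions of the \<open>C\<^sup>i\<close> with \<open>i \<ge> m\<close>, let \<open>X\<^sub>0\<close> in \<open>U \<otimes> P\<^sup>j\<close> lift a cycle \<open>x\<close> of \<open>U \<otimes> C\<^sup>j\<close>, and let
  \<open>m = j - 1\<close>. The boundary of \<open>X\<^sub>0\<close> maps to \<open>0\<close> in \<open>U \<otimes> C\<close>; peeling off the resolutions one by one shows
  that it is the boundary of some \<open>Y\<close> all of whose components lie in the resolutions of the \<open>C\<^sup>i\<close> with
  \<open>i > j\<close>, so that \<open>Y\<close> maps to \<open>0\<close> in \<open>U \<otimes> C\<^sup>j\<close> (\<open>tensor_twisted_exact\<close>). Hence \<open>X\<^sub>0 - Y\<close> is a cycle which still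
  lifts \<open>x\<close>. Above degree \<open>m\<close> the complex \<open>P\<close> is an exact complex of free modules which is bounded above.
  It is contractible there by bounded maps (\<open>ex_contraction\<close>), and a contraction survives the tensor
  product with \<open>U\<close>. So \<open>X\<^sub>0 - Y\<close> is a boundary in \<open>U \<otimes> P\<close>, and \<open>x\<close> is one in \<open>U \<otimes> C\<close> (\<open>strictly_exact\<close>). All
  steps come with bounds.
\<close>

section \<open>Tensor products as formal sums modulo relations\<close>

definition tensor_generators ::
    "('k, 'a, 'y) module_scheme \<Rightarrow> ('a, 'u, 'z) module_scheme \<Rightarrow> ('a, 'n, 'w) module_scheme \<Rightarrow>
      (('u \<times> 'n) \<Rightarrow>\<^sub>0 int) set"
  where "tensor_generators A U N =
    {frag_of (u \<oplus>\<^bsub>U\<^esub> u', n) - frag_of (u, n) - frag_of (u', n) | u u' n.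
        u \<in> carrier U \<and> u' \<in> carrier U \<and> n \<in> carrier N} \<union>
     {frag_of (u, n \<oplus>\<^bsub>N\<^esub> n') - frag_of (u, n) - frag_of (u, n') | u n n'.
        u \<in> carrier U \<and> n \<in> carrier N \<and> n' \<in> carrier N} \<union>
     {frag_of (a \<odot>\<^bsub>U\<^esub> u, n) - frag_of (u, a \<odot>\<^bsub>N\<^esub> n) | a u n.
        a \<in> carrier A \<and> u \<in> carrier U \<and> n \<in> carrier N}"

lemma tensor_relations_generate:
  "tensor_relations A U N =
    generate (free_Abelian_group (carrier U \<times> carrier N)) (tensor_generators A U N)"
  by (simp add: tensor_relations_def tensor_generators_def)

definition tensor_frags ::
    "('a, 'u, 'z) module_scheme \<Rightarrow> ('a, 'n, 'w) module_scheme \<Rightarrow> (('u \<times> 'n) \<Rightarrow>\<^sub>0 int) set"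
  where "tensor_frags U N = {x. Poly_Mapping.keys x \<subseteq> carrier U \<times> carrier N}"

definition frag_map :: "('m \<Rightarrow> 'n) \<Rightarrow> (('u \<times> 'm) \<Rightarrow>\<^sub>0 int) \<Rightarrow> (('u \<times> 'n) \<Rightarrow>\<^sub>0 int)"
  where "frag_map f = frag_extend (\<lambda>(u, m). frag_of (u, f m))"

lemma tensor_frags_0 [simp]: "0 \<in> tensor_frags U N"
  by (simp add: tensor_frags_def)

lemma tensor_frags_frag_of [simp]:
  "frag_of (u, n) \<in> tensor_frags U N \<longleftrightarrow> u \<in> carrier U \<and> n \<in> carrier N"
  by (simp add: tensor_frags_def)

lemma tensor_frags_diff [simp]:
  "\<lbrakk>x \<in> tensor_frags U N; y \<in> tensor_frags U N\<rbrakk> \<Longrightarrow> x - y \<in> tensor_frags U N"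
  using keys_diff[of x y] by (auto simp: tensor_frags_def)

lemma tensor_frags_minus [simp]: "- x \<in> tensor_frags U N \<longleftrightarrow> x \<in> tensor_frags U N"
  by (simp add: tensor_frags_def)

lemma tensor_frags_add [simp]:
  "\<lbrakk>x \<in> tensor_frags U N; y \<in> tensor_frags U N\<rbrakk> \<Longrightarrow> x + y \<in> tensor_frags U N"
  using keys_add[of x y] by (auto simp: tensor_frags_def)

lemma tensor_frags_mono:
  "\<lbrakk>x \<in> tensor_frags U N; carrier U \<subseteq> carrier U'; carrier N \<subseteq> carrier N'\<rbrakk> \<Longrightarrow> x \<in> tensor_frags U' N'"
  by (force simp: tensor_frags_def)

lemma tensor_frags_induct [consumes 1, case_names zero diff pure]:
  assumes "x \<in> tensor_frags U N" and "P 0"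
    and "\<And>x y. \<lbrakk>x \<in> tensor_frags U N; y \<in> tensor_frags U N; P x; P y\<rbrakk> \<Longrightarrow> P (x - y)"
    and "\<And>u n. \<lbrakk>u \<in> carrier U; n \<in> carrier N\<rbrakk> \<Longrightarrow> P (frag_of (u, n))"
  shows "P x"
  using assms(1) unfolding tensor_frags_def mem_Collect_eq
  by (rule free_Abelian_group_induct) (use assms in \<open>auto simp: tensor_frags_def\<close>)

lemma frag_extend_tensor_frags:
  assumes "x \<in> tensor_frags U N"
    and "\<And>u n. \<lbrakk>u \<in> carrier U; n \<in> carrier N\<rbrakk> \<Longrightarrow> g (u, n) \<in> tensor_frags U' N'"
  shows "frag_extend g x \<in> tensor_frags U' N'"
  using assms(1) by (induction rule: tensor_frags_induct) (auto simp: frag_extend_diff assms(2))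

lemma frag_map_0 [simp]: "frag_map f 0 = 0"
  by (simp add: frag_map_def)

lemma frag_map_frag_of [simp]: "frag_map f (frag_of (u, n)) = frag_of (u, f n)"
  by (simp add: frag_map_def)

lemma frag_map_diff [simp]: "frag_map f (x - y) = frag_map f x - frag_map f y"
  by (simp add: frag_map_def frag_extend_diff)

lemma frag_map_add [simp]: "frag_map f (x + y) = frag_map f x + frag_map f y"
  by (simp add: frag_map_def frag_extend_add)

lemma frag_map_closed:
  "\<lbrakk>x \<in> tensor_frags U N; \<And>n. n \<in> carrier N \<Longrightarrow> f n \<in> carrier N'\<rbrakk> \<Longrightarrow> frag_map f x \<in> tensor_frags U N'"
  unfolding frag_map_def by (rule frag_extend_tensor_frags) auto

lemma frag_map_cong:
  assumes "x \<in> tensor_frags U N" and "\<And>n. n \<in> carrier N \<Longrightarrow> f n = g n"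
  shows "frag_map f x = frag_map g x"
  using assms(1) by (induction rule: tensor_frags_induct) (auto simp: assms(2))

lemma frag_map_comp: "frag_map f (frag_map g x) = frag_map (\<lambda>n. f (g n)) x"
  by (rule frag_induction[where c = x and S = UNIV]) auto

lemma frag_map_ident:
  assumes "x \<in> tensor_frags U N" and "\<And>n. n \<in> carrier N \<Longrightarrow> f n = n"
  shows "frag_map f x = x"
  using assms(1) by (induction rule: tensor_frags_induct) (auto simp: assms(2))

subsection \<open>Linear maps\<close>

lemma left_hom_closed: "\<lbrakk>f \<in> left_hom R M N; x \<in> carrier M\<rbrakk> \<Longrightarrow> f x \<in> carrier N"
  by (auto simp: left_hom_def)

lemma left_hom_add:
  "\<lbrakk>f \<in> left_hom R M N; x \<in> carrier M; y \<in> carrier M\<rbrakk> \<Longrightarrow> f (x \<oplus>\<^bsub>M\<^esub> y) = f x \<oplus>\<^bsub>N\<^esub> f y"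
  by (auto simp: left_hom_def)

lemma left_hom_act:
  "\<lbrakk>f \<in> left_hom R M N; a \<in> carrier R; x \<in> carrier M\<rbrakk> \<Longrightarrow> f (a \<odot>\<^bsub>M\<^esub> x) = a \<odot>\<^bsub>N\<^esub> f x"
  by (auto simp: left_hom_def)

lemma left_homI:
  assumes "\<And>x. x \<in> carrier M \<Longrightarrow> f x \<in> carrier N"
    and "\<And>x y. \<lbrakk>x \<in> carrier M; y \<in> carrier M\<rbrakk> \<Longrightarrow> f (x \<oplus>\<^bsub>M\<^esub> y) = f x \<oplus>\<^bsub>N\<^esub> f y"
    and "\<And>a x. \<lbrakk>a \<in> carrier R; x \<in> carrier M\<rbrakk> \<Longrightarrow> f (a \<odot>\<^bsub>M\<^esub> x) = a \<odot>\<^bsub>N\<^esub> f x"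
  shows "f \<in> left_hom R M N"
  using assms by (auto simp: left_hom_def)

lemma left_hom_comp:
  "\<lbrakk>f \<in> left_hom R M N; g \<in> left_hom R N P\<rbrakk> \<Longrightarrow> (\<lambda>x. g (f x)) \<in> left_hom R M P"
  by (intro left_homI) (auto simp: left_hom_closed left_hom_add left_hom_act)

lemma left_hom_zero:
  assumes "f \<in> left_hom R M N" "abelian_group M" "abelian_group N"
  shows "f \<zero>\<^bsub>M\<^esub> = \<zero>\<^bsub>N\<^esub>"
proof -
  interpret M: abelian_group M by fact
  interpret N: abelian_group N by fact
  have "f \<zero>\<^bsub>M\<^esub> \<oplus>\<^bsub>N\<^esub> f \<zero>\<^bsub>M\<^esub> = f \<zero>\<^bsub>M\<^esub>"
    using left_hom_add[OF assms(1) M.zero_closed M.zero_closed] by simp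
  then show ?thesis
    using left_hom_closed[OF assms(1) M.zero_closed] N.add.l_cancel_one by blast
qed

lemma left_hom_uminus:
  assumes "f \<in> left_hom R M N" "abelian_group M" "abelian_group N" "x \<in> carrier M"
  shows "f (\<ominus>\<^bsub>M\<^esub> x) = \<ominus>\<^bsub>N\<^esub> f x"
proof -
  interpret M: abelian_group M by fact
  interpret N: abelian_group N by fact
  have "f (\<ominus>\<^bsub>M\<^esub> x) \<oplus>\<^bsub>N\<^esub> f x = \<zero>\<^bsub>N\<^esub>"
    using left_hom_add[OF assms(1), of "\<ominus>\<^bsub>M\<^esub> x" x] left_hom_zero[OF assms(1-3)] assms(4)
    by (simp add: M.l_neg)
  then show ?thesis
    using assms by (metis M.a_inv_closed N.minus_equality left_hom_closed)
qed

lemma left_hom_minus: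
  assumes "f \<in> left_hom R M N" "abelian_group M" "abelian_group N" "x \<in> carrier M" "y \<in> carrier M"
  shows "f (x \<ominus>\<^bsub>M\<^esub> y) = f x \<ominus>\<^bsub>N\<^esub> f y"
  using assms abelian_group.a_inv_closed[OF assms(2)]
  by (simp add: a_minus_def left_hom_add left_hom_uminus)

context left_module
begin

lemma act_zero [simp]: "a \<in> carrier R \<Longrightarrow> a \<odot>\<^bsub>M\<^esub> \<zero>\<^bsub>M\<^esub> = \<zero>\<^bsub>M\<^esub>"
  by (metis M.add.l_cancel_one M.zero_closed M.l_zero act_add act_closed)

lemma zero_act [simp]: "x \<in> carrier M \<Longrightarrow> \<zero>\<^bsub>R\<^esub> \<odot>\<^bsub>M\<^esub> x = \<zero>\<^bsub>M\<^esub>"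
  by (metis M.add.l_cancel_one R.zero_closed R.l_zero act_add_ring act_closed)

lemma submodule:
  assumes "W \<subseteq> carrier M" "\<zero>\<^bsub>M\<^esub> \<in> W" "\<And>x y. \<lbrakk>x \<in> W; y \<in> W\<rbrakk> \<Longrightarrow> x \<oplus>\<^bsub>M\<^esub> y \<in> W"
    and "\<And>a x. \<lbrakk>a \<in> carrier R; x \<in> W\<rbrakk> \<Longrightarrow> a \<odot>\<^bsub>M\<^esub> x \<in> W"
  shows "left_module R (M\<lparr>carrier := W\<rparr>)"
proof -
  have "(\<ominus>\<^bsub>R\<^esub> \<one>\<^bsub>R\<^esub>) \<odot>\<^bsub>M\<^esub> x \<oplus>\<^bsub>M\<^esub> x = \<zero>\<^bsub>M\<^esub>" if "x \<in> W" for x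
    using that assms(1) act_add_ring[of "\<ominus>\<^bsub>R\<^esub> \<one>\<^bsub>R\<^esub>" "\<one>\<^bsub>R\<^esub>" x] by (auto simp: R.l_neg act_one)
  then have "\<exists>y\<in>W. y \<oplus>\<^bsub>M\<^esub> x = \<zero>\<^bsub>M\<^esub>" if "x \<in> W" for x
    using assms(4) that by (metis R.a_inv_closed R.one_closed)
  then have "abelian_group (M\<lparr>carrier := W\<rparr>)"
    using assms(1-3) by (intro abelian_groupI) (auto simp: subset_iff M.a_assoc intro: M.a_comm)
  then show ?thesis
    using assms by (auto intro!: left_module.intro left_module_axioms.intro R.ring_axioms
        simp: subset_iff act_add_ring act_add act_mult act_one)
qed

end

locale tensor_factor = right_module A U
  for A :: "('k, 'a, 'y) module_scheme" and U :: "('a, 'u, 'z) module_scheme"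
begin

abbreviation rel :: "('a, 'n, 'w) module_scheme \<Rightarrow> (('u \<times> 'n) \<Rightarrow>\<^sub>0 int) set"
  where "rel \<equiv> tensor_relations A U"

lemma tensor_generators_frags:
  "left_module A N \<Longrightarrow> tensor_generators A U N \<subseteq> tensor_frags U N"
proof -
  assume "left_module A N"
  then interpret N: left_module A N .
  show ?thesis
    by (auto simp: tensor_generators_def act_closed N.act_closed)
qed

lemma rel_frags: "left_module A N \<Longrightarrow> x \<in> rel N \<Longrightarrow> x \<in> tensor_frags U N"
  using group.generate_incl[OF group_free_Abelian_group, of "tensor_generators A U N"
      "carrier U \<times> carrier N"] tensor_generators_frags[of N]
  unfolding tensor_relations_generate tensor_frags_def free_Abelian_group_def by fastforce

lemma rel_subgroup:
  "left_module A N \<Longrightarrow> subgroup (rel N) (free_Abelian_group (carrier U \<times> carrier N))"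
  unfolding tensor_relations_generate
  by (rule group.generate_is_subgroup[OF group_free_Abelian_group])
    (use tensor_generators_frags[of N] in \<open>simp add: tensor_frags_def free_Abelian_group_def\<close>)

lemma rel_0 [simp]: "0 \<in> rel N"
  using generate.one[of "free_Abelian_group (carrier U \<times> carrier N)"]
  by (simp add: tensor_relations_generate)

lemma rel_add: "\<lbrakk>x \<in> rel N; y \<in> rel N\<rbrakk> \<Longrightarrow> x + y \<in> rel N"
  using generate.eng[of x "free_Abelian_group (carrier U \<times> carrier N)"]
  by (simp add: tensor_relations_generate)

lemma rel_minus: "\<lbrakk>left_module A N; x \<in> rel N\<rbrakk> \<Longrightarrow> - x \<in> rel N"
  using subgroup.m_inv_closed[OF rel_subgroup, of N x] rel_frags[of N x]
  by (simp add: tensor_frags_def)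

lemma rel_diff: "\<lbrakk>left_module A N; x \<in> rel N; y \<in> rel N\<rbrakk> \<Longrightarrow> x - y \<in> rel N"
  using rel_add[of x N "- y"] rel_minus[of N y] by simp

lemma rel_minus_commute: "left_module A N \<Longrightarrow> x - y \<in> rel N \<Longrightarrow> y - x \<in> rel N"
  using rel_minus[of N "x - y"] by simp

lemma rel_trans: "\<lbrakk>x - y \<in> rel N; y - z \<in> rel N\<rbrakk> \<Longrightarrow> x - z \<in> rel N"
  using rel_add[of "x - y" N "y - z"] by simp

lemma rel_generator: "x \<in> tensor_generators A U N \<Longrightarrow> x \<in> rel N"
  unfolding tensor_relations_generate by (rule generate.incl)

lemma rel_add_left:
  "\<lbrakk>u \<in> carrier U; u' \<in> carrier U; n \<in> carrier N\<rbrakk> \<Longrightarrow>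
    frag_of (u \<oplus>\<^bsub>U\<^esub> u', n) - frag_of (u, n) - frag_of (u', n) \<in> rel N"
  by (rule rel_generator) (auto simp: tensor_generators_def)

lemma rel_add_right:
  "\<lbrakk>u \<in> carrier U; n \<in> carrier N; n' \<in> carrier N\<rbrakk> \<Longrightarrow>
    frag_of (u, n \<oplus>\<^bsub>N\<^esub> n') - frag_of (u, n) - frag_of (u, n') \<in> rel N"
  by (rule rel_generator) (auto simp: tensor_generators_def)

lemma rel_act:
  "\<lbrakk>a \<in> carrier A; u \<in> carrier U; n \<in> carrier N\<rbrakk> \<Longrightarrow>
    frag_of (a \<odot>\<^bsub>U\<^esub> u, n) - frag_of (u, a \<odot>\<^bsub>N\<^esub> n) \<in> rel N"
  by (rule rel_generator) (auto simp: tensor_generators_def)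

lemma rel_zero_left:
  assumes "left_module A N" "n \<in> carrier N"
  shows "frag_of (\<zero>\<^bsub>U\<^esub>, n) \<in> rel N"
  using rel_minus[OF assms(1) rel_add_left[of "\<zero>\<^bsub>U\<^esub>" "\<zero>\<^bsub>U\<^esub>" n N]] assms(2) by simp

lemma rel_zero_right:
  assumes "left_module A N" "u \<in> carrier U"
  shows "frag_of (u, \<zero>\<^bsub>N\<^esub>) \<in> rel N"
proof -
  interpret N: left_module A N by fact
  show ?thesis
    using rel_minus[OF assms(1) rel_add_right[of u "\<zero>\<^bsub>N\<^esub>" N "\<zero>\<^bsub>N\<^esub>"]] assms(2) by simp
qed

lemma rel_minus_left:
  assumes "left_module A N" "u \<in> carrier U" "n \<in> carrier N"
  shows "- frag_of (u, n) - frag_of (\<ominus>\<^bsub>U\<^esub> u, n) \<in> rel N"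
  using rel_add[OF rel_add_left[of u "\<ominus>\<^bsub>U\<^esub> u" n N] rel_minus[OF assms(1) rel_zero_left[OF assms(1,3)]]] assms
  by (simp add: M.r_neg)

lemma rel_diff_right:
  assumes "left_module A N" "u \<in> carrier U" "n \<in> carrier N" "n' \<in> carrier N"
  shows "frag_of (u, n) - frag_of (u, n') - frag_of (u, n \<ominus>\<^bsub>N\<^esub> n') \<in> rel N"
proof -
  interpret N: left_module A N by fact
  have "n' \<oplus>\<^bsub>N\<^esub> (n \<ominus>\<^bsub>N\<^esub> n') = n"
    using assms(3,4) N.M.a_comm[of n' "n \<ominus>\<^bsub>N\<^esub> n'"] by (simp add: N.M.minus_eq N.M.a_assoc N.M.l_neg)
  then show ?thesis
    using rel_add_right[of u n' N "n \<ominus>\<^bsub>N\<^esub> n'"] assms by simp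
qed

lemma rel_induct [consumes 2, case_names zero diff add_left add_right act]:
  assumes N: "left_module A N" and x: "x \<in> rel N"
    and zero: "P 0" and diff: "\<And>x y. \<lbrakk>x \<in> rel N; y \<in> rel N; P x; P y\<rbrakk> \<Longrightarrow> P (x - y)"
    and gen: "\<And>u u' n. \<lbrakk>u \<in> carrier U; u' \<in> carrier U; n \<in> carrier N\<rbrakk> \<Longrightarrow>
      P (frag_of (u \<oplus>\<^bsub>U\<^esub> u', n) - frag_of (u, n) - frag_of (u', n))"
      "\<And>u n n'. \<lbrakk>u \<in> carrier U; n \<in> carrier N; n' \<in> carrier N\<rbrakk> \<Longrightarrow>
      P (frag_of (u, n \<oplus>\<^bsub>N\<^esub> n') - frag_of (u, n) - frag_of (u, n'))"
      "\<And>a u n. \<lbrakk>a \<in> carrier A; u \<in> carrier U; n \<in> carrier N\<rbrakk> \<Longrightarrow>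
      P (frag_of (a \<odot>\<^bsub>U\<^esub> u, n) - frag_of (u, a \<odot>\<^bsub>N\<^esub> n))"
  shows "P x"
proof -
  have gens: "P g" if "g \<in> tensor_generators A U N" for g
    using that gen by (auto simp: tensor_generators_def)
  have "x \<in> rel N \<and> P x"
    using x[unfolded tensor_relations_generate]
  proof (induction rule: generate.induct)
    case one
    then show ?case using zero by simp
  next
    case (incl h)
    then show ?case using gens rel_generator by blast
  next
    case (inv h)
    then have "inv\<^bsub>free_Abelian_group (carrier U \<times> carrier N)\<^esub> h = 0 - h"
      using tensor_generators_frags[OF N] by (auto simp: tensor_frags_def)
    then show ?case
      using diff[OF rel_0 rel_generator[OF inv] zero gens[OF inv]]
        rel_diff[OF N rel_0 rel_generator[OF inv]] by simp
  next
    case (eng h1 h2)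
    then have "P (0 - h2)" "0 - h2 \<in> rel N"
      using diff[OF rel_0 _ zero] rel_diff[OF N rel_0] by blast+
    then have "P (h1 - (0 - h2))"
      using diff eng by blast
    then show ?case using eng rel_add[of h1 N h2] by simp
  qed
  then show ?thesis ..
qed

lemma rel_cong: "\<lbrakk>left_module A N; x - y \<in> rel N\<rbrakk> \<Longrightarrow> x \<in> rel N \<longleftrightarrow> y \<in> rel N"
  by (metis rel_add rel_minus_commute diff_add_cancel)

lemma frag_map_rel:
  assumes "left_module A N" "left_module A N'" "f \<in> left_hom A N N'" "x \<in> rel N"
  shows "frag_map f x \<in> rel N'"
  using assms(1,4)
proof (induction rule: rel_induct)
  case (diff x y)
  then show ?case using rel_diff[OF assms(2)] by simp
qed (use assms(3) in \<open>auto simp: left_hom_closed left_hom_add left_hom_act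
    intro!: rel_add_left rel_add_right rel_act\<close>)

lemma frag_map_zero:
  assumes "left_module A N'" "x \<in> tensor_frags U N" "\<And>n. n \<in> carrier N \<Longrightarrow> f n = \<zero>\<^bsub>N'\<^esub>"
  shows "frag_map f x \<in> rel N'"
  using assms(2) by (induction rule: tensor_frags_induct)
    (auto simp: rel_diff assms(1,3) rel_zero_right)

lemma frag_map_sum:
  assumes N': "left_module A N'" and x: "x \<in> tensor_frags U N"
    and f: "\<And>n. n \<in> carrier N \<Longrightarrow> f n \<in> carrier N'" and g: "\<And>n. n \<in> carrier N \<Longrightarrow> g n \<in> carrier N'"
  shows "frag_map (\<lambda>n. f n \<oplus>\<^bsub>N'\<^esub> g n) x - (frag_map f x + frag_map g x) \<in> rel N'"
  using x
proof (induction rule: tensor_frags_induct)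
  case (diff x y)
  then show ?case
    using rel_diff[OF N' diff(3,4)] by (simp add: algebra_simps)
next
  case (pure u n)
  then show ?case
    using rel_add_right[of u "f n" N' "g n"] f g by (simp add: algebra_simps)
qed simp

end

lemma left_module_image:
  assumes N: "left_module R N" and N': "left_module R N'" and h: "h \<in> left_hom R N N'"
  shows "left_module R (N'\<lparr>carrier := h ` carrier N\<rparr>)"
proof -
  interpret N: left_module R N by fact
  interpret N': left_module R N' by fact
  show ?thesis
  proof (rule N'.submodule)
    show "h ` carrier N \<subseteq> carrier N'" using left_hom_closed[OF h] by auto
    show "\<zero>\<^bsub>N'\<^esub> \<in> h ` carrier N"
      using left_hom_zero[OF h N.M.abelian_group_axioms N'.M.abelian_group_axioms]
      by (intro image_eqI[where x = "\<zero>\<^bsub>N\<^esub>"]) auto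
    show "x \<oplus>\<^bsub>N'\<^esub> y \<in> h ` carrier N" if xy: "x \<in> h ` carrier N" "y \<in> h ` carrier N" for x y
    proof -
      obtain m n where "m \<in> carrier N" "n \<in> carrier N" "x = h m" "y = h n" using xy by blast
      then show ?thesis
        using left_hom_add[OF h, of m n] N.M.a_closed[of m n]
        by (intro image_eqI[where x = "m \<oplus>\<^bsub>N\<^esub> n"]) auto
    qed
    show "a \<odot>\<^bsub>N'\<^esub> x \<in> h ` carrier N" if ax: "a \<in> carrier R" "x \<in> h ` carrier N" for a x
    proof -
      obtain m where "m \<in> carrier N" "x = h m" using ax by blast
      then show ?thesis
        using left_hom_act[OF h, of a m] N.act_closed[of a m] ax(1)
        by (intro image_eqI[where x = "a \<odot>\<^bsub>N\<^esub> m"]) auto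
    qed
  qed
qed

subsection \<open>Cosets\<close>

definition tensor_class ::
    "('k, 'a, 'y) module_scheme \<Rightarrow> ('a, 'u, 'z) module_scheme \<Rightarrow> ('a, 'n, 'w) module_scheme \<Rightarrow>
      (('u \<times> 'n) \<Rightarrow>\<^sub>0 int) \<Rightarrow> (('u \<times> 'n) \<Rightarrow>\<^sub>0 int) set"
  where "tensor_class A U N x = {y. y - x \<in> tensor_relations A U N}"

lemma a_r_coset_tensor_class: "tensor_relations A U N +>\<^bsub>tensor_free A U N\<^esub> x = tensor_class A U N x"
  by (auto simp: a_r_coset_def' tensor_free_def tensor_class_def algebra_simps)

lemma pure_tensor_class: "pure_tensor A U N u n = tensor_class A U N (frag_of (u, n))"
  by (simp add: pure_tensor_def a_r_coset_tensor_class)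

lemma carrier_tensor: "carrier (tensor A U N) = tensor_class A U N ` tensor_frags U N"
  by (auto simp: tensor_def quot_module_def A_RCOSETS_def' a_r_coset_tensor_class)
    (auto simp: tensor_free_def tensor_frags_def free_Abelian_group_def)

lemma zero_tensor: "\<zero>\<^bsub>tensor A U N\<^esub> = tensor_class A U N 0"
  by (simp add: tensor_def quot_module_def tensor_class_def)

definition frag_act :: "('a \<Rightarrow> 'u \<Rightarrow> 'u) \<Rightarrow> 'a \<Rightarrow> (('u \<times> 'n) \<Rightarrow>\<^sub>0 int) \<Rightarrow> (('u \<times> 'n) \<Rightarrow>\<^sub>0 int)"
  where "frag_act act a = frag_extend (\<lambda>(u, n). frag_of (act a u, n))"

lemma frag_act_0 [simp]: "frag_act f a 0 = 0"
  by (simp add: frag_act_def)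

lemma frag_act_frag_of [simp]: "frag_act f a (frag_of (u, n)) = frag_of (f a u, n)"
  by (simp add: frag_act_def)

lemma frag_act_diff [simp]: "frag_act f a (x - y) = frag_act f a x - frag_act f a y"
  by (simp add: frag_act_def frag_extend_diff)

lemma frag_act_frag_map: "frag_act f a (frag_map g x) = frag_map g (frag_act f a x)"
  by (rule frag_induction[where c = x and S = UNIV]) auto

context tensor_factor
begin

abbreviation cls :: "('a, 'n, 'w) module_scheme \<Rightarrow> (('u \<times> 'n) \<Rightarrow>\<^sub>0 int) \<Rightarrow> (('u \<times> 'n) \<Rightarrow>\<^sub>0 int) set"
  where "cls \<equiv> tensor_class A U"

lemma cls_self [simp]: "x \<in> cls N x"
  by (simp add: tensor_class_def)

lemma cls_eq_iff: "left_module A N \<Longrightarrow> cls N x = cls N y \<longleftrightarrow> x - y \<in> rel N"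
proof -
  assume N: "left_module A N"
  have "x - y \<in> rel N" if "cls N x = cls N y"
    using cls_self[of x N] unfolding that by (simp add: tensor_class_def)
  moreover have "cls N x = cls N y" if "x - y \<in> rel N"
  proof -
    have "z - x \<in> rel N \<longleftrightarrow> z - y \<in> rel N" for z
      using that rel_cong[OF N, of "z - y" "z - x"] by simp
    then show ?thesis by (simp add: tensor_class_def)
  qed
  ultimately show ?thesis
    by blast
qed

lemma cls_zero_iff: "left_module A N \<Longrightarrow> cls N x = \<zero>\<^bsub>tensor A U N\<^esub> \<longleftrightarrow> x \<in> rel N"
  by (simp add: zero_tensor cls_eq_iff)

lemma add_cls:
  assumes "left_module A N"
  shows "cls N x \<oplus>\<^bsub>tensor A U N\<^esub> cls N y = cls N (x + y)"
proof -
  have "z \<in> cls N (x + y)" if "a \<in> cls N x" "b \<in> cls N y" "z = a + b" for z a b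
    using rel_add[of "a - x" N "b - y"] that by (simp add: tensor_class_def algebra_simps)
  moreover have "\<exists>a\<in>cls N x. \<exists>b\<in>cls N y. z = a + b" if "z \<in> cls N (x + y)" for z
    using that by (intro bexI[of _ x] bexI[of _ "z - x"]) (auto simp: tensor_class_def algebra_simps)
  ultimately show ?thesis
    by (auto simp: tensor_def quot_module_def set_add_def' tensor_free_def)
qed

lemma abelian_group_tensor:
  assumes N: "left_module A N"
  shows "abelian_group (tensor A U N)"
proof (rule abelian_groupI)
  fix X assume "X \<in> carrier (tensor A U N)"
  then obtain x where x: "x \<in> tensor_frags U N" "X = cls N x"
    by (auto simp: carrier_tensor)
  then show "\<exists>Y\<in>carrier (tensor A U N). Y \<oplus>\<^bsub>tensor A U N\<^esub> X = \<zero>\<^bsub>tensor A U N\<^esub>"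
    by (intro bexI[of _ "cls N (- x)"]) (auto simp: carrier_tensor add_cls[OF N] zero_tensor)
qed (auto simp: carrier_tensor add_cls[OF N] zero_tensor algebra_simps)

lemma uminus_cls:
  assumes N: "left_module A N" and x: "x \<in> tensor_frags U N"
  shows "\<ominus>\<^bsub>tensor A U N\<^esub> cls N x = cls N (- x)"
proof -
  interpret T: abelian_group "tensor A U N" by (rule abelian_group_tensor[OF N])
  show ?thesis
    using x by (intro T.minus_equality) (auto simp: carrier_tensor add_cls[OF N] zero_tensor)
qed

lemma finsum_cls:
  fixes r :: nat
  assumes N: "left_module A N" and "\<And>i. i < r \<Longrightarrow> x i \<in> tensor_frags U N"
  shows "(\<Oplus>\<^bsub>tensor A U N\<^esub>i\<in>{..<r}. cls N (x i)) = cls N (\<Sum>i<r. x i)"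
  using assms(2)
proof (induction r)
  case 0
  interpret T: abelian_group "tensor A U N" by (rule abelian_group_tensor[OF N])
  show ?case by (simp add: zero_tensor)
next
  case (Suc r)
  interpret T: abelian_group "tensor A U N" by (rule abelian_group_tensor[OF N])
  show ?case
    using Suc by (simp add: lessThan_Suc T.finsum_insert carrier_tensor Pi_iff add_cls[OF N] add.commute)
qed

lemma tensor_map_cls:
  assumes N: "left_module A N" and N': "left_module A N'" and g: "g \<in> left_hom A N N'"
  shows "tensor_map A U N' g (cls N x) = cls N' (frag_map g x)"
proof -
  have "cls N' (frag_map g y) = cls N' (frag_map g x)" if "y \<in> cls N x" for y
    using that frag_map_rel[OF N N' g, of "y - x"] unfolding cls_eq_iff[OF N']
    by (simp add: tensor_class_def)
  then have "(\<Union>y\<in>cls N x. cls N' (frag_map g y)) = cls N' (frag_map g x)"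
    using cls_self by blast
  then show ?thesis
    by (simp add: tensor_map_def quot_map_def a_r_coset_tensor_class flip: frag_map_def)
qed

lemma frag_act_closed:
  "\<lbrakk>a \<in> carrier A; x \<in> tensor_frags U N\<rbrakk> \<Longrightarrow> frag_act (smult U) a x \<in> tensor_frags U N"
  unfolding frag_act_def by (rule frag_extend_tensor_frags) (auto simp: act_closed)

lemma frag_act_rel:
  assumes N: "left_module A N" and x: "x \<in> rel N" and a: "a \<in> carrier A"
    and central: "\<And>b. b \<in> carrier A \<Longrightarrow> a \<otimes>\<^bsub>A\<^esub> b = b \<otimes>\<^bsub>A\<^esub> a"
  shows "frag_act (smult U) a x \<in> rel N"
  using N x
proof (induction rule: rel_induct)
  case (diff x y)
  then show ?case using rel_diff[OF N] by simp
next
  case (act b u n)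
  moreover have "a \<odot>\<^bsub>U\<^esub> (b \<odot>\<^bsub>U\<^esub> u) = b \<odot>\<^bsub>U\<^esub> (a \<odot>\<^bsub>U\<^esub> u)"
    using act a central by (metis act_mult)
  ultimately show ?case
    using rel_act[of b "a \<odot>\<^bsub>U\<^esub> u" n N] a by (simp add: act_closed)
qed (use a in \<open>auto simp: act_closed act_add intro: rel_add_left rel_add_right\<close>)

lemma smult_cls:
  assumes N: "left_module A N" and a: "k \<odot>\<^bsub>A\<^esub> \<one>\<^bsub>A\<^esub> \<in> carrier A"
    and central: "\<And>b. b \<in> carrier A \<Longrightarrow> (k \<odot>\<^bsub>A\<^esub> \<one>\<^bsub>A\<^esub>) \<otimes>\<^bsub>A\<^esub> b = b \<otimes>\<^bsub>A\<^esub> (k \<odot>\<^bsub>A\<^esub> \<one>\<^bsub>A\<^esub>)"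
  shows "k \<odot>\<^bsub>tensor A U N\<^esub> cls N x = cls N (frag_act (smult U) (k \<odot>\<^bsub>A\<^esub> \<one>\<^bsub>A\<^esub>) x)"
proof -
  let ?f = "frag_act (smult U) (k \<odot>\<^bsub>A\<^esub> \<one>\<^bsub>A\<^esub>) :: _ \<Rightarrow> ('u \<times> 'b) \<Rightarrow>\<^sub>0 int"
  have f: "smult (tensor_free A U N) k = ?f"
    by (simp add: tensor_free_def frag_act_def)
  have "h + ?f y \<in> cls N (?f x)" if "h \<in> rel N" "y \<in> cls N x" for h y
    using rel_add[OF that(1) frag_act_rel[OF N _ a central, of "y - x"]] that(2)
    by (simp add: tensor_class_def algebra_simps)
  moreover have "\<exists>h\<in>rel N. \<exists>y\<in>cls N x. z = h + ?f y" if "z \<in> cls N (?f x)" for z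
    using that by (intro bexI[of _ "z - ?f x"] bexI[of _ x]) (auto simp: tensor_class_def)
  ultimately have "(\<Union>h\<in>rel N. \<Union>y\<in>cls N x. {h + ?f y}) = cls N (?f x)"
    by blast
  then show ?thesis
    by (simp add: tensor_def quot_module_def set_add_def' f) (simp add: tensor_free_def)
qed

subsection \<open>Exactness\<close>

text \<open>Sections of \<open>h\<close> need not be linear. Applying one to the relations over the image of \<open>h\<close> gives
  relations over \<open>N\<close> up to tensors of elements of the kernel, and the set \<open>G\<close> of all elements that are
  congruent to such tensors absorbs this error.\<close>

lemma tensor_right_exact:
  assumes N: "left_module A N" and N': "left_module A N'" and h: "h \<in> left_hom A N N'"
    and x: "x \<in> tensor_frags U N" and hx: "frag_map h x \<in> rel (N'\<lparr>carrier := h ` carrier N\<rparr>)"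
  shows "\<exists>y\<in>tensor_frags U (N\<lparr>carrier := {n \<in> carrier N. h n = \<zero>\<^bsub>N'\<^esub>}\<rparr>). x - y \<in> rel N"
proof -
  interpret N: left_module A N by fact
  interpret N': left_module A N' by fact
  note hmm = left_hom_closed[OF h] left_hom_add[OF h] left_hom_act[OF h]
    left_hom_minus[OF h N.M.abelian_group_axioms N'.M.abelian_group_axioms]
  have zero: "h \<zero>\<^bsub>N\<^esub> = \<zero>\<^bsub>N'\<^esub>"
    by (rule left_hom_zero[OF h N.M.abelian_group_axioms N'.M.abelian_group_axioms])
  let ?ker = "N\<lparr>carrier := {n \<in> carrier N. h n = \<zero>\<^bsub>N'\<^esub>}\<rparr>"
  let ?im = "N'\<lparr>carrier := h ` carrier N\<rparr>"
  have im: "left_module A ?im"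
    by (rule left_module_image[OF N N' h])
  then interpret im: left_module A ?im .
  define G where "G = {x \<in> tensor_frags U N. \<exists>y\<in>tensor_frags U ?ker. x - y \<in> rel N}"
  have G_diff: "a - b \<in> G" if ab: "a \<in> G" "b \<in> G" for a b
  proof -
    obtain c d where "c \<in> tensor_frags U ?ker" "d \<in> tensor_frags U ?ker" "a - c \<in> rel N" "b - d \<in> rel N"
      using ab by (auto simp: G_def)
    then have "c - d \<in> tensor_frags U ?ker" "(a - b) - (c - d) \<in> rel N"
      using rel_diff[OF N, of "a - c" "b - d"] by (auto simp: algebra_simps)
    then show ?thesis using ab by (auto simp: G_def)
  qed
  have G_0: "0 \<in> G"
    by (auto simp: G_def intro!: bexI[of _ 0])
  have G_rel: "a \<in> G" if "a \<in> rel N" for a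
    using that rel_frags[OF N that] by (auto simp: G_def intro!: bexI[of _ 0])
  have G_add: "a + b \<in> G" if "a \<in> G" "b \<in> G" for a b
    using G_diff[OF that(1) G_diff[OF G_0 that(2)]] by simp
  have G_ker: "a \<in> G" if "a \<in> tensor_frags U ?ker" for a
    using that tensor_frags_mono[OF that, of U N] by (auto simp: G_def intro!: bexI[of _ a])
  \<comment> \<open>A section of \<open>h\<close>, in general not linear.\<close>
  define s where "s z = (SOME n. n \<in> carrier N \<and> h n = z)" for z
  have s: "s z \<in> carrier N" "h (s z) = z" if "z \<in> h ` carrier N" for z
    using someI_ex[of "\<lambda>n. n \<in> carrier N \<and> h n = z"] that unfolding s_def by blast+
  have sG: "frag_map s z \<in> G" if "z \<in> rel ?im" for z
    using im that
  proof (induction rule: rel_induct)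
    case zero
    show ?case by (simp add: G_0)
  next
    case (diff x y)
    then show ?case using G_diff by simp
  next
    case (add_left u u' n)
    then show ?case using s by (auto intro!: G_rel rel_add_left)
  next
    case (add_right u n n')
    let ?k = "s (n \<oplus>\<^bsub>N'\<^esub> n') \<ominus>\<^bsub>N\<^esub> (s n \<oplus>\<^bsub>N\<^esub> s n')"
    have nn': "n \<oplus>\<^bsub>N'\<^esub> n' \<in> h ` carrier N"
      using add_right im.M.a_closed[of n n'] by simp
    have k: "frag_of (u, ?k) \<in> G"
      using add_right s nn' hmm by (intro G_ker) (auto simp: N'.M.r_neg N'.M.minus_eq)
    have "frag_of (u, s (n \<oplus>\<^bsub>N'\<^esub> n')) - frag_of (u, s n \<oplus>\<^bsub>N\<^esub> s n') - frag_of (u, ?k) \<in> rel N"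
      using add_right s nn' by (intro rel_diff_right N) auto
    moreover have "frag_of (u, s n \<oplus>\<^bsub>N\<^esub> s n') - frag_of (u, s n) - frag_of (u, s n') \<in> rel N"
      using add_right s by (intro rel_add_right) auto
    ultimately have "(frag_of (u, s (n \<oplus>\<^bsub>N'\<^esub> n')) - frag_of (u, s n \<oplus>\<^bsub>N\<^esub> s n') - frag_of (u, ?k)) +
        (frag_of (u, s n \<oplus>\<^bsub>N\<^esub> s n') - frag_of (u, s n) - frag_of (u, s n')) \<in> G"
      by (intro G_rel rel_add)
    from G_add[OF this k] show ?case by (simp add: algebra_simps)
  next
    case (act a u n)
    let ?k = "a \<odot>\<^bsub>N\<^esub> s n \<ominus>\<^bsub>N\<^esub> s (a \<odot>\<^bsub>N'\<^esub> n)"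
    have an: "a \<odot>\<^bsub>N'\<^esub> n \<in> h ` carrier N"
      using act im.act_closed[of a n] by simp
    have k: "frag_of (u, ?k) \<in> G"
      using act s an hmm by (intro G_ker) (auto simp: N'.M.r_neg N'.M.minus_eq N.act_closed)
    have "frag_of (u, a \<odot>\<^bsub>N\<^esub> s n) - frag_of (u, s (a \<odot>\<^bsub>N'\<^esub> n)) - frag_of (u, ?k) \<in> rel N"
      using act s an by (intro rel_diff_right N) (auto simp: N.act_closed)
    moreover have "frag_of (a \<odot>\<^bsub>U\<^esub> u, s n) - frag_of (u, a \<odot>\<^bsub>N\<^esub> s n) \<in> rel N"
      using act s by (intro rel_act) auto
    ultimately have "(frag_of (u, a \<odot>\<^bsub>N\<^esub> s n) - frag_of (u, s (a \<odot>\<^bsub>N'\<^esub> n)) - frag_of (u, ?k)) +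
        (frag_of (a \<odot>\<^bsub>U\<^esub> u, s n) - frag_of (u, a \<odot>\<^bsub>N\<^esub> s n)) \<in> G"
      by (intro G_rel rel_add)
    from G_add[OF this k] show ?case by simp
  qed
  have "x - frag_map s (frag_map h x) \<in> G"
    using x
  proof (induction rule: tensor_frags_induct)
    case zero
    show ?case by (simp add: G_0)
  next
    case (diff x y)
    then show ?case using G_diff[OF diff(3,4)] by (simp add: algebra_simps)
  next
    case (pure u n)
    let ?k = "n \<ominus>\<^bsub>N\<^esub> s (h n)"
    have k: "frag_of (u, ?k) \<in> G"
      using pure s hmm by (intro G_ker) (auto simp: N'.M.r_neg N'.M.minus_eq)
    have "frag_of (u, n) - frag_of (u, s (h n)) - frag_of (u, ?k) \<in> rel N"
      using pure s by (intro rel_diff_right N) auto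
    from G_add[OF G_rel[OF this] k] show ?case by simp
  qed
  from G_add[OF this sG[OF hx]] have "x \<in> G" by simp
  then show ?thesis by (simp add: G_def)
qed

end

text \<open>Structure transport along \<open>j\<close>, which brings a module into the universe type of the flatness
  predicate.\<close>

definition transport :: "('m \<Rightarrow> 'n) \<Rightarrow> ('a, 'm, 'z) module_scheme \<Rightarrow> ('a, 'n) module"
  where "transport j N =
    \<lparr>carrier = j ` carrier N, monoid.mult = undefined, one = undefined, ring.zero = j \<zero>\<^bsub>N\<^esub>,
     add = (\<lambda>x y. j (inv_into (carrier N) j x \<oplus>\<^bsub>N\<^esub> inv_into (carrier N) j y)),
     smult = (\<lambda>a x. j (a \<odot>\<^bsub>N\<^esub> inv_into (carrier N) j x))\<rparr>"

lemma left_module_transport: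
  assumes "left_module R N" and j: "inj_on j (carrier N)"
  shows "left_module R (transport j N)"
proof -
  interpret N: left_module R N by fact
  have "abelian_group (transport j N)"
  proof (rule abelian_groupI)
    fix x assume "x \<in> carrier (transport j N)"
    then show "\<exists>y\<in>carrier (transport j N). y \<oplus>\<^bsub>transport j N\<^esub> x = \<zero>\<^bsub>transport j N\<^esub>"
      using j by (auto simp: transport_def N.M.l_neg intro!: bexI[of _ "\<ominus>\<^bsub>N\<^esub> _"])
  qed (use j in \<open>auto simp: transport_def N.M.a_ac\<close>)
  then show ?thesis
    using j by (auto intro!: left_module.intro left_module_axioms.intro N.R.ring_axioms
        simp: transport_def N.act_closed N.act_add_ring N.act_add N.act_mult N.act_one)
qed

lemma transport_hom: "inj_on j (carrier N) \<Longrightarrow> j \<in> left_hom R N (transport j N)"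
  by (auto simp: left_hom_def transport_def)

lemma transport_inv_hom:
  assumes "left_module R N" and "inj_on j (carrier N)"
  shows "inv_into (carrier N) j \<in> left_hom R (transport j N) N"
proof -
  interpret N: left_module R N by fact
  show ?thesis
    using assms by (auto simp: left_hom_def transport_def N.act_closed)
qed

text \<open>The map \<open>j\<close> embeds \<open>N\<close> into the universe type \<open>'n\<close> of the flatness predicate, which is applied to the
  inclusion of the copy of \<open>W\<close> in the copy of \<open>N\<close>.\<close>

lemma flat_submodule:
  fixes N :: "('a, 'm, 'w) module_scheme" and j :: "'m \<Rightarrow> 'n"
  assumes flat: "flat_right_module TYPE('n) A U" and N: "left_module A N" and W: "W \<subseteq> carrier N"
    and NW: "left_module A (N\<lparr>carrier := W\<rparr>)"
    and j: "inj_on j (carrier N)"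
    and x: "x \<in> tensor_frags U (N\<lparr>carrier := W\<rparr>)" "x \<in> tensor_relations A U N"
  shows "x \<in> tensor_relations A U (N\<lparr>carrier := W\<rparr>)"
proof -
  have "right_module A U" using flat by (simp add: flat_right_module_def)
  then interpret tensor_factor A U by (rule tensor_factor.intro)
  let ?W = "N\<lparr>carrier := W\<rparr>"
  let ?T = "transport j N" and ?TW = "transport j ?W"
  have jW: "inj_on j (carrier ?W)" using j W by (simp add: inj_on_subset)
  note T = left_module_transport[OF N j] left_module_transport[OF NW jW]
  have inv: "inv_into (carrier N) j (j z) = inv_into W j (j z)" if "z \<in> W" for z
    using j jW W that by (auto simp: subset_iff)
  have incl: "(\<lambda>x. x) \<in> left_hom A ?TW ?T"
    using W NW by (auto simp: left_hom_def transport_def inv subset_iff image_iff)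
  then have inj: "inj_on (tensor_map A U ?T (\<lambda>x. x)) (carrier (tensor A U ?TW))"
    using flat T unfolding flat_right_module_def by (metis inj_on_id2)
  let ?y = "frag_map j x"
  have y: "?y \<in> tensor_frags U ?TW"
    using x(1) by (rule frag_map_closed) (auto simp: transport_def)
  have "?y \<in> rel ?T"
    by (rule frag_map_rel[OF N T(1) transport_hom[OF j] x(2)])
  then have "tensor_map A U ?T (\<lambda>x. x) (cls ?TW ?y) = tensor_map A U ?T (\<lambda>x. x) (cls ?TW 0)"
    by (simp add: tensor_map_cls[OF T(2,1) incl] cls_eq_iff[OF T(1)] frag_map_ident[OF y])
  then have "cls ?TW ?y = cls ?TW 0"
    by (rule inj_onD[OF inj]) (use y in \<open>auto simp: carrier_tensor\<close>)
  then have "?y \<in> rel ?TW"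
    by (simp add: cls_eq_iff[OF T(2)])
  then have "frag_map (inv_into W j) ?y \<in> rel ?W"
    using frag_map_rel[OF T(2) NW transport_inv_hom[OF NW jW]] by simp
  moreover have "frag_map (inv_into W j) ?y = x"
    using jW by (auto simp: frag_map_comp intro!: frag_map_ident[OF x(1)])
  ultimately show ?thesis by simp
qed

text \<open>Flatness makes the tensor product with the image of \<open>h\<close> a subgroup of the one with \<open>N'\<close>; the rest
  is right exactness.\<close>

lemma flat_exact:
  fixes N' :: "('a, 'm, 'w) module_scheme" and j :: "'m \<Rightarrow> 'n"
  assumes flat: "flat_right_module TYPE('n) A U" and N: "left_module A N" and N': "left_module A N'"
    and h: "h \<in> left_hom A N N'" and j: "inj_on j (carrier N')"
    and x: "x \<in> tensor_frags U N" and hx: "frag_map h x \<in> tensor_relations A U N'"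
  shows "\<exists>y\<in>tensor_frags U (N\<lparr>carrier := {n \<in> carrier N. h n = \<zero>\<^bsub>N'\<^esub>}\<rparr>).
    x - y \<in> tensor_relations A U N"
proof -
  have "right_module A U" using flat by (simp add: flat_right_module_def)
  then interpret tensor_factor A U by (rule tensor_factor.intro)
  interpret N: left_module A N by fact
  interpret N': left_module A N' by fact
  let ?im = "N'\<lparr>carrier := h ` carrier N\<rparr>"
  have im: "left_module A ?im"
    by (rule left_module_image[OF N N' h])
  have "frag_map h x \<in> rel ?im"
    using left_hom_closed[OF h]
    by (intro flat_submodule[OF flat N' _ im j] hx frag_map_closed[OF x]) auto
  then show ?thesis
    by (rule tensor_right_exact[OF N N' h x])
qed

section \<open>Free modules\<close>

definition basis_vector :: "('a, 'y) ring_scheme \<Rightarrow> 'b \<Rightarrow> 'b \<Rightarrow> 'a"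
  where "basis_vector R b = (\<lambda>c. if c = b then \<one>\<^bsub>R\<^esub> else \<zero>\<^bsub>R\<^esub>)"

lemma free_module_simps [simp]:
  "\<zero>\<^bsub>free_module R B\<^esub> = (\<lambda>_. \<zero>\<^bsub>R\<^esub>)"
  "f \<oplus>\<^bsub>free_module R B\<^esub> g = (\<lambda>b. f b \<oplus>\<^bsub>R\<^esub> g b)"
  "a \<odot>\<^bsub>free_module R B\<^esub> f = (\<lambda>b. a \<otimes>\<^bsub>R\<^esub> f b)"
  by (simp_all add: free_module_def)

lemma free_module_carrier:
  "f \<in> carrier (free_module R B) \<longleftrightarrow>
    (\<forall>b. f b \<in> carrier R) \<and> (\<forall>b. b \<notin> B \<longrightarrow> f b = \<zero>\<^bsub>R\<^esub>) \<and> finite {b. f b \<noteq> \<zero>\<^bsub>R\<^esub>}"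
  by (simp add: free_module_def)

lemma free_module_mono: "B \<subseteq> B' \<Longrightarrow> carrier (free_module R B) \<subseteq> carrier (free_module R B')"
  unfolding subset_iff free_module_carrier by blast

context ring
begin

lemma free_module_comap:
  assumes "f \<in> carrier (free_module R B)" "inj s" "\<And>b. s b \<in> B \<Longrightarrow> b \<in> B'"
  shows "(\<lambda>b. f (s b)) \<in> carrier (free_module R B')"
proof -
  have "finite (s -` {b. f b \<noteq> \<zero>})"
    using assms(1,2) by (intro finite_vimageI) (auto simp: free_module_carrier)
  then show ?thesis
    using assms by (auto simp: free_module_carrier vimage_def)
qed

lemma basis_vector_closed: "b \<in> B \<Longrightarrow> basis_vector R b \<in> carrier (free_module R B)"
  by (auto simp: free_module_carrier basis_vector_def)

lemma abelian_group_free_module: "abelian_group (free_module R B)"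
proof (rule abelian_groupI)
  fix f g assume "f \<in> carrier (free_module R B)" "g \<in> carrier (free_module R B)"
  moreover from this have "finite {b. f b \<oplus> g b \<noteq> \<zero>}"
    by (rule_tac finite_subset[where B = "{b. f b \<noteq> \<zero>} \<union> {b. g b \<noteq> \<zero>}"])
      (auto simp: free_module_carrier)
  ultimately show "f \<oplus>\<^bsub>free_module R B\<^esub> g \<in> carrier (free_module R B)"
    by (auto simp: free_module_carrier)
next
  fix f assume f: "f \<in> carrier (free_module R B)"
  have "finite {b. \<ominus> f b \<noteq> \<zero>}"
    using f by (rule_tac finite_subset[where B = "{b. f b \<noteq> \<zero>}"]) (auto simp: free_module_carrier)
  then show "\<exists>g\<in>carrier (free_module R B). g \<oplus>\<^bsub>free_module R B\<^esub> f = \<zero>\<^bsub>free_module R B\<^esub>"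
    using f by (intro bexI[of _ "\<lambda>b. \<ominus> f b"]) (auto simp: free_module_carrier l_neg)
qed (auto simp: free_module_carrier a_ac)

lemma left_module_free_module: "left_module R (free_module R B)"
proof -
  have "a \<odot>\<^bsub>free_module R B\<^esub> f \<in> carrier (free_module R B)"
    if "a \<in> carrier R" "f \<in> carrier (free_module R B)" for a f
  proof -
    have "finite {b. a \<otimes> f b \<noteq> \<zero>}"
      using that by (rule_tac finite_subset[where B = "{b. f b \<noteq> \<zero>}"]) (auto simp: free_module_carrier)
    then show ?thesis using that by (auto simp: free_module_carrier)
  qed
  then show ?thesis
    by (intro left_module.intro left_module_axioms.intro abelian_group_free_module ring_axioms)
      (auto simp: free_module_carrier l_distr r_distr m_assoc)
qed

lemma free_module_uminus:
  "f \<in> carrier (free_module R B) \<Longrightarrow> \<ominus>\<^bsub>free_module R B\<^esub> f = (\<lambda>b. \<ominus> f b)"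
proof -
  assume f: "f \<in> carrier (free_module R B)"
  interpret F: abelian_group "free_module R B" by (rule abelian_group_free_module)
  have "finite {b. \<ominus> f b \<noteq> \<zero>}"
    using f by (rule_tac finite_subset[where B = "{b. f b \<noteq> \<zero>}"]) (auto simp: free_module_carrier)
  then show ?thesis
    using f by (intro F.minus_equality) (auto simp: free_module_carrier l_neg)
qed

lemma free_module_minus:
  "g \<in> carrier (free_module R B) \<Longrightarrow> f \<ominus>\<^bsub>free_module R B\<^esub> g = (\<lambda>b. f b \<ominus> g b)"
  by (simp add: a_minus_def free_module_uminus)

lemma free_module_induct [consumes 1, case_names zero add]:
  assumes f: "f \<in> carrier (free_module R B)" and zero: "P (\<lambda>_. \<zero>)"
    and add: "\<And>f a b. \<lbrakk>f \<in> carrier (free_module R B); a \<in> carrier R; b \<in> B; f b = \<zero>; P f\<rbrakk> \<Longrightarrow>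
      P (f \<oplus>\<^bsub>free_module R B\<^esub> (a \<odot>\<^bsub>free_module R B\<^esub> basis_vector R b))"
  shows "P f"
proof -
  have "finite S \<Longrightarrow> f \<in> carrier (free_module R B) \<Longrightarrow> {b. f b \<noteq> \<zero>} = S \<Longrightarrow> P f" for S f
  proof (induction S arbitrary: f rule: finite_induct)
    case empty
    then have "f = (\<lambda>_. \<zero>)" by auto
    then show ?case using zero by simp
  next
    case (insert b S)
    let ?g = "\<lambda>c. if c = b then \<zero> else f c"
    have S: "{c. ?g c \<noteq> \<zero>} = S" using insert.hyps insert.prems(2) by auto
    then have g: "?g \<in> carrier (free_module R B)"
      using insert.prems insert.hyps by (auto simp: free_module_carrier)
    have "b \<in> B" using insert.prems by (auto simp: free_module_carrier)
    moreover have "f b \<in> carrier R" using insert.prems by (auto simp: free_module_carrier)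
    moreover have "f = ?g \<oplus>\<^bsub>free_module R B\<^esub> (f b \<odot>\<^bsub>free_module R B\<^esub> basis_vector R b)"
      using insert.prems by (auto simp: basis_vector_def free_module_carrier fun_eq_iff)
    ultimately show ?case
      using add[OF g, of "f b" b] insert.IH[OF g S] by simp
  qed
  then show ?thesis using f by (auto simp: free_module_carrier)
qed

lemma left_hom_free_module_in:
  assumes M: "left_module R M" and h: "h \<in> left_hom R (free_module R B) M"
    and W: "\<zero>\<^bsub>M\<^esub> \<in> W" "\<And>x y. \<lbrakk>x \<in> W; y \<in> W\<rbrakk> \<Longrightarrow> x \<oplus>\<^bsub>M\<^esub> y \<in> W"
      "\<And>a x. \<lbrakk>a \<in> carrier R; x \<in> W\<rbrakk> \<Longrightarrow> a \<odot>\<^bsub>M\<^esub> x \<in> W"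
    and B: "\<And>b. b \<in> B \<Longrightarrow> h (basis_vector R b) \<in> W"
    and f: "f \<in> carrier (free_module R B)"
  shows "h f \<in> W"
proof -
  interpret F: left_module R "free_module R B" by (rule left_module_free_module)
  interpret M: left_module R M by fact
  have h0: "h (\<lambda>_. \<zero>) = \<zero>\<^bsub>M\<^esub>"
    using left_hom_zero[OF h F.M.abelian_group_axioms M.M.abelian_group_axioms] by simp
  show ?thesis
    using f
  proof (induction rule: free_module_induct)
    case (add f a b)
    then show ?case
      using left_hom_add[OF h add(1), of "a \<odot>\<^bsub>free_module R B\<^esub> basis_vector R b"]
        left_hom_act[OF h add(2), of "basis_vector R b"] F.act_closed[of a "basis_vector R b"] B W
      by (simp add: basis_vector_closed del: free_module_simps)
  qed (simp add: h0 W)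
qed

lemma left_hom_free_module_eq:
  assumes M: "left_module R M" and h: "h \<in> left_hom R (free_module R B) M"
    and h': "h' \<in> left_hom R (free_module R B) M"
    and B: "\<And>b. b \<in> B \<Longrightarrow> h (basis_vector R b) = h' (basis_vector R b)"
    and f: "f \<in> carrier (free_module R B)"
  shows "h f = h' f"
proof -
  interpret F: left_module R "free_module R B" by (rule left_module_free_module)
  interpret M: left_module R M by fact
  have h0: "h (\<lambda>_. \<zero>) = \<zero>\<^bsub>M\<^esub>" "h' (\<lambda>_. \<zero>) = \<zero>\<^bsub>M\<^esub>"
    using left_hom_zero[OF h F.M.abelian_group_axioms M.M.abelian_group_axioms]
      left_hom_zero[OF h' F.M.abelian_group_axioms M.M.abelian_group_axioms] by simp_all
  show ?thesis
    using f
  proof (induction rule: free_module_induct)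
    case (add f a b)
    then show ?case
      using left_hom_add[OF h add(1), of "a \<odot>\<^bsub>free_module R B\<^esub> basis_vector R b"]
        left_hom_act[OF h add(2), of "basis_vector R b"] F.act_closed[of a "basis_vector R b"] B
        left_hom_add[OF h' add(1), of "a \<odot>\<^bsub>free_module R B\<^esub> basis_vector R b"]
        left_hom_act[OF h' add(2), of "basis_vector R b"]
      by (simp add: basis_vector_closed del: free_module_simps)
  qed (simp add: h0)
qed

lemma linear_extension_superset:
  assumes M: "left_module R M" and g: "\<And>b. b \<in> B \<Longrightarrow> g b \<in> carrier M"
    and f: "f \<in> carrier (free_module R B)"
    and S: "finite S" "{b. f b \<noteq> \<zero>} \<subseteq> S" "S \<subseteq> B"
  shows "linear_extension R M g f = (\<Oplus>\<^bsub>M\<^esub>b\<in>S. f b \<odot>\<^bsub>M\<^esub> g b)"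
proof -
  interpret M: left_module R M by fact
  show ?thesis
    unfolding linear_extension_def
    by (rule M.add.finprod_mono_neutral_cong_left[OF S(1,2)])
      (use f g S in \<open>auto simp: free_module_carrier M.act_closed\<close>)
qed

lemma linear_extension_hom:
  assumes M: "left_module R M" and g: "\<And>b. b \<in> B \<Longrightarrow> g b \<in> carrier M"
  shows "linear_extension R M g \<in> left_hom R (free_module R B) M"
proof (rule left_homI)
  interpret M: left_module R M by fact
  interpret F: left_module R "free_module R B" by (rule left_module_free_module)
  note super = linear_extension_superset[OF M g]
  have supp: "finite {b. f b \<noteq> \<zero>}" "{b. f b \<noteq> \<zero>} \<subseteq> B" "\<And>b. f b \<in> carrier R"
    if "f \<in> carrier (free_module R B)" for f
    using that by (auto simp: free_module_carrier)
  show "linear_extension R M g f \<in> carrier M" if "f \<in> carrier (free_module R B)" for f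
    using supp[OF that] g unfolding linear_extension_def
    by (intro M.M.finsum_closed) (auto simp: M.act_closed)
  show "linear_extension R M g (f \<oplus>\<^bsub>free_module R B\<^esub> h) =
      linear_extension R M g f \<oplus>\<^bsub>M\<^esub> linear_extension R M g h"
    if fh: "f \<in> carrier (free_module R B)" "h \<in> carrier (free_module R B)" for f h
  proof -
    let ?S = "{b. f b \<noteq> \<zero>} \<union> {b. h b \<noteq> \<zero>}"
    have S: "finite ?S" "?S \<subseteq> B" using supp(1,2)[OF fh(1)] supp(1,2)[OF fh(2)] by blast+
    have "linear_extension R M g (f \<oplus>\<^bsub>free_module R B\<^esub> h)
        = (\<Oplus>\<^bsub>M\<^esub>b\<in>?S. (f \<oplus>\<^bsub>free_module R B\<^esub> h) b \<odot>\<^bsub>M\<^esub> g b)"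
      by (rule super[OF _ F.M.a_closed[OF fh] S(1) _ S(2)]) (use fh in \<open>auto simp: free_module_carrier\<close>)
    also have "\<dots> = (\<Oplus>\<^bsub>M\<^esub>b\<in>?S. f b \<odot>\<^bsub>M\<^esub> g b \<oplus>\<^bsub>M\<^esub> h b \<odot>\<^bsub>M\<^esub> g b)"
      using S(2) supp[OF fh(1)] supp[OF fh(2)] g
      by (intro M.M.finsum_cong') (auto simp: M.act_add_ring M.act_closed subset_iff)
    also have "\<dots> = (\<Oplus>\<^bsub>M\<^esub>b\<in>?S. f b \<odot>\<^bsub>M\<^esub> g b) \<oplus>\<^bsub>M\<^esub> (\<Oplus>\<^bsub>M\<^esub>b\<in>?S. h b \<odot>\<^bsub>M\<^esub> g b)"
      using S supp[OF fh(1)] supp[OF fh(2)] g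
      by (intro M.M.finsum_addf) (auto simp: M.act_closed subset_iff)
    also have "\<dots> = linear_extension R M g f \<oplus>\<^bsub>M\<^esub> linear_extension R M g h"
      using super[OF _ fh(1) S(1) _ S(2)] super[OF _ fh(2) S(1) _ S(2)] by simp
    finally show ?thesis .
  qed
  show "linear_extension R M g (a \<odot>\<^bsub>free_module R B\<^esub> f) = a \<odot>\<^bsub>M\<^esub> linear_extension R M g f"
    if af: "a \<in> carrier R" "f \<in> carrier (free_module R B)" for a f
  proof -
    let ?S = "{b. f b \<noteq> \<zero>}"
    have sum: "finite T \<Longrightarrow> T \<subseteq> B \<Longrightarrow>
      a \<odot>\<^bsub>M\<^esub> (\<Oplus>\<^bsub>M\<^esub>b\<in>T. f b \<odot>\<^bsub>M\<^esub> g b) = (\<Oplus>\<^bsub>M\<^esub>b\<in>T. a \<odot>\<^bsub>M\<^esub> (f b \<odot>\<^bsub>M\<^esub> g b))" for T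
    proof (induction T rule: finite_induct)
      case (insert b T)
      then have "b \<in> B" "\<And>c. c \<in> T \<Longrightarrow> c \<in> B" by auto
      then show ?case
        using insert af supp(3)[OF af(2)] g
        by (subst (1 2) M.M.finsum_insert) (auto simp: M.act_closed M.act_add M.M.finsum_closed Pi_iff)
    qed (use af in auto)
    have "linear_extension R M g (a \<odot>\<^bsub>free_module R B\<^esub> f)
        = (\<Oplus>\<^bsub>M\<^esub>b\<in>?S. (a \<odot>\<^bsub>free_module R B\<^esub> f) b \<odot>\<^bsub>M\<^esub> g b)"
      by (rule super[OF _ F.act_closed[OF af]]) (use af in \<open>auto simp: free_module_carrier\<close>)
    also have "\<dots> = (\<Oplus>\<^bsub>M\<^esub>b\<in>?S. a \<odot>\<^bsub>M\<^esub> (f b \<odot>\<^bsub>M\<^esub> g b))"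
      using supp[OF af(2)] g af
      by (intro M.M.finsum_cong') (auto simp: M.act_mult M.act_closed subset_iff)
    also have "\<dots> = a \<odot>\<^bsub>M\<^esub> linear_extension R M g f"
      using sum[of ?S] supp[OF af(2)] by (simp add: linear_extension_def)
    finally show ?thesis .
  qed
qed

lemma linear_extension_basis_vector:
  assumes M: "left_module R M" and g: "g b \<in> carrier M"
  shows "linear_extension R M g (basis_vector R b) = g b"
proof -
  interpret M: left_module R M by fact
  have "linear_extension R M g (basis_vector R b) = (\<Oplus>\<^bsub>M\<^esub>c\<in>{b}. basis_vector R b c \<odot>\<^bsub>M\<^esub> g c)"
    by (rule linear_extension_superset[OF M, of "{b}"])
      (use g in \<open>auto simp: basis_vector_closed, auto simp: basis_vector_def split: if_splits\<close>)
  also have "\<dots> = basis_vector R b b \<odot>\<^bsub>M\<^esub> g b"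
    by (subst M.M.finsum_insert) (use g in \<open>auto simp: basis_vector_def M.act_one\<close>)
  also have "\<dots> = g b"
    using g by (simp add: basis_vector_def M.act_one)
  finally show ?thesis .
qed

lemma combination_closed:
  "set w \<subseteq> carrier R \<times> B \<Longrightarrow> combination R w \<in> carrier (free_module R B)"
proof (induction w)
  case Nil
  then show ?case by (simp add: free_module_carrier)
next
  case (Cons ab w)
  interpret F: left_module R "free_module R B" by (rule left_module_free_module)
  have "combination R (ab # w) = (fst ab \<odot>\<^bsub>free_module R B\<^esub> basis_vector R (snd ab))
      \<oplus>\<^bsub>free_module R B\<^esub> combination R w"
    using Cons.prems by (auto simp: basis_vector_def fun_eq_iff)
  moreover have "fst ab \<odot>\<^bsub>free_module R B\<^esub> basis_vector R (snd ab) \<in> carrier (free_module R B)"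
    using Cons.prems by (intro F.act_closed basis_vector_closed) auto
  ultimately show ?case
    using Cons by (simp del: free_module_simps combination.simps)
qed

text \<open>Every cycle of the canonical resolution is thus the value of a formal expression, that is, the
  boundary of a basis vector.\<close>

lemma ex_combination:
  "f \<in> carrier (free_module R B) \<Longrightarrow> \<exists>w. set w \<subseteq> carrier R \<times> B \<and> combination R w = f"
proof (induction rule: free_module_induct)
  case zero
  show ?case by (rule exI[of _ "[]"]) simp
next
  case (add f a b)
  then obtain w where w: "set w \<subseteq> carrier R \<times> B" "combination R w = f" by blast
  have fc: "f c \<in> carrier R" for c using add by (simp add: free_module_carrier)
  show ?case
    by (rule exI[of _ "(a, b) # w"])
      (use w add fc in \<open>auto simp: basis_vector_def fun_eq_iff a_comm\<close>)
qed

end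

section \<open>Normed modules over the algebra\<close>

locale dvf_algebra = K: mixed_char_dvf K av \<pi> p + A: normed_algebra K av A
  for K :: "('k, 'x) ring_scheme" and av :: "'k \<Rightarrow> real" and \<pi> :: 'k and p :: nat
    and A :: "('k, 'a, 'y) normed_module_scheme"
begin

abbreviation q :: real where "q \<equiv> av \<pi>"

lemma q: "0 < q" "q < 1"
  using K.av_nonneg[OF K.uniformizer_closed] K.av_eq_0_iff[OF K.uniformizer_closed]
    K.uniformizer_nonzero K.uniformizer_lt_1 by auto

lemma av_pos: "\<lbrakk>k \<in> carrier K; k \<noteq> \<zero>\<^bsub>K\<^esub>\<rbrakk> \<Longrightarrow> 0 < av k"
  using K.av_nonneg[of k] K.av_eq_0_iff[of k] by auto

lemma av_one: "av \<one>\<^bsub>K\<^esub> = 1"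
  using K.av_mult[of "\<one>\<^bsub>K\<^esub>" "\<one>\<^bsub>K\<^esub>"] av_pos[of "\<one>\<^bsub>K\<^esub>"] by auto

lemma av_pow: "av (\<pi> [^]\<^bsub>K\<^esub> (n::nat)) = q ^ n"
  by (induction n) (auto simp: av_one K.av_mult K.uniformizer_closed)

lemma pow_closed [simp]: "\<pi> [^]\<^bsub>K\<^esub> (n::nat) \<in> carrier K"
  by (simp add: K.uniformizer_closed)

lemma pow_nonzero: "\<pi> [^]\<^bsub>K\<^esub> (n::nat) \<noteq> \<zero>\<^bsub>K\<^esub>"
  using av_pow[of n] q K.av_eq_0_iff[OF pow_closed, of n] by auto

lemma inv_closed:
  assumes "k \<in> carrier K" "k \<noteq> \<zero>\<^bsub>K\<^esub>"
  shows "inv\<^bsub>K\<^esub> k \<in> carrier K" "inv\<^bsub>K\<^esub> k \<noteq> \<zero>\<^bsub>K\<^esub>" "k \<otimes>\<^bsub>K\<^esub> inv\<^bsub>K\<^esub> k = \<one>\<^bsub>K\<^esub>" "inv\<^bsub>K\<^esub> k \<otimes>\<^bsub>K\<^esub> k = \<one>\<^bsub>K\<^esub>"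
    "av (inv\<^bsub>K\<^esub> k) = 1 / av k"
proof -
  have k: "k \<in> Units K" using assms K.field_Units by auto
  then show i: "inv\<^bsub>K\<^esub> k \<in> carrier K" "k \<otimes>\<^bsub>K\<^esub> inv\<^bsub>K\<^esub> k = \<one>\<^bsub>K\<^esub>" "inv\<^bsub>K\<^esub> k \<otimes>\<^bsub>K\<^esub> k = \<one>\<^bsub>K\<^esub>"
    by auto
  then show "inv\<^bsub>K\<^esub> k \<noteq> \<zero>\<^bsub>K\<^esub>" using assms by auto
  have "av k * av (inv\<^bsub>K\<^esub> k) = 1" using K.av_mult[OF assms(1) i(1)] i(2) av_one by simp
  then show "av (inv\<^bsub>K\<^esub> k) = 1 / av k" using av_pos[OF assms] by (simp add: field_simps)
qed

text \<open>Powers of \<open>\<pi>\<close> move every positive real number into the interval from \<open>q\<close>, excluded, to \<open>1\<close>.\<close>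

lemma ex_scaling:
  assumes "0 < r"
  shows "\<exists>k\<in>carrier K. k \<noteq> \<zero>\<^bsub>K\<^esub> \<and> av k * r \<le> 1 \<and> q < av k * r"
proof (cases "r \<le> 1")
  case True
  have "\<exists>n. q ^ Suc n < r"
    using real_arch_pow_inv[OF assms q(2)] q
    by (metis less_le_trans mult_le_cancel_right1 not_less order.strict_trans1 power_Suc zero_less_power less_eq_real_def)
  then obtain n where n: "q ^ Suc n < r" "\<And>m. m < n \<Longrightarrow> \<not> q ^ Suc m < r"
    using exists_least_iff[of "\<lambda>n. q ^ Suc n < r"] by blast
  have "r \<le> q ^ n"
    using n(2)[of "n - 1"] True by (cases n) auto
  then have "1 / q ^ n * r \<le> 1" "q < 1 / q ^ n * r"
    using n(1) q by (simp_all add: field_simps)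
  then show ?thesis
    using inv_closed[OF pow_closed pow_nonzero, of n]
    by (intro bexI[of _ "inv\<^bsub>K\<^esub> (\<pi> [^]\<^bsub>K\<^esub> n)"]) (simp_all add: av_pow)
next
  case False
  have "\<exists>n. q ^ n < 1 / r"
    using real_arch_pow_inv[of "1 / r" q] q assms by auto
  then have "\<exists>n. q ^ n * r \<le> 1"
    using assms by (auto simp: field_simps intro: less_imp_le)
  then obtain n where n: "q ^ n * r \<le> 1" "\<And>m. m < n \<Longrightarrow> \<not> q ^ m * r \<le> 1"
    using exists_least_iff[of "\<lambda>n. q ^ n * r \<le> 1"] by blast
  then obtain m where m: "n = Suc m" using False by (cases n) auto
  have "1 < q ^ m * r" using n(2)[of m] m by simp
  then have "q < q ^ n * r"
    using q m by (simp add: mult.assoc)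
  then show ?thesis
    using n(1) by (intro bexI[of _ "\<pi> [^]\<^bsub>K\<^esub> n"]) (auto simp: av_pow pow_nonzero)
qed

lemma ex_pow_small: "0 < e \<Longrightarrow> \<exists>m0. \<forall>m\<ge>m0. q ^ m * r \<le> e"
proof -
  assume e: "0 < e"
  obtain m0 where m0: "q ^ m0 < e / (\<bar>r\<bar> + 1)"
    using real_arch_pow_inv[of "e / (\<bar>r\<bar> + 1)" q] q e by auto
  have "q ^ m * r \<le> e" if "m \<ge> m0" for m
  proof -
    have "q ^ m * r \<le> q ^ m * (\<bar>r\<bar> + 1)" using q by (intro mult_left_mono) auto
    also have "\<dots> \<le> q ^ m0 * (\<bar>r\<bar> + 1)"
      using that q by (intro mult_right_mono power_decreasing) auto
    also have "\<dots> \<le> e" using m0 by (simp add: field_simps)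
    finally show ?thesis .
  qed
  then show ?thesis by blast
qed

abbreviation sc :: "'k \<Rightarrow> 'a" where "sc k \<equiv> k \<odot>\<^bsub>A\<^esub> \<one>\<^bsub>A\<^esub>"

lemma sc_closed [simp]: "k \<in> carrier K \<Longrightarrow> sc k \<in> carrier A"
  by simp

lemma sc_central: "\<lbrakk>k \<in> carrier K; a \<in> carrier A\<rbrakk> \<Longrightarrow> sc k \<otimes>\<^bsub>A\<^esub> a = a \<otimes>\<^bsub>A\<^esub> sc k"
  by (simp add: A.smult_mult_left A.smult_mult_right)

lemma sc_mult: "\<lbrakk>k \<in> carrier K; l \<in> carrier K\<rbrakk> \<Longrightarrow> sc k \<otimes>\<^bsub>A\<^esub> sc l = sc (k \<otimes>\<^bsub>K\<^esub> l)"
  by (simp add: A.smult_mult_left A.V.smult_assoc1)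

lemma sc_one [simp]: "sc \<one>\<^bsub>K\<^esub> = \<one>\<^bsub>A\<^esub>"
  by simp

lemma nrm_sc: "k \<in> carrier K \<Longrightarrow> \<parallel>sc k\<parallel>\<^bsub>A\<^esub> \<le> av k"
  using A.nrm_smult[of k "\<one>\<^bsub>A\<^esub>"] A.nrm_one K.av_nonneg[of k] mult_left_mono[of "\<parallel>\<one>\<^bsub>A\<^esub>\<parallel>\<^bsub>A\<^esub>" 1 "av k"]
  by simp

lemma nrm_zero [simp]: "\<parallel>\<zero>\<^bsub>A\<^esub>\<parallel>\<^bsub>A\<^esub> = 0"
  using A.nrm_eq_0_iff[of "\<zero>\<^bsub>A\<^esub>"] by simp

lemma av_uminus_one: "av (\<ominus>\<^bsub>K\<^esub> \<one>\<^bsub>K\<^esub>) = 1"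
proof -
  have "av (\<ominus>\<^bsub>K\<^esub> \<one>\<^bsub>K\<^esub>) * av (\<ominus>\<^bsub>K\<^esub> \<one>\<^bsub>K\<^esub>) = 1"
    using K.av_mult[of "\<ominus>\<^bsub>K\<^esub> \<one>\<^bsub>K\<^esub>" "\<ominus>\<^bsub>K\<^esub> \<one>\<^bsub>K\<^esub>"] av_one by (simp add: K.l_minus)
  then show ?thesis
    using K.av_nonneg[of "\<ominus>\<^bsub>K\<^esub> \<one>\<^bsub>K\<^esub>"] by (simp add: square_eq_1_iff)
qed

lemma nrm_uminus: "a \<in> carrier A \<Longrightarrow> \<parallel>\<ominus>\<^bsub>A\<^esub> a\<parallel>\<^bsub>A\<^esub> = \<parallel>a\<parallel>\<^bsub>A\<^esub>"
  using A.nrm_smult[of "\<ominus>\<^bsub>K\<^esub> \<one>\<^bsub>K\<^esub>" a] av_uminus_one A.V.smult_l_minus[of "\<one>\<^bsub>K\<^esub>" a] by simp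

lemma nrm_uminus_one: "\<parallel>\<ominus>\<^bsub>A\<^esub> \<one>\<^bsub>A\<^esub>\<parallel>\<^bsub>A\<^esub> \<le> 1"
  using A.nrm_one by (simp add: nrm_uminus)

text \<open>The norm \<open>\<nu>\<close> is not a field of the record, so that free modules can be given the supremum norm.
  It may vanish on nonzero elements.\<close>

definition normed_left :: "('a, 'n, 'w) module_scheme \<Rightarrow> ('n \<Rightarrow> real) \<Rightarrow> bool"
  where "normed_left N \<nu> \<longleftrightarrow> left_module A N \<and> \<nu> \<zero>\<^bsub>N\<^esub> = 0 \<and>
    (\<forall>x\<in>carrier N. 0 \<le> \<nu> x) \<and>
    (\<forall>x\<in>carrier N. \<forall>y\<in>carrier N. \<nu> (x \<oplus>\<^bsub>N\<^esub> y) \<le> max (\<nu> x) (\<nu> y)) \<and>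
    (\<forall>a\<in>carrier A. \<forall>x\<in>carrier N. \<nu> (a \<odot>\<^bsub>N\<^esub> x) \<le> \<parallel>a\<parallel>\<^bsub>A\<^esub> * \<nu> x)"

lemma normed_leftD:
  assumes "normed_left N \<nu>"
  shows "left_module A N" "\<nu> \<zero>\<^bsub>N\<^esub> = 0" "x \<in> carrier N \<Longrightarrow> 0 \<le> \<nu> x"
    "\<lbrakk>x \<in> carrier N; y \<in> carrier N\<rbrakk> \<Longrightarrow> \<nu> (x \<oplus>\<^bsub>N\<^esub> y) \<le> max (\<nu> x) (\<nu> y)"
    "\<lbrakk>a \<in> carrier A; x \<in> carrier N\<rbrakk> \<Longrightarrow> \<nu> (a \<odot>\<^bsub>N\<^esub> x) \<le> \<parallel>a\<parallel>\<^bsub>A\<^esub> * \<nu> x"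
  using assms by (auto simp: normed_left_def)

lemma normed_left_normed_left_module:
  assumes "normed_left_module K av A M"
  shows "normed_left M (nrm M)"
proof -
  interpret V: normed_space K av "restrict_scalars A M"
    using assms by (simp add: normed_left_module_def)
  interpret M: left_module A M
    using assms by (simp add: normed_left_module_def)
  show ?thesis
    using assms V.nrm_nonneg V.nrm_add V.nrm_eq_0_iff[of "\<zero>\<^bsub>M\<^esub>"] M.M.zero_closed
    by (auto simp: normed_left_def normed_left_module_def restrict_scalars_def)
qed

context
  fixes N :: "('a, 'n, 'w) module_scheme" and \<nu> :: "'n \<Rightarrow> real"
  assumes N: "normed_left N \<nu>"
begin

interpretation N: left_module A N by (rule normed_leftD(1)[OF N])

lemma sc_act_act:
  "\<lbrakk>k \<in> carrier K; l \<in> carrier K; x \<in> carrier N\<rbrakk> \<Longrightarrow> sc k \<odot>\<^bsub>N\<^esub> (sc l \<odot>\<^bsub>N\<^esub> x) = sc (k \<otimes>\<^bsub>K\<^esub> l) \<odot>\<^bsub>N\<^esub> x"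
  by (simp add: sc_mult flip: N.act_mult)

lemma norm_uminus: "x \<in> carrier N \<Longrightarrow> \<nu> (\<ominus>\<^bsub>N\<^esub> x) = \<nu> x"
proof -
  have le: "\<nu> (\<ominus>\<^bsub>N\<^esub> x) \<le> \<nu> x" if x: "x \<in> carrier N" for x
  proof -
    have "(\<ominus>\<^bsub>A\<^esub> \<one>\<^bsub>A\<^esub>) \<odot>\<^bsub>N\<^esub> x \<oplus>\<^bsub>N\<^esub> x = \<zero>\<^bsub>N\<^esub>"
      using x N.act_add_ring[of "\<ominus>\<^bsub>A\<^esub> \<one>\<^bsub>A\<^esub>" "\<one>\<^bsub>A\<^esub>" x] by (simp add: A.l_neg N.act_one)
    then have "\<ominus>\<^bsub>N\<^esub> x = (\<ominus>\<^bsub>A\<^esub> \<one>\<^bsub>A\<^esub>) \<odot>\<^bsub>N\<^esub> x"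
      using x by (intro N.M.minus_equality) (auto simp: N.act_closed)
    then have "\<nu> (\<ominus>\<^bsub>N\<^esub> x) \<le> \<parallel>\<ominus>\<^bsub>A\<^esub> \<one>\<^bsub>A\<^esub>\<parallel>\<^bsub>A\<^esub> * \<nu> x"
      using normed_leftD(5)[OF N, of "\<ominus>\<^bsub>A\<^esub> \<one>\<^bsub>A\<^esub>" x] x by simp
    also have "\<dots> \<le> 1 * \<nu> x"
      using nrm_uminus_one normed_leftD(3)[OF N x] by (intro mult_right_mono)
    finally show ?thesis by simp
  qed
  assume "x \<in> carrier N"
  then show ?thesis using le[of x] le[of "\<ominus>\<^bsub>N\<^esub> x"] by simp
qed

lemma norm_diff: "\<lbrakk>x \<in> carrier N; y \<in> carrier N\<rbrakk> \<Longrightarrow> \<nu> (x \<ominus>\<^bsub>N\<^esub> y) \<le> max (\<nu> x) (\<nu> y)"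
  using normed_leftD(4)[OF N, of x "\<ominus>\<^bsub>N\<^esub> y"] by (simp add: a_minus_def norm_uminus)

text \<open>Submultiplicativity gives one inequality; applied to the inverse of \<open>k\<close>, it gives the other one.\<close>

lemma norm_sc:
  assumes k: "k \<in> carrier K" and x: "x \<in> carrier N"
  shows "\<nu> (sc k \<odot>\<^bsub>N\<^esub> x) = av k * \<nu> x"
proof (cases "k = \<zero>\<^bsub>K\<^esub>")
  case True
  then show ?thesis using x K.av_eq_0_iff[of k] k normed_leftD(2)[OF N] by simp
next
  case False
  have le: "\<nu> (sc k \<odot>\<^bsub>N\<^esub> x) \<le> av k * \<nu> x" if "k \<in> carrier K" "x \<in> carrier N" for k x
    using normed_leftD(5)[OF N, of "sc k" x] that
      mult_right_mono[OF nrm_sc[of k] normed_leftD(3)[OF N, of x]] by simp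
  have "\<nu> x = \<nu> (sc (inv\<^bsub>K\<^esub> k) \<odot>\<^bsub>N\<^esub> (sc k \<odot>\<^bsub>N\<^esub> x))"
    using inv_closed[OF k False] k x by (simp add: sc_act_act N.act_one)
  also have "\<dots> \<le> 1 / av k * \<nu> (sc k \<odot>\<^bsub>N\<^esub> x)"
    using le[of "inv\<^bsub>K\<^esub> k" "sc k \<odot>\<^bsub>N\<^esub> x"] inv_closed[OF k False] k x by (simp add: N.act_closed)
  finally show ?thesis
    using le[OF k x] av_pos[OF k False] by (simp add: field_simps)
qed

lemma sc_hom: "k \<in> carrier K \<Longrightarrow> (\<lambda>x. sc k \<odot>\<^bsub>N\<^esub> x) \<in> left_hom A N N"
  by (intro left_homI) (auto simp: N.act_closed N.act_add sc_central simp flip: N.act_mult)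

end

definition sup_norm :: "('b \<Rightarrow> 'a) \<Rightarrow> real"
  where "sup_norm f = Max (range (\<lambda>b. \<parallel>f b\<parallel>\<^bsub>A\<^esub>))"

lemma finite_range_free_module:
  assumes "f \<in> carrier (free_module A B)"
  shows "finite (range (\<lambda>b. \<parallel>f b\<parallel>\<^bsub>A\<^esub>))"
proof (rule finite_subset)
  show "range (\<lambda>b. \<parallel>f b\<parallel>\<^bsub>A\<^esub>) \<subseteq> insert \<parallel>\<zero>\<^bsub>A\<^esub>\<parallel>\<^bsub>A\<^esub> ((\<lambda>b. \<parallel>f b\<parallel>\<^bsub>A\<^esub>) ` {b. f b \<noteq> \<zero>\<^bsub>A\<^esub>})"
    by force
qed (use assms in \<open>auto simp: free_module_carrier\<close>)

lemma sup_norm_le_iff: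
  "f \<in> carrier (free_module A B) \<Longrightarrow> sup_norm f \<le> r \<longleftrightarrow> (\<forall>b. \<parallel>f b\<parallel>\<^bsub>A\<^esub> \<le> r)"
  unfolding sup_norm_def using finite_range_free_module[of f B] by (subst Max_le_iff) auto

lemma nrm_le_sup_norm: "f \<in> carrier (free_module A B) \<Longrightarrow> \<parallel>f b\<parallel>\<^bsub>A\<^esub> \<le> sup_norm f"
  using sup_norm_le_iff[of f B "sup_norm f"] by simp

lemma sup_norm_nonneg: "f \<in> carrier (free_module A B) \<Longrightarrow> 0 \<le> sup_norm f"
  using nrm_le_sup_norm[of f B undefined] A.nrm_nonneg[of "f undefined"]
  by (auto simp: free_module_carrier)

lemma normed_left_free_module: "normed_left (free_module A B) sup_norm"
proof -
  interpret F: left_module A "free_module A B" by (rule A.A.left_module_free_module)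
  have zero: "sup_norm (\<lambda>_. \<zero>\<^bsub>A\<^esub>) = 0"
    by (simp add: sup_norm_def)
  have add: "sup_norm (f \<oplus>\<^bsub>free_module A B\<^esub> g) \<le> max (sup_norm f) (sup_norm g)"
    if fg: "f \<in> carrier (free_module A B)" "g \<in> carrier (free_module A B)" for f g
  proof -
    have "\<parallel>f b \<oplus>\<^bsub>A\<^esub> g b\<parallel>\<^bsub>A\<^esub> \<le> max (sup_norm f) (sup_norm g)" for b
      using A.nrm_add[of "f b" "g b"] nrm_le_sup_norm[OF fg(1), of b] nrm_le_sup_norm[OF fg(2), of b] fg
      by (auto simp: free_module_carrier)
    then show ?thesis
      using F.M.a_closed[OF fg] by (subst sup_norm_le_iff) auto
  qed
  have act: "sup_norm (a \<odot>\<^bsub>free_module A B\<^esub> f) \<le> \<parallel>a\<parallel>\<^bsub>A\<^esub> * sup_norm f"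
    if af: "a \<in> carrier A" "f \<in> carrier (free_module A B)" for a f
  proof -
    have "\<parallel>a \<otimes>\<^bsub>A\<^esub> f b\<parallel>\<^bsub>A\<^esub> \<le> \<parallel>a\<parallel>\<^bsub>A\<^esub> * sup_norm f" for b
      using A.nrm_mult[of a "f b"] af mult_left_mono[OF nrm_le_sup_norm[OF af(2), of b] A.nrm_nonneg[OF af(1)]]
      by (force simp: free_module_carrier)
    then show ?thesis
      using F.act_closed[OF af] by (subst sup_norm_le_iff) auto
  qed
  show ?thesis
    using F.left_module_axioms zero add act sup_norm_nonneg
    unfolding normed_left_def by (auto simp del: free_module_simps(2,3))
qed

lemma sup_norm_basis_vector: "b \<in> B \<Longrightarrow> sup_norm (basis_vector A b) \<le> 1"
  using sup_norm_le_iff[OF A.A.basis_vector_closed, of b B 1] A.nrm_one by (auto simp: basis_vector_def)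

text \<open>The elements of norm at most \<open>c s\<close>, where \<open>s\<close> is the supremum norm of \<open>f\<close>, are closed under addition
  because the norm is non-archimedean, and contain all terms \<open>f(b) h(b)\<close>.\<close>

lemma bounded_on_free_module:
  assumes N: "normed_left N \<nu>" and h: "h \<in> left_hom A (free_module A B) N"
    and c: "0 \<le> c" "\<And>b. b \<in> B \<Longrightarrow> \<nu> (h (basis_vector A b)) \<le> c"
    and f: "f \<in> carrier (free_module A B)"
  shows "\<nu> (h f) \<le> c * sup_norm f"
proof -
  interpret N: left_module A N by (rule normed_leftD(1)[OF N])
  interpret F: left_module A "free_module A B" by (rule A.A.left_module_free_module)
  have "(\<forall>b. \<parallel>f b\<parallel>\<^bsub>A\<^esub> \<le> r) \<longrightarrow> \<nu> (h f) \<le> c * r" if r: "0 \<le> r" for r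
    using f
  proof (induction rule: A.A.free_module_induct)
    case zero
    then show ?case
      using left_hom_zero[OF h F.M.abelian_group_axioms N.M.abelian_group_axioms] normed_leftD(2)[OF N] r c(1)
      by simp
  next
    case (add f a b)
    let ?g = "f \<oplus>\<^bsub>free_module A B\<^esub> (a \<odot>\<^bsub>free_module A B\<^esub> basis_vector A b)"
    have fc: "\<And>b. f b \<in> carrier A" using add by (simp add: free_module_carrier)
    have gc: "?g c = (if c = b then a else f c)" for c
      using add fc by (auto simp: basis_vector_def)
    have h1: "h ?g = h f \<oplus>\<^bsub>N\<^esub> a \<odot>\<^bsub>N\<^esub> h (basis_vector A b)"
      using left_hom_add[OF h add(1), of "a \<odot>\<^bsub>free_module A B\<^esub> basis_vector A b"]
        left_hom_act[OF h add(2), of "basis_vector A b"] F.act_closed[OF add(2), of "basis_vector A b"] add(3)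
      by (simp add: A.A.basis_vector_closed del: free_module_simps)
    have hb: "h (basis_vector A b) \<in> carrier N"
      using left_hom_closed[OF h] A.A.basis_vector_closed[OF add(3)] by blast
    show ?case
    proof
      assume g: "\<forall>c. \<parallel>?g c\<parallel>\<^bsub>A\<^esub> \<le> r"
      have "\<parallel>f c\<parallel>\<^bsub>A\<^esub> \<le> r" for c
        using g[rule_format, of c] add(4) r by (auto simp: gc simp del: free_module_simps split: if_splits)
      then have "\<nu> (h f) \<le> c * r" using add(5) by blast
      moreover have "\<nu> (a \<odot>\<^bsub>N\<^esub> h (basis_vector A b)) \<le> c * r"
      proof -
        have "\<parallel>a\<parallel>\<^bsub>A\<^esub> \<le> r" using g[rule_format, of b] by (simp add: gc del: free_module_simps)
        then have "\<parallel>a\<parallel>\<^bsub>A\<^esub> * \<nu> (h (basis_vector A b)) \<le> r * c"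
          using c(2)[OF add(3)] normed_leftD(3)[OF N hb] r by (intro mult_mono) auto
        then show ?thesis
          using normed_leftD(5)[OF N add(2) hb] by (simp add: mult.commute)
      qed
      ultimately show "\<nu> (h ?g) \<le> c * r"
        unfolding h1 using normed_leftD(4)[OF N left_hom_closed[OF h add(1)] N.act_closed[OF add(2) hb]]
        by linarith
    qed
  qed
  from this[OF sup_norm_nonneg[OF f]] show ?thesis
    using nrm_le_sup_norm[OF f] by blast
qed

end

section \<open>The tensor semi-norm on formal sums\<close>

definition frag_bounded ::
    "('a, 'u, 'z) normed_module_scheme \<Rightarrow> ('n \<Rightarrow> real) \<Rightarrow> (('u \<times> 'n) \<Rightarrow>\<^sub>0 int) \<Rightarrow> real \<Rightarrow> bool"
  where "frag_bounded U \<nu> y r \<longleftrightarrow> (\<forall>(u, n)\<in>Poly_Mapping.keys y. \<parallel>u\<parallel>\<^bsub>U\<^esub> * \<nu> n \<le> r)"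

text \<open>Here one representation has all its terms bounded by \<open>r\<close>, whereas the tensor semi-norm is an
  infimum; the two notions are compared in \<open>tensor_seminorm_le\<close> and \<open>tensor_seminorm_less\<close>.\<close>

definition tensor_bounded ::
    "('k, 'a, 'y) module_scheme \<Rightarrow> ('a, 'u, 'z) normed_module_scheme \<Rightarrow> ('a, 'n, 'w) module_scheme \<Rightarrow>
      ('n \<Rightarrow> real) \<Rightarrow> (('u \<times> 'n) \<Rightarrow>\<^sub>0 int) \<Rightarrow> real \<Rightarrow> bool"
  where "tensor_bounded A U N \<nu> x r \<longleftrightarrow>
    (\<exists>y\<in>tensor_frags U N. x - y \<in> tensor_relations A U N \<and> frag_bounded U \<nu> y r)"

lemma frag_bounded_0 [simp]: "frag_bounded U \<nu> 0 r"
  by (simp add: frag_bounded_def)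

lemma frag_bounded_add: "\<lbrakk>frag_bounded U \<nu> x r; frag_bounded U \<nu> y r\<rbrakk> \<Longrightarrow> frag_bounded U \<nu> (x + y) r"
  using keys_add[of x y] by (fastforce simp: frag_bounded_def)

lemma frag_bounded_uminus [simp]: "frag_bounded U \<nu> (- x) r \<longleftrightarrow> frag_bounded U \<nu> x r"
  by (simp add: frag_bounded_def)

lemma frag_bounded_mono: "\<lbrakk>frag_bounded U \<nu> x r; r \<le> s\<rbrakk> \<Longrightarrow> frag_bounded U \<nu> x s"
  by (force simp: frag_bounded_def)

lemma keys_frag_map: "Poly_Mapping.keys (frag_map f x) \<subseteq> (\<lambda>(u, n). (u, f n)) ` Poly_Mapping.keys x"
  unfolding frag_map_def using keys_frag_extend[of "\<lambda>(u, m). frag_of (u, f m)" x] by fastforce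

lemma right_module_restrict_ring:
  assumes "right_module R M" "S \<subseteq> carrier R" "ring (R\<lparr>carrier := S\<rparr>)"
  shows "right_module (R\<lparr>carrier := S\<rparr>) M"
proof -
  interpret right_module R M by fact
  show ?thesis
    using assms by (auto intro!: right_module.intro right_module_axioms.intro M.abelian_group_axioms
        simp: act_closed act_add_ring act_add act_mult act_one subset_iff)
qed

lemma left_module_restrict_ring:
  assumes "left_module R M" "S \<subseteq> carrier R" "ring (R\<lparr>carrier := S\<rparr>)"
  shows "left_module (R\<lparr>carrier := S\<rparr>) M"
proof -
  interpret left_module R M by fact
  show ?thesis
    using assms by (auto intro!: left_module.intro left_module_axioms.intro M.abelian_group_axioms
        simp: act_closed act_add_ring act_add act_mult act_one subset_iff)
qed

lemma (in right_module) submodule: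
  assumes "W \<subseteq> carrier M" "\<zero>\<^bsub>M\<^esub> \<in> W" "\<And>x y. \<lbrakk>x \<in> W; y \<in> W\<rbrakk> \<Longrightarrow> x \<oplus>\<^bsub>M\<^esub> y \<in> W"
    and "\<And>a x. \<lbrakk>a \<in> carrier R; x \<in> W\<rbrakk> \<Longrightarrow> a \<odot>\<^bsub>M\<^esub> x \<in> W"
  shows "right_module R (M\<lparr>carrier := W\<rparr>)"
proof -
  have "(\<ominus>\<^bsub>R\<^esub> \<one>\<^bsub>R\<^esub>) \<odot>\<^bsub>M\<^esub> x \<oplus>\<^bsub>M\<^esub> x = \<zero>\<^bsub>M\<^esub>" if "x \<in> W" for x
  proof -
    have x: "x \<in> carrier M" using that assms(1) by blast
    have "\<zero>\<^bsub>R\<^esub> \<odot>\<^bsub>M\<^esub> x \<oplus>\<^bsub>M\<^esub> \<zero>\<^bsub>R\<^esub> \<odot>\<^bsub>M\<^esub> x = \<zero>\<^bsub>R\<^esub> \<odot>\<^bsub>M\<^esub> x"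
      using x act_add_ring[of "\<zero>\<^bsub>R\<^esub>" "\<zero>\<^bsub>R\<^esub>" x] by simp
    then have "\<zero>\<^bsub>R\<^esub> \<odot>\<^bsub>M\<^esub> x = \<zero>\<^bsub>M\<^esub>"
      using x by (metis M.add.l_cancel_one R.zero_closed act_closed)
    then show ?thesis
      using x act_add_ring[of "\<ominus>\<^bsub>R\<^esub> \<one>\<^bsub>R\<^esub>" "\<one>\<^bsub>R\<^esub>" x] by (simp add: R.l_neg act_one)
  qed
  then have "\<exists>y\<in>W. y \<oplus>\<^bsub>M\<^esub> x = \<zero>\<^bsub>M\<^esub>" if "x \<in> W" for x
    using assms(4) that by (metis R.a_inv_closed R.one_closed)
  then have "abelian_group (M\<lparr>carrier := W\<rparr>)"
    using assms(1-3) by (intro abelian_groupI) (auto simp: subset_iff M.a_assoc intro: M.a_comm)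
  then show ?thesis
    using assms by (auto intro!: right_module.intro right_module_axioms.intro R.ring_axioms
        simp: subset_iff act_add_ring act_add act_mult act_one)
qed

definition closed_ball :: "('a, 'n, 'w) module_scheme \<Rightarrow> ('n \<Rightarrow> real) \<Rightarrow> ('a, 'n, 'w) module_scheme"
  where "closed_ball N \<nu> = N\<lparr>carrier := {n \<in> carrier N. \<nu> n \<le> 1}\<rparr>"

lemma closed_ball_simps [simp]:
  "carrier (closed_ball N \<nu>) = {n \<in> carrier N. \<nu> n \<le> 1}" "\<zero>\<^bsub>closed_ball N \<nu>\<^esub> = \<zero>\<^bsub>N\<^esub>"
  "x \<oplus>\<^bsub>closed_ball N \<nu>\<^esub> y = x \<oplus>\<^bsub>N\<^esub> y" "a \<odot>\<^bsub>closed_ball N \<nu>\<^esub> x = a \<odot>\<^bsub>N\<^esub> x"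
  by (simp_all add: closed_ball_def)

lemma closed_ball_unit_ball: "closed_ball V (nrm V) = unit_ball V"
  by (simp add: closed_ball_def unit_ball_def)

lemma unit_ball_simps [simp]:
  "carrier (unit_ball V) = {n \<in> carrier V. \<parallel>n\<parallel>\<^bsub>V\<^esub> \<le> 1}" "\<zero>\<^bsub>unit_ball V\<^esub> = \<zero>\<^bsub>V\<^esub>" "\<one>\<^bsub>unit_ball V\<^esub> = \<one>\<^bsub>V\<^esub>"
  "x \<oplus>\<^bsub>unit_ball V\<^esub> y = x \<oplus>\<^bsub>V\<^esub> y" "a \<odot>\<^bsub>unit_ball V\<^esub> x = a \<odot>\<^bsub>V\<^esub> x" "x \<otimes>\<^bsub>unit_ball V\<^esub> y = x \<otimes>\<^bsub>V\<^esub> y"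
  "nrm (unit_ball V) = nrm V"
  by (simp_all add: unit_ball_def)

locale dvf_right_module = dvf_algebra K av \<pi> p A
  for K :: "('k, 'x) ring_scheme" and av :: "'k \<Rightarrow> real" and \<pi> :: 'k and p :: nat
    and A :: "('k, 'a, 'y) normed_module_scheme" +
  fixes U :: "('a, 'u, 'z) normed_module_scheme"
  assumes normed_U: "normed_right_module K av A U"
begin

sublocale U: right_module A U
  using normed_U by (simp add: normed_right_module_def)

sublocale tensor_factor A U
  by unfold_locales

lemma nrm_U:
  shows nrm_U_nonneg: "u \<in> carrier U \<Longrightarrow> 0 \<le> \<parallel>u\<parallel>\<^bsub>U\<^esub>"
    and nrm_U_eq_0_iff: "u \<in> carrier U \<Longrightarrow> \<parallel>u\<parallel>\<^bsub>U\<^esub> = 0 \<longleftrightarrow> u = \<zero>\<^bsub>U\<^esub>"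
    and nrm_U_add: "\<lbrakk>u \<in> carrier U; u' \<in> carrier U\<rbrakk> \<Longrightarrow> \<parallel>u \<oplus>\<^bsub>U\<^esub> u'\<parallel>\<^bsub>U\<^esub> \<le> max \<parallel>u\<parallel>\<^bsub>U\<^esub> \<parallel>u'\<parallel>\<^bsub>U\<^esub>"
    and nrm_U_act: "\<lbrakk>a \<in> carrier A; u \<in> carrier U\<rbrakk> \<Longrightarrow> \<parallel>a \<odot>\<^bsub>U\<^esub> u\<parallel>\<^bsub>U\<^esub> \<le> \<parallel>a\<parallel>\<^bsub>A\<^esub> * \<parallel>u\<parallel>\<^bsub>U\<^esub>"
    and nrm_U_sc: "\<lbrakk>k \<in> carrier K; u \<in> carrier U\<rbrakk> \<Longrightarrow> \<parallel>sc k \<odot>\<^bsub>U\<^esub> u\<parallel>\<^bsub>U\<^esub> = av k * \<parallel>u\<parallel>\<^bsub>U\<^esub>"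
proof -
  interpret V: normed_space K av "restrict_scalars A U"
    using normed_U by (simp add: normed_right_module_def)
  show "u \<in> carrier U \<Longrightarrow> 0 \<le> \<parallel>u\<parallel>\<^bsub>U\<^esub>" "u \<in> carrier U \<Longrightarrow> \<parallel>u\<parallel>\<^bsub>U\<^esub> = 0 \<longleftrightarrow> u = \<zero>\<^bsub>U\<^esub>"
    "\<lbrakk>u \<in> carrier U; u' \<in> carrier U\<rbrakk> \<Longrightarrow> \<parallel>u \<oplus>\<^bsub>U\<^esub> u'\<parallel>\<^bsub>U\<^esub> \<le> max \<parallel>u\<parallel>\<^bsub>U\<^esub> \<parallel>u'\<parallel>\<^bsub>U\<^esub>"
    "\<lbrakk>k \<in> carrier K; u \<in> carrier U\<rbrakk> \<Longrightarrow> \<parallel>sc k \<odot>\<^bsub>U\<^esub> u\<parallel>\<^bsub>U\<^esub> = av k * \<parallel>u\<parallel>\<^bsub>U\<^esub>"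
    using V.nrm_nonneg V.nrm_add V.nrm_eq_0_iff V.nrm_smult
    by (simp_all add: restrict_scalars_def)
  show "\<lbrakk>a \<in> carrier A; u \<in> carrier U\<rbrakk> \<Longrightarrow> \<parallel>a \<odot>\<^bsub>U\<^esub> u\<parallel>\<^bsub>U\<^esub> \<le> \<parallel>a\<parallel>\<^bsub>A\<^esub> * \<parallel>u\<parallel>\<^bsub>U\<^esub>"
    using normed_U by (simp add: normed_right_module_def)
qed

lemma ring_unit_ball: "ring (unit_ball A)"
proof (rule ringI)
  have le1: "\<parallel>a \<otimes>\<^bsub>A\<^esub> b\<parallel>\<^bsub>A\<^esub> \<le> 1" if "a \<in> carrier A" "b \<in> carrier A" "\<parallel>a\<parallel>\<^bsub>A\<^esub> \<le> 1" "\<parallel>b\<parallel>\<^bsub>A\<^esub> \<le> 1" for a b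
    using A.nrm_mult[of a b] A.nrm_nonneg that
      mult_mono[of "\<parallel>a\<parallel>\<^bsub>A\<^esub>" 1 "\<parallel>b\<parallel>\<^bsub>A\<^esub>" 1] by force
  show "abelian_group (unit_ball A)"
  proof (rule abelian_groupI)
    fix a b assume "a \<in> carrier (unit_ball A)" "b \<in> carrier (unit_ball A)"
    then show "a \<oplus>\<^bsub>unit_ball A\<^esub> b \<in> carrier (unit_ball A)"
      using A.nrm_add[of a b] by auto
  next
    fix a assume "a \<in> carrier (unit_ball A)"
    then show "\<exists>b\<in>carrier (unit_ball A). b \<oplus>\<^bsub>unit_ball A\<^esub> a = \<zero>\<^bsub>unit_ball A\<^esub>"
      by (intro bexI[of _ "\<ominus>\<^bsub>A\<^esub> a"]) (auto simp: nrm_uminus A.l_neg)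
  qed (auto simp: A.a_assoc intro: A.a_comm)
  show "Group.monoid (unit_ball A)"
    by (rule monoidI) (auto simp: le1 A.nrm_one A.m_assoc)
qed (auto simp: A.l_distr A.r_distr)

lemma sc_unit_ball: "\<lbrakk>k \<in> carrier K; av k \<le> 1\<rbrakk> \<Longrightarrow> sc k \<in> carrier (unit_ball A)"
  using nrm_sc[of k] by simp

sublocale B: tensor_factor "unit_ball A" "unit_ball U"
proof -
  interpret R: right_module "unit_ball A" U
    using right_module_restrict_ring[OF U.right_module_axioms, of "carrier (unit_ball A)"] ring_unit_ball
    by (simp add: unit_ball_def)
  have "right_module (unit_ball A) (U\<lparr>carrier := {u \<in> carrier U. \<parallel>u\<parallel>\<^bsub>U\<^esub> \<le> 1}\<rparr>)"
  proof (rule R.submodule)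
    show "\<zero>\<^bsub>U\<^esub> \<in> {u \<in> carrier U. \<parallel>u\<parallel>\<^bsub>U\<^esub> \<le> 1}" using nrm_U_eq_0_iff[of "\<zero>\<^bsub>U\<^esub>"] by simp
    show "x \<oplus>\<^bsub>U\<^esub> y \<in> {u \<in> carrier U. \<parallel>u\<parallel>\<^bsub>U\<^esub> \<le> 1}"
      if "x \<in> {u \<in> carrier U. \<parallel>u\<parallel>\<^bsub>U\<^esub> \<le> 1}" "y \<in> {u \<in> carrier U. \<parallel>u\<parallel>\<^bsub>U\<^esub> \<le> 1}" for x y
      using that nrm_U_add[of x y] by auto
    show "a \<odot>\<^bsub>U\<^esub> x \<in> {u \<in> carrier U. \<parallel>u\<parallel>\<^bsub>U\<^esub> \<le> 1}"
      if "a \<in> carrier (unit_ball A)" "x \<in> {u \<in> carrier U. \<parallel>u\<parallel>\<^bsub>U\<^esub> \<le> 1}" for a x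
      using that nrm_U_act[of a x] mult_mono[of "\<parallel>a\<parallel>\<^bsub>A\<^esub>" 1 "\<parallel>x\<parallel>\<^bsub>U\<^esub>" 1] nrm_U_nonneg[of x]
      by (auto simp: U.act_closed)
  qed auto
  then show "tensor_factor (unit_ball A) (unit_ball U)"
    unfolding unit_ball_def[of U] by (rule tensor_factor.intro)
qed

lemma left_module_over_unit_ball: "left_module A N \<Longrightarrow> left_module (unit_ball A) N"
  using left_module_restrict_ring[of A N "carrier (unit_ball A)"] ring_unit_ball
  by (simp add: unit_ball_def)

lemma left_module_closed_ball:
  assumes N: "normed_left N \<nu>"
  shows "left_module (unit_ball A) (closed_ball N \<nu>)"
proof -
  interpret N: left_module "unit_ball A" N
    by (rule left_module_over_unit_ball[OF normed_leftD(1)[OF N]])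
  show ?thesis
    unfolding closed_ball_def
  proof (rule N.submodule)
    show "x \<oplus>\<^bsub>N\<^esub> y \<in> {n \<in> carrier N. \<nu> n \<le> 1}"
      if "x \<in> {n \<in> carrier N. \<nu> n \<le> 1}" "y \<in> {n \<in> carrier N. \<nu> n \<le> 1}" for x y
      using that normed_leftD(4)[OF N, of x y] by auto
    show "a \<odot>\<^bsub>N\<^esub> x \<in> {n \<in> carrier N. \<nu> n \<le> 1}"
      if "a \<in> carrier (unit_ball A)" "x \<in> {n \<in> carrier N. \<nu> n \<le> 1}" for a x
      using that normed_leftD(5)[OF N, of a x] mult_mono[of "\<parallel>a\<parallel>\<^bsub>A\<^esub>" 1 "\<nu> x" 1]
        normed_leftD(3)[OF N, of x] N.act_closed[of a x] by auto
  qed (use normed_leftD(2)[OF N] in auto)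
qed

lemma ball_rel_rel:
  assumes "left_module (unit_ball A) (closed_ball N \<nu>)" "left_module A N" "x \<in> B.rel (closed_ball N \<nu>)"
  shows "x \<in> rel N"
  using assms(1,3)
  by (induction rule: B.rel_induct)
    (auto simp: rel_diff[OF assms(2)] intro: rel_add_left rel_add_right rel_act)

subsection \<open>Boundedness\<close>

lemma frag_bounded_frag_map:
  assumes "x \<in> tensor_frags U N" "frag_bounded U \<nu> x r" "\<And>n. n \<in> carrier N \<Longrightarrow> \<nu>' (f n) \<le> c * \<nu> n" "0 \<le> c"
  shows "frag_bounded U \<nu>' (frag_map f x) (c * r)"
  unfolding frag_bounded_def
proof clarify
  fix u m assume "(u, m) \<in> Poly_Mapping.keys (frag_map f x)"
  then obtain n where n: "(u, n) \<in> Poly_Mapping.keys x" "m = f n"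
    using keys_frag_map[of f x] by auto
  then have un: "u \<in> carrier U" "n \<in> carrier N" "\<parallel>u\<parallel>\<^bsub>U\<^esub> * \<nu> n \<le> r"
    using assms(1,2) by (auto simp: tensor_frags_def frag_bounded_def)
  have "\<parallel>u\<parallel>\<^bsub>U\<^esub> * \<nu>' m \<le> \<parallel>u\<parallel>\<^bsub>U\<^esub> * (c * \<nu> n)"
    using n un assms(3)[of n] nrm_U_nonneg[of u] by (auto intro: mult_left_mono)
  also have "\<dots> \<le> c * r"
    using mult_left_mono[OF un(3) assms(4)] by (simp add: algebra_simps)
  finally show "\<parallel>u\<parallel>\<^bsub>U\<^esub> * \<nu>' m \<le> c * r" .
qed

abbreviation bounded_by :: "('a, 'n, 'w) module_scheme \<Rightarrow> ('n \<Rightarrow> real) \<Rightarrow> (('u \<times> 'n) \<Rightarrow>\<^sub>0 int) \<Rightarrow> real \<Rightarrow> bool"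
  where "bounded_by \<equiv> tensor_bounded A U"

lemma bounded_by_frag:
  "\<lbrakk>x \<in> tensor_frags U N; frag_bounded U \<nu> x r\<rbrakk> \<Longrightarrow> bounded_by N \<nu> x r"
  by (auto simp: tensor_bounded_def intro!: bexI[of _ x])

lemma bounded_by_mono: "\<lbrakk>bounded_by N \<nu> x r; r \<le> s\<rbrakk> \<Longrightarrow> bounded_by N \<nu> x s"
  using frag_bounded_mono unfolding tensor_bounded_def by blast

lemma bounded_by_zero: "x \<in> rel N \<Longrightarrow> bounded_by N \<nu> x r"
  by (auto simp: tensor_bounded_def intro!: bexI[of _ 0])

lemma bounded_by_add:
  assumes "bounded_by N \<nu> x r" "bounded_by N \<nu> y s"
  shows "bounded_by N \<nu> (x + y) (max r s)"
proof -
  obtain x' y' where "x' \<in> tensor_frags U N" "x - x' \<in> rel N" "frag_bounded U \<nu> x' r"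
    "y' \<in> tensor_frags U N" "y - y' \<in> rel N" "frag_bounded U \<nu> y' s"
    using assms by (auto simp: tensor_bounded_def)
  then show ?thesis
    using rel_add[of "x - x'" N "y - y'"] frag_bounded_mono[of U \<nu> _ _ "max r s"]
    unfolding tensor_bounded_def
    by (intro bexI[of _ "x' + y'"] conjI frag_bounded_add) (auto simp: algebra_simps)
qed

lemma bounded_by_uminus:
  assumes "left_module A N" "bounded_by N \<nu> x r"
  shows "bounded_by N \<nu> (- x) r"
proof -
  obtain x' where "x' \<in> tensor_frags U N" "x - x' \<in> rel N" "frag_bounded U \<nu> x' r"
    using assms by (auto simp: tensor_bounded_def)
  then show ?thesis
    using rel_minus[OF assms(1), of "x - x'"] unfolding tensor_bounded_def
    by (intro bexI[of _ "- x'"]) auto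
qed

lemma bounded_by_diff:
  "\<lbrakk>left_module A N; bounded_by N \<nu> x r; bounded_by N \<nu> y s\<rbrakk> \<Longrightarrow> bounded_by N \<nu> (x - y) (max r s)"
  using bounded_by_add[of N \<nu> x r "- y" s] bounded_by_uminus[of N \<nu> y s] by simp

lemma bounded_by_frag_map:
  assumes "left_module A N" "left_module A N'" "f \<in> left_hom A N N'" "bounded_by N \<nu> x r"
    and "\<And>n. n \<in> carrier N \<Longrightarrow> \<nu>' (f n) \<le> c * \<nu> n" "0 \<le> c"
  shows "bounded_by N' \<nu>' (frag_map f x) (c * r)"
proof -
  obtain y where y: "y \<in> tensor_frags U N" "x - y \<in> rel N" "frag_bounded U \<nu> y r"
    using assms(4) by (auto simp: tensor_bounded_def)
  have "frag_map f y \<in> tensor_frags U N'"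
    using y(1) left_hom_closed[OF assms(3)] by (rule frag_map_closed)
  moreover have "frag_map f x - frag_map f y \<in> rel N'"
    using frag_map_rel[OF assms(1-3) y(2)] by simp
  moreover have "frag_bounded U \<nu>' (frag_map f y) (c * r)"
    using y(1,3) assms(5,6) by (rule frag_bounded_frag_map)
  ultimately show ?thesis unfolding tensor_bounded_def by blast
qed

lemma ex_frag_bounded: "\<exists>r>0. frag_bounded U \<nu> x r"
proof -
  let ?S = "(\<lambda>(u, n). \<parallel>u\<parallel>\<^bsub>U\<^esub> * \<nu> n) ` Poly_Mapping.keys x"
  have "frag_bounded U \<nu> x (Max (insert 1 ?S))"
    unfolding frag_bounded_def by (intro ballI, clarify, intro Max_ge) (auto intro!: rev_image_eqI)
  moreover have "0 < Max (insert 1 ?S)"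
    by (simp add: less_le_trans[OF zero_less_one Max_ge])
  ultimately show ?thesis by blast
qed

lemma frag_map_sc_inv:
  assumes N: "normed_left N \<nu>" and k: "k \<in> carrier K" "k \<noteq> \<zero>\<^bsub>K\<^esub>" and x: "x \<in> tensor_frags U N"
  shows "frag_map ((\<odot>\<^bsub>N\<^esub>) (sc (inv\<^bsub>K\<^esub> k))) (frag_map ((\<odot>\<^bsub>N\<^esub>) (sc k)) x) = x"
proof -
  interpret N: left_module A N by (rule normed_leftD(1)[OF N])
  show ?thesis
    using inv_closed[OF k] k(1)
    by (auto simp: frag_map_comp sc_act_act[OF N] N.act_one intro!: frag_map_ident[OF x])
qed

text \<open>Write \<open>x\<close> as a sum of terms \<open>u \<otimes> n\<close> with \<open>|u| |n| \<le> r\<close>. For each of them a scalar \<open>l\<close> brings \<open>u\<close> to a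
  norm between \<open>q\<close> and \<open>1\<close>, and \<open>k u \<otimes> n = l u \<otimes> (k / l) n\<close> has both factors in the unit balls if \<open>k\<close> is
  small enough, independently of the term.\<close>

lemma integralize:
  assumes N: "normed_left N \<nu>" and x: "bounded_by N \<nu> x r" and r: "0 < r"
  shows "\<exists>k\<in>carrier K. k \<noteq> \<zero>\<^bsub>K\<^esub> \<and> q\<^sup>2 \<le> av k * r \<and>
    (\<exists>y\<in>tensor_frags (unit_ball U) (closed_ball N \<nu>). frag_map ((\<odot>\<^bsub>N\<^esub>) (sc k)) x - y \<in> rel N)"
proof -
  interpret N: left_module A N by (rule normed_leftD(1)[OF N])
  note Nm = N.left_module_axioms
  \<comment> \<open>The norm of \<open>l u\<close> may be as small as \<open>q\<close>; the margin \<open>1 / q\<close> makes up for it.\<close>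
  obtain k where k: "k \<in> carrier K" "k \<noteq> \<zero>\<^bsub>K\<^esub>" "av k * (r / q) \<le> 1" "q < av k * (r / q)"
    using ex_scaling[of "r / q"] r q by auto
  obtain y where y: "y \<in> tensor_frags U N" "x - y \<in> rel N" "frag_bounded U \<nu> y r"
    using x by (auto simp: tensor_bounded_def)
  have "\<forall>u. \<exists>l. u \<in> carrier U \<and> u \<noteq> \<zero>\<^bsub>U\<^esub> \<longrightarrow>
      l \<in> carrier K \<and> l \<noteq> \<zero>\<^bsub>K\<^esub> \<and> av l * \<parallel>u\<parallel>\<^bsub>U\<^esub> \<le> 1 \<and> q < av l * \<parallel>u\<parallel>\<^bsub>U\<^esub>"
    using ex_scaling nrm_U_nonneg nrm_U_eq_0_iff by (metis order_le_less)
  then obtain l where l: "\<And>u. \<lbrakk>u \<in> carrier U; u \<noteq> \<zero>\<^bsub>U\<^esub>\<rbrakk> \<Longrightarrow>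
      l u \<in> carrier K \<and> l u \<noteq> \<zero>\<^bsub>K\<^esub> \<and> av (l u) * \<parallel>u\<parallel>\<^bsub>U\<^esub> \<le> 1 \<and> q < av (l u) * \<parallel>u\<parallel>\<^bsub>U\<^esub>"
    by metis
  define g where "g = (\<lambda>(u, n). if u = \<zero>\<^bsub>U\<^esub> then 0 else
    frag_of (sc (l u) \<odot>\<^bsub>U\<^esub> u, sc (k \<otimes>\<^bsub>K\<^esub> inv\<^bsub>K\<^esub> (l u)) \<odot>\<^bsub>N\<^esub> n))"
  have key: "g (u, n) \<in> tensor_frags (unit_ball U) (closed_ball N \<nu>) \<and>
      frag_of (u, sc k \<odot>\<^bsub>N\<^esub> n) - g (u, n) \<in> rel N"
    if un: "u \<in> carrier U" "n \<in> carrier N" "\<parallel>u\<parallel>\<^bsub>U\<^esub> * \<nu> n \<le> r" for u n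
  proof (cases "u = \<zero>\<^bsub>U\<^esub>")
    case True
    then show ?thesis
      using un k by (auto simp: g_def intro: rel_zero_left[OF Nm] N.act_closed)
  next
    case False
    note lu = l[OF un(1) False]
    note inv = inv_closed[of "l u"]
    let ?n = "sc (k \<otimes>\<^bsub>K\<^esub> inv\<^bsub>K\<^esub> (l u)) \<odot>\<^bsub>N\<^esub> n"
    have av_l: "0 < av (l u)" using av_pos[of "l u"] lu by simp
    have "\<nu> ?n = av k / av (l u) * \<nu> n"
      using lu inv k un by (simp add: norm_sc[OF N] K.av_mult)
    also have "\<dots> \<le> av k / av (l u) * (r / \<parallel>u\<parallel>\<^bsub>U\<^esub>)"
      using un lu nrm_U_nonneg[of u] nrm_U_eq_0_iff[of u] False av_pos[OF k(1,2)] av_l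
      by (intro mult_left_mono) (auto simp: field_simps)
    also have "\<dots> = av k * r * (1 / (av (l u) * \<parallel>u\<parallel>\<^bsub>U\<^esub>))" by simp
    also have "\<dots> \<le> av k * r * (1 / q)"
      using lu q r av_pos[OF k(1,2)] by (intro mult_left_mono divide_left_mono) auto
    also have "\<dots> \<le> 1" using k(3) by simp
    finally have n: "\<nu> ?n \<le> 1" .
    have "sc (l u) \<odot>\<^bsub>N\<^esub> ?n = sc k \<odot>\<^bsub>N\<^esub> n"
      using lu inv k un by (simp add: sc_act_act[OF N] K.m_lcomm[of "l u" k])
    moreover have "frag_of (sc (l u) \<odot>\<^bsub>U\<^esub> u, ?n) - frag_of (u, sc (l u) \<odot>\<^bsub>N\<^esub> ?n) \<in> rel N"
      using lu inv k un by (intro rel_act) (auto simp: N.act_closed)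
    ultimately show ?thesis
      using n lu inv k un False rel_minus_commute[OF Nm]
      by (auto simp: g_def U.act_closed N.act_closed nrm_U_sc)
  qed
  have sub: "Poly_Mapping.keys y \<subseteq> {(u, n). u \<in> carrier U \<and> n \<in> carrier N \<and> \<parallel>u\<parallel>\<^bsub>U\<^esub> * \<nu> n \<le> r}"
    using y(1,3) by (auto simp: tensor_frags_def frag_bounded_def)
  have "frag_extend g y \<in> tensor_frags (unit_ball U) (closed_ball N \<nu>) \<and>
      frag_map ((\<odot>\<^bsub>N\<^esub>) (sc k)) y - frag_extend g y \<in> rel N"
    using sub
  proof (induction y rule: frag_induction)
    case (one un)
    then show ?case using key by auto
  next
    case (diff a b)
    then show ?case
      using rel_diff[OF Nm, of "frag_map ((\<odot>\<^bsub>N\<^esub>) (sc k)) a - frag_extend g a"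
          "frag_map ((\<odot>\<^bsub>N\<^esub>) (sc k)) b - frag_extend g b"]
      by (auto simp: frag_extend_diff algebra_simps)
  qed auto
  moreover have "frag_map ((\<odot>\<^bsub>N\<^esub>) (sc k)) x - frag_map ((\<odot>\<^bsub>N\<^esub>) (sc k)) y \<in> rel N"
    using frag_map_rel[OF Nm Nm sc_hom[OF N k(1)] y(2)] by simp
  ultimately have "frag_map ((\<odot>\<^bsub>N\<^esub>) (sc k)) x - frag_extend g y \<in> rel N"
    using rel_trans by blast
  moreover have "q\<^sup>2 \<le> av k * r" using k(4) q by (simp add: field_simps power2_eq_square)
  ultimately show ?thesis
    using k \<open>_ \<and> _\<close> by blast
qed

text \<open>Both factors are multiplied by the power of \<open>\<pi>\<close>, since both may have a norm larger than \<open>1\<close>. On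
  tensors of the unit balls this is multiplication by \<open>\<pi>\<^sup>2\<^sup>m\<close>, see \<open>scale_ball\<close>.\<close>

definition scale :: "('a, 'n, 'w) module_scheme \<Rightarrow> nat \<Rightarrow> (('u \<times> 'n) \<Rightarrow>\<^sub>0 int) \<Rightarrow> (('u \<times> 'n) \<Rightarrow>\<^sub>0 int)"
  where "scale N m = frag_extend (\<lambda>(u, n).
    frag_of (sc (\<pi> [^]\<^bsub>K\<^esub> m) \<odot>\<^bsub>U\<^esub> u, sc (\<pi> [^]\<^bsub>K\<^esub> m) \<odot>\<^bsub>N\<^esub> n))"

lemma scale_simps [simp]:
  "scale N m 0 = 0"
  "scale N m (frag_of (u, n)) = frag_of (sc (\<pi> [^]\<^bsub>K\<^esub> m) \<odot>\<^bsub>U\<^esub> u, sc (\<pi> [^]\<^bsub>K\<^esub> m) \<odot>\<^bsub>N\<^esub> n)"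
  "scale N m (x - y) = scale N m x - scale N m y"
  by (simp_all add: scale_def frag_extend_diff)

lemma ex_pow_ball_U: "u \<in> carrier U \<Longrightarrow>
    \<exists>m0. \<forall>m\<ge>m0. sc (\<pi> [^]\<^bsub>K\<^esub> (m::nat)) \<odot>\<^bsub>U\<^esub> u \<in> carrier (unit_ball U)"
  using ex_pow_small[of 1 "\<parallel>u\<parallel>\<^bsub>U\<^esub>"] by (auto simp: U.act_closed nrm_U_sc av_pow)

lemma ex_pow_ball:
  assumes N: "normed_left N \<nu>" and n: "n \<in> carrier N"
  shows "\<exists>m0. \<forall>m\<ge>m0. sc (\<pi> [^]\<^bsub>K\<^esub> (m::nat)) \<odot>\<^bsub>N\<^esub> n \<in> carrier (closed_ball N \<nu>)"
proof -
  interpret N: left_module A N by (rule normed_leftD(1)[OF N])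
  show ?thesis
    using n ex_pow_small[of 1 "\<nu> n"] by (auto simp: N.act_closed norm_sc[OF N] av_pow)
qed

lemma scale_frags:
  assumes N: "normed_left N \<nu>" and x: "x \<in> tensor_frags U N"
  shows "\<exists>m0. \<forall>m\<ge>m0. scale N m x \<in> tensor_frags (unit_ball U) (closed_ball N \<nu>)"
  using x
proof (induction rule: tensor_frags_induct)
  case (diff x y)
  then obtain a b where "\<forall>m\<ge>a. scale N m x \<in> tensor_frags (unit_ball U) (closed_ball N \<nu>)"
    "\<forall>m\<ge>b. scale N m y \<in> tensor_frags (unit_ball U) (closed_ball N \<nu>)" by blast
  then show ?case by (intro exI[of _ "max a b"]) auto
next
  case (pure u n)
  obtain a b where "\<forall>m\<ge>a. sc (\<pi> [^]\<^bsub>K\<^esub> (m::nat)) \<odot>\<^bsub>U\<^esub> u \<in> carrier (unit_ball U)"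
    "\<forall>m\<ge>b. sc (\<pi> [^]\<^bsub>K\<^esub> (m::nat)) \<odot>\<^bsub>N\<^esub> n \<in> carrier (closed_ball N \<nu>)"
    using ex_pow_ball_U[OF pure(1)] ex_pow_ball[OF N pure(2)] by blast
  then show ?case by (intro exI[of _ "max a b"]) auto
qed auto

lemma scale_frag_map:
  assumes "f \<in> left_hom A N N'" "x \<in> tensor_frags U N"
  shows "scale N' m (frag_map f x) = frag_map f (scale N m x)"
  using assms(2) by (induction rule: tensor_frags_induct) (auto simp: left_hom_act[OF assms(1)])

lemma scale_ball:
  assumes N: "normed_left N \<nu>" and x: "x \<in> tensor_frags (unit_ball U) (closed_ball N \<nu>)"
  shows "scale N m x - frag_map ((\<odot>\<^bsub>N\<^esub>) (sc (\<pi> [^]\<^bsub>K\<^esub> (m + m)))) x \<in> B.rel (closed_ball N \<nu>)"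
proof -
  interpret N: left_module A N by (rule normed_leftD(1)[OF N])
  interpret N0: left_module "unit_ball A" "closed_ball N \<nu>" by (rule left_module_closed_ball[OF N])
  have q1: "av (\<pi> [^]\<^bsub>K\<^esub> m) \<le> 1" using q by (simp add: av_pow power_le_one)
  note s = sc_unit_ball[OF pow_closed q1]
  show ?thesis
    using x
  proof (induction rule: tensor_frags_induct)
    case (diff x y)
    then show ?case
      using B.rel_diff[OF N0.left_module_axioms diff(3,4)] by (simp add: algebra_simps)
  next
    case (pure u n)
    then have "frag_of (sc (\<pi> [^]\<^bsub>K\<^esub> m) \<odot>\<^bsub>unit_ball U\<^esub> u, sc (\<pi> [^]\<^bsub>K\<^esub> m) \<odot>\<^bsub>closed_ball N \<nu>\<^esub> n) -
        frag_of (u, sc (\<pi> [^]\<^bsub>K\<^esub> m) \<odot>\<^bsub>closed_ball N \<nu>\<^esub> (sc (\<pi> [^]\<^bsub>K\<^esub> m) \<odot>\<^bsub>closed_ball N \<nu>\<^esub> n))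
        \<in> B.rel (closed_ball N \<nu>)"
      by (intro B.rel_act s N0.act_closed)
    then show ?case
      using pure by (simp add: sc_act_act[OF N] K.nat_pow_mult K.uniformizer_closed)
  qed simp
qed

text \<open>Only finitely many generators of the relations occur in \<open>x\<close>, and each of them becomes a relation
  over the unit balls under a high power of \<open>\<pi>\<close>.\<close>

lemma clear_denominators:
  assumes N: "normed_left N \<nu>" and x: "x \<in> rel N"
  shows "\<exists>m0. \<forall>m\<ge>m0. scale N m x \<in> B.rel (closed_ball N \<nu>)"
proof -
  interpret N: left_module A N by (rule normed_leftD(1)[OF N])
  interpret N0: left_module "unit_ball A" "closed_ball N \<nu>" by (rule left_module_closed_ball[OF N])
  note U = ex_pow_ball_U and n = ex_pow_ball[OF N]
  let ?s = "\<lambda>m::nat. sc (\<pi> [^]\<^bsub>K\<^esub> m)"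
  show ?thesis
    using N.left_module_axioms x
  proof (induction rule: rel_induct)
    case (diff x y)
    then obtain a b where "\<forall>m\<ge>a. scale N m x \<in> B.rel (closed_ball N \<nu>)"
      "\<forall>m\<ge>b. scale N m y \<in> B.rel (closed_ball N \<nu>)" by blast
    then show ?case
      by (intro exI[of _ "max a b"]) (auto intro: B.rel_diff[OF N0.left_module_axioms])
  next
    case (add_left u u' n)
    obtain a b c where m: "\<forall>m\<ge>a. ?s m \<odot>\<^bsub>U\<^esub> u \<in> carrier (unit_ball U)"
      "\<forall>m\<ge>b. ?s m \<odot>\<^bsub>U\<^esub> u' \<in> carrier (unit_ball U)" "\<forall>m\<ge>c. ?s m \<odot>\<^bsub>N\<^esub> n \<in> carrier (closed_ball N \<nu>)"
      using U[OF add_left(1)] U[OF add_left(2)] n[OF add_left(3)] by blast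
    show ?case
    proof (intro exI[of _ "max a (max b c)"] allI impI)
      fix k assume "max a (max b c) \<le> k"
      then show "scale N k (frag_of (u \<oplus>\<^bsub>U\<^esub> u', n) - frag_of (u, n) - frag_of (u', n)) \<in> B.rel (closed_ball N \<nu>)"
        using B.rel_add_left[of "?s k \<odot>\<^bsub>U\<^esub> u" "?s k \<odot>\<^bsub>U\<^esub> u'" "?s k \<odot>\<^bsub>N\<^esub> n" "closed_ball N \<nu>"] m add_left
        by (simp add: U.act_add)
    qed
  next
    case (add_right u n n')
    obtain a b c where m: "\<forall>m\<ge>a. ?s m \<odot>\<^bsub>U\<^esub> u \<in> carrier (unit_ball U)"
      "\<forall>m\<ge>b. ?s m \<odot>\<^bsub>N\<^esub> n \<in> carrier (closed_ball N \<nu>)" "\<forall>m\<ge>c. ?s m \<odot>\<^bsub>N\<^esub> n' \<in> carrier (closed_ball N \<nu>)"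
      using U[OF add_right(1)] n[OF add_right(2)] n[OF add_right(3)] by blast
    show ?case
    proof (intro exI[of _ "max a (max b c)"] allI impI)
      fix k assume "max a (max b c) \<le> k"
      then show "scale N k (frag_of (u, n \<oplus>\<^bsub>N\<^esub> n') - frag_of (u, n) - frag_of (u, n')) \<in> B.rel (closed_ball N \<nu>)"
        using B.rel_add_right[of "?s k \<odot>\<^bsub>U\<^esub> u" "?s k \<odot>\<^bsub>N\<^esub> n" "closed_ball N \<nu>" "?s k \<odot>\<^bsub>N\<^esub> n'"] m add_right
        by (simp add: N.act_add)
    qed
  next
    case (act a u n)
    \<comment> \<open>The generator that moves \<open>a\<close> across the tensor sign is the difference of those for \<open>\<pi>\<^sup>l a\<close> and
      \<open>\<pi>\<^sup>l\<close>, which are integral.\<close>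
    obtain l b c e where m: "\<forall>m\<ge>b. ?s m \<odot>\<^bsub>U\<^esub> u \<in> carrier (unit_ball U)"
      "\<forall>m\<ge>c. ?s m \<odot>\<^bsub>N\<^esub> n \<in> carrier (closed_ball N \<nu>)"
      "\<forall>m\<ge>e. ?s m \<odot>\<^bsub>N\<^esub> (a \<odot>\<^bsub>N\<^esub> n) \<in> carrier (closed_ball N \<nu>)"
      "q ^ l * \<parallel>a\<parallel>\<^bsub>A\<^esub> \<le> 1"
      using U[OF act(2)] n[OF act(3)] n[OF N.act_closed[OF act(1,3)]] ex_pow_small[of 1 "\<parallel>a\<parallel>\<^bsub>A\<^esub>"]
      by auto
    show ?case
    proof (intro exI[of _ "b + c + e + l"] allI impI)
      fix k assume k: "b + c + e + l \<le> k"
      define j where "j = k - l"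
      have j: "k = l + j" "b \<le> j" "c \<le> k" "e \<le> k" using k by (auto simp: j_def)
      let ?a = "?s l \<otimes>\<^bsub>A\<^esub> a"
      have sk: "?s k = ?s l \<otimes>\<^bsub>A\<^esub> ?s j" "?s k = ?s j \<otimes>\<^bsub>A\<^esub> ?s l"
        by (simp_all add: j(1) sc_mult K.nat_pow_mult K.uniformizer_closed add.commute)
      have "\<parallel>?a\<parallel>\<^bsub>A\<^esub> \<le> q ^ l * \<parallel>a\<parallel>\<^bsub>A\<^esub>"
        using act(1) A.nrm_mult[of "?s l" a] nrm_sc[of "\<pi> [^]\<^bsub>K\<^esub> l"] A.nrm_nonneg[of a]
          mult_right_mono[of "\<parallel>?s l\<parallel>\<^bsub>A\<^esub>" "q ^ l" "\<parallel>a\<parallel>\<^bsub>A\<^esub>"] by (simp add: av_pow)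
      then have a: "?a \<in> carrier (unit_ball A)" using m(4) act(1) by simp
      have sl: "?s l \<in> carrier (unit_ball A)"
        using q by (intro sc_unit_ball) (auto simp: av_pow power_le_one)
      have 1: "?s k \<odot>\<^bsub>U\<^esub> (a \<odot>\<^bsub>U\<^esub> u) = ?a \<odot>\<^bsub>U\<^esub> (?s j \<odot>\<^bsub>U\<^esub> u)"
      proof -
        have "?s k \<odot>\<^bsub>U\<^esub> (a \<odot>\<^bsub>U\<^esub> u) = (a \<otimes>\<^bsub>A\<^esub> ?s k) \<odot>\<^bsub>U\<^esub> u"
          using act by (simp add: U.act_mult)
        also have "a \<otimes>\<^bsub>A\<^esub> ?s k = ?s j \<otimes>\<^bsub>A\<^esub> ?a"
          using act(1) sc_central[of "\<pi> [^]\<^bsub>K\<^esub> k" a] by (simp add: sk(2) A.m_assoc)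
        also have "(?s j \<otimes>\<^bsub>A\<^esub> ?a) \<odot>\<^bsub>U\<^esub> u = ?a \<odot>\<^bsub>U\<^esub> (?s j \<odot>\<^bsub>U\<^esub> u)"
          using act by (intro U.act_mult) auto
        finally show ?thesis .
      qed
      have 2: "?s k \<odot>\<^bsub>U\<^esub> u = ?s l \<odot>\<^bsub>U\<^esub> (?s j \<odot>\<^bsub>U\<^esub> u)"
        using act by (simp add: sk(2) U.act_mult)
      have 3: "?a \<odot>\<^bsub>N\<^esub> (?s k \<odot>\<^bsub>N\<^esub> n) = ?s l \<odot>\<^bsub>N\<^esub> (?s k \<odot>\<^bsub>N\<^esub> (a \<odot>\<^bsub>N\<^esub> n))"
      proof -
        have "?a \<odot>\<^bsub>N\<^esub> (?s k \<odot>\<^bsub>N\<^esub> n) = ?s l \<odot>\<^bsub>N\<^esub> ((a \<otimes>\<^bsub>A\<^esub> ?s k) \<odot>\<^bsub>N\<^esub> n)"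
          using act by (simp add: N.act_mult N.act_closed)
        also have "a \<otimes>\<^bsub>A\<^esub> ?s k = ?s k \<otimes>\<^bsub>A\<^esub> a" using act by (simp add: sc_central)
        finally show ?thesis using act by (simp add: N.act_mult N.act_closed)
      qed
      have e1: "frag_of (?a \<odot>\<^bsub>U\<^esub> (?s j \<odot>\<^bsub>U\<^esub> u), ?s k \<odot>\<^bsub>N\<^esub> n) - frag_of (?s j \<odot>\<^bsub>U\<^esub> u, ?a \<odot>\<^bsub>N\<^esub> (?s k \<odot>\<^bsub>N\<^esub> n))
          \<in> B.rel (closed_ball N \<nu>)"
        using B.rel_act[of ?a "?s j \<odot>\<^bsub>U\<^esub> u" "?s k \<odot>\<^bsub>N\<^esub> n" "closed_ball N \<nu>"] a m j by simp
      have e2: "frag_of (?s l \<odot>\<^bsub>U\<^esub> (?s j \<odot>\<^bsub>U\<^esub> u), ?s k \<odot>\<^bsub>N\<^esub> (a \<odot>\<^bsub>N\<^esub> n)) -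
          frag_of (?s j \<odot>\<^bsub>U\<^esub> u, ?s l \<odot>\<^bsub>N\<^esub> (?s k \<odot>\<^bsub>N\<^esub> (a \<odot>\<^bsub>N\<^esub> n))) \<in> B.rel (closed_ball N \<nu>)"
        using B.rel_act[of "?s l" "?s j \<odot>\<^bsub>U\<^esub> u" "?s k \<odot>\<^bsub>N\<^esub> (a \<odot>\<^bsub>N\<^esub> n)" "closed_ball N \<nu>"] sl m j by simp
      have "frag_of (?s k \<odot>\<^bsub>U\<^esub> (a \<odot>\<^bsub>U\<^esub> u), ?s k \<odot>\<^bsub>N\<^esub> n) - frag_of (?s k \<odot>\<^bsub>U\<^esub> u, ?s k \<odot>\<^bsub>N\<^esub> (a \<odot>\<^bsub>N\<^esub> n))
          \<in> B.rel (closed_ball N \<nu>)"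
        using B.rel_diff[OF N0.left_module_axioms e1 e2] by (simp only: 1 2 3 diff_diff_eq2 diff_add_cancel)
      then show "scale N k (frag_of (a \<odot>\<^bsub>U\<^esub> u, n) - frag_of (u, a \<odot>\<^bsub>N\<^esub> n)) \<in> B.rel (closed_ball N \<nu>)"
        by simp
    qed
  qed auto
qed

end

section \<open>Strict maps\<close>

context dvf_algebra
begin

text \<open>Strictness makes the image of the open unit ball of the quotient by the kernel open, so the
  image of the unit ball contains all elements of \<open>d ` carrier G\<close> of norm less than some \<open>e\<close>. Scaling
  yields the bound for all elements.\<close>

lemma strict_map_lift:
  assumes G: "normed_left_module K av A G" and H: "normed_left_module K av A H"
    and d: "d \<in> left_hom A G H" and strict: "strict_map G H d"
  shows "\<exists>c>0. \<forall>z\<in>d ` carrier G. \<exists>x\<in>carrier G. d x = z \<and> \<parallel>x\<parallel>\<^bsub>G\<^esub> \<le> c * \<parallel>z\<parallel>\<^bsub>H\<^esub>"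
proof -
  note nG = normed_left_normed_left_module[OF G] and nH = normed_left_normed_left_module[OF H]
  interpret G: left_module A G by (rule normed_leftD(1)[OF nG])
  interpret H: left_module A H by (rule normed_leftD(1)[OF nH])
  note d0 = left_hom_zero[OF d G.M.abelian_group_axioms H.M.abelian_group_axioms]
  note dm = left_hom_minus[OF d G.M.abelian_group_axioms H.M.abelian_group_axioms]
  define N where "N = a_kernel G H d"
  have N: "N = {x \<in> carrier G. d x = \<zero>\<^bsub>H\<^esub>}" by (simp add: N_def a_kernel_def')
  have "left_module A (G\<lparr>carrier := N\<rparr>)"
    by (rule G.submodule) (use d0 in \<open>auto simp: N left_hom_add[OF d] left_hom_act[OF d] G.act_closed\<close>)
  then interpret N': left_module A "G\<lparr>carrier := N\<rparr>" .
  have "\<ominus>\<^bsub>G\<^esub> x \<in> N" if "x \<in> N" for x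
    using that left_hom_uminus[OF d G.M.abelian_group_axioms H.M.abelian_group_axioms]
    by (auto simp: N)
  then have "subgroup N (add_monoid G)"
    using d0 left_hom_add[OF d]
    by (intro group.subgroupI[OF G.M.a_group]) (auto simp: N a_inv_def)
  then interpret sub: abelian_subgroup N G
    by (intro abelian_subgroupI2 G.M.a_comm_group)
  define Q where "Q = quot_normed G N"
  have Q: "carrier Q = a_rcosets\<^bsub>G\<^esub> N" "\<zero>\<^bsub>Q\<^esub> = N" "add Q = set_add G" "nrm Q = (\<lambda>X. Inf (nrm G ` X))"
    by (simp_all add: Q_def quot_normed_def with_norm_def quot_module_def)
  have Qc: "X \<in> carrier Q \<longleftrightarrow> (\<exists>x\<in>carrier G. X = N +>\<^bsub>G\<^esub> x)" for X
    by (auto simp: Q A_RCOSETS_def')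
  have Qadd: "(N +>\<^bsub>G\<^esub> x) \<oplus>\<^bsub>Q\<^esub> (N +>\<^bsub>G\<^esub> y) = N +>\<^bsub>G\<^esub> (x \<oplus>\<^bsub>G\<^esub> y)"
    if "x \<in> carrier G" "y \<in> carrier G" for x y
    using that by (simp add: Q(3) sub.a_rcos_sum)
  have Qzero: "\<zero>\<^bsub>Q\<^esub> = N +>\<^bsub>G\<^esub> \<zero>\<^bsub>G\<^esub>"
    using G.M.a_coset_add_zero[OF sub.a_subset] by (simp add: Q(2))
  interpret Q: abelian_group Q
  proof (rule abelian_groupI)
    fix X assume "X \<in> carrier Q"
    then obtain x where "x \<in> carrier G" "X = N +>\<^bsub>G\<^esub> x" by (auto simp: Qc)
    then show "\<exists>Y\<in>carrier Q. Y \<oplus>\<^bsub>Q\<^esub> X = \<zero>\<^bsub>Q\<^esub>"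
      by (intro bexI[of _ "N +>\<^bsub>G\<^esub> (\<ominus>\<^bsub>G\<^esub> x)"]) (auto simp: Qc Qadd Qzero G.M.l_neg)
  qed (auto simp: Qc Qadd Qzero G.M.a_ac)
  have coset_sub: "N +>\<^bsub>G\<^esub> x \<subseteq> carrier G" if "x \<in> carrier G" for x
    by (rule G.M.a_r_coset_subset_G[OF sub.a_subset that])
  define S where "S = {X \<in> carrier Q. \<exists>x\<in>X. \<parallel>x\<parallel>\<^bsub>G\<^esub> < 1}"
  have "openin (seminorm_topology Q) S"
    unfolding openin_seminorm_topology
  proof (intro conjI ballI)
    fix X assume X: "X \<in> S"
    then obtain x where x: "x \<in> X" "\<parallel>x\<parallel>\<^bsub>G\<^esub> < 1" and XQ: "X \<in> carrier Q" by (auto simp: S_def)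
    then have xG: "x \<in> carrier G" using coset_sub by (auto simp: Qc)
    have Xx: "X = N +>\<^bsub>G\<^esub> x" using XQ x(1) sub.a_repr_independence' by (auto simp: Qc)
    have "Y \<in> S" if Y: "Y \<in> carrier Q" "\<parallel>Y \<ominus>\<^bsub>Q\<^esub> X\<parallel>\<^bsub>Q\<^esub> < 1" for Y
    proof -
      have "Y \<ominus>\<^bsub>Q\<^esub> X \<in> carrier Q" using Y XQ by simp
      then obtain z where z: "z \<in> carrier G" "Y \<ominus>\<^bsub>Q\<^esub> X = N +>\<^bsub>G\<^esub> z" by (auto simp: Qc)
      have "z \<in> N +>\<^bsub>G\<^esub> z" using z by (simp add: sub.a_rcos_self)
      then have "nrm G ` (N +>\<^bsub>G\<^esub> z) \<noteq> {}" by blast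
      moreover have "Inf (nrm G ` (N +>\<^bsub>G\<^esub> z)) < 1" using Y(2) z(2) by (simp add: Q(4))
      ultimately obtain t where t: "t \<in> N +>\<^bsub>G\<^esub> z" "\<parallel>t\<parallel>\<^bsub>G\<^esub> < 1"
        using cInf_lessD by (metis (no_types, lifting) imageE)
      have tG: "t \<in> carrier G" using t coset_sub[OF z(1)] by blast
      have "Y \<ominus>\<^bsub>Q\<^esub> X = N +>\<^bsub>G\<^esub> t" using z t sub.a_repr_independence' by simp
      then have "Y = (N +>\<^bsub>G\<^esub> t) \<oplus>\<^bsub>Q\<^esub> X"
        using Y XQ by (metis Q.add.inv_solve_right' Q.a_inv_closed Q.minus_closed a_minus_def Q.add.inv_solve_right)
      then have "Y = N +>\<^bsub>G\<^esub> (t \<oplus>\<^bsub>G\<^esub> x)"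
        using Xx tG xG by (simp add: Qadd)
      then have "t \<oplus>\<^bsub>G\<^esub> x \<in> Y" using tG xG by (simp add: sub.a_rcos_self)
      moreover have "\<parallel>t \<oplus>\<^bsub>G\<^esub> x\<parallel>\<^bsub>G\<^esub> < 1"
        using normed_leftD(4)[OF nG tG xG] t x by simp
      ultimately show ?thesis using Y by (auto simp: S_def)
    qed
    then show "\<exists>e>0. \<forall>Y\<in>carrier Q. \<parallel>Y \<ominus>\<^bsub>Q\<^esub> X\<parallel>\<^bsub>Q\<^esub> < e \<longrightarrow> Y \<in> S"
      by (intro exI[of _ 1]) auto
  qed (auto simp: S_def)
  moreover have "open_map (seminorm_topology Q) (seminorm_topology (H\<lparr>carrier := d ` carrier G\<rparr>))
      (\<lambda>X. the_elem (d ` X))"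
    using strict homeomorphic_imp_open_map unfolding strict_map_def Q_def N_def by blast
  ultimately have op: "openin (seminorm_topology (H\<lparr>carrier := d ` carrier G\<rparr>)) ((\<lambda>X. the_elem (d ` X)) ` S)"
    by (simp add: open_map_def)
  have the: "the_elem (d ` X) = d x" if X: "X \<in> carrier Q" "x \<in> X" for X x
  proof -
    obtain y where y: "y \<in> carrier G" "X = N +>\<^bsub>G\<^esub> y" using X(1) by (auto simp: Qc)
    have "d z = d y" if z: "z \<in> X" for z
    proof -
      obtain n where n: "n \<in> N" "z = n \<oplus>\<^bsub>G\<^esub> y"
        using z unfolding y(2) a_r_coset_def' by blast
      from n(1) have "n \<in> carrier G" "d n = \<zero>\<^bsub>H\<^esub>" unfolding N by blast+
      then have "d z = \<zero>\<^bsub>H\<^esub> \<oplus>\<^bsub>H\<^esub> d y"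
        unfolding n(2) using left_hom_add[OF d _ y(1)] by metis
      also have "\<dots> = d y" using left_hom_closed[OF d y(1)] by (rule H.M.l_zero)
      finally show ?thesis .
    qed
    note eq = this
    have "d ` X = (\<lambda>_. d x) ` X"
      by (rule image_cong[OF refl]) (simp only: eq[OF X(2)] eq)
    then show ?thesis using X(2) by (simp add: image_constant)
  qed
  have img: "\<exists>x\<in>carrier G. d x = w \<and> \<parallel>x\<parallel>\<^bsub>G\<^esub> < 1" if "w \<in> (\<lambda>X. the_elem (d ` X)) ` S" for w
  proof -
    obtain X x where "X \<in> carrier Q" "x \<in> X" "\<parallel>x\<parallel>\<^bsub>G\<^esub> < 1" "w = the_elem (d ` X)"
      using \<open>w \<in> _\<close> by (auto simp: S_def)
    then show ?thesis using the[of X x] coset_sub by (auto simp: Qc)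
  qed
  have zero_in: "\<zero>\<^bsub>G\<^esub> \<in> N +>\<^bsub>G\<^esub> \<zero>\<^bsub>G\<^esub>" and zero_Q: "N +>\<^bsub>G\<^esub> \<zero>\<^bsub>G\<^esub> \<in> carrier Q"
    using Qc sub.a_rcos_self[of "\<zero>\<^bsub>G\<^esub>"] by blast+
  have "N +>\<^bsub>G\<^esub> \<zero>\<^bsub>G\<^esub> \<in> S"
    unfolding S_def using normed_leftD(2)[OF nG] zero_Q by (intro CollectI conjI bexI[OF _ zero_in]) simp_all
  moreover have "\<zero>\<^bsub>H\<^esub> = the_elem (d ` (N +>\<^bsub>G\<^esub> \<zero>\<^bsub>G\<^esub>))"
    using the[OF zero_Q zero_in] d0 by simp
  ultimately have zero: "\<zero>\<^bsub>H\<^esub> \<in> (\<lambda>X. the_elem (d ` X)) ` S"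
    by (rule rev_image_eqI)
  interpret im: left_module A "H\<lparr>carrier := d ` carrier G\<rparr>"
    by (rule left_module_image[OF G.left_module_axioms H.left_module_axioms d])
  have "\<ominus>\<^bsub>H\<lparr>carrier := d ` carrier G\<rparr>\<^esub> \<zero>\<^bsub>H\<^esub> = \<zero>\<^bsub>H\<^esub>"
    using im.M.minus_equality[of "\<zero>\<^bsub>H\<^esub>" "\<zero>\<^bsub>H\<^esub>"] im.M.l_zero[of "\<zero>\<^bsub>H\<^esub>"] im.M.zero_closed by simp
  then have minus0: "z \<ominus>\<^bsub>H\<lparr>carrier := d ` carrier G\<rparr>\<^esub> \<zero>\<^bsub>H\<^esub> = z" if "z \<in> d ` carrier G" for z
    using im.M.r_zero[of z] that by (simp add: a_minus_def)
  from op[unfolded openin_seminorm_topology] zero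
  obtain e where e0: "e > 0" "\<forall>z\<in>carrier (H\<lparr>carrier := d ` carrier G\<rparr>).
      \<parallel>z \<ominus>\<^bsub>H\<lparr>carrier := d ` carrier G\<rparr>\<^esub> \<zero>\<^bsub>H\<^esub>\<parallel>\<^bsub>H\<lparr>carrier := d ` carrier G\<rparr>\<^esub> < e \<longrightarrow>
      z \<in> (\<lambda>X. the_elem (d ` X)) ` S" by blast
  have e: "e > 0" "\<And>z. \<lbrakk>z \<in> d ` carrier G; \<parallel>z\<parallel>\<^bsub>H\<^esub> < e\<rbrakk> \<Longrightarrow> z \<in> (\<lambda>X. the_elem (d ` X)) ` S"
    using e0 minus0 by auto
  have dG: "d ` carrier G \<subseteq> carrier H" using left_hom_closed[OF d] by auto
  have "\<exists>x\<in>carrier G. d x = z \<and> \<parallel>x\<parallel>\<^bsub>G\<^esub> \<le> 2 / (e * q) * \<parallel>z\<parallel>\<^bsub>H\<^esub>" if z: "z \<in> d ` carrier G" for z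
  proof (cases "z = \<zero>\<^bsub>H\<^esub>")
    case True
    then show ?thesis
      using d0 normed_leftD(2)[OF nG] normed_leftD(2)[OF nH] by (intro bexI[of _ "\<zero>\<^bsub>G\<^esub>"]) auto
  next
    case False
    interpret V: normed_space K av "restrict_scalars A H"
      using H by (simp add: normed_left_module_def)
    have zH: "z \<in> carrier H" using z dG by blast
    have "\<parallel>z\<parallel>\<^bsub>H\<^esub> \<noteq> 0"
      using V.nrm_eq_0_iff[of z] zH False by (simp add: restrict_scalars_def)
    then have zpos: "0 < \<parallel>z\<parallel>\<^bsub>H\<^esub>" using normed_leftD(3)[OF nH zH] by simp
    \<comment> \<open>The factor \<open>2\<close> makes the norm of the scaled element strictly smaller than \<open>e\<close>.\<close>
    obtain k where k: "k \<in> carrier K" "k \<noteq> \<zero>\<^bsub>K\<^esub>" "av k * (2 * \<parallel>z\<parallel>\<^bsub>H\<^esub> / e) \<le> 1" "q < av k * (2 * \<parallel>z\<parallel>\<^bsub>H\<^esub> / e)"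
      using ex_scaling[of "2 * \<parallel>z\<parallel>\<^bsub>H\<^esub> / e"] e zpos by auto
    note inv = inv_closed[OF k(1,2)]
    have "\<parallel>sc k \<odot>\<^bsub>H\<^esub> z\<parallel>\<^bsub>H\<^esub> < e"
      using k(3) e(1) zpos by (simp add: norm_sc[OF nH k(1) zH] field_simps)
    moreover have "sc k \<odot>\<^bsub>H\<^esub> z \<in> d ` carrier G"
      using im.act_closed[of "sc k" z] z k by simp
    ultimately obtain x where x: "x \<in> carrier G" "d x = sc k \<odot>\<^bsub>H\<^esub> z" "\<parallel>x\<parallel>\<^bsub>G\<^esub> < 1"
      using e(2) img by blast
    have "\<parallel>sc (inv\<^bsub>K\<^esub> k) \<odot>\<^bsub>G\<^esub> x\<parallel>\<^bsub>G\<^esub> \<le> 1 / av k"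
      using x(1,3) inv(1,5) av_pos[OF k(1,2)] by (simp add: norm_sc[OF nG] divide_right_mono)
    also have "\<dots> \<le> 2 / (e * q) * \<parallel>z\<parallel>\<^bsub>H\<^esub>"
      using k(4) e(1) q av_pos[OF k(1,2)] by (simp add: field_simps)
    finally show ?thesis
      using x inv k zH by (intro bexI[of _ "sc (inv\<^bsub>K\<^esub> k) \<odot>\<^bsub>G\<^esub> x"])
        (auto simp: left_hom_act[OF d] sc_act_act[OF nH] H.act_one G.act_closed)
  qed
  moreover have "0 < 2 / (e * q)" using e q by simp
  ultimately show ?thesis by blast
qed

end

section \<open>Completions of strictly exact sequences\<close>

locale seminormed_group = abelian_group V for V :: "('r, 'm, 'z) normed_module_scheme" (structure) +
  assumes nrm_nonneg: "x \<in> carrier V \<Longrightarrow> 0 \<le> \<parallel>x\<parallel>"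
    and nrm_uminus: "x \<in> carrier V \<Longrightarrow> \<parallel>\<ominus> x\<parallel> = \<parallel>x\<parallel>"
    and nrm_zero [simp]: "\<parallel>\<zero>\<parallel> = 0"
    and nrm_add: "\<lbrakk>x \<in> carrier V; y \<in> carrier V\<rbrakk> \<Longrightarrow> \<parallel>x \<oplus> y\<parallel> \<le> max \<parallel>x\<parallel> \<parallel>y\<parallel>"
begin

lemma nrm_diff: "\<lbrakk>x \<in> carrier V; y \<in> carrier V\<rbrakk> \<Longrightarrow> \<parallel>x \<ominus> y\<parallel> \<le> max \<parallel>x\<parallel> \<parallel>y\<parallel>"
  using nrm_add[of x "\<ominus> y"] by (simp add: minus_eq nrm_uminus)

lemma nrm_diff_commute: "\<lbrakk>x \<in> carrier V; y \<in> carrier V\<rbrakk> \<Longrightarrow> \<parallel>x \<ominus> y\<parallel> = \<parallel>y \<ominus> x\<parallel>"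
  using nrm_uminus[of "y \<ominus> x"] by (simp add: minus_eq minus_add a_comm)

lemma diff_diff: "\<lbrakk>x \<in> carrier V; y \<in> carrier V; z \<in> carrier V\<rbrakk> \<Longrightarrow> (x \<ominus> y) \<oplus> (y \<ominus> z) = x \<ominus> z"
  by (simp add: minus_eq a_assoc) (simp add: l_neg flip: a_assoc)

definition seq_class :: "(nat \<Rightarrow> 'm) \<Rightarrow> (nat \<Rightarrow> 'm) set"
  where "seq_class x = {y. (\<forall>n. y n \<in> carrier V) \<and> (\<lambda>n. \<parallel>y n \<ominus> x n\<parallel>) \<longlonglongrightarrow> 0}"

lemma null_coset:
  assumes "\<And>n. x n \<in> carrier V"
  shows "null_sequences V +>\<^bsub>cauchy_space V\<^esub> x = seq_class x"
proof -
  have "y \<in> null_sequences V +>\<^bsub>cauchy_space V\<^esub> x \<longleftrightarrow> (\<exists>h\<in>null_sequences V. y = (\<lambda>n. h n \<oplus> x n))" for y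
    by (auto simp: a_r_coset_def' cauchy_space_def)
  moreover have "(h n \<oplus> x n) \<ominus> x n = h n" if "h \<in> null_sequences V" for h n
    using that assms by (simp add: null_sequences_def minus_eq a_assoc r_neg)
  moreover have "\<exists>h\<in>null_sequences V. y = (\<lambda>n. h n \<oplus> x n)" if "y \<in> seq_class x" for y
    using that assms
    by (intro bexI[of _ "\<lambda>n. y n \<ominus> x n"])
      (auto simp: null_sequences_def seq_class_def minus_eq a_assoc l_neg)
  ultimately show ?thesis
    using assms by (auto simp: seq_class_def null_sequences_def)
qed

lemma tendsto_diff_trans:
  assumes "\<And>n. x n \<in> carrier V" "\<And>n. y n \<in> carrier V" "\<And>n. z n \<in> carrier V"
    and "(\<lambda>n. \<parallel>x n \<ominus> y n\<parallel>) \<longlonglongrightarrow> 0" "(\<lambda>n. \<parallel>y n \<ominus> z n\<parallel>) \<longlonglongrightarrow> 0"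
  shows "(\<lambda>n. \<parallel>x n \<ominus> z n\<parallel>) \<longlonglongrightarrow> 0"
proof (rule tendsto_sandwich[OF _ _ tendsto_const])
  show "(\<lambda>n. max \<parallel>x n \<ominus> y n\<parallel> \<parallel>y n \<ominus> z n\<parallel>) \<longlonglongrightarrow> 0"
    using tendsto_max[OF assms(4,5)] by simp
  have "\<parallel>x n \<ominus> z n\<parallel> \<le> max \<parallel>x n \<ominus> y n\<parallel> \<parallel>y n \<ominus> z n\<parallel>" for n
    using nrm_add[of "x n \<ominus> y n" "y n \<ominus> z n"] assms(1-3) by (simp add: diff_diff)
  then show "\<forall>\<^sub>F n in sequentially. \<parallel>x n \<ominus> z n\<parallel> \<le> max \<parallel>x n \<ominus> y n\<parallel> \<parallel>y n \<ominus> z n\<parallel>" by simp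
qed (use assms nrm_nonneg in simp)

lemma tendsto_diff_sym:
  assumes "\<And>n. x n \<in> carrier V" "\<And>n. y n \<in> carrier V"
  shows "(\<lambda>n. \<parallel>x n \<ominus> y n\<parallel>) \<longlonglongrightarrow> 0 \<longleftrightarrow> (\<lambda>n. \<parallel>y n \<ominus> x n\<parallel>) \<longlonglongrightarrow> 0"
  using nrm_diff_commute[of "x _" "y _"] assms by simp

lemma seq_class_self: "(\<And>n. x n \<in> carrier V) \<Longrightarrow> x \<in> seq_class x"
  by (simp add: seq_class_def minus_eq r_neg)

lemma seq_class_eq_iff:
  assumes x: "\<And>n. x n \<in> carrier V" and y: "\<And>n. y n \<in> carrier V"
  shows "seq_class x = seq_class y \<longleftrightarrow> (\<lambda>n. \<parallel>x n \<ominus> y n\<parallel>) \<longlonglongrightarrow> 0"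
proof
  assume "seq_class x = seq_class y"
  then show "(\<lambda>n. \<parallel>x n \<ominus> y n\<parallel>) \<longlonglongrightarrow> 0"
    using seq_class_self[of x] x by (simp add: seq_class_def)
next
  assume xy: "(\<lambda>n. \<parallel>x n \<ominus> y n\<parallel>) \<longlonglongrightarrow> 0"
  then have yx: "(\<lambda>n. \<parallel>y n \<ominus> x n\<parallel>) \<longlonglongrightarrow> 0" using tendsto_diff_sym[of x y] x y by simp
  show "seq_class x = seq_class y"
    using tendsto_diff_trans[OF _ x y _ xy] tendsto_diff_trans[OF _ y x _ yx]
    unfolding seq_class_def by blast
qed

definition cauchy :: "(nat \<Rightarrow> 'm) \<Rightarrow> bool"
  where "cauchy x \<longleftrightarrow> (\<forall>n. x n \<in> carrier V) \<and> (\<forall>e>0. \<exists>n0. \<forall>m\<ge>n0. \<forall>n\<ge>n0. \<parallel>x m \<ominus> x n\<parallel> < e)"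

lemma carrier_completion: "carrier (completion V) = seq_class ` Collect cauchy"
proof -
  have "carrier (cauchy_space V) = Collect cauchy"
    by (auto simp: cauchy_space_def cauchy_def)
  then have "carrier (completion V) = (\<lambda>x. null_sequences V +>\<^bsub>cauchy_space V\<^esub> x) ` Collect cauchy"
    by (auto simp: completion_def quot_normed_def with_norm_def quot_module_def A_RCOSETS_def')
  also have "\<dots> = seq_class ` Collect cauchy"
    by (intro image_cong refl null_coset) (simp add: cauchy_def)
  finally show ?thesis .
qed

lemma zero_completion: "\<zero>\<^bsub>completion V\<^esub> = seq_class (\<lambda>_. \<zero>)"
proof -
  have "x n \<ominus> \<zero> = x n" if "\<forall>n. x n \<in> carrier V" for x :: "nat \<Rightarrow> 'm" and n
    using that add.inv_one by (simp add: minus_eq)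
  then have "null_sequences V = seq_class (\<lambda>_. \<zero>)"
    unfolding null_sequences_def seq_class_def by (intro Collect_cong conj_cong refl) simp
  then show ?thesis
    by (simp add: completion_def quot_normed_def with_norm_def quot_module_def)
qed

text \<open>By the ultrametric inequality, the differences from some index on are bounded by the largest
  increment.\<close>

lemma cauchyI_step:
  assumes s: "\<And>n. s n \<in> carrier V" and lim: "(\<lambda>n. \<parallel>s (Suc n) \<ominus> s n\<parallel>) \<longlonglongrightarrow> 0"
  shows "cauchy s"
  unfolding cauchy_def
proof (intro conjI allI impI s)
  fix e :: real assume e: "0 < e"
  from lim e obtain n0 where n0: "\<And>n. n \<ge> n0 \<Longrightarrow> \<parallel>s (Suc n) \<ominus> s n\<parallel> < e"
    using s by (force simp: LIMSEQ_iff nrm_nonneg)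
  have 1: "\<parallel>s (n0 + k) \<ominus> s n0\<parallel> < e" for k
  proof (induction k)
    case 0
    then show ?case using s e by (simp add: minus_eq r_neg)
  next
    case (Suc k)
    have "s (n0 + Suc k) \<ominus> s n0 = (s (Suc (n0 + k)) \<ominus> s (n0 + k)) \<oplus> (s (n0 + k) \<ominus> s n0)"
      using s by (simp add: diff_diff)
    then show ?case
      using nrm_add[of "s (Suc (n0 + k)) \<ominus> s (n0 + k)" "s (n0 + k) \<ominus> s n0"] s Suc n0[of "n0 + k"] by simp
  qed
  have "\<parallel>s m \<ominus> s n\<parallel> < e" if "m \<ge> n0" "n \<ge> n0" for m n
  proof -
    have "\<parallel>s m \<ominus> s n0\<parallel> < e" "\<parallel>s n0 \<ominus> s n\<parallel> < e"
      using 1[of "m - n0"] 1[of "n - n0"] that nrm_diff_commute[of "s n0" "s n"] s by simp_all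
    then show ?thesis
      using nrm_add[of "s m \<ominus> s n0" "s n0 \<ominus> s n"] s by (simp add: diff_diff)
  qed
  then show "\<exists>n0. \<forall>m\<ge>n0. \<forall>n\<ge>n0. \<parallel>s m \<ominus> s n\<parallel> < e" by blast
qed

lemma cauchy_step: "cauchy s \<Longrightarrow> (\<lambda>n. \<parallel>s (Suc n) \<ominus> s n\<parallel>) \<longlonglongrightarrow> 0"
  unfolding LIMSEQ_iff
proof clarify
  fix e :: real assume s: "cauchy s" "0 < e"
  then obtain n0 where "\<forall>m\<ge>n0. \<forall>n\<ge>n0. \<parallel>s m \<ominus> s n\<parallel> < e" by (auto simp: cauchy_def)
  then show "\<exists>no. \<forall>n\<ge>no. norm (\<parallel>s (Suc n) \<ominus> s n\<parallel> - 0) < e"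
    using s by (intro exI[of _ n0]) (auto simp: cauchy_def nrm_nonneg)
qed

lemma cauchy_diff_null:
  assumes x: "cauchy x" and w: "\<And>n. w n \<in> carrier V" "(\<lambda>n. \<parallel>w n\<parallel>) \<longlonglongrightarrow> 0"
  shows "cauchy (\<lambda>n. x n \<ominus> w n)"
proof (rule cauchyI_step)
  have xV: "x n \<in> carrier V" for n using x by (simp add: cauchy_def)
  show "(\<lambda>n. \<parallel>(x (Suc n) \<ominus> w (Suc n)) \<ominus> (x n \<ominus> w n)\<parallel>) \<longlonglongrightarrow> 0"
  proof (rule tendsto_sandwich[OF _ _ tendsto_const])
    show "(\<lambda>n. max \<parallel>x (Suc n) \<ominus> x n\<parallel> (max \<parallel>w n\<parallel> \<parallel>w (Suc n)\<parallel>)) \<longlonglongrightarrow> 0"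
      using tendsto_max[OF cauchy_step[OF x] tendsto_max[OF w(2) LIMSEQ_Suc[OF w(2)]]] by simp
    have eq: "(x (Suc n) \<ominus> w (Suc n)) \<ominus> (x n \<ominus> w n) = (x (Suc n) \<ominus> x n) \<oplus> (w n \<ominus> w (Suc n))" for n
      using xV w(1) by (simp add: minus_eq minus_add a_ac)
    have "\<parallel>(x (Suc n) \<ominus> w (Suc n)) \<ominus> (x n \<ominus> w n)\<parallel> \<le> max \<parallel>x (Suc n) \<ominus> x n\<parallel> (max \<parallel>w n\<parallel> \<parallel>w (Suc n)\<parallel>)" for n
      using nrm_add[of "x (Suc n) \<ominus> x n" "w n \<ominus> w (Suc n)"] nrm_diff[of "w n" "w (Suc n)"] xV w(1)
      unfolding eq by (simp add: max_def split: if_splits)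
    then show "\<forall>\<^sub>F n in sequentially. \<parallel>(x (Suc n) \<ominus> w (Suc n)) \<ominus> (x n \<ominus> w n)\<parallel>
        \<le> max \<parallel>x (Suc n) \<ominus> x n\<parallel> (max \<parallel>w n\<parallel> \<parallel>w (Suc n)\<parallel>)" by simp
  qed (use xV w(1) nrm_nonneg in simp)
qed (use x w in \<open>auto simp: cauchy_def\<close>)

end


definition bounded_additive ::
    "('r, 'm, 'z) normed_module_scheme \<Rightarrow> ('r, 'n, 'w) normed_module_scheme \<Rightarrow> ('m \<Rightarrow> 'n) \<Rightarrow> bool"
  where "bounded_additive V W f \<longleftrightarrow> (\<forall>x\<in>carrier V. f x \<in> carrier W) \<and>
    (\<forall>x\<in>carrier V. \<forall>y\<in>carrier V. f (x \<ominus>\<^bsub>V\<^esub> y) = f x \<ominus>\<^bsub>W\<^esub> f y) \<and>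
    (\<exists>c. \<forall>x\<in>carrier V. \<parallel>f x\<parallel>\<^bsub>W\<^esub> \<le> c * \<parallel>x\<parallel>\<^bsub>V\<^esub>)"

lemma bounded_additive_tendsto_0:
  assumes "seminormed_group V" "seminormed_group W" "bounded_additive V W f"
    and x: "\<And>n. x n \<in> carrier V" "(\<lambda>n. \<parallel>x n\<parallel>\<^bsub>V\<^esub>) \<longlonglongrightarrow> 0"
  shows "(\<lambda>n. \<parallel>f (x n)\<parallel>\<^bsub>W\<^esub>) \<longlonglongrightarrow> 0"
proof -
  interpret V: seminormed_group V by fact
  interpret W: seminormed_group W by fact
  obtain c where c: "\<And>x. x \<in> carrier V \<Longrightarrow> \<parallel>f x\<parallel>\<^bsub>W\<^esub> \<le> c * \<parallel>x\<parallel>\<^bsub>V\<^esub>" "\<And>x. x \<in> carrier V \<Longrightarrow> f x \<in> carrier W"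
    using assms(3) unfolding bounded_additive_def by blast
  show ?thesis
  proof (rule tendsto_sandwich[OF _ _ tendsto_const])
    show "(\<lambda>n. c * \<parallel>x n\<parallel>\<^bsub>V\<^esub>) \<longlonglongrightarrow> 0"
      using tendsto_mult_left[OF x(2), of c] by simp
  qed (use c x(1) W.nrm_nonneg in simp_all)
qed

lemma bounded_additive_cauchy:
  assumes V: "seminormed_group V" and W: "seminormed_group W" and f: "bounded_additive V W f"
    and x: "seminormed_group.cauchy V x"
  shows "seminormed_group.cauchy W (f \<circ> x)"
proof -
  interpret V: seminormed_group V by fact
  interpret W: seminormed_group W by fact
  have xV: "x n \<in> carrier V" for n using x by (simp add: V.cauchy_def)
  show ?thesis
    using bounded_additive_tendsto_0[OF V W f _ V.cauchy_step[OF x]] xV f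
    by (intro W.cauchyI_step) (simp_all add: bounded_additive_def)
qed

lemma completion_map_seq_class:
  assumes V: "seminormed_group V" and W: "seminormed_group W" and f: "bounded_additive V W f"
    and x: "\<And>n. x n \<in> carrier V"
  shows "completion_map W f (seminormed_group.seq_class V x) = seminormed_group.seq_class W (f \<circ> x)"
proof -
  interpret V: seminormed_group V by fact
  interpret W: seminormed_group W by fact
  have fW: "f x \<in> carrier W" if "x \<in> carrier V" for x using f that by (simp add: bounded_additive_def)
  have "null_sequences W +>\<^bsub>cauchy_space W\<^esub> (f \<circ> y) = W.seq_class (f \<circ> x)" if y: "y \<in> V.seq_class x" for y
  proof -
    have yV: "y n \<in> carrier V" for n using y by (simp add: V.seq_class_def)
    have "(\<lambda>n. \<parallel>f (y n \<ominus>\<^bsub>V\<^esub> x n)\<parallel>\<^bsub>W\<^esub>) \<longlonglongrightarrow> 0"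
      using y x yV by (intro bounded_additive_tendsto_0[OF V W f]) (auto simp: V.seq_class_def)
    then have "W.seq_class (f \<circ> y) = W.seq_class (f \<circ> x)"
      using f x yV fW by (subst W.seq_class_eq_iff) (auto simp: bounded_additive_def)
    then show ?thesis using yV fW by (subst W.null_coset) auto
  qed
  moreover have "x \<in> V.seq_class x" using x by (rule V.seq_class_self)
  ultimately show ?thesis
    unfolding completion_map_def quot_map_def by blast
qed

text \<open>An element of the kernel is represented by a Cauchy sequence \<open>x\<close> with \<open>g x\<close> tending to \<open>0\<close>. By \<open>strict\<close>
  it differs by a null sequence \<open>w\<close> from a Cauchy sequence \<open>t\<close> in the kernel of \<open>g\<close>. By \<open>exact\<close> the
  increments of \<open>t\<close> have preimages \<open>y\<close> that tend to \<open>0\<close>; their partial sums are a Cauchy sequence which is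
  mapped to \<open>t\<close>.\<close>

lemma completion_exact:
  assumes V1: "seminormed_group V1" and V2: "seminormed_group V2" and V3: "seminormed_group V3"
    and f: "bounded_additive V1 V2 f" and g: "bounded_additive V2 V3 g"
    and gf: "\<And>x. x \<in> carrier V1 \<Longrightarrow> g (f x) = \<zero>\<^bsub>V3\<^esub>"
    and exact: "\<And>x r. \<lbrakk>x \<in> carrier V2; g x = \<zero>\<^bsub>V3\<^esub>; \<parallel>x\<parallel>\<^bsub>V2\<^esub> < r\<rbrakk> \<Longrightarrow>
      \<exists>y\<in>carrier V1. f y = x \<and> \<parallel>y\<parallel>\<^bsub>V1\<^esub> \<le> c * r"
    and strict: "\<And>x r. \<lbrakk>x \<in> carrier V2; \<parallel>g x\<parallel>\<^bsub>V3\<^esub> < r\<rbrakk> \<Longrightarrow>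
      \<exists>w\<in>carrier V2. g w = g x \<and> \<parallel>w\<parallel>\<^bsub>V2\<^esub> \<le> c' * r"
  shows "completion_map V2 f ` carrier (completion V1) =
    a_kernel (completion V2) (completion V3) (completion_map V3 g)"
proof -
  interpret V1: seminormed_group V1 by fact
  interpret V2: seminormed_group V2 by fact
  interpret V3: seminormed_group V3 by fact
  have fV: "f x \<in> carrier V2" if "x \<in> carrier V1" for x using f that by (simp add: bounded_additive_def)
  have gV: "g x \<in> carrier V3" if "x \<in> carrier V2" for x using g that by (simp add: bounded_additive_def)
  have fdiff: "f (x \<ominus>\<^bsub>V1\<^esub> y) = f x \<ominus>\<^bsub>V2\<^esub> f y" if "x \<in> carrier V1" "y \<in> carrier V1" for x y
    using f that by (simp add: bounded_additive_def)
  have gdiff: "g (x \<ominus>\<^bsub>V2\<^esub> y) = g x \<ominus>\<^bsub>V3\<^esub> g y" if "x \<in> carrier V2" "y \<in> carrier V2" for x y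
    using g that by (simp add: bounded_additive_def)
  show ?thesis
  proof (intro equalityI subsetI)
    fix X assume "X \<in> completion_map V2 f ` carrier (completion V1)"
    then obtain x where x: "V1.cauchy x" "X = completion_map V2 f (V1.seq_class x)"
      by (auto simp: V1.carrier_completion)
    have xV: "x n \<in> carrier V1" for n using x by (simp add: V1.cauchy_def)
    have X: "X = V2.seq_class (f \<circ> x)"
      using x completion_map_seq_class[OF V1 V2 f xV] by simp
    have fx: "V2.cauchy (f \<circ> x)" by (rule bounded_additive_cauchy[OF V1 V2 f x(1)])
    have "completion_map V3 g X = V3.seq_class (g \<circ> (f \<circ> x))"
      unfolding X using xV fV by (intro completion_map_seq_class[OF V2 V3 g]) simp
    also have "g \<circ> (f \<circ> x) = (\<lambda>_. \<zero>\<^bsub>V3\<^esub>)" using gf xV by auto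
    finally show "X \<in> a_kernel (completion V2) (completion V3) (completion_map V3 g)"
      using fx by (auto simp: a_kernel_def' V2.carrier_completion V3.zero_completion X)
  next
    fix X assume "X \<in> a_kernel (completion V2) (completion V3) (completion_map V3 g)"
    then obtain x where x: "V2.cauchy x" "X = V2.seq_class x"
      "completion_map V3 g (V2.seq_class x) = V3.seq_class (\<lambda>_. \<zero>\<^bsub>V3\<^esub>)"
      by (auto simp: a_kernel_def' V2.carrier_completion V3.zero_completion)
    have xV: "x n \<in> carrier V2" for n using x by (simp add: V2.cauchy_def)
    have "V3.seq_class (g \<circ> x) = V3.seq_class (\<lambda>_. \<zero>\<^bsub>V3\<^esub>)"
      using x(3) completion_map_seq_class[OF V2 V3 g xV] by simp
    then have "(\<lambda>n. \<parallel>g (x n) \<ominus>\<^bsub>V3\<^esub> \<zero>\<^bsub>V3\<^esub>\<parallel>\<^bsub>V3\<^esub>) \<longlonglongrightarrow> 0"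
      using xV gV by (subst (asm) V3.seq_class_eq_iff) auto
    moreover have "g (x n) \<ominus>\<^bsub>V3\<^esub> \<zero>\<^bsub>V3\<^esub> = g (x n)" for n
      using gV[OF xV] V3.add.inv_one by (simp add: V3.minus_eq)
    ultimately have gx: "(\<lambda>n. \<parallel>g (x n)\<parallel>\<^bsub>V3\<^esub>) \<longlonglongrightarrow> 0" by simp
    \<comment> \<open>The summand \<open>1 / Suc n\<close> turns the norm into a strict upper bound.\<close>
    have "\<exists>w\<in>carrier V2. g w = g (x n) \<and> \<parallel>w\<parallel>\<^bsub>V2\<^esub> \<le> c' * (\<parallel>g (x n)\<parallel>\<^bsub>V3\<^esub> + 1 / Suc n)" for n
      by (rule strict[OF xV]) simp
    then obtain w where w: "\<And>n. w n \<in> carrier V2" "\<And>n. g (w n) = g (x n)"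
      "\<And>n. \<parallel>w n\<parallel>\<^bsub>V2\<^esub> \<le> c' * (\<parallel>g (x n)\<parallel>\<^bsub>V3\<^esub> + 1 / Suc n)"
      by metis
    have w0: "(\<lambda>n. \<parallel>w n\<parallel>\<^bsub>V2\<^esub>) \<longlonglongrightarrow> 0"
    proof (rule tendsto_sandwich[OF _ _ tendsto_const])
      show "(\<lambda>n. c' * (\<parallel>g (x n)\<parallel>\<^bsub>V3\<^esub> + 1 / Suc n)) \<longlonglongrightarrow> 0"
        using tendsto_mult_left[OF tendsto_add[OF gx LIMSEQ_Suc[OF lim_1_over_n]], of c'] by simp
    qed (use w V2.nrm_nonneg in simp_all)
    define t where "t n = x n \<ominus>\<^bsub>V2\<^esub> w n" for n
    have t: "V2.cauchy t" unfolding t_def by (rule V2.cauchy_diff_null[OF x(1) w(1) w0])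
    have tV: "t n \<in> carrier V2" for n using xV w(1) by (simp add: t_def)
    have gt: "g (t n) = \<zero>\<^bsub>V3\<^esub>" for n
      using xV w(1,2) gV by (simp add: t_def gdiff V3.minus_eq V3.r_neg)
    have "\<exists>y\<in>carrier V1. f y = t (Suc n) \<ominus>\<^bsub>V2\<^esub> t n \<and>
        \<parallel>y\<parallel>\<^bsub>V1\<^esub> \<le> c * (\<parallel>t (Suc n) \<ominus>\<^bsub>V2\<^esub> t n\<parallel>\<^bsub>V2\<^esub> + 1 / Suc n)" for n
      by (rule exact) (use tV gt in \<open>auto simp: gdiff V3.minus_eq V3.r_neg\<close>)
    then obtain y where y: "\<And>n. y n \<in> carrier V1" "\<And>n. f (y n) = t (Suc n) \<ominus>\<^bsub>V2\<^esub> t n"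
      "\<And>n. \<parallel>y n\<parallel>\<^bsub>V1\<^esub> \<le> c * (\<parallel>t (Suc n) \<ominus>\<^bsub>V2\<^esub> t n\<parallel>\<^bsub>V2\<^esub> + 1 / Suc n)"
      by metis
    have y0: "(\<lambda>n. \<parallel>y n\<parallel>\<^bsub>V1\<^esub>) \<longlonglongrightarrow> 0"
    proof (rule tendsto_sandwich[OF _ _ tendsto_const])
      show "(\<lambda>n. c * (\<parallel>t (Suc n) \<ominus>\<^bsub>V2\<^esub> t n\<parallel>\<^bsub>V2\<^esub> + 1 / Suc n)) \<longlonglongrightarrow> 0"
        using tendsto_mult_left[OF tendsto_add[OF V2.cauchy_step[OF t] LIMSEQ_Suc[OF lim_1_over_n]], of c] by simp
    qed (use y V1.nrm_nonneg in simp_all)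
    obtain y' where y': "y' \<in> carrier V1" "f y' = t 0"
      using exact[OF tV gt, of 0 "\<parallel>t 0\<parallel>\<^bsub>V2\<^esub> + 1"] by auto
    define s where "s = rec_nat y' (\<lambda>n z. z \<oplus>\<^bsub>V1\<^esub> y n)"
    have s_Suc: "s (Suc n) = s n \<oplus>\<^bsub>V1\<^esub> y n" and s_0: "s 0 = y'" for n by (simp_all add: s_def)
    have sV: "s n \<in> carrier V1" for n
      by (induction n) (auto simp: s_Suc s_0 y y')
    have s_diff: "s (Suc n) \<ominus>\<^bsub>V1\<^esub> s n = y n" for n
      using sV[of n] y(1)[of n] by (simp add: s_Suc V1.minus_eq V1.a_comm[of "s n"] V1.a_assoc V1.r_neg)
    have s: "V1.cauchy s"
      by (rule V1.cauchyI_step[OF sV]) (simp add: s_diff y0)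
    have fs: "f (s n) = t n" for n
    proof (induction n)
      case (Suc n)
      have "f (s (Suc n)) \<ominus>\<^bsub>V2\<^esub> f (s n) = t (Suc n) \<ominus>\<^bsub>V2\<^esub> t n"
        using fdiff[OF sV sV, of "Suc n" n] s_diff y(2) by simp
      then show ?case
        using Suc fV[OF sV] tV by (metis V2.add.inv_closed V2.add.right_cancel V2.minus_eq)
    qed (simp add: s_0 y')
    have "f \<circ> s = t" using fs by auto
    then have "completion_map V2 f (V1.seq_class s) = V2.seq_class t"
      using completion_map_seq_class[OF V1 V2 f sV] by simp
    also have "\<dots> = V2.seq_class x"
    proof -
      have "t n \<ominus>\<^bsub>V2\<^esub> x n = \<ominus>\<^bsub>V2\<^esub> w n" for n
        using xV[of n] w(1)[of n]
        by (simp add: t_def V2.minus_eq V2.a_comm[of "x n"] V2.a_assoc V2.r_neg)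
      then show ?thesis
        using w0 w(1) tV xV by (subst V2.seq_class_eq_iff) (auto simp: V2.nrm_uminus)
    qed
    finally show "X \<in> completion_map V2 f ` carrier (completion V1)"
      using s x(2) by (auto simp: V1.carrier_completion)
  qed
qed

section \<open>The tensored complex and its completion\<close>

context dvf_right_module
begin

lemma nrm_U_uminus: "u \<in> carrier U \<Longrightarrow> \<parallel>\<ominus>\<^bsub>U\<^esub> u\<parallel>\<^bsub>U\<^esub> = \<parallel>u\<parallel>\<^bsub>U\<^esub>"
proof -
  have le: "\<parallel>\<ominus>\<^bsub>U\<^esub> u\<parallel>\<^bsub>U\<^esub> \<le> \<parallel>u\<parallel>\<^bsub>U\<^esub>" if u: "u \<in> carrier U" for u
  proof -
    have "(\<ominus>\<^bsub>A\<^esub> \<one>\<^bsub>A\<^esub>) \<odot>\<^bsub>U\<^esub> u \<oplus>\<^bsub>U\<^esub> u = \<zero>\<^bsub>A\<^esub> \<odot>\<^bsub>U\<^esub> u"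
      using u U.act_add_ring[of "\<ominus>\<^bsub>A\<^esub> \<one>\<^bsub>A\<^esub>" "\<one>\<^bsub>A\<^esub>" u] by (simp add: A.l_neg U.act_one)
    moreover have "\<zero>\<^bsub>A\<^esub> \<odot>\<^bsub>U\<^esub> u = \<zero>\<^bsub>U\<^esub>"
      using u nrm_U_act[of "\<zero>\<^bsub>A\<^esub>" u] nrm_U_nonneg[of "\<zero>\<^bsub>A\<^esub> \<odot>\<^bsub>U\<^esub> u"]
        nrm_U_eq_0_iff[of "\<zero>\<^bsub>A\<^esub> \<odot>\<^bsub>U\<^esub> u"] U.act_closed[of "\<zero>\<^bsub>A\<^esub>" u] by simp
    ultimately have "\<ominus>\<^bsub>U\<^esub> u = (\<ominus>\<^bsub>A\<^esub> \<one>\<^bsub>A\<^esub>) \<odot>\<^bsub>U\<^esub> u"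
      using u by (intro U.M.minus_equality) (auto simp: U.act_closed)
    then have "\<parallel>\<ominus>\<^bsub>U\<^esub> u\<parallel>\<^bsub>U\<^esub> \<le> \<parallel>\<ominus>\<^bsub>A\<^esub> \<one>\<^bsub>A\<^esub>\<parallel>\<^bsub>A\<^esub> * \<parallel>u\<parallel>\<^bsub>U\<^esub>"
      using nrm_U_act[of "\<ominus>\<^bsub>A\<^esub> \<one>\<^bsub>A\<^esub>" u] u by simp
    also have "\<dots> \<le> 1 * \<parallel>u\<parallel>\<^bsub>U\<^esub>"
      using nrm_uminus_one nrm_U_nonneg[OF u] by (intro mult_right_mono)
    finally show ?thesis by simp
  qed
  assume "u \<in> carrier U"
  then show ?thesis using le[of u] le[of "\<ominus>\<^bsub>U\<^esub> u"] by simp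
qed

lemma frag_bounded_unit_ball:
  assumes x: "x \<in> tensor_frags (unit_ball U) N" and \<nu>: "\<And>n. n \<in> carrier N \<Longrightarrow> 0 \<le> \<nu> n \<and> \<nu> n \<le> 1"
  shows "frag_bounded U \<nu> x 1"
  unfolding frag_bounded_def
proof clarify
  fix u n assume "(u, n) \<in> Poly_Mapping.keys x"
  then have "u \<in> carrier (unit_ball U)" "n \<in> carrier N"
    using x by (auto simp: tensor_frags_def)
  then show "\<parallel>u\<parallel>\<^bsub>U\<^esub> * \<nu> n \<le> 1"
    using \<nu> by (intro mult_le_one) auto
qed

definition representations ::
    "('a, 'n, 'w) normed_module_scheme \<Rightarrow> (('u \<times> 'n) \<Rightarrow>\<^sub>0 int) set \<Rightarrow> real set"
  where "representations N X = {Max (insert 0 ((\<lambda>i. \<parallel>u i\<parallel>\<^bsub>U\<^esub> * \<parallel>n i\<parallel>\<^bsub>N\<^esub>) ` {..<r})) | (r::nat) u n.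
      (\<forall>i<r. u i \<in> carrier U \<and> n i \<in> carrier N) \<and>
      X = (\<Oplus>\<^bsub>tensor A U N\<^esub>i\<in>{..<r}. pure_tensor A U N (u i) (n i))}"

lemma tensor_seminorm_eq: "tensor_seminorm A U N X = Inf (representations N X)"
  by (simp add: tensor_seminorm_def representations_def)

text \<open>Formal sums have integer coefficients, while the representations in the definition of the
  tensor semi-norm have none; the sign is moved into the first factor.\<close>

lemma ex_signless:
  assumes N: "left_module A N" and y: "y \<in> tensor_frags U N" "frag_bounded U (nrm N) y r"
  shows "\<exists>ps. set ps \<subseteq> carrier U \<times> carrier N \<and> (\<forall>(u, n)\<in>set ps. \<parallel>u\<parallel>\<^bsub>U\<^esub> * \<parallel>n\<parallel>\<^bsub>N\<^esub> \<le> r) \<and>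
    y - sum_list (map frag_of ps) \<in> rel N"
proof -
  have sub: "Poly_Mapping.keys y \<subseteq> {(u, n). u \<in> carrier U \<and> n \<in> carrier N \<and> \<parallel>u\<parallel>\<^bsub>U\<^esub> * \<parallel>n\<parallel>\<^bsub>N\<^esub> \<le> r}"
    using y by (auto simp: tensor_frags_def frag_bounded_def)
  then show ?thesis
  proof (induction y rule: frag_induction)
    case zero
    show ?case by (rule exI[of _ "[]"]) simp
  next
    case (one un)
    then show ?case by (intro exI[of _ "[un]"]) auto
  next
    case (diff a b)
    then obtain ps qs where ps: "set ps \<subseteq> carrier U \<times> carrier N" "\<forall>(u, n)\<in>set ps. \<parallel>u\<parallel>\<^bsub>U\<^esub> * \<parallel>n\<parallel>\<^bsub>N\<^esub> \<le> r"
      "a - sum_list (map frag_of ps) \<in> rel N"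
      and qs: "set qs \<subseteq> carrier U \<times> carrier N" "\<forall>(u, n)\<in>set qs. \<parallel>u\<parallel>\<^bsub>U\<^esub> * \<parallel>n\<parallel>\<^bsub>N\<^esub> \<le> r"
      "b - sum_list (map frag_of qs) \<in> rel N" by blast
    define qs' where "qs' = map (\<lambda>(u, n). (\<ominus>\<^bsub>U\<^esub> u, n)) qs"
    have "- sum_list (map frag_of qs) - sum_list (map frag_of qs') \<in> rel N"
      using qs(1) unfolding qs'_def
    proof (induction qs)
      case (Cons un qs)
      obtain u n where un: "un = (u, n)" "u \<in> carrier U" "n \<in> carrier N" using Cons.prems by auto
      then show ?case
        using rel_add[OF rel_minus_left[OF N un(2,3)] Cons.IH] Cons.prems by (simp add: algebra_simps)
    qed simp
    from rel_add[OF rel_diff[OF N ps(3) qs(3)] this]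
    have "(a - b) - sum_list (map frag_of (ps @ qs')) \<in> rel N" by (simp add: algebra_simps)
    moreover have "set (ps @ qs') \<subseteq> carrier U \<times> carrier N"
      using ps(1) qs(1) by (auto simp: qs'_def)
    moreover have "\<forall>(u, n)\<in>set (ps @ qs'). \<parallel>u\<parallel>\<^bsub>U\<^esub> * \<parallel>n\<parallel>\<^bsub>N\<^esub> \<le> r"
      using ps(2) qs(1,2) by (fastforce simp: qs'_def nrm_U_uminus)
    ultimately show ?case by blast
  qed
qed

lemma bounded_by_representation:
  assumes N: "left_module A N" and x: "bounded_by N (nrm N) x r" and r: "0 \<le> r"
  shows "\<exists>s\<in>representations N (cls N x). s \<le> r"
proof -
  obtain y where y: "y \<in> tensor_frags U N" "x - y \<in> rel N" "frag_bounded U (nrm N) y r"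
    using x by (auto simp: tensor_bounded_def)
  obtain ps where ps: "set ps \<subseteq> carrier U \<times> carrier N" "\<forall>(u, n)\<in>set ps. \<parallel>u\<parallel>\<^bsub>U\<^esub> * \<parallel>n\<parallel>\<^bsub>N\<^esub> \<le> r"
    "y - sum_list (map frag_of ps) \<in> rel N"
    using ex_signless[OF N y(1,3)] by blast
  define k where "k = length ps"
  have nth: "ps ! i \<in> carrier U \<times> carrier N" "\<parallel>fst (ps ! i)\<parallel>\<^bsub>U\<^esub> * \<parallel>snd (ps ! i)\<parallel>\<^bsub>N\<^esub> \<le> r" if "i < k" for i
    using ps(1,2) nth_mem[of i ps] that unfolding k_def by (fastforce simp: case_prod_beta)+
  have "cls N x = cls N (\<Sum>i<k. frag_of (fst (ps ! i), snd (ps ! i)))"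
    using rel_trans[OF y(2) ps(3)]
    by (simp add: cls_eq_iff[OF N] k_def sum_list_sum_nth atLeast0LessThan)
  also have "\<dots> = (\<Oplus>\<^bsub>tensor A U N\<^esub>i\<in>{..<k}. pure_tensor A U N (fst (ps ! i)) (snd (ps ! i)))"
    unfolding pure_tensor_class using nth(1) by (intro finsum_cls[OF N, symmetric])
      (auto simp: mem_Times_iff tensor_frags_def)
  finally have "Max (insert 0 ((\<lambda>i. \<parallel>fst (ps ! i)\<parallel>\<^bsub>U\<^esub> * \<parallel>snd (ps ! i)\<parallel>\<^bsub>N\<^esub>) ` {..<k})) \<in> representations N (cls N x)"
    using nth(1) unfolding representations_def mem_Times_iff
    by (intro CollectI exI[of _ k] exI[of _ "\<lambda>i. fst (ps ! i)"] exI[of _ "\<lambda>i. snd (ps ! i)"]) auto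
  moreover have "Max (insert 0 ((\<lambda>i. \<parallel>fst (ps ! i)\<parallel>\<^bsub>U\<^esub> * \<parallel>snd (ps ! i)\<parallel>\<^bsub>N\<^esub>) ` {..<k})) \<le> r"
    using r nth(2) by (subst Max_le_iff) auto
  ultimately show ?thesis by blast
qed

lemma representation_bounded_by:
  assumes N: "left_module A N" and s: "s \<in> representations N (cls N x)"
  shows "bounded_by N (nrm N) x s" "0 \<le> s"
proof -
  obtain k u n where un: "\<forall>i<k. u i \<in> carrier U \<and> n i \<in> carrier N"
    "cls N x = (\<Oplus>\<^bsub>tensor A U N\<^esub>i\<in>{..<k}. pure_tensor A U N (u i) (n i))"
    and s_eq: "s = Max (insert 0 ((\<lambda>i. \<parallel>u i\<parallel>\<^bsub>U\<^esub> * \<parallel>n i\<parallel>\<^bsub>N\<^esub>) ` {..<(k::nat)}))"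
    using s by (auto simp: representations_def)
  show "0 \<le> s" by (simp add: s_eq)
  have "cls N x = cls N (\<Sum>i<k. frag_of (u i, n i))"
    unfolding un(2) pure_tensor_class using un(1) by (intro finsum_cls[OF N]) auto
  then have x: "x - (\<Sum>i<k. frag_of (u i, n i)) \<in> rel N" by (simp add: cls_eq_iff[OF N])
  have le: "\<parallel>u i\<parallel>\<^bsub>U\<^esub> * \<parallel>n i\<parallel>\<^bsub>N\<^esub> \<le> s" if "i < k" for i
    unfolding s_eq using that by (intro Max_ge) auto
  have keys: "Poly_Mapping.keys (\<Sum>i<k. frag_of (u i, n i)) \<subseteq> (\<lambda>i. (u i, n i)) ` {..<k}"
    using keys_sum[of "\<lambda>i. frag_of (u i, n i)" "{..<k}"] by auto
  show "bounded_by N (nrm N) x s"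
    unfolding tensor_bounded_def
    using x keys le un(1) by (intro bexI[of _ "\<Sum>i<k. frag_of (u i, n i)"])
      (auto simp: frag_bounded_def tensor_frags_def)
qed

lemma tensor_seminorm_le:
  assumes N: "left_module A N" and x: "bounded_by N (nrm N) x r" "0 \<le> r"
  shows "tensor_seminorm A U N (cls N x) \<le> r"
proof -
  obtain s where s: "s \<in> representations N (cls N x)" "s \<le> r"
    using bounded_by_representation[OF N x] by blast
  have "Inf (representations N (cls N x)) \<le> s"
    using s(1) representation_bounded_by(2)[OF N] by (intro cInf_lower bdd_belowI[of _ 0])
  then show ?thesis using s(2) by (simp add: tensor_seminorm_eq)
qed

lemma representations_nonempty:
  assumes N: "left_module A N" and x: "x \<in> tensor_frags U N"
  shows "representations N (cls N x) \<noteq> {}"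
proof -
  obtain r where "r > 0" "frag_bounded U (nrm N) x r" using ex_frag_bounded by blast
  then show ?thesis
    using bounded_by_representation[OF N bounded_by_frag[OF x], of r] by auto
qed

lemma tensor_seminorm_less:
  assumes N: "left_module A N" and x: "x \<in> tensor_frags U N" "tensor_seminorm A U N (cls N x) < r"
  shows "bounded_by N (nrm N) x r"
proof -
  obtain s where s: "s \<in> representations N (cls N x)" "s < r"
    using cInf_lessD[OF representations_nonempty[OF N x(1)]] x(2) by (auto simp: tensor_seminorm_eq)
  then show ?thesis
    using bounded_by_mono[OF representation_bounded_by(1)[OF N s(1)], of r] by simp
qed

lemma tensor_seminorm_nonneg:
  assumes N: "left_module A N" and x: "x \<in> tensor_frags U N"
  shows "0 \<le> tensor_seminorm A U N (cls N x)"
  unfolding tensor_seminorm_eq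
  using representations_nonempty[OF N x] representation_bounded_by(2)[OF N] by (intro cInf_greatest)

lemma normed_tensor_simps [simp]:
  "carrier (normed_tensor A U N) = carrier (tensor A U N)" "\<zero>\<^bsub>normed_tensor A U N\<^esub> = \<zero>\<^bsub>tensor A U N\<^esub>"
  "X \<oplus>\<^bsub>normed_tensor A U N\<^esub> Y = X \<oplus>\<^bsub>tensor A U N\<^esub> Y" "nrm (normed_tensor A U N) = tensor_seminorm A U N"
  by (simp_all add: normed_tensor_def with_norm_def)

lemma uminus_normed_tensor:
  assumes N: "left_module A N" and x: "x \<in> tensor_frags U N"
  shows "\<ominus>\<^bsub>normed_tensor A U N\<^esub> cls N x = cls N (- x)"
proof -
  interpret T: abelian_group "tensor A U N" by (rule abelian_group_tensor[OF N])
  interpret V: abelian_group "normed_tensor A U N"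
    by (rule abelian_groupI) (use T.l_neg in \<open>auto simp: T.a_ac intro!: bexI[of _ "\<ominus>\<^bsub>tensor A U N\<^esub> _"]\<close>)
  show ?thesis
    using x by (intro V.minus_equality) (auto simp: carrier_tensor add_cls[OF N] zero_tensor)
qed

lemma minus_normed_tensor:
  "\<lbrakk>left_module A N; y \<in> tensor_frags U N\<rbrakk> \<Longrightarrow> cls N x \<ominus>\<^bsub>normed_tensor A U N\<^esub> cls N y = cls N (x - y)"
  by (simp add: a_minus_def uminus_normed_tensor add_cls)

lemma seminormed_group_normed_tensor:
  assumes N: "left_module A N"
  shows "seminormed_group (normed_tensor A U N)"
proof -
  interpret T: abelian_group "tensor A U N" by (rule abelian_group_tensor[OF N])
  have abel: "abelian_group (normed_tensor A U N)"
    by (rule abelian_groupI) (use T.l_neg in \<open>auto simp: T.a_ac intro!: bexI[of _ "\<ominus>\<^bsub>tensor A U N\<^esub> _"]\<close>)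
  have uminus_le: "tensor_seminorm A U N (cls N (- x)) \<le> tensor_seminorm A U N (cls N x)"
    if x: "x \<in> tensor_frags U N" for x
  proof (rule dense_ge)
    fix r assume "tensor_seminorm A U N (cls N x) < r"
    then show "tensor_seminorm A U N (cls N (- x)) \<le> r"
      using tensor_seminorm_less[OF N x] tensor_seminorm_nonneg[OF N x]
      by (intro tensor_seminorm_le[OF N] bounded_by_uminus[OF N]) auto
  qed
  have add_le: "tensor_seminorm A U N (cls N (x + y)) \<le>
      max (tensor_seminorm A U N (cls N x)) (tensor_seminorm A U N (cls N y))"
    if x: "x \<in> tensor_frags U N" and y: "y \<in> tensor_frags U N" for x y
  proof (rule dense_ge)
    fix r assume r: "max (tensor_seminorm A U N (cls N x)) (tensor_seminorm A U N (cls N y)) < r"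
    then show "tensor_seminorm A U N (cls N (x + y)) \<le> r"
      using bounded_by_add[OF tensor_seminorm_less[OF N x, of r] tensor_seminorm_less[OF N y, of r]]
        tensor_seminorm_nonneg[OF N x]
      by (intro tensor_seminorm_le[OF N]) auto
  qed
  have zero: "tensor_seminorm A U N (cls N 0) = 0"
    using tensor_seminorm_nonneg[OF N, of 0]
    by (intro antisym tensor_seminorm_le[OF N bounded_by_zero]) auto
  show ?thesis
  proof (intro seminormed_group.intro abel seminormed_group_axioms.intro)
    fix X assume "X \<in> carrier (normed_tensor A U N)"
    then obtain x where x: "x \<in> tensor_frags U N" "X = cls N x" by (auto simp: carrier_tensor)
    show "0 \<le> \<parallel>X\<parallel>\<^bsub>normed_tensor A U N\<^esub>" using x by (simp add: tensor_seminorm_nonneg[OF N])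
    show "\<parallel>\<ominus>\<^bsub>normed_tensor A U N\<^esub> X\<parallel>\<^bsub>normed_tensor A U N\<^esub> = \<parallel>X\<parallel>\<^bsub>normed_tensor A U N\<^esub>"
      using x uminus_le[of x] uminus_le[of "- x"] by (simp add: uminus_normed_tensor[OF N])
  next
    fix X Y assume "X \<in> carrier (normed_tensor A U N)" "Y \<in> carrier (normed_tensor A U N)"
    then show "\<parallel>X \<oplus>\<^bsub>normed_tensor A U N\<^esub> Y\<parallel>\<^bsub>normed_tensor A U N\<^esub>
        \<le> max \<parallel>X\<parallel>\<^bsub>normed_tensor A U N\<^esub> \<parallel>Y\<parallel>\<^bsub>normed_tensor A U N\<^esub>"
      using add_le by (auto simp: carrier_tensor add_cls[OF N])
  qed (simp add: zero_tensor zero)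
qed

end

locale normed_complex = dvf_right_module K av \<pi> p A U
  for K :: "('k, 'x) ring_scheme" and av :: "'k \<Rightarrow> real" and \<pi> :: 'k and p :: nat
    and A :: "('k, 'a, 'y) normed_module_scheme" and U :: "('a, 'u, 'z) normed_module_scheme" +
  fixes C :: "int \<Rightarrow> ('a, 'c, 'w) normed_module_scheme" and d :: "int \<Rightarrow> 'c \<Rightarrow> 'c"
  assumes normed_C: "normed_left_module K av A (C i)"
    and d_hom: "d i \<in> bounded_left_hom A (C i) (C (i + 1))"
    and strict_d: "strict_map (C i) (C (i + 1)) (d i)"
    and exact_d: "exact_cochain C d"
begin

lemma C: "normed_left (C i) (nrm (C i))"
  by (rule normed_left_normed_left_module[OF normed_C])

lemma left_C: "left_module A (C i)"
  by (rule normed_leftD(1)[OF C])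

lemma d: "d i \<in> left_hom A (C i) (C (i + 1))"
  using d_hom[of i] by (simp add: bounded_left_hom_def)

lemma d_bounded: "\<exists>c>0. \<forall>x\<in>carrier (C i). \<parallel>d i x\<parallel>\<^bsub>C (i + 1)\<^esub> \<le> c * \<parallel>x\<parallel>\<^bsub>C i\<^esub>"
proof -
  obtain c where c: "\<forall>x\<in>carrier (C i). \<parallel>d i x\<parallel>\<^bsub>C (i + 1)\<^esub> \<le> c * \<parallel>x\<parallel>\<^bsub>C i\<^esub>"
    using d_hom[of i] by (auto simp: bounded_left_hom_def)
  have "c * \<parallel>x\<parallel>\<^bsub>C i\<^esub> \<le> max c 1 * \<parallel>x\<parallel>\<^bsub>C i\<^esub>" if "x \<in> carrier (C i)" for x
    using normed_leftD(3)[OF C that] by (intro mult_right_mono) auto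
  then show ?thesis
    using c by (intro exI[of _ "max c 1"]) force
qed

lemma exact:
  "x \<in> d (i - 1) ` carrier (C (i - 1)) \<longleftrightarrow> x \<in> carrier (C i) \<and> d i x = \<zero>\<^bsub>C (i + 1)\<^esub>"
  using exact_d by (auto simp: exact_cochain_def a_kernel_def')

lemma d_d: "x \<in> carrier (C i) \<Longrightarrow> d (i + 1) (d i x) = \<zero>\<^bsub>C (i + 2)\<^esub>"
  using exact[of "d i x" "i + 1"] by (simp add: add.assoc)

lemma ex_preimage:
  "\<exists>c>0. \<forall>x\<in>carrier (C i). d i x = \<zero>\<^bsub>C (i + 1)\<^esub> \<longrightarrow>
    (\<exists>y\<in>carrier (C (i - 1)). d (i - 1) y = x \<and> \<parallel>y\<parallel>\<^bsub>C (i - 1)\<^esub> \<le> c * \<parallel>x\<parallel>\<^bsub>C i\<^esub>)"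
proof -
  have "d (i - 1) \<in> left_hom A (C (i - 1)) (C i)" "strict_map (C (i - 1)) (C i) (d (i - 1))"
    using d[of "i - 1"] strict_d[of "i - 1"] by simp_all
  from strict_map_lift[OF normed_C normed_C this] show ?thesis
    using exact[of _ i] by blast
qed

text \<open>Exactness of \<open>U \<otimes> C\<close> at degree \<open>i\<close>, with a bound on the preimages of cycles.\<close>

definition strictly_exact_at :: "int \<Rightarrow> bool"
  where "strictly_exact_at i \<longleftrightarrow> (\<exists>c>0. \<forall>x\<in>tensor_frags U (C i). \<forall>r>0.
    bounded_by (C i) (nrm (C i)) x r \<longrightarrow> frag_map (d i) x \<in> rel (C (i + 1)) \<longrightarrow>
    (\<exists>y\<in>tensor_frags U (C (i - 1)). x - frag_map (d (i - 1)) y \<in> rel (C i) \<and>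
      bounded_by (C (i - 1)) (nrm (C (i - 1))) y (c * r)))"

lemma bounded_additive_tensor_map:
  "bounded_additive (normed_tensor A U (C i)) (normed_tensor A U (C (i + 1)))
    (tensor_map A U (C (i + 1)) (d i))"
proof -
  obtain c where c: "c > 0" "\<And>x. x \<in> carrier (C i) \<Longrightarrow> \<parallel>d i x\<parallel>\<^bsub>C (i + 1)\<^esub> \<le> c * \<parallel>x\<parallel>\<^bsub>C i\<^esub>"
    using d_bounded by blast
  have closed: "frag_map (d i) x \<in> tensor_frags U (C (i + 1))" if "x \<in> tensor_frags U (C i)" for x
    by (rule frag_map_closed[OF that left_hom_closed[OF d]])
  have "tensor_seminorm A U (C (i + 1)) (cls (C (i + 1)) (frag_map (d i) x)) \<le> c * tensor_seminorm A U (C i) (cls (C i) x)"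
    if x: "x \<in> tensor_frags U (C i)" for x
  proof -
    have "tensor_seminorm A U (C (i + 1)) (cls (C (i + 1)) (frag_map (d i) x)) / c \<le> tensor_seminorm A U (C i) (cls (C i) x)"
    proof (rule dense_ge)
      fix r assume r: "tensor_seminorm A U (C i) (cls (C i) x) < r"
      then have "bounded_by (C (i + 1)) (nrm (C (i + 1))) (frag_map (d i) x) (c * r)"
        using c by (intro bounded_by_frag_map[OF left_C left_C d tensor_seminorm_less[OF left_C x]]) auto
      then have "tensor_seminorm A U (C (i + 1)) (cls (C (i + 1)) (frag_map (d i) x)) \<le> c * r"
        using r c(1) tensor_seminorm_nonneg[OF left_C x] by (intro tensor_seminorm_le[OF left_C]) auto
      then show "tensor_seminorm A U (C (i + 1)) (cls (C (i + 1)) (frag_map (d i) x)) / c \<le> r"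
        using c(1) by (simp add: field_simps)
    qed
    then show ?thesis using c(1) by (simp add: field_simps)
  qed
  then show ?thesis
    unfolding bounded_additive_def using closed
    by (auto simp: carrier_tensor tensor_map_cls[OF left_C left_C d] minus_normed_tensor[OF left_C] intro!: exI[of _ c])
qed

text \<open>Exactness of the completion in degree \<open>i\<close> needs bounded preimages in degree \<open>i\<close> and, in order to
  replace almost-cycles by cycles, in degree \<open>i + 1\<close>.\<close>

lemma exact_completed_tensor:
  assumes "\<And>i. strictly_exact_at i"
  shows "exact_cochain (\<lambda>i. completed_tensor A U (C i)) (\<lambda>i. completed_tensor_map A U (C (i + 1)) (d i))"
  unfolding exact_cochain_def
proof
  fix i
  let ?V = "\<lambda>i. normed_tensor A U (C i)" and ?f = "\<lambda>i. tensor_map A U (C (i + 1)) (d i)"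
  have lift: "\<exists>c. \<forall>X r. X \<in> carrier (?V i) \<longrightarrow> ?f i X = \<zero>\<^bsub>?V (i + 1)\<^esub> \<longrightarrow> \<parallel>X\<parallel>\<^bsub>?V i\<^esub> < r \<longrightarrow>
      (\<exists>Y\<in>carrier (?V (i - 1)). ?f (i - 1) Y = X \<and> \<parallel>Y\<parallel>\<^bsub>?V (i - 1)\<^esub> \<le> c * r)" for i
  proof -
    have d': "d (i - 1) \<in> left_hom A (C (i - 1)) (C i)" using d[of "i - 1"] by simp
    obtain c where c: "c > 0" "\<And>x r. \<lbrakk>x \<in> tensor_frags U (C i); 0 < r; bounded_by (C i) (nrm (C i)) x r;
        frag_map (d i) x \<in> rel (C (i + 1))\<rbrakk> \<Longrightarrow>
      \<exists>y\<in>tensor_frags U (C (i - 1)). x - frag_map (d (i - 1)) y \<in> rel (C i) \<and>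
        bounded_by (C (i - 1)) (nrm (C (i - 1))) y (c * r)"
      using assms[of i] unfolding strictly_exact_at_def by blast
    have "\<exists>Y\<in>carrier (?V (i - 1)). ?f (i - 1) Y = X \<and> \<parallel>Y\<parallel>\<^bsub>?V (i - 1)\<^esub> \<le> c * r"
      if X: "X \<in> carrier (?V i)" "?f i X = \<zero>\<^bsub>?V (i + 1)\<^esub>" "\<parallel>X\<parallel>\<^bsub>?V i\<^esub> < r" for X r
    proof -
      obtain x where x: "x \<in> tensor_frags U (C i)" "X = cls (C i) x"
        using X(1) by (auto simp: carrier_tensor)
      have r: "0 < r" using X(3) x tensor_seminorm_nonneg[OF left_C x(1)] by simp
      have "frag_map (d i) x \<in> rel (C (i + 1))"
        using X(2) by (simp add: x(2) tensor_map_cls[OF left_C left_C d] cls_zero_iff[OF left_C])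
      moreover have "bounded_by (C i) (nrm (C i)) x r"
        using X(3) x by (intro tensor_seminorm_less[OF left_C]) auto
      ultimately obtain y where y: "y \<in> tensor_frags U (C (i - 1))" "x - frag_map (d (i - 1)) y \<in> rel (C i)"
        "bounded_by (C (i - 1)) (nrm (C (i - 1))) y (c * r)"
        using c(2)[OF x(1) r] by blast
      have "?f (i - 1) (cls (C (i - 1)) y) = X"
        using y(2) rel_minus_commute[OF left_C]
        by (simp add: x(2) tensor_map_cls[OF left_C left_C d'] cls_eq_iff[OF left_C])
      moreover have "\<parallel>cls (C (i - 1)) y\<parallel>\<^bsub>?V (i - 1)\<^esub> \<le> c * r"
        using tensor_seminorm_le[OF left_C y(3)] c(1) r by simp
      ultimately show ?thesis
        using y(1) by (intro bexI[of _ "cls (C (i - 1)) y"]) (auto simp: carrier_tensor)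
    qed
    then show ?thesis by blast
  qed
  have ff: "?f (i + 1) (?f i X) = \<zero>\<^bsub>?V (i + 1 + 1)\<^esub>" if X: "X \<in> carrier (?V i)" for X i
  proof -
    obtain x where x: "x \<in> tensor_frags U (C i)" "X = cls (C i) x"
      using X by (auto simp: carrier_tensor)
    have "frag_map (\<lambda>n. d (i + 1) (d i n)) x \<in> rel (C (i + 1 + 1))"
      using x(1) d_d[of _ i] by (intro frag_map_zero[OF left_C]) (auto simp: add.assoc)
    then show ?thesis
      unfolding x(2) normed_tensor_simps tensor_map_cls[OF left_C left_C d] frag_map_comp cls_zero_iff[OF left_C] .
  qed
  obtain c where c: "\<And>X r. \<lbrakk>X \<in> carrier (?V i); ?f i X = \<zero>\<^bsub>?V (i + 1)\<^esub>; \<parallel>X\<parallel>\<^bsub>?V i\<^esub> < r\<rbrakk> \<Longrightarrow>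
      \<exists>Y\<in>carrier (?V (i - 1)). ?f (i - 1) Y = X \<and> \<parallel>Y\<parallel>\<^bsub>?V (i - 1)\<^esub> \<le> c * r"
    using lift[of i] by blast
  obtain c' where c': "\<And>X r. \<lbrakk>X \<in> carrier (?V (i + 1)); ?f (i + 1) X = \<zero>\<^bsub>?V (i + 1 + 1)\<^esub>; \<parallel>X\<parallel>\<^bsub>?V (i + 1)\<^esub> < r\<rbrakk> \<Longrightarrow>
      \<exists>Y\<in>carrier (?V i). ?f i Y = X \<and> \<parallel>Y\<parallel>\<^bsub>?V i\<^esub> \<le> c' * r"
    using lift[of "i + 1"] unfolding add_diff_cancel_right' by blast
  have b1: "bounded_additive (?V (i - 1)) (?V i) (?f (i - 1))"
    using bounded_additive_tensor_map[of "i - 1"] by simp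
  have "completion_map (?V i) (?f (i - 1)) ` carrier (completion (?V (i - 1))) =
      a_kernel (completion (?V i)) (completion (?V (i + 1))) (completion_map (?V (i + 1)) (?f i))"
  proof (rule completion_exact[OF _ _ _ b1 bounded_additive_tensor_map])
    show "?f i (?f (i - 1) X) = \<zero>\<^bsub>?V (i + 1)\<^esub>" if "X \<in> carrier (?V (i - 1))" for X
      using ff[of X "i - 1"] that by simp
    show "\<exists>w\<in>carrier (?V i). ?f i w = ?f i X \<and> \<parallel>w\<parallel>\<^bsub>?V i\<^esub> \<le> c' * r"
      if "X \<in> carrier (?V i)" "\<parallel>?f i X\<parallel>\<^bsub>?V (i + 1)\<^esub> < r" for X r
      using that bounded_additive_tensor_map[of i] ff[of X i]
      by (intro c') (auto simp: bounded_additive_def)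
  qed (use c seminormed_group_normed_tensor[OF left_C] in auto)
  then show "completed_tensor_map A U (C (i - 1 + 1)) (d (i - 1)) ` carrier (completed_tensor A U (C (i - 1))) =
      a_kernel (completed_tensor A U (C i)) (completed_tensor A U (C (i + 1)))
        (completed_tensor_map A U (C (i + 1)) (d i))"
    by (simp add: completed_tensor_map_def completed_tensor_def)
qed

section \<open>Flat unit ball\<close>

text \<open>A cycle of norm at most \<open>r\<close> is scaled to a tensor \<open>z\<close> of elements of the unit balls. The map
  \<open>h = \<pi>\<^sup>2\<^sup>m d\<close> has the same kernel as \<open>d\<close>, and for large \<open>m\<close> it maps \<open>z\<close> to \<open>0\<close> over the unit balls, so
  flatness moves \<open>z\<close> into the unit ball of the kernel. The bound does not depend on \<open>m\<close>.\<close>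

lemma strictly_exact_of_flat_unit_ball:
  fixes j :: "'c \<Rightarrow> 'n"
  assumes flat: "flat_right_module TYPE('n) (unit_ball A) (unit_ball U)" and j: "inj j"
  shows "strictly_exact_at i"
proof -
  obtain c where c: "c > 0" "\<forall>x\<in>carrier (C i). d i x = \<zero>\<^bsub>C (i + 1)\<^esub> \<longrightarrow>
      (\<exists>y\<in>carrier (C (i - 1)). d (i - 1) y = x \<and> \<parallel>y\<parallel>\<^bsub>C (i - 1)\<^esub> \<le> c * \<parallel>x\<parallel>\<^bsub>C i\<^esub>)"
    using ex_preimage by blast
  then have "\<forall>x. \<exists>y. x \<in> carrier (C i) \<and> d i x = \<zero>\<^bsub>C (i + 1)\<^esub> \<longrightarrow>
      y \<in> carrier (C (i - 1)) \<and> d (i - 1) y = x \<and> \<parallel>y\<parallel>\<^bsub>C (i - 1)\<^esub> \<le> c * \<parallel>x\<parallel>\<^bsub>C i\<^esub>" by blast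
  then obtain l where l: "\<And>x. \<lbrakk>x \<in> carrier (C i); d i x = \<zero>\<^bsub>C (i + 1)\<^esub>\<rbrakk> \<Longrightarrow>
      l x \<in> carrier (C (i - 1)) \<and> d (i - 1) (l x) = x \<and> \<parallel>l x\<parallel>\<^bsub>C (i - 1)\<^esub> \<le> c * \<parallel>x\<parallel>\<^bsub>C i\<^esub>"
    by metis
  obtain b where b: "b > 0" "\<forall>x\<in>carrier (C i). \<parallel>d i x\<parallel>\<^bsub>C (i + 1)\<^esub> \<le> b * \<parallel>x\<parallel>\<^bsub>C i\<^esub>"
    using d_bounded by blast
  have b1: "\<parallel>d i n\<parallel>\<^bsub>C (i + 1)\<^esub> \<le> b" if "n \<in> carrier (C i)" "\<parallel>n\<parallel>\<^bsub>C i\<^esub> \<le> 1" for n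
  proof -
    have "\<parallel>d i n\<parallel>\<^bsub>C (i + 1)\<^esub> \<le> b * \<parallel>n\<parallel>\<^bsub>C i\<^esub>" using b(2) that(1) by blast
    also have "\<dots> \<le> b * 1" using b(1) that(2) by (intro mult_left_mono) auto
    finally show ?thesis by simp
  qed
  interpret N: left_module A "C i" by (rule left_C)
  interpret N': left_module A "C (i + 1)" by (rule left_C)
  interpret P: left_module A "C (i - 1)" by (rule left_C)
  let ?N0 = "closed_ball (C i) (nrm (C i))" and ?N0' = "closed_ball (C (i + 1)) (nrm (C (i + 1)))"
  note N0 = left_module_closed_ball[OF C[of i]] and N0' = left_module_closed_ball[OF C[of "i + 1"]]
  have "\<exists>y\<in>tensor_frags U (C (i - 1)). x - frag_map (d (i - 1)) y \<in> rel (C i) \<and>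
      bounded_by (C (i - 1)) (nrm (C (i - 1))) y (c / q\<^sup>2 * r)"
    if x: "x \<in> tensor_frags U (C i)" and r: "0 < r" and xr: "bounded_by (C i) (nrm (C i)) x r"
      and dx: "frag_map (d i) x \<in> rel (C (i + 1))" for x r
  proof -
    obtain k z where k: "k \<in> carrier K" "k \<noteq> \<zero>\<^bsub>K\<^esub>" "q\<^sup>2 \<le> av k * r"
      and z: "z \<in> tensor_frags (unit_ball U) ?N0" "frag_map ((\<odot>\<^bsub>C i\<^esub>) (sc k)) x - z \<in> rel (C i)"
      using integralize[OF C xr r] by blast
    note inv = inv_closed[OF k(1,2)]
    have zU: "z \<in> tensor_frags U (C i)" by (rule tensor_frags_mono[OF z(1)]) auto
    have "frag_map (d i) (frag_map ((\<odot>\<^bsub>C i\<^esub>) (sc k)) x) = frag_map ((\<odot>\<^bsub>C (i + 1)\<^esub>) (sc k)) (frag_map (d i) x)"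
      using x k(1) by (auto simp: frag_map_comp left_hom_act[OF d] intro!: frag_map_cong)
    also have "\<dots> \<in> rel (C (i + 1))"
      by (rule frag_map_rel[OF left_C left_C sc_hom[OF C k(1)] dx])
    finally have dz: "frag_map (d i) z \<in> rel (C (i + 1))"
      using frag_map_rel[OF left_C left_C d z(2)] rel_cong[OF left_C, of _ _ "i + 1"] by simp
    obtain m1 where m1: "\<forall>m\<ge>m1. scale (C (i + 1)) m (frag_map (d i) z) \<in> B.rel ?N0'"
      using clear_denominators[OF C dz] by blast
    obtain m2 where m2: "\<forall>m\<ge>m2. q ^ m * b \<le> 1" using ex_pow_small[of 1 b] by auto
    define m where "m = max m1 m2"
    have sm: "sc (\<pi> [^]\<^bsub>K\<^esub> m) \<in> carrier (unit_ball A)"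
      using q by (intro sc_unit_ball) (auto simp: av_pow power_le_one)
    \<comment> \<open>The exponent is \<open>2 m\<close> because \<open>scale\<close> multiplies both factors of a tensor by \<open>\<pi>\<^sup>m\<close>.\<close>
    define h where "h n = sc (\<pi> [^]\<^bsub>K\<^esub> (m + m)) \<odot>\<^bsub>C (i + 1)\<^esub> d i n" for n
    have h_hom: "h \<in> left_hom A (C i) (C (i + 1))"
      unfolding h_def by (rule left_hom_comp[OF d sc_hom[OF C]]) simp
    have h_le: "\<parallel>h n\<parallel>\<^bsub>C (i + 1)\<^esub> \<le> 1" if "n \<in> carrier (C i)" "\<parallel>n\<parallel>\<^bsub>C i\<^esub> \<le> 1" for n
    proof -
      have "\<parallel>h n\<parallel>\<^bsub>C (i + 1)\<^esub> = q ^ (m + m) * \<parallel>d i n\<parallel>\<^bsub>C (i + 1)\<^esub>"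
        using that by (simp add: h_def norm_sc[OF C] av_pow left_hom_closed[OF d])
      also have "\<dots> \<le> q ^ (m + m) * b"
        using b1[OF that] q by (intro mult_left_mono) auto
      also have "\<dots> \<le> 1" using m2 by (auto simp: m_def)
      finally show ?thesis .
    qed
    have hb: "h \<in> left_hom (unit_ball A) ?N0 ?N0'"
      using h_hom h_le by (auto simp: left_hom_def)
    have "scale (C (i + 1)) m (frag_map (d i) z) - frag_map h z \<in> B.rel ?N0'"
      using z(1)
    proof (induction rule: tensor_frags_induct)
      case (diff x y)
      then show ?case
        using B.rel_diff[OF N0' diff(3,4)] by (simp add: algebra_simps)
    next
      case (pure u n)
      let ?n = "sc (\<pi> [^]\<^bsub>K\<^esub> m) \<odot>\<^bsub>C (i + 1)\<^esub> d i n"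
      have n: "n \<in> carrier (C i)" "\<parallel>n\<parallel>\<^bsub>C i\<^esub> \<le> 1" using pure by auto
      have "\<parallel>?n\<parallel>\<^bsub>C (i + 1)\<^esub> \<le> q ^ m * b"
        using b1[OF n] n(1) q by (simp add: norm_sc[OF C] av_pow left_hom_closed[OF d])
      also have "\<dots> \<le> 1" using m2 by (simp add: m_def)
      finally have "?n \<in> carrier ?N0'"
        using n by (simp add: N'.act_closed left_hom_closed[OF d])
      then have "frag_of (sc (\<pi> [^]\<^bsub>K\<^esub> m) \<odot>\<^bsub>unit_ball U\<^esub> u, ?n) -
          frag_of (u, sc (\<pi> [^]\<^bsub>K\<^esub> m) \<odot>\<^bsub>?N0'\<^esub> ?n) \<in> B.rel ?N0'"
        using pure(1) sm by (intro B.rel_act)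
      then show ?case
        using n by (simp add: h_def sc_act_act[OF C] left_hom_closed[OF d] K.nat_pow_mult K.uniformizer_closed)
    qed simp
    moreover have "scale (C (i + 1)) m (frag_map (d i) z) \<in> B.rel ?N0'"
      using m1 by (simp add: m_def)
    ultimately have "frag_map h z \<in> B.rel ?N0'"
      using B.rel_cong[OF N0'] by blast
    obtain y where y: "y \<in> tensor_frags (unit_ball U) (?N0\<lparr>carrier := {n \<in> carrier ?N0. h n = \<zero>\<^bsub>?N0'\<^esub>}\<rparr>)"
      "z - y \<in> B.rel ?N0"
      using flat_exact[OF flat N0 N0' hb inj_on_subset[OF j subset_UNIV] z(1) \<open>frag_map h z \<in> _\<close>] by blast
    have ker: "d i n = \<zero>\<^bsub>C (i + 1)\<^esub>" if "n \<in> carrier (C i)" "h n = \<zero>\<^bsub>C (i + 1)\<^esub>" for n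
    proof -
      have "sc (inv\<^bsub>K\<^esub> (\<pi> [^]\<^bsub>K\<^esub> (m + m))) \<odot>\<^bsub>C (i + 1)\<^esub> h n = d i n"
        using that(1) inv_closed[OF pow_closed pow_nonzero, of "m + m"]
        by (simp add: h_def sc_act_act[OF C] left_hom_closed[OF d] N'.act_one)
      then show ?thesis
        using that(2) inv_closed[OF pow_closed pow_nonzero, of "m + m"] by simp
    qed
    let ?Z = "(C i)\<lparr>carrier := {n \<in> carrier (C i). d i n = \<zero>\<^bsub>C (i + 1)\<^esub> \<and> \<parallel>n\<parallel>\<^bsub>C i\<^esub> \<le> 1}\<rparr>"
    have yZ: "y \<in> tensor_frags (unit_ball U) ?Z"
      by (rule tensor_frags_mono[OF y(1)]) (auto intro: ker)
    define w where "w = frag_map (\<lambda>n. sc (inv\<^bsub>K\<^esub> k) \<odot>\<^bsub>C (i - 1)\<^esub> l n) y"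
    have w: "w \<in> tensor_frags U (C (i - 1))"
      unfolding w_def using l inv by (intro tensor_frags_mono[OF frag_map_closed[OF yZ]]) (auto intro!: P.act_closed)
    have y1: "frag_bounded U (nrm (C i)) y 1"
      by (rule frag_bounded_unit_ball[OF yZ]) (use normed_leftD(3)[OF C] in auto)
    have yU: "y \<in> tensor_frags U ?Z"
      using yZ by (rule tensor_frags_mono) auto
    have yC: "y \<in> tensor_frags U (C i)"
      using yZ by (rule tensor_frags_mono) auto
    have "frag_bounded U (nrm (C (i - 1))) w (c / av k * 1)"
      unfolding w_def
    proof (rule frag_bounded_frag_map[OF yU y1])
      fix n assume "n \<in> carrier ?Z"
      then have n: "n \<in> carrier (C i)" "d i n = \<zero>\<^bsub>C (i + 1)\<^esub>" by auto
      then show "\<parallel>sc (inv\<^bsub>K\<^esub> k) \<odot>\<^bsub>C (i - 1)\<^esub> l n\<parallel>\<^bsub>C (i - 1)\<^esub> \<le> c / av k * \<parallel>n\<parallel>\<^bsub>C i\<^esub>"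
        using l[OF n] inv av_pos[OF k(1,2)] by (simp add: norm_sc[OF C] divide_right_mono)
    qed (use c(1) av_pos[OF k(1,2)] in simp)
    moreover have "c / av k * 1 \<le> c / q\<^sup>2 * r"
      using k(3) c(1) q av_pos[OF k(1,2)] r by (simp add: field_simps)
    ultimately have "bounded_by (C (i - 1)) (nrm (C (i - 1))) w (c / q\<^sup>2 * r)"
      using frag_bounded_mono bounded_by_frag[OF w] by blast
    moreover have "x - frag_map (d (i - 1)) w \<in> rel (C i)"
    proof -
      have d': "d (i - 1) \<in> left_hom A (C (i - 1)) (C i)" using d[of "i - 1"] by simp
      have "frag_map (d (i - 1)) w = frag_map ((\<odot>\<^bsub>C i\<^esub>) (sc (inv\<^bsub>K\<^esub> k))) y"
        unfolding w_def frag_map_comp using l inv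
        by (intro frag_map_cong[OF yU]) (auto simp: left_hom_act[OF d'])
      moreover have "frag_map ((\<odot>\<^bsub>C i\<^esub>) (sc k)) x - y \<in> rel (C i)"
        using rel_trans[OF z(2) ball_rel_rel[OF N0 left_C y(2)]] .
      then have "x - frag_map ((\<odot>\<^bsub>C i\<^esub>) (sc (inv\<^bsub>K\<^esub> k))) y \<in> rel (C i)"
        using frag_map_rel[OF left_C left_C sc_hom[OF C inv(1)]] frag_map_sc_inv[OF C k(1,2) x]
        by (metis frag_map_diff)
      ultimately show ?thesis by simp
    qed
    ultimately show ?thesis using w by blast
  qed
  then show ?thesis
    unfolding strictly_exact_at_def using c(1) q by (intro exI[of _ "c / q\<^sup>2"]) auto
qed

end

section \<open>The canonical resolution\<close>

context dvf_right_module
begin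

lemma combination_unit_ball: "combination (unit_ball A) w = combination A w"
  by (induction w) auto

lemma basis_vector_unit_ball: "basis_vector (unit_ball A) b = basis_vector A b"
  by (auto simp: basis_vector_def fun_eq_iff)

lemma free_module_unit_ball: "free_module (unit_ball A) B = closed_ball (free_module A B) sup_norm"
proof -
  have "f \<in> carrier (free_module (unit_ball A) B) \<longleftrightarrow> f \<in> carrier (free_module A B) \<and> sup_norm f \<le> 1" for f
    using sup_norm_le_iff[of f B 1] by (auto simp: free_module_carrier)
  then show ?thesis
    by (auto simp: closed_ball_def free_module_def)
qed

lemma hom_restrict_unit_ball:
  assumes h: "h \<in> left_hom A N N'" and le: "\<And>n. \<lbrakk>n \<in> carrier N; \<nu> n \<le> 1\<rbrakk> \<Longrightarrow> \<nu>' (h n) \<le> 1"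
  shows "h \<in> left_hom (unit_ball A) (closed_ball N \<nu>) (closed_ball N' \<nu>')"
  using assms by (auto simp: left_hom_def)

subsection \<open>Coordinates in a tensor product with a free module\<close>

text \<open>The map that takes \<open>u \<otimes> f\<close> to \<open>u f(b)\<close>, on formal sums.\<close>

definition is_coordinate :: "'b set \<Rightarrow> 'b \<Rightarrow> (('u \<times> ('b \<Rightarrow> 'a) \<Rightarrow>\<^sub>0 int) \<Rightarrow> 'u) \<Rightarrow> bool"
  where "is_coordinate B b h \<longleftrightarrow> (\<forall>x\<in>tensor_frags U (free_module A B). h x \<in> carrier U) \<and>
    (\<forall>x\<in>tensor_frags U (free_module A B). \<forall>y\<in>tensor_frags U (free_module A B).
      h (x - y) = h x \<ominus>\<^bsub>U\<^esub> h y) \<and>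
    (\<forall>u\<in>carrier U. \<forall>f\<in>carrier (free_module A B). h (frag_of (u, f)) = f b \<odot>\<^bsub>U\<^esub> u)"

lemma ex_coordinate: "\<exists>h. is_coordinate B b h"
proof -
  let ?S = "carrier U \<times> carrier (free_module A B)"
  have "comm_group (add_monoid U)" by (rule U.M.a_comm_group)
  moreover have "(\<lambda>(u, f). f b \<odot>\<^bsub>U\<^esub> u) ` ?S \<subseteq> carrier (add_monoid U)"
    by (auto simp: free_module_carrier U.act_closed)
  ultimately obtain h where h: "h \<in> hom (free_Abelian_group ?S) (add_monoid U)"
    "\<And>x. x \<in> ?S \<Longrightarrow> h (frag_of x) = (case x of (u, f) \<Rightarrow> f b \<odot>\<^bsub>U\<^esub> u)"
    by (rule comm_group.free_Abelian_group_universal) blast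
  have frags: "tensor_frags U (free_module A B) = carrier (free_Abelian_group ?S)"
    by (auto simp: tensor_frags_def)
  have hU: "h x \<in> carrier U" if "x \<in> tensor_frags U (free_module A B)" for x
    using h(1) that hom_in_carrier[of h "free_Abelian_group ?S" "add_monoid U" x] by (simp add: frags)
  have h_add: "h (x + y) = h x \<oplus>\<^bsub>U\<^esub> h y"
    if "x \<in> tensor_frags U (free_module A B)" "y \<in> tensor_frags U (free_module A B)" for x y
    using hom_mult[OF h(1), of x y] that by (simp add: frags del: carrier_free_Abelian_group_iff)
  have "h (x - y) = h x \<ominus>\<^bsub>U\<^esub> h y"
    if xy: "x \<in> tensor_frags U (free_module A B)" "y \<in> tensor_frags U (free_module A B)" for x y
  proof -
    have "h x = h (x - y) \<oplus>\<^bsub>U\<^esub> h y"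
      using h_add[of "x - y" y] xy by simp
    then show ?thesis
      using hU[OF xy(1)] hU[OF xy(2)] hU[of "x - y"] xy
      by (simp add: U.M.minus_eq U.M.a_assoc U.M.r_neg)
  qed
  then show ?thesis using h(2) hU unfolding is_coordinate_def by (intro exI[of _ h]) simp
qed

lemma ball_rel_sum:
  assumes "\<And>b. b \<in> S \<Longrightarrow> x b \<in> B.rel N"
  shows "sum x S \<in> B.rel N"
  using assms by (induction S rule: infinite_finite_induct) (auto intro: B.rel_add)

lemma pure_coordinates:
  assumes S: "finite S" and u: "u \<in> carrier (unit_ball U)" and f: "f \<in> carrier (free_module (unit_ball A) S)"
    and SB: "S \<subseteq> B"
  shows "frag_of (u, f) - (\<Sum>b\<in>S. frag_of (f b \<odot>\<^bsub>U\<^esub> u, basis_vector A b)) \<in> B.rel (free_module (unit_ball A) B)"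
proof -
  interpret F: left_module "unit_ball A" "free_module (unit_ball A) B" by (rule B.R.left_module_free_module)
  note FB = F.left_module_axioms
  have sub: "carrier (free_module (unit_ball A) S) \<subseteq> carrier (free_module (unit_ball A) B)"
    by (rule free_module_mono[OF SB])
  have bv: "basis_vector A b \<in> carrier (free_module (unit_ball A) B)" if "b \<in> S" for b
    using B.R.basis_vector_closed[of b B] that SB unfolding basis_vector_unit_ball by blast
  have zero_u: "\<zero>\<^bsub>A\<^esub> \<odot>\<^bsub>U\<^esub> u = \<zero>\<^bsub>U\<^esub>"
  proof -
    have uU: "u \<in> carrier U" using u by simp
    then show ?thesis
      using U.act_add_ring[of "\<zero>\<^bsub>A\<^esub>" "\<zero>\<^bsub>A\<^esub>" u] U.act_closed[of "\<zero>\<^bsub>A\<^esub>" u]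
      by (simp add: U.M.add.l_cancel_one')
  qed
  show ?thesis
    using f
  proof (induction rule: B.R.free_module_induct)
    case zero
    have "frag_of (u, \<lambda>_. \<zero>\<^bsub>A\<^esub>) \<in> B.rel (free_module (unit_ball A) B)"
      using B.rel_zero_right[OF FB u] by simp
    moreover have "(\<Sum>b\<in>S. frag_of (\<zero>\<^bsub>A\<^esub> \<odot>\<^bsub>U\<^esub> u, basis_vector A b)) \<in> B.rel (free_module (unit_ball A) B)"
      using B.rel_zero_left[OF FB bv] unfolding zero_u by (intro ball_rel_sum) simp
    ultimately show ?case
      using B.rel_diff[OF FB] by simp
  next
    case (add f a b)
    let ?F = "free_module (unit_ball A) B"
    let ?g = "f \<oplus>\<^bsub>free_module (unit_ball A) S\<^esub> (a \<odot>\<^bsub>free_module (unit_ball A) S\<^esub> basis_vector (unit_ball A) b)"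
    let ?e = "a \<odot>\<^bsub>?F\<^esub> basis_vector A b"
    have a: "a \<in> carrier A" "a \<in> carrier (unit_ball A)" using add by auto
    have fc: "f c \<in> carrier A" for c using add(1) by (auto simp: free_module_carrier)
    have g: "?g = f \<oplus>\<^bsub>?F\<^esub> ?e" by (simp add: basis_vector_unit_ball)
    have gc: "?g c = (if c = b then a else f c)" for c
      using add(4) fc a by (auto simp: basis_vector_def)
    have "(\<Sum>c\<in>S. frag_of (?g c \<odot>\<^bsub>U\<^esub> u, basis_vector A c)) - (\<Sum>c\<in>S. frag_of (f c \<odot>\<^bsub>U\<^esub> u, basis_vector A c))
        = (\<Sum>c\<in>S. if c = b then frag_of (a \<odot>\<^bsub>U\<^esub> u, basis_vector A b) - frag_of (\<zero>\<^bsub>U\<^esub>, basis_vector A b) else 0)"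
      unfolding sum_subtractf[symmetric] gc using add(4) by (intro sum.cong refl) (auto simp: zero_u)
    also have "\<dots> = frag_of (a \<odot>\<^bsub>U\<^esub> u, basis_vector A b) - frag_of (\<zero>\<^bsub>U\<^esub>, basis_vector A b)"
      using S add(3) by simp
    finally have eq: "(\<Sum>c\<in>S. frag_of (?g c \<odot>\<^bsub>U\<^esub> u, basis_vector A c)) =
        (\<Sum>c\<in>S. frag_of (f c \<odot>\<^bsub>U\<^esub> u, basis_vector A c)) +
        (frag_of (a \<odot>\<^bsub>U\<^esub> u, basis_vector A b) - frag_of (\<zero>\<^bsub>U\<^esub>, basis_vector A b))"
      by (simp add: algebra_simps)
    have fB: "f \<in> carrier ?F" using add(1) sub by blast
    have eB: "?e \<in> carrier ?F" using F.act_closed[OF a(2) bv[OF add(3)]] .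
    have r1: "frag_of (u, f \<oplus>\<^bsub>?F\<^esub> ?e) - frag_of (u, f) - frag_of (u, ?e) \<in> B.rel ?F"
      by (rule B.rel_add_right[OF u fB eB])
    have r2: "frag_of (a \<odot>\<^bsub>U\<^esub> u, basis_vector A b) - frag_of (u, ?e) \<in> B.rel ?F"
      using B.rel_act[OF a(2) u bv[OF add(3)]] by (simp del: free_module_simps)
    have r3: "frag_of (\<zero>\<^bsub>U\<^esub>, basis_vector A b) \<in> B.rel ?F"
      using B.rel_zero_left[OF FB bv[OF add(3)]] by simp
    from B.rel_add[OF B.rel_diff[OF FB B.rel_add[OF r1 add(5)] r2] r3]
    have "frag_of (u, ?g) - ((\<Sum>c\<in>S. frag_of (f c \<odot>\<^bsub>U\<^esub> u, basis_vector A c)) +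
        (frag_of (a \<odot>\<^bsub>U\<^esub> u, basis_vector A b) - frag_of (\<zero>\<^bsub>U\<^esub>, basis_vector A b))) \<in> B.rel ?F"
      unfolding g by (simp add: algebra_simps del: free_module_simps)
    then show ?case unfolding eq .
  qed
qed

text \<open>Over \<open>A\<close> as well as over its unit ball, the tensor product with a free module is a direct sum of
  copies of the right module, so an element is determined by its coordinates. The coordinates lie in
  the unit ball of \<open>U\<close>, and whether they vanish can be decided in \<open>U\<close>.\<close>

lemma rel_free_module_ball:
  assumes z: "z \<in> tensor_frags (unit_ball U) (free_module (unit_ball A) B)" and rel: "z \<in> rel (free_module A B)"
  shows "z \<in> B.rel (free_module (unit_ball A) B)"
proof -
  interpret F0: left_module "unit_ball A" "free_module (unit_ball A) B" by (rule B.R.left_module_free_module)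
  note F0 = F0.left_module_axioms
  interpret F: left_module A "free_module A B" by (rule A.A.left_module_free_module)
  let ?FB = "free_module (unit_ball A) B" and ?F = "free_module A B"
  obtain h where h: "\<And>b x. x \<in> tensor_frags U ?F \<Longrightarrow> h b x \<in> carrier U"
    "\<And>b x y. \<lbrakk>x \<in> tensor_frags U ?F; y \<in> tensor_frags U ?F\<rbrakk> \<Longrightarrow> h b (x - y) = h b x \<ominus>\<^bsub>U\<^esub> h b y"
    "\<And>b u f. \<lbrakk>u \<in> carrier U; f \<in> carrier ?F\<rbrakk> \<Longrightarrow> h b (frag_of (u, f)) = f b \<odot>\<^bsub>U\<^esub> u"
  proof -
    obtain h where "\<forall>b. is_coordinate B b (h b)"
      using choice[of "is_coordinate B"] ex_coordinate[of B] by blast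
    then show thesis unfolding is_coordinate_def by (intro that[of h]) simp_all
  qed
  have h0: "h b 0 = \<zero>\<^bsub>U\<^esub>" for b
    using h(2)[of 0 0 b] h(1)[of 0 b] by (simp add: U.M.minus_eq U.M.r_neg)
  have kills: "h b x = \<zero>\<^bsub>U\<^esub>" if "x \<in> rel ?F" for x b
    using F.left_module_axioms that
  proof (induction rule: rel_induct)
    case (diff x y)
    then show ?case
      using rel_frags[OF F.left_module_axioms] by (simp add: h(2) U.M.minus_eq U.M.r_neg)
  next
    case (add_left u u' f)
    then show ?case
      by (subst h(2) h(3), simp_all)+ (auto simp: h(2,3) free_module_carrier U.act_add U.M.minus_eq U.M.minus_add U.M.a_ac U.M.r_neg U.act_closed)
  next
    case (add_right u f f')
    then have c: "f b \<in> carrier A" "f' b \<in> carrier A" by (auto simp: free_module_carrier)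
    have ff: "f \<oplus>\<^bsub>?F\<^esub> f' \<in> carrier ?F" by (rule F.M.a_closed[OF add_right(2,3)])
    let ?x = "f b \<odot>\<^bsub>U\<^esub> u" and ?y = "f' b \<odot>\<^bsub>U\<^esub> u"
    have "h b (frag_of (u, f \<oplus>\<^bsub>?F\<^esub> f') - frag_of (u, f) - frag_of (u, f')) = (?x \<oplus>\<^bsub>U\<^esub> ?y) \<ominus>\<^bsub>U\<^esub> ?x \<ominus>\<^bsub>U\<^esub> ?y"
      using add_right ff c h(3)[OF add_right(1) ff, of b]
      by (simp add: h(2,3) U.act_add_ring del: free_module_simps) (simp add: U.act_add_ring)
    also have "\<dots> = \<zero>\<^bsub>U\<^esub>"
      using c add_right(1) by (simp add: U.act_closed U.M.minus_eq U.M.minus_add U.M.a_ac U.M.r_neg)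
    finally show ?case .
  next
    case (act a u f)
    then have c: "f b \<in> carrier A" by (auto simp: free_module_carrier)
    have "a \<odot>\<^bsub>?F\<^esub> f \<in> carrier ?F" by (rule F.act_closed[OF act(1,3)])
    then show ?case
      using act c by (simp add: h(2,3) U.act_mult U.act_closed U.M.minus_eq U.M.r_neg)
  qed (simp add: h0)
  define S where "S = (\<Union>(u, f)\<in>Poly_Mapping.keys z. {b. f b \<noteq> \<zero>\<^bsub>A\<^esub>})"
  have fin: "finite S"
    using z unfolding S_def tensor_frags_def by (intro finite_UN_I) (auto simp: free_module_carrier)
  have SB: "S \<subseteq> B"
    using z unfolding S_def tensor_frags_def by (fastforce simp: free_module_carrier)
  have keys: "Poly_Mapping.keys z \<subseteq> carrier (unit_ball U) \<times> carrier (free_module (unit_ball A) S)"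
  proof
    fix un assume un: "un \<in> Poly_Mapping.keys z"
    obtain u f where uf: "un = (u, f)" by force
    have "u \<in> carrier (unit_ball U)" "f \<in> carrier ?FB"
      using z un uf by (auto simp: tensor_frags_def)
    moreover have "f b = \<zero>\<^bsub>A\<^esub>" if "b \<notin> S" for b
      using that un uf by (auto simp: S_def)
    ultimately show "un \<in> carrier (unit_ball U) \<times> carrier (free_module (unit_ball A) S)"
      by (simp add: uf free_module_carrier)
  qed
  have sub: "carrier (free_module (unit_ball A) S) \<subseteq> carrier ?F"
    using free_module_mono[OF SB, of A] by (auto simp: free_module_unit_ball)
  have bv: "basis_vector A b \<in> carrier ?FB" if "b \<in> S" for b
    using B.R.basis_vector_closed[of b B] that SB unfolding basis_vector_unit_ball by blast
  \<comment> \<open>The coordinates reconstruct \<open>z\<close> over the unit balls.\<close>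
  have "z \<in> tensor_frags U ?F \<and> (\<forall>b\<in>S. h b z \<in> carrier (unit_ball U)) \<and>
      z - (\<Sum>b\<in>S. frag_of (h b z, basis_vector A b)) \<in> B.rel ?FB"
    using keys
  proof (induction z rule: frag_induction)
    case zero
    have "(\<Sum>b\<in>S. frag_of (\<zero>\<^bsub>U\<^esub>, basis_vector A b)) \<in> B.rel ?FB"
      using B.rel_zero_left[OF F0 bv] by (intro ball_rel_sum) simp
    then show ?case
      using B.rel_minus[OF F0] nrm_U_eq_0_iff[of "\<zero>\<^bsub>U\<^esub>"] by (simp add: h0)
  next
    case (one un)
    then obtain u f where uf: "un = (u, f)" "u \<in> carrier (unit_ball U)" "f \<in> carrier (free_module (unit_ball A) S)"
      by blast
    have fF: "f \<in> carrier ?F" using sub uf(3) by blast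
    have uU: "u \<in> carrier U" using uf(2) by simp
    have "f b \<in> carrier (unit_ball A)" for b using uf(3) unfolding free_module_carrier by blast
    then have "f b \<odot>\<^bsub>U\<^esub> u \<in> carrier (unit_ball U)" for b
      using B.act_closed[OF _ uf(2)] by simp
    then show ?case
      using pure_coordinates[OF fin uf(2,3) SB] fF uU by (simp add: uf(1) h(3))
  next
    case (diff x y)
    then have x: "x \<in> tensor_frags U ?F" "\<And>b. b \<in> S \<Longrightarrow> h b x \<in> carrier (unit_ball U)"
        "x - (\<Sum>b\<in>S. frag_of (h b x, basis_vector A b)) \<in> B.rel ?FB"
      and y: "y \<in> tensor_frags U ?F" "\<And>b. b \<in> S \<Longrightarrow> h b y \<in> carrier (unit_ball U)"
        "y - (\<Sum>b\<in>S. frag_of (h b y, basis_vector A b)) \<in> B.rel ?FB" by blast+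
    have hd: "h b (x - y) = h b x \<ominus>\<^bsub>U\<^esub> h b y" for b using h(2)[OF x(1) y(1)] .
    have hc: "h b (x - y) \<in> carrier (unit_ball U)" if "b \<in> S" for b
      using x(2)[OF that] y(2)[OF that] nrm_U_add[of "h b x" "\<ominus>\<^bsub>U\<^esub> h b y"] nrm_U_uminus[of "h b y"]
      by (auto simp: hd U.M.minus_eq)
    have "(\<Sum>b\<in>S. frag_of (h b x, basis_vector A b) - frag_of (h b (x - y), basis_vector A b)
        - frag_of (h b y, basis_vector A b)) \<in> B.rel ?FB"
    proof (rule ball_rel_sum)
      fix b assume b: "b \<in> S"
      have "h b (x - y) \<oplus>\<^bsub>U\<^esub> h b y = h b x"
        using x(2)[OF b] y(2)[OF b] by (simp add: hd U.M.minus_eq U.M.a_assoc U.M.l_neg)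
      then show "frag_of (h b x, basis_vector A b) - frag_of (h b (x - y), basis_vector A b)
        - frag_of (h b y, basis_vector A b) \<in> B.rel ?FB"
        using B.rel_add_left[OF hc[OF b] y(2)[OF b] bv[OF b]] by simp
    qed
    from B.rel_add[OF B.rel_diff[OF F0 x(3) y(3)] this]
    have "(x - y) - (\<Sum>b\<in>S. frag_of (h b (x - y), basis_vector A b)) \<in> B.rel ?FB"
      by (simp add: sum_subtractf sum.distrib algebra_simps)
    then show ?case using x(1) y(1) hc by simp
  qed
  then have "z - (\<Sum>b\<in>S. frag_of (\<zero>\<^bsub>U\<^esub>, basis_vector A b)) \<in> B.rel ?FB"
    by (simp add: kills[OF rel])
  moreover have "(\<Sum>b\<in>S. frag_of (\<zero>\<^bsub>U\<^esub>, basis_vector A b)) \<in> B.rel ?FB"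
    using B.rel_zero_left[OF F0 bv] by (intro ball_rel_sum) simp
  ultimately show ?thesis
    using B.rel_cong[OF F0] by blast
qed

end

(* Membership in the bases is governed by basis_Suc_iff instead. *)
declare resolution_basis.simps(2) [simp del]

text \<open>The canonical resolution of the unit ball of \<open>M\<close>, given by the free modules \<open>F0 s\<close>, and the
  resolution of \<open>M\<close> by the free modules \<open>F s\<close> on the same bases that it becomes when \<open>\<pi>\<close> is inverted.\<close>

locale normed_resolution = dvf_right_module K av \<pi> p A U
  for K :: "('k, 'x) ring_scheme" and av :: "'k \<Rightarrow> real" and \<pi> :: 'k and p :: nat
    and A :: "('k, 'a, 'y) normed_module_scheme" and U :: "('a, 'u, 'z) normed_module_scheme" +
  fixes M :: "('a, 'c, 'w) normed_module_scheme"
  assumes normed_M: "normed_left_module K av A M"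
begin

lemma M: "normed_left M (nrm M)"
  by (rule normed_left_normed_left_module[OF normed_M])

lemma left_M: "left_module A M"
  by (rule normed_leftD(1)[OF M])

lemma nrm_M_pos: "x \<in> carrier M \<Longrightarrow> x \<noteq> \<zero>\<^bsub>M\<^esub> \<Longrightarrow> 0 < \<parallel>x\<parallel>\<^bsub>M\<^esub>"
proof -
  interpret V: normed_space K av "restrict_scalars A M"
    using normed_M by (simp add: normed_left_module_def)
  assume "x \<in> carrier M" "x \<noteq> \<zero>\<^bsub>M\<^esub>"
  then show ?thesis
    using V.nrm_eq_0_iff[of x] V.nrm_nonneg[of x] by (simp add: restrict_scalars_def)
qed

abbreviation basis :: "nat \<Rightarrow> ('a, 'c) syzygy set"
  where "basis \<equiv> resolution_basis (unit_ball A) (unit_ball M)"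

abbreviation F :: "nat \<Rightarrow> ('a, ('a, 'c) syzygy \<Rightarrow> 'a) module"
  where "F s \<equiv> free_module A (basis s)"

abbreviation F0 :: "nat \<Rightarrow> ('a, ('a, 'c) syzygy \<Rightarrow> 'a) module"
  where "F0 s \<equiv> free_module (unit_ball A) (basis s)"

abbreviation \<delta> :: "(('a, 'c) syzygy \<Rightarrow> 'a) \<Rightarrow> (('a, 'c) syzygy \<Rightarrow> 'a)"
  where "\<delta> \<equiv> resolution_diff A"

abbreviation \<epsilon> :: "(('a, 'c) syzygy \<Rightarrow> 'a) \<Rightarrow> 'c"
  where "\<epsilon> \<equiv> resolution_aug A M"

definition diff_value :: "('a, 'c) syzygy \<Rightarrow> (('a, 'c) syzygy \<Rightarrow> 'a)"
  where "diff_value b = (case b of Gen _ \<Rightarrow> (\<lambda>_. \<zero>\<^bsub>A\<^esub>) | Rel w \<Rightarrow> combination A w)"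

definition aug_value :: "('a, 'c) syzygy \<Rightarrow> 'c"
  where "aug_value b = (case b of Gen m \<Rightarrow> m | Rel _ \<Rightarrow> \<zero>\<^bsub>M\<^esub>)"

lemma resolution_eq: "resolution (unit_ball A) (unit_ball M) s = F0 s"
  by (simp add: resolution_def)

lemma left_F0: "left_module (unit_ball A) (free_module (unit_ball A) B)"
  by (rule B.R.left_module_free_module)

lemma left_F: "left_module A (free_module A B)"
  by (rule A.A.left_module_free_module)

lemma F0_F: "carrier (free_module (unit_ball A) B) \<subseteq> carrier (free_module A B)"
  by (auto simp: free_module_carrier)

lemma aug_value_closed: "b \<in> basis s \<Longrightarrow> aug_value b \<in> carrier (unit_ball M)"
proof -
  have "\<zero>\<^bsub>M\<^esub> \<in> carrier (unit_ball M)"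
    using normed_leftD(2)[OF M] abelian_group.axioms[OF left_module.axioms(2)[OF left_M]]
      abelian_monoid.zero_closed by fastforce
  then show "b \<in> basis s \<Longrightarrow> aug_value b \<in> carrier (unit_ball M)"
    by (cases s) (auto simp: aug_value_def resolution_basis.simps(2))
qed

lemma diff_value_closed: "b \<in> basis (Suc s) \<Longrightarrow> diff_value b \<in> carrier (F0 s)"
  using B.R.combination_closed[of _ "basis s"] by (auto simp: diff_value_def combination_unit_ball resolution_basis.simps(2))

lemma diff_value_closed_UNIV: "b \<in> basis s \<Longrightarrow> diff_value b \<in> carrier (free_module (unit_ball A) UNIV)"
proof (cases s)
  case 0
  then show "b \<in> basis s \<Longrightarrow> diff_value b \<in> carrier (free_module (unit_ball A) UNIV)"
    using normed_leftD(2)[OF normed_left_free_module] by (auto simp: diff_value_def free_module_carrier)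
next
  case (Suc t)
  then show "b \<in> basis s \<Longrightarrow> diff_value b \<in> carrier (free_module (unit_ball A) UNIV)"
    using diff_value_closed[of b t] free_module_mono[OF subset_UNIV, of "unit_ball A" "basis t"] by blast
qed

lemma diff_def: "\<delta> = linear_extension A (free_module A UNIV) diff_value"
  by (simp add: resolution_diff_def diff_value_def[abs_def])

lemma aug_def: "\<epsilon> = linear_extension A M aug_value"
  by (simp add: resolution_aug_def aug_value_def[abs_def])

lemma diff_hom_UNIV: "\<delta> \<in> left_hom A (F s) (free_module A UNIV)"
  unfolding diff_def
  by (rule A.A.linear_extension_hom[OF left_F]) (use diff_value_closed_UNIV F0_F in blast)

lemma diff_basis_vector: "b \<in> basis s \<Longrightarrow> \<delta> (basis_vector A b) = diff_value b"
  unfolding diff_def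
  by (rule A.A.linear_extension_basis_vector[OF left_F]) (use diff_value_closed_UNIV F0_F in blast)

lemma aug_hom: "\<epsilon> \<in> left_hom A (F s) M"
  unfolding aug_def
  by (rule A.A.linear_extension_hom[OF left_M]) (use aug_value_closed in auto)

lemma aug_basis_vector: "b \<in> basis s \<Longrightarrow> \<epsilon> (basis_vector A b) = aug_value b"
  unfolding aug_def
  by (rule A.A.linear_extension_basis_vector[OF left_M]) (use aug_value_closed in auto)

lemma diff_closed:
  assumes "f \<in> carrier (F (Suc s))"
  shows "\<delta> f \<in> carrier (F s)"
proof (rule A.A.left_hom_free_module_in[OF left_F diff_hom_UNIV _ _ _ _ assms])
  interpret F: left_module A "F s" by (rule left_F)
  show "\<zero>\<^bsub>free_module A UNIV\<^esub> \<in> carrier (F s)" using F.M.zero_closed by simp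
  show "x \<oplus>\<^bsub>free_module A UNIV\<^esub> y \<in> carrier (F s)" if "x \<in> carrier (F s)" "y \<in> carrier (F s)" for x y
    using F.M.a_closed[OF that] by simp
  show "a \<odot>\<^bsub>free_module A UNIV\<^esub> x \<in> carrier (F s)" if "a \<in> carrier A" "x \<in> carrier (F s)" for a x
    using F.act_closed[OF that] by simp
  show "\<delta> (basis_vector A b) \<in> carrier (F s)" if "b \<in> basis (Suc s)" for b
    using diff_basis_vector[OF that] diff_value_closed[OF that] F0_F by auto
qed

lemma diff_hom: "\<delta> \<in> left_hom A (F (Suc s)) (F s)"
  using diff_hom_UNIV[of "Suc s"] diff_closed by (auto simp: left_hom_def)

lemma diff_le:
  assumes "f \<in> carrier (F (Suc s))"
  shows "sup_norm (\<delta> f) \<le> sup_norm f"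
proof -
  have "sup_norm (\<delta> (basis_vector A b)) \<le> 1" if "b \<in> basis (Suc s)" for b
    using diff_basis_vector[OF that] diff_value_closed[OF that]
    by (auto simp: free_module_unit_ball)
  then have "sup_norm (\<delta> f) \<le> 1 * sup_norm f"
    by (intro bounded_on_free_module[OF normed_left_free_module diff_hom zero_le_one _ assms])
  then show ?thesis by simp
qed

lemma aug_le:
  assumes "f \<in> carrier (F s)"
  shows "\<parallel>\<epsilon> f\<parallel>\<^bsub>M\<^esub> \<le> sup_norm f"
proof -
  have "\<parallel>\<epsilon> (basis_vector A b)\<parallel>\<^bsub>M\<^esub> \<le> 1" if "b \<in> basis s" for b
    using aug_basis_vector[OF that] aug_value_closed[OF that] by auto
  then have "\<parallel>\<epsilon> f\<parallel>\<^bsub>M\<^esub> \<le> 1 * sup_norm f"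
    by (intro bounded_on_free_module[OF M aug_hom zero_le_one _ assms])
  then show ?thesis by simp
qed

lemma diff_hom_ball: "\<delta> \<in> left_hom (unit_ball A) (F0 (Suc s)) (F0 s)"
  unfolding free_module_unit_ball by (rule hom_restrict_unit_ball[OF diff_hom]) (use diff_le in force)

lemma diff_unit_ball:
  assumes f: "f \<in> carrier (F0 s)"
  shows "resolution_diff (unit_ball A) f = \<delta> f"
proof -
  have dv: "(\<lambda>b. case b of Gen _ \<Rightarrow> (\<lambda>_. \<zero>\<^bsub>unit_ball A\<^esub>) | Rel w \<Rightarrow> combination (unit_ball A) w) = diff_value"
    by (auto simp: diff_value_def combination_unit_ball fun_eq_iff split: syzygy.splits)
  have 1: "resolution_diff (unit_ball A) = linear_extension (unit_ball A) (free_module (unit_ball A) UNIV) diff_value"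
    by (simp add: resolution_diff_def dv)
  have "resolution_diff (unit_ball A) \<in> left_hom (unit_ball A) (F0 s) (free_module (unit_ball A) UNIV)"
    unfolding 1 by (rule B.R.linear_extension_hom[OF left_F0]) (rule diff_value_closed_UNIV)
  then have h1: "resolution_diff (unit_ball A) \<in> left_hom (unit_ball A) (F0 s) (free_module A UNIV)"
    using F0_F[of UNIV] by (auto simp: left_hom_def)
  have h2: "\<delta> \<in> left_hom (unit_ball A) (F0 s) (free_module A UNIV)"
    using diff_hom_UNIV[of s] F0_F[of "basis s"] by (auto simp: left_hom_def subset_iff)
  show ?thesis
  proof (rule B.R.left_hom_free_module_eq[OF left_module_over_unit_ball[OF left_F] h1 h2 _ f])
    fix b assume b: "b \<in> basis s"
    have "resolution_diff (unit_ball A) (basis_vector (unit_ball A) b) = diff_value b"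
      unfolding 1 by (rule B.R.linear_extension_basis_vector[where g = diff_value and b = b,
            OF left_F0 diff_value_closed_UNIV[OF b]])
    then show "resolution_diff (unit_ball A) (basis_vector (unit_ball A) b) = \<delta> (basis_vector (unit_ball A) b)"
      using diff_basis_vector[OF b] by (simp add: basis_vector_unit_ball)
  qed
qed

lemma left_M0: "left_module (unit_ball A) (unit_ball M)"
  using left_module_closed_ball[OF M] by (simp add: closed_ball_unit_ball)

lemma aug_unit_ball:
  assumes f: "f \<in> carrier (F0 s)"
  shows "resolution_aug (unit_ball A) (unit_ball M) f = \<epsilon> f"
proof -
  have dv: "(\<lambda>b. case b of Gen m \<Rightarrow> m | Rel _ \<Rightarrow> \<zero>\<^bsub>unit_ball M\<^esub>) = aug_value"
    by (auto simp: aug_value_def fun_eq_iff split: syzygy.splits)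
  have 1: "resolution_aug (unit_ball A) (unit_ball M) = linear_extension (unit_ball A) (unit_ball M) aug_value"
    by (simp add: resolution_aug_def dv)
  have "resolution_aug (unit_ball A) (unit_ball M) \<in> left_hom (unit_ball A) (F0 s) (unit_ball M)"
    unfolding 1 by (rule B.R.linear_extension_hom[OF left_M0]) (rule aug_value_closed)
  then have h1: "resolution_aug (unit_ball A) (unit_ball M) \<in> left_hom (unit_ball A) (F0 s) M"
    by (auto simp: left_hom_def)
  have h2: "\<epsilon> \<in> left_hom (unit_ball A) (F0 s) M"
    using aug_hom[of s] F0_F[of "basis s"] by (auto simp: left_hom_def subset_iff)
  show ?thesis
  proof (rule B.R.left_hom_free_module_eq[OF left_module_over_unit_ball[OF left_M] h1 h2 _ f])
    fix b assume b: "b \<in> basis s"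
    have "resolution_aug (unit_ball A) (unit_ball M) (basis_vector (unit_ball A) b) = aug_value b"
      unfolding 1 by (rule B.R.linear_extension_basis_vector[where g = aug_value and b = b,
            OF left_M0 aug_value_closed[OF b]])
    then show "resolution_aug (unit_ball A) (unit_ball M) (basis_vector (unit_ball A) b) = \<epsilon> (basis_vector (unit_ball A) b)"
      using aug_basis_vector[OF b] by (simp add: basis_vector_unit_ball)
  qed
qed

definition cycle :: "nat \<Rightarrow> (('a, 'c) syzygy \<Rightarrow> 'a) \<Rightarrow> bool"
  where "cycle s f \<longleftrightarrow> (if s = 0 then \<epsilon> f = \<zero>\<^bsub>M\<^esub> else \<delta> f = (\<lambda>_. \<zero>\<^bsub>A\<^esub>))"

lemma basis_Suc_iff:
  "b \<in> basis (Suc s) \<longleftrightarrow> (\<exists>w. b = Rel w \<and> set w \<subseteq> carrier (unit_ball A) \<times> basis s \<and> cycle s (combination A w))"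
proof -
  have "(if s = 0 then resolution_aug (unit_ball A) (unit_ball M) (combination (unit_ball A) w) = \<zero>\<^bsub>unit_ball M\<^esub>
      else resolution_diff (unit_ball A) (combination (unit_ball A) w) = (\<lambda>_. \<zero>\<^bsub>unit_ball A\<^esub>))
      \<longleftrightarrow> cycle s (combination A w)"
    if "set w \<subseteq> carrier (unit_ball A) \<times> basis s" for w
    using diff_unit_ball[of "combination A w" s] aug_unit_ball[of "combination A w" s] B.R.combination_closed[OF that]
    by (simp add: combination_unit_ball cycle_def)
  then show ?thesis
    unfolding resolution_basis.simps(2) mem_Collect_eq by blast
qed

lemma cycle_hom:
  assumes "b \<in> basis (Suc s)"
  shows "cycle s (\<delta> (basis_vector A b))"
proof -
  obtain w where "b = Rel w" "cycle s (combination A w)"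
    using assms unfolding basis_Suc_iff by blast
  then show ?thesis
    unfolding diff_basis_vector[OF assms] by (simp add: diff_value_def)
qed

lemma diff_diff:
  assumes "f \<in> carrier (F (Suc (Suc s)))"
  shows "\<delta> (\<delta> f) = (\<lambda>_. \<zero>\<^bsub>A\<^esub>)"
proof -
  interpret F: left_module A "F s" by (rule left_F)
  have z: "(\<lambda>_ _. \<zero>\<^bsub>A\<^esub>) \<in> left_hom A (F (Suc (Suc s))) (F s)"
    using F.M.zero_closed by (auto simp: left_hom_def)
  show ?thesis
    by (rule A.A.left_hom_free_module_eq[OF left_F left_hom_comp[OF diff_hom diff_hom] z _ assms])
      (use cycle_hom[of _ "Suc s"] in \<open>auto simp: cycle_def\<close>)
qed

lemma aug_diff:
  assumes "f \<in> carrier (F (Suc 0))"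
  shows "\<epsilon> (\<delta> f) = \<zero>\<^bsub>M\<^esub>"
proof -
  interpret M: left_module A M by (rule left_M)
  have z: "(\<lambda>_. \<zero>\<^bsub>M\<^esub>) \<in> left_hom A (F (Suc 0)) M"
    by (auto simp: left_hom_def)
  show ?thesis
    by (rule A.A.left_hom_free_module_eq[OF left_M left_hom_comp[OF diff_hom aug_hom] z _ assms])
      (use cycle_hom[of _ 0] in \<open>auto simp: cycle_def\<close>)
qed

text \<open>The next basis contains a symbol for every formal expression whose value is a cycle.\<close>

lemma integral_preimage:
  assumes f: "f \<in> carrier (F0 s)" and c: "cycle s f"
  shows "\<exists>b\<in>basis (Suc s). \<delta> (basis_vector A b) = f"
proof -
  obtain w where w: "set w \<subseteq> carrier (unit_ball A) \<times> basis s" "combination A w = f"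
    using B.R.ex_combination[OF f] by (auto simp: combination_unit_ball)
  then have b: "Rel w \<in> basis (Suc s)"
    using c basis_Suc_iff by blast
  then show ?thesis
    using diff_basis_vector[OF b] w by (intro bexI[of _ "Rel w"]) (auto simp: diff_value_def)
qed

lemma sup_norm_pos:
  assumes "f \<in> carrier (free_module A B)" "f \<noteq> (\<lambda>_. \<zero>\<^bsub>A\<^esub>)"
  shows "0 < sup_norm f"
proof -
  obtain b where b: "f b \<noteq> \<zero>\<^bsub>A\<^esub>" using assms(2) by auto
  have "f b \<in> carrier A" using assms(1) by (auto simp: free_module_carrier)
  then have "0 < \<parallel>f b\<parallel>\<^bsub>A\<^esub>" using A.nrm_eq_0_iff[of "f b"] A.nrm_nonneg[of "f b"] b by simp
  then show ?thesis using nrm_le_sup_norm[OF assms(1), of b] by simp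
qed

lemma cycle_act:
  assumes f: "f \<in> carrier (F s)" and c: "cycle s f" and a: "a \<in> carrier A"
  shows "cycle s (a \<odot>\<^bsub>F s\<^esub> f)"
proof (cases s)
  case 0
  interpret M: left_module A M by (rule left_M)
  show ?thesis
    using left_hom_act[OF aug_hom a f] c a 0 by (simp add: cycle_def)
next
  case (Suc t)
  have "f \<in> carrier (F (Suc t))" using f Suc by simp
  then show ?thesis
    using left_hom_act[OF diff_hom a, of f t] c a Suc by (simp add: cycle_def)
qed

text \<open>A cycle is scaled into the unit ball, where it is the boundary of a basis vector.\<close>

lemma preimage:
  assumes f: "f \<in> carrier (F s)" and c: "cycle s f"
  shows "\<exists>g\<in>carrier (F (Suc s)). \<delta> g = f \<and> sup_norm g \<le> 1 / q * sup_norm f"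
proof (cases "f = (\<lambda>_. \<zero>\<^bsub>A\<^esub>)")
  case True
  interpret F: left_module A "F (Suc s)" by (rule left_F)
  interpret F': left_module A "F s" by (rule left_F)
  have "\<delta> (\<lambda>_. \<zero>\<^bsub>A\<^esub>) = (\<lambda>_. \<zero>\<^bsub>A\<^esub>)"
    using left_hom_zero[OF diff_hom[of s] F.M.abelian_group_axioms F'.M.abelian_group_axioms] by simp
  then show ?thesis
    using True F.M.zero_closed normed_leftD(2)[OF normed_left_free_module, of "basis s"]
    by (intro bexI[of _ "\<lambda>_. \<zero>\<^bsub>A\<^esub>"]) auto
next
  case False
  interpret F: left_module A "F (Suc s)" by (rule left_F)
  interpret F': left_module A "F s" by (rule left_F)
  have pos: "0 < sup_norm f" by (rule sup_norm_pos[OF f False])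
  obtain k where k: "k \<in> carrier K" "k \<noteq> \<zero>\<^bsub>K\<^esub>" "av k * sup_norm f \<le> 1" "q < av k * sup_norm f"
    using ex_scaling[OF pos] by auto
  note inv = inv_closed[OF k(1,2)]
  let ?f = "sc k \<odot>\<^bsub>F s\<^esub> f"
  have skA: "sc k \<in> carrier A" and siA: "sc (inv\<^bsub>K\<^esub> k) \<in> carrier A" using k inv by auto
  have "?f \<in> carrier (F s)" by (rule F'.act_closed[OF skA f])
  moreover have "sup_norm ?f \<le> 1"
    using norm_sc[OF normed_left_free_module k(1) f] k(3) by simp
  ultimately have "?f \<in> carrier (F0 s)"
    unfolding free_module_unit_ball by simp
  then obtain b where b: "b \<in> basis (Suc s)" "\<delta> (basis_vector A b) = ?f"
    using integral_preimage cycle_act[OF f c skA] by blast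
  have bv: "basis_vector A b \<in> carrier (F (Suc s))" by (rule A.A.basis_vector_closed[OF b(1)])
  let ?g = "sc (inv\<^bsub>K\<^esub> k) \<odot>\<^bsub>F (Suc s)\<^esub> basis_vector A b"
  have g: "?g \<in> carrier (F (Suc s))" by (rule F.act_closed[OF siA bv])
  have "\<delta> ?g = sc (inv\<^bsub>K\<^esub> k) \<odot>\<^bsub>F s\<^esub> ?f"
    using left_hom_act[OF diff_hom siA bv] b(2) by simp
  also have "\<dots> = sc (inv\<^bsub>K\<^esub> k \<otimes>\<^bsub>K\<^esub> k) \<odot>\<^bsub>F s\<^esub> f"
    by (rule sc_act_act[OF normed_left_free_module inv(1) k(1) f])
  also have "\<dots> = f" using F'.act_one[OF f] inv(4) by simp
  finally have "\<delta> ?g = f" .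
  moreover have "sup_norm ?g \<le> 1 / q * sup_norm f"
  proof -
    have "sup_norm ?g = 1 / av k * sup_norm (basis_vector A b)"
      using norm_sc[OF normed_left_free_module inv(1) bv] inv(5) by simp
    also have "\<dots> \<le> 1 / av k * 1"
      using sup_norm_basis_vector[OF b(1)] av_pos[OF k(1,2)] by (intro mult_left_mono) auto
    also have "\<dots> \<le> 1 / q * sup_norm f"
      using k(4) q av_pos[OF k(1,2)] by (simp add: field_simps)
    finally show ?thesis .
  qed
  ultimately show ?thesis using g by blast
qed

lemma aug_preimage:
  assumes m: "m \<in> carrier M"
  shows "\<exists>f\<in>carrier (F 0). \<epsilon> f = m \<and> sup_norm f \<le> 1 / q * \<parallel>m\<parallel>\<^bsub>M\<^esub>"
proof (cases "m = \<zero>\<^bsub>M\<^esub>")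
  case True
  interpret F: left_module A "F 0" by (rule left_F)
  interpret M: left_module A M by (rule left_M)
  have "\<epsilon> (\<lambda>_. \<zero>\<^bsub>A\<^esub>) = \<zero>\<^bsub>M\<^esub>"
    using left_hom_zero[OF aug_hom[of 0] F.M.abelian_group_axioms M.M.abelian_group_axioms] by simp
  then show ?thesis
    using True F.M.zero_closed normed_leftD(2)[OF normed_left_free_module, of "basis 0"] normed_leftD(2)[OF M]
    by (intro bexI[of _ "\<lambda>_. \<zero>\<^bsub>A\<^esub>"]) auto
next
  case False
  interpret F: left_module A "F 0" by (rule left_F)
  interpret M: left_module A M by (rule left_M)
  have pos: "0 < \<parallel>m\<parallel>\<^bsub>M\<^esub>" by (rule nrm_M_pos[OF m False])
  obtain k where k: "k \<in> carrier K" "k \<noteq> \<zero>\<^bsub>K\<^esub>" "av k * \<parallel>m\<parallel>\<^bsub>M\<^esub> \<le> 1" "q < av k * \<parallel>m\<parallel>\<^bsub>M\<^esub>"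
    using ex_scaling[OF pos] by auto
  note inv = inv_closed[OF k(1,2)]
  have siA: "sc (inv\<^bsub>K\<^esub> k) \<in> carrier A" using inv by auto
  let ?b = "Gen (sc k \<odot>\<^bsub>M\<^esub> m) :: ('a, 'c) syzygy"
  have b: "?b \<in> basis 0"
    using m k(1,3) norm_sc[OF M k(1) m] M.act_closed[of "sc k" m] by simp
  have bv: "basis_vector A ?b \<in> carrier (F 0)" by (rule A.A.basis_vector_closed[OF b])
  let ?g = "sc (inv\<^bsub>K\<^esub> k) \<odot>\<^bsub>F 0\<^esub> basis_vector A ?b"
  have g: "?g \<in> carrier (F 0)" by (rule F.act_closed[OF siA bv])
  have "\<epsilon> ?g = sc (inv\<^bsub>K\<^esub> k) \<odot>\<^bsub>M\<^esub> (sc k \<odot>\<^bsub>M\<^esub> m)"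
    using left_hom_act[OF aug_hom siA bv] aug_basis_vector[OF b] by (simp add: aug_value_def)
  also have "\<dots> = sc (inv\<^bsub>K\<^esub> k \<otimes>\<^bsub>K\<^esub> k) \<odot>\<^bsub>M\<^esub> m"
    by (rule sc_act_act[OF M inv(1) k(1) m])
  also have "\<dots> = m" using M.act_one[OF m] inv(4) by simp
  finally have "\<epsilon> ?g = m" .
  moreover have "sup_norm ?g \<le> 1 / q * \<parallel>m\<parallel>\<^bsub>M\<^esub>"
  proof -
    have "sup_norm ?g = 1 / av k * sup_norm (basis_vector A ?b)"
      using norm_sc[OF normed_left_free_module inv(1) bv] inv(5) by simp
    also have "\<dots> \<le> 1 / av k * 1"
      using sup_norm_basis_vector[OF b] av_pos[OF k(1,2)] by (intro mult_left_mono) auto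
    also have "\<dots> \<le> 1 / q * \<parallel>m\<parallel>\<^bsub>M\<^esub>"
      using k(4) q av_pos[OF k(1,2)] by (simp add: field_simps)
    finally show ?thesis .
  qed
  ultimately show ?thesis using g by blast
qed

end

section \<open>Strict exactness of the tensored resolution\<close>

context normed_resolution
begin

definition tensor_cycle :: "nat \<Rightarrow> (('u \<times> (('a, 'c) syzygy \<Rightarrow> 'a)) \<Rightarrow>\<^sub>0 int) \<Rightarrow> bool"
  where "tensor_cycle s x \<longleftrightarrow>
    (if s = 0 then frag_map \<epsilon> x \<in> rel M else frag_map \<delta> x \<in> rel (F (s - 1)))"

abbreviation cycle_module :: "nat \<Rightarrow> ('a, ('a, 'c) syzygy \<Rightarrow> 'a) module"
  where "cycle_module s \<equiv> (F s)\<lparr>carrier := {f \<in> carrier (F s). cycle s f}\<rparr>"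

text \<open>An injection of the free modules into \<open>syzygy\<close>, the universe type of the flatness predicate.\<close>

definition code :: "(('a, 'c) syzygy \<Rightarrow> 'a) \<Rightarrow> ('a, 'c) syzygy"
  where "code f = Rel (SOME w. combination A w = f)"

lemma code_inj: "inj_on code (carrier (free_module A B))"
proof (rule inj_onI)
  have ex: "combination A (SOME w. combination A w = f) = f" if "f \<in> carrier (free_module A B)" for f
    using A.A.ex_combination[OF that] by (intro someI_ex[of "\<lambda>w. combination A w = f"]) blast
  fix f g assume f: "f \<in> carrier (free_module A B)" and g: "g \<in> carrier (free_module A B)"
    and "code f = code g"
  then have "(SOME w. combination A w = f) = (SOME w. combination A w = g)" by (simp add: code_def)
  then have "combination A (SOME w. combination A w = f) = combination A (SOME w. combination A w = g)"
    by (rule arg_cong)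
  then show "f = g" unfolding ex[OF f] ex[OF g] .
qed

text \<open>By flatness a cycle is a tensor of cycles of the resolution, which can be lifted one by one.\<close>

lemma flat_boundary:
  assumes flat: "flat_right_module TYPE(('a, 'c) syzygy) A U"
    and x: "x \<in> tensor_frags U (F s)" and cyc: "tensor_cycle s x"
  shows "\<exists>y\<in>tensor_frags U (F (Suc s)). x - frag_map \<delta> y \<in> rel (F s)"
proof -
  have "\<exists>y\<in>tensor_frags U (cycle_module s). x - y \<in> rel (F s)"
  proof (cases s)
    case 0
    have "frag_map \<epsilon> x \<in> rel M" using cyc 0 by (simp add: tensor_cycle_def)
    moreover have "inj_on Gen (carrier M)" by (simp add: inj_on_def)
    ultimately have "\<exists>y\<in>tensor_frags U ((F s)\<lparr>carrier := {n \<in> carrier (F s). \<epsilon> n = \<zero>\<^bsub>M\<^esub>}\<rparr>). x - y \<in> rel (F s)"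
      using flat_exact[OF flat left_F left_M aug_hom _ x] by blast
    then show ?thesis using 0 by (simp add: cycle_def)
  next
    case (Suc t)
    have "frag_map \<delta> x \<in> rel (F t)" using cyc Suc by (simp add: tensor_cycle_def)
    moreover have "\<delta> \<in> left_hom A (F s) (F t)" using diff_hom Suc by simp
    ultimately have "\<exists>y\<in>tensor_frags U ((F s)\<lparr>carrier := {n \<in> carrier (F s). \<delta> n = \<zero>\<^bsub>F t\<^esub>}\<rparr>). x - y \<in> rel (F s)"
      using flat_exact[OF flat left_F left_F _ code_inj x] by blast
    then show ?thesis using Suc by (simp add: cycle_def)
  qed
  then obtain y where y: "y \<in> tensor_frags U (cycle_module s)" "x - y \<in> rel (F s)" by blast
  define l where "l f = (SOME g. g \<in> carrier (F (Suc s)) \<and> \<delta> g = f)" for f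
  have l: "l f \<in> carrier (F (Suc s)) \<and> \<delta> (l f) = f" if "f \<in> carrier (cycle_module s)" for f
  proof -
    have "f \<in> carrier (F s)" "cycle s f" using that by simp_all
    then have "\<exists>g. g \<in> carrier (F (Suc s)) \<and> \<delta> g = f" using preimage[of f s] by blast
    then show ?thesis unfolding l_def by (rule someI_ex)
  qed
  have "frag_map l y \<in> tensor_frags U (F (Suc s))"
    by (rule frag_map_closed[OF y(1)]) (use l in blast)
  moreover have "frag_map \<delta> (frag_map l y) = y"
    unfolding frag_map_comp by (rule frag_map_ident[OF y(1)]) (use l in blast)
  ultimately show ?thesis using y(2) by (intro bexI[of _ "frag_map l y"]) simp_all
qed

lemma resolution_diff_hom: "resolution_diff (unit_ball A) \<in> left_hom (unit_ball A) (F0 (Suc s)) (F0 s)"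
proof -
  interpret F: left_module "unit_ball A" "F0 (Suc s)" by (rule left_F0)
  show ?thesis
  proof (rule left_homI)
    fix x assume x: "x \<in> carrier (F0 (Suc s))"
    show "resolution_diff (unit_ball A) x \<in> carrier (F0 s)"
      unfolding diff_unit_ball[OF x] by (rule left_hom_closed[OF diff_hom_ball x])
    show "resolution_diff (unit_ball A) (x \<oplus>\<^bsub>F0 (Suc s)\<^esub> y) =
        resolution_diff (unit_ball A) x \<oplus>\<^bsub>F0 s\<^esub> resolution_diff (unit_ball A) y" if y: "y \<in> carrier (F0 (Suc s))" for y
      unfolding diff_unit_ball[OF x] diff_unit_ball[OF y] diff_unit_ball[OF F.M.a_closed[OF x y]]
      by (rule left_hom_add[OF diff_hom_ball x y])
    show "resolution_diff (unit_ball A) (a \<odot>\<^bsub>F0 (Suc s)\<^esub> x) = a \<odot>\<^bsub>F0 s\<^esub> resolution_diff (unit_ball A) x"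
      if a: "a \<in> carrier (unit_ball A)" for a
      unfolding diff_unit_ball[OF x] diff_unit_ball[OF F.act_closed[OF a x]]
      by (rule left_hom_act[OF diff_hom_ball a x])
  qed
qed

lemma tor_diff_class:
  assumes "y \<in> tensor_frags (unit_ball U) (F0 (Suc s))"
  shows "tor_diff (unit_ball A) (unit_ball U) (unit_ball M) s (B.cls (F0 (Suc s)) y) = B.cls (F0 s) (frag_map \<delta> y)"
  using B.tensor_map_cls[OF left_F0 left_F0 resolution_diff_hom]
    frag_map_cong[OF assms, of "resolution_diff (unit_ball A)" \<delta>] diff_unit_ball
  by (simp add: tor_diff_def resolution_eq)

lemma frag_act_pow_closed:
  "x \<in> tensor_frags (unit_ball U) N \<Longrightarrow> frag_act (smult U) (sc (\<pi> [^]\<^bsub>K\<^esub> (n::nat))) x \<in> tensor_frags (unit_ball U) N"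
  using B.frag_act_closed[of "sc (\<pi> [^]\<^bsub>K\<^esub> n)" x N] q sc_unit_ball[OF pow_closed, of n]
  by (simp add: av_pow power_le_one unit_ball_def)

text \<open>Bounded torsion of Tor in terms of formal sums: if some power of \<open>\<pi>\<close> makes the cycle \<open>x\<close> a
  boundary, then the \<open>n\<close>-th power does.\<close>

lemma tor_bounded_torsion:
  assumes tor: "bounded_torsion K \<pi> (Tor (unit_ball A) (unit_ball U) (unit_ball M) s)"
  shows "\<exists>n::nat. \<forall>x m y. x \<in> tensor_frags (unit_ball U) (F0 s) \<longrightarrow>
    (s \<noteq> 0 \<longrightarrow> frag_map \<delta> x \<in> B.rel (F0 (s - 1))) \<longrightarrow>
    y \<in> tensor_frags (unit_ball U) (F0 (Suc s)) \<longrightarrow>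
    frag_act (smult U) (sc (\<pi> [^]\<^bsub>K\<^esub> (m::nat))) x - frag_map \<delta> y \<in> B.rel (F0 s) \<longrightarrow>
    (\<exists>z\<in>tensor_frags (unit_ball U) (F0 (Suc s)).
      frag_act (smult U) (sc (\<pi> [^]\<^bsub>K\<^esub> n)) x - frag_map \<delta> z \<in> B.rel (F0 s))"
proof -
  let ?T = "tensor (unit_ball A) (unit_ball U) (F0 s)"
  let ?fr = "tensor_frags (unit_ball U) (F0 (Suc s))"
  define T' where "T' = ?T\<lparr>carrier := tor_cycles (unit_ball A) (unit_ball U) (unit_ball M) s\<rparr>"
  define W where "W = tor_diff (unit_ball A) (unit_ball U) (unit_ball M) s `
    carrier (tensor (unit_ball A) (unit_ball U) (F0 (Suc s)))"
  have W: "W = (\<lambda>y. B.cls (F0 s) (frag_map \<delta> y)) ` ?fr"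
    unfolding W_def carrier_tensor image_image by (rule image_cong[OF refl tor_diff_class])
  have Tor: "Tor (unit_ball A) (unit_ball U) (unit_ball M) s = quot_module T' W"
    by (simp add: Tor_def T'_def W_def resolution_eq)
  have T'_simps: "X \<oplus>\<^bsub>T'\<^esub> Y = X \<oplus>\<^bsub>?T\<^esub> Y" "k \<odot>\<^bsub>T'\<^esub> X = k \<odot>\<^bsub>?T\<^esub> X" for k X Y
    by (simp_all add: T'_def)
  have smult: "\<pi> [^]\<^bsub>K\<^esub> n \<odot>\<^bsub>?T\<^esub> B.cls (F0 s) x = B.cls (F0 s) (frag_act (smult U) (sc (\<pi> [^]\<^bsub>K\<^esub> n)) x)"
    for n :: nat and x
  proof -
    have "sc (\<pi> [^]\<^bsub>K\<^esub> n) \<in> carrier (unit_ball A)"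
      using q by (intro sc_unit_ball[OF pow_closed]) (simp add: av_pow power_le_one)
    then show ?thesis
      using B.smult_cls[of "F0 s" "\<pi> [^]\<^bsub>K\<^esub> n" x, OF left_F0] sc_central[OF pow_closed, of _ n]
      by (simp add: unit_ball_def)
  qed
  have coset: "W +>\<^bsub>T'\<^esub> B.cls (F0 s) x = (\<lambda>y. B.cls (F0 s) (frag_map \<delta> y + x)) ` ?fr" for x
    unfolding a_r_coset_def' T'_simps W by (simp add: B.add_cls[OF left_F0] UNION_singleton_eq_range image_image)
  \<comment> \<open>The summand with \<open>y1\<close> stems from the scalar multiplication of \<open>quot_module\<close>, which adds the
    submodule \<open>W\<close>; the one with \<open>y2\<close> stems from the coset.\<close>
  have act: "\<pi> [^]\<^bsub>K\<^esub> n \<odot>\<^bsub>quot_module T' W\<^esub> (W +>\<^bsub>T'\<^esub> B.cls (F0 s) x) =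
      (\<Union>y1\<in>?fr. \<Union>y2\<in>?fr. {B.cls (F0 s) (frag_map \<delta> y1 + frag_act (smult U) (sc (\<pi> [^]\<^bsub>K\<^esub> n)) (frag_map \<delta> y2 + x))})"
    for n :: nat and x
  proof -
    have "\<pi> [^]\<^bsub>K\<^esub> n \<odot>\<^bsub>quot_module T' W\<^esub> (W +>\<^bsub>T'\<^esub> B.cls (F0 s) x) =
        (\<Union>w\<in>W. \<Union>X\<in>(W +>\<^bsub>T'\<^esub> B.cls (F0 s) x). {w \<oplus>\<^bsub>?T\<^esub> (\<pi> [^]\<^bsub>K\<^esub> n \<odot>\<^bsub>?T\<^esub> X)})"
      by (simp add: quot_module_def set_add_def' T'_simps)
    then show ?thesis
      unfolding coset unfolding W by (simp add: smult B.add_cls[OF left_F0])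
  qed
  have act_add: "frag_act (smult U) a (x + y) = frag_act (smult U) a x + frag_act (smult U) a y" for a x y
    by (simp add: frag_act_def frag_extend_add)
  have carrier: "W +>\<^bsub>T'\<^esub> B.cls (F0 s) x \<in> carrier (quot_module T' W)"
    if x: "x \<in> tensor_frags (unit_ball U) (F0 s)" and cyc: "s \<noteq> 0 \<longrightarrow> frag_map \<delta> x \<in> B.rel (F0 (s - 1))" for x
  proof -
    have "B.cls (F0 s) x \<in> tor_cycles (unit_ball A) (unit_ball U) (unit_ball M) s"
    proof (cases s)
      case 0
      then show ?thesis using x by (simp add: resolution_eq carrier_tensor)
    next
      case (Suc t)
      then show ?thesis
        using x cyc tor_diff_class[of x t]
        by (simp add: a_kernel_def' resolution_eq carrier_tensor B.cls_zero_iff[OF left_F0])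
    qed
    then show ?thesis
      by (auto simp: quot_module_def A_RCOSETS_def' T'_def)
  qed
  obtain n where n: "\<And>X m. \<lbrakk>X \<in> carrier (quot_module T' W);
      \<pi> [^]\<^bsub>K\<^esub> (m::nat) \<odot>\<^bsub>quot_module T' W\<^esub> X = W\<rbrakk> \<Longrightarrow> \<pi> [^]\<^bsub>K\<^esub> (n::nat) \<odot>\<^bsub>quot_module T' W\<^esub> X = W"
    using tor unfolding bounded_torsion_def Tor by (auto simp: quot_module_def)
  show ?thesis
  proof (intro exI[of _ n] allI impI)
    fix x :: "('u \<times> (('a, 'c) syzygy \<Rightarrow> 'a)) \<Rightarrow>\<^sub>0 int" and m y
    let ?a = "\<lambda>n. frag_act (smult U) (sc (\<pi> [^]\<^bsub>K\<^esub> (n::nat)))"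
    assume x: "x \<in> tensor_frags (unit_ball U) (F0 s)" "s \<noteq> 0 \<longrightarrow> frag_map \<delta> x \<in> B.rel (F0 (s - 1))"
      and y: "y \<in> ?fr" "?a m x - frag_map \<delta> y \<in> B.rel (F0 s)"
    have 1: "frag_map \<delta> y1 + ?a m (frag_map \<delta> y2 + x) - frag_map \<delta> (y1 + ?a m y2 + y) \<in> B.rel (F0 s)" for y1 y2
      using y(2) by (simp add: act_add frag_act_frag_map algebra_simps)
    have "\<pi> [^]\<^bsub>K\<^esub> m \<odot>\<^bsub>quot_module T' W\<^esub> (W +>\<^bsub>T'\<^esub> B.cls (F0 s) x) = W"
    proof (intro equalityI subsetI)
      fix X assume "X \<in> \<pi> [^]\<^bsub>K\<^esub> m \<odot>\<^bsub>quot_module T' W\<^esub> (W +>\<^bsub>T'\<^esub> B.cls (F0 s) x)"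
      then obtain y1 y2 where y12: "y1 \<in> ?fr" "y2 \<in> ?fr" "X = B.cls (F0 s) (frag_map \<delta> y1 + ?a m (frag_map \<delta> y2 + x))"
        unfolding act by blast
      have "X = B.cls (F0 s) (frag_map \<delta> (y1 + ?a m y2 + y))"
        using 1 by (simp only: y12(3) B.cls_eq_iff[OF left_F0])
      moreover have "y1 + ?a m y2 + y \<in> ?fr"
        using y12 y(1) frag_act_pow_closed by (intro tensor_frags_add)
      ultimately show "X \<in> W" unfolding W by blast
    next
      fix X assume "X \<in> W"
      then obtain z where z: "z \<in> ?fr" "X = B.cls (F0 s) (frag_map \<delta> z)" unfolding W by blast
      have "frag_map \<delta> (z - y) + ?a m (frag_map \<delta> 0 + x) - frag_map \<delta> z \<in> B.rel (F0 s)"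
        using 1[of "z - y" 0] by (simp del: frag_map_add frag_map_diff)
      then have "X = B.cls (F0 s) (frag_map \<delta> (z - y) + ?a m (frag_map \<delta> 0 + x))"
        unfolding z(2) using B.cls_eq_iff[OF left_F0] by metis
      moreover have "z - y \<in> ?fr" "0 \<in> ?fr" using z(1) y(1) by simp_all
      ultimately show "X \<in> \<pi> [^]\<^bsub>K\<^esub> m \<odot>\<^bsub>quot_module T' W\<^esub> (W +>\<^bsub>T'\<^esub> B.cls (F0 s) x)"
        unfolding act by blast
    qed
    then have "\<pi> [^]\<^bsub>K\<^esub> n \<odot>\<^bsub>quot_module T' W\<^esub> (W +>\<^bsub>T'\<^esub> B.cls (F0 s) x) = W"
      by (rule n[OF carrier[OF x]])
    moreover have "B.cls (F0 s) (frag_map \<delta> 0 + ?a n (frag_map \<delta> 0 + x)) \<in>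
        \<pi> [^]\<^bsub>K\<^esub> n \<odot>\<^bsub>quot_module T' W\<^esub> (W +>\<^bsub>T'\<^esub> B.cls (F0 s) x)"
      unfolding act using tensor_frags_0 by blast
    ultimately obtain z where "z \<in> ?fr" "B.cls (F0 s) (?a n x) = B.cls (F0 s) (frag_map \<delta> z)"
      unfolding W by auto
    then show "\<exists>z\<in>?fr. ?a n x - frag_map \<delta> z \<in> B.rel (F0 s)"
      unfolding B.cls_eq_iff[OF left_F0] by blast
  qed
qed

lemma frag_act_frag_map_sc:
  assumes N: "normed_left N \<nu>" and x: "x \<in> tensor_frags (unit_ball U) (closed_ball N \<nu>)"
  shows "frag_act (smult U) (sc (\<pi> [^]\<^bsub>K\<^esub> (n::nat))) x - frag_map ((\<odot>\<^bsub>N\<^esub>) (sc (\<pi> [^]\<^bsub>K\<^esub> n))) x \<in> B.rel (closed_ball N \<nu>)"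
proof -
  note N0 = left_module_closed_ball[OF N]
  have s: "sc (\<pi> [^]\<^bsub>K\<^esub> n) \<in> carrier (unit_ball A)"
    using q by (intro sc_unit_ball[OF pow_closed]) (simp add: av_pow power_le_one)
  show ?thesis
    using x
  proof (induction rule: tensor_frags_induct)
    case (diff x y)
    then show ?case using B.rel_diff[OF N0 diff(3,4)] by (simp add: algebra_simps)
  next
    case (pure u m)
    then show ?case using B.rel_act[OF s pure] by simp
  qed simp
qed

text \<open>A cycle of norm at most \<open>r\<close> is scaled to a tensor \<open>z\<close> of elements of the unit balls, which is a
  cycle over the unit balls by \<open>rel_free_module_ball\<close>. By flatness \<open>z\<close> is a boundary over \<open>A\<close>, so some
  multiple \<open>\<pi>\<^sup>2\<^sup>m z\<close> is one over the unit balls. Bounded torsion replaces \<open>2 m\<close>, which depends on the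
  cycle, by a fixed exponent \<open>n\<close>.\<close>

lemma strict_tensor_resolution:
  assumes flat: "flat_right_module TYPE(('a, 'c) syzygy) A U"
    and tor: "bounded_torsion K \<pi> (Tor (unit_ball A) (unit_ball U) (unit_ball M) s)"
  shows "\<exists>c>0. \<forall>x\<in>tensor_frags U (F s). \<forall>r>0. bounded_by (F s) sup_norm x r \<longrightarrow> tensor_cycle s x \<longrightarrow>
    (\<exists>y\<in>tensor_frags U (F (Suc s)). x - frag_map \<delta> y \<in> rel (F s) \<and> bounded_by (F (Suc s)) sup_norm y (c * r))"
proof -
  obtain n where n: "\<And>x m y. \<lbrakk>x \<in> tensor_frags (unit_ball U) (F0 s);
      s \<noteq> 0 \<Longrightarrow> frag_map \<delta> x \<in> B.rel (F0 (s - 1)); y \<in> tensor_frags (unit_ball U) (F0 (Suc s));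
      frag_act (smult U) (sc (\<pi> [^]\<^bsub>K\<^esub> (m::nat))) x - frag_map \<delta> y \<in> B.rel (F0 s)\<rbrakk> \<Longrightarrow>
    \<exists>z\<in>tensor_frags (unit_ball U) (F0 (Suc s)).
      frag_act (smult U) (sc (\<pi> [^]\<^bsub>K\<^esub> (n::nat))) x - frag_map \<delta> z \<in> B.rel (F0 s)"
    using tor_bounded_torsion[OF tor] by blast
  note nF = normed_left_free_module
  \<comment> \<open>The factor \<open>q\<^sup>2\<close> is the loss of \<open>integralize\<close>, the factor \<open>q ^ n\<close> that of the torsion.\<close>
  define c where "c = 1 / (q ^ n * q\<^sup>2)"
  have c: "c > 0" using q by (simp add: c_def)
  have "\<exists>y\<in>tensor_frags U (F (Suc s)). x - frag_map \<delta> y \<in> rel (F s) \<and> bounded_by (F (Suc s)) sup_norm y (c * r)"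
    if x: "x \<in> tensor_frags U (F s)" and r: "0 < r" and xr: "bounded_by (F s) sup_norm x r"
      and cyc: "tensor_cycle s x" for x r
  proof -
    obtain k z where k: "k \<in> carrier K" "k \<noteq> \<zero>\<^bsub>K\<^esub>" "q\<^sup>2 \<le> av k * r"
      and z: "z \<in> tensor_frags (unit_ball U) (F0 s)" "frag_map ((\<odot>\<^bsub>F s\<^esub>) (sc k)) x - z \<in> rel (F s)"
      using integralize[OF nF xr r] unfolding free_module_unit_ball by blast
    have zU: "z \<in> tensor_frags U (F s)"
      by (rule tensor_frags_mono[OF z(1)]) (use F0_F in auto)
    have tc_sc: "tensor_cycle s (frag_map ((\<odot>\<^bsub>F s\<^esub>) (sc k)) x)"
    proof (cases s)
      case 0
      have "frag_map \<epsilon> (frag_map ((\<odot>\<^bsub>F s\<^esub>) (sc k)) x) = frag_map ((\<odot>\<^bsub>M\<^esub>) (sc k)) (frag_map \<epsilon> x)"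
        unfolding frag_map_comp by (rule frag_map_cong[OF x]) (rule left_hom_act[OF aug_hom sc_closed[OF k(1)]])
      moreover have "frag_map ((\<odot>\<^bsub>M\<^esub>) (sc k)) (frag_map \<epsilon> x) \<in> rel M"
        using cyc 0 by (intro frag_map_rel[OF left_M left_M sc_hom[OF M k(1)]]) (simp add: tensor_cycle_def)
      ultimately show ?thesis using 0 unfolding tensor_cycle_def by simp
    next
      case (Suc t)
      have h: "\<delta> \<in> left_hom A (F s) (F t)" using diff_hom Suc by simp
      have "frag_map \<delta> (frag_map ((\<odot>\<^bsub>F s\<^esub>) (sc k)) x) = frag_map ((\<odot>\<^bsub>F t\<^esub>) (sc k)) (frag_map \<delta> x)"
        unfolding frag_map_comp by (rule frag_map_cong[OF x]) (rule left_hom_act[OF h sc_closed[OF k(1)]])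
      moreover have "frag_map ((\<odot>\<^bsub>F t\<^esub>) (sc k)) (frag_map \<delta> x) \<in> rel (F t)"
        using cyc Suc by (intro frag_map_rel[OF left_F left_F sc_hom[OF nF k(1)]]) (simp add: tensor_cycle_def)
      ultimately show ?thesis using Suc unfolding tensor_cycle_def by simp
    qed
    have tc: "tensor_cycle s z"
    proof (cases s)
      case 0
      then show ?thesis
        using tc_sc frag_map_rel[OF left_F left_M aug_hom z(2)] rel_cong[OF left_M]
        unfolding tensor_cycle_def frag_map_diff by auto
    next
      case (Suc t)
      have h: "\<delta> \<in> left_hom A (F s) (F t)" using diff_hom Suc by simp
      show ?thesis
        using tc_sc frag_map_rel[OF left_F left_F h z(2)] rel_cong[OF left_F, of _ _ "basis t"] Suc
        unfolding tensor_cycle_def frag_map_diff by auto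
    qed
    have zcyc: "frag_map \<delta> z \<in> B.rel (F0 (s - 1))" if "s \<noteq> 0"
    proof (rule rel_free_module_ball)
      show "frag_map \<delta> z \<in> rel (F (s - 1))" using tc that by (simp add: tensor_cycle_def)
      show "frag_map \<delta> z \<in> tensor_frags (unit_ball U) (F0 (s - 1))"
        using frag_map_closed[OF z(1) left_hom_closed[OF diff_hom_ball[of "s - 1"]]] that by simp
    qed
    obtain y where y: "y \<in> tensor_frags U (F (Suc s))" "z - frag_map \<delta> y \<in> rel (F s)"
      using flat_boundary[OF flat zU tc] by blast
    obtain m1 m2 where m1: "\<forall>m\<ge>m1. scale (F s) m (z - frag_map \<delta> y) \<in> B.rel (F0 s)"
      and m2: "\<forall>m\<ge>m2. scale (F (Suc s)) m y \<in> tensor_frags (unit_ball U) (F0 (Suc s))"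
      using clear_denominators[OF nF y(2)] scale_frags[OF nF y(1)] unfolding free_module_unit_ball by blast
    define m where "m = max m1 m2"
    have m: "m1 \<le> m" "m2 \<le> m" by (simp_all add: m_def)
    let ?y = "scale (F (Suc s)) m y"
    have y': "?y \<in> tensor_frags (unit_ball U) (F0 (Suc s))" using m2 m(2) by blast
    have e1: "scale (F s) m z - frag_map \<delta> ?y \<in> B.rel (F0 s)"
      using m1[rule_format, OF m(1)] scale_frag_map[OF diff_hom y(1), of m] by simp
    have e2: "scale (F s) m z - frag_map ((\<odot>\<^bsub>F s\<^esub>) (sc (\<pi> [^]\<^bsub>K\<^esub> (m + m)))) z \<in> B.rel (F0 s)"
      using scale_ball[OF nF, of z "basis s" m] z(1) unfolding free_module_unit_ball by blast
    have e3: "frag_act (smult U) (sc (\<pi> [^]\<^bsub>K\<^esub> j)) z - frag_map ((\<odot>\<^bsub>F s\<^esub>) (sc (\<pi> [^]\<^bsub>K\<^esub> j))) z \<in> B.rel (F0 s)" for j :: nat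
      using frag_act_frag_map_sc[OF nF, of z "basis s" j] z(1) unfolding free_module_unit_ball by blast
    have "frag_act (smult U) (sc (\<pi> [^]\<^bsub>K\<^esub> (m + m))) z - frag_map \<delta> ?y \<in> B.rel (F0 s)"
      using B.rel_trans[OF B.rel_trans[OF e3 B.rel_minus_commute[OF left_F0 e2]] e1] .
    from n[OF z(1) zcyc y' this] obtain w where w: "w \<in> tensor_frags (unit_ball U) (F0 (Suc s))"
      "frag_act (smult U) (sc (\<pi> [^]\<^bsub>K\<^esub> n)) z - frag_map \<delta> w \<in> B.rel (F0 s)" by blast
    have wU: "w \<in> tensor_frags U (F (Suc s))"
      by (rule tensor_frags_mono[OF w(1)]) (use F0_F in auto)
    have w1: "frag_bounded U sup_norm w 1"
      by (rule frag_bounded_unit_ball[OF w(1)[unfolded free_module_unit_ball]]) (auto simp: sup_norm_nonneg)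
    define l where "l = inv\<^bsub>K\<^esub> (\<pi> [^]\<^bsub>K\<^esub> n \<otimes>\<^bsub>K\<^esub> k)"
    have pk: "\<pi> [^]\<^bsub>K\<^esub> n \<otimes>\<^bsub>K\<^esub> k \<in> carrier K" "\<pi> [^]\<^bsub>K\<^esub> n \<otimes>\<^bsub>K\<^esub> k \<noteq> \<zero>\<^bsub>K\<^esub>"
      using k(1,2) pow_nonzero[of n] K.integral_iff by auto
    note inv = inv_closed[OF pk, folded l_def]
    have l: "av l = 1 / (q ^ n * av k)"
      using inv(5) K.av_mult[OF pow_closed k(1)] by (simp add: av_pow)
    define v where "v = frag_map ((\<odot>\<^bsub>F (Suc s)\<^esub>) (sc l)) w"
    have v: "v \<in> tensor_frags U (F (Suc s))"
      unfolding v_def by (rule frag_map_closed[OF wU left_hom_closed[OF sc_hom[OF nF inv(1)]]])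
    have "frag_bounded U sup_norm v (av l * 1)"
      unfolding v_def by (rule frag_bounded_frag_map[OF wU w1])
        (use inv(1) in \<open>simp_all add: norm_sc[OF nF] K.av_nonneg del: free_module_simps\<close>)
    moreover have "av l * 1 \<le> c * r"
      using k(3) q r av_pos[OF k(1,2)] unfolding l c_def by (simp add: field_simps)
    ultimately have "bounded_by (F (Suc s)) sup_norm v (c * r)"
      using bounded_by_frag[OF v] frag_bounded_mono by blast
    moreover have "x - frag_map \<delta> v \<in> rel (F s)"
    proof -
      have left_ball: "left_module (unit_ball A) (closed_ball (F s) sup_norm)"
        using left_module_closed_ball[OF nF] .
      have "frag_map ((\<odot>\<^bsub>F s\<^esub>) (sc (\<pi> [^]\<^bsub>K\<^esub> n))) z - frag_map \<delta> w \<in> B.rel (F0 s)"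
        using B.rel_trans[OF B.rel_minus_commute[OF left_F0 e3[of n]] w(2)] .
      then have "frag_map ((\<odot>\<^bsub>F s\<^esub>) (sc (\<pi> [^]\<^bsub>K\<^esub> n))) z - frag_map \<delta> w \<in> rel (F s)"
        unfolding free_module_unit_ball by (rule ball_rel_rel[OF left_ball left_F])
      moreover have "frag_map ((\<odot>\<^bsub>F s\<^esub>) (sc (\<pi> [^]\<^bsub>K\<^esub> n))) (frag_map ((\<odot>\<^bsub>F s\<^esub>) (sc k)) x)
          - frag_map ((\<odot>\<^bsub>F s\<^esub>) (sc (\<pi> [^]\<^bsub>K\<^esub> n))) z \<in> rel (F s)"
        using frag_map_rel[OF left_F left_F sc_hom[OF nF pow_closed[of n]] z(2)] unfolding frag_map_diff .
      moreover have "frag_map ((\<odot>\<^bsub>F s\<^esub>) (sc (\<pi> [^]\<^bsub>K\<^esub> n))) (frag_map ((\<odot>\<^bsub>F s\<^esub>) (sc k)) x) =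
          frag_map ((\<odot>\<^bsub>F s\<^esub>) (sc (\<pi> [^]\<^bsub>K\<^esub> n \<otimes>\<^bsub>K\<^esub> k))) x"
        unfolding frag_map_comp by (rule frag_map_cong[OF x]) (rule sc_act_act[OF nF pow_closed k(1)])
      ultimately have "frag_map ((\<odot>\<^bsub>F s\<^esub>) (sc (\<pi> [^]\<^bsub>K\<^esub> n \<otimes>\<^bsub>K\<^esub> k))) x - frag_map \<delta> w \<in> rel (F s)"
        using rel_trans by metis
      from frag_map_rel[OF left_F left_F sc_hom[OF nF inv(1)] this]
      have "x - frag_map ((\<odot>\<^bsub>F s\<^esub>) (sc l)) (frag_map \<delta> w) \<in> rel (F s)"
        unfolding frag_map_diff frag_map_sc_inv[OF nF pk x, folded l_def] .
      moreover have "frag_map ((\<odot>\<^bsub>F s\<^esub>) (sc l)) (frag_map \<delta> w) = frag_map \<delta> v"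
        unfolding v_def frag_map_comp
        by (rule frag_map_cong[OF wU]) (rule left_hom_act[OF diff_hom sc_closed[OF inv(1)], symmetric])
      ultimately show ?thesis by simp
    qed
    ultimately show ?thesis using v by blast
  qed
  then show ?thesis using c by blast
qed

end

section \<open>The twisted total complex of the resolutions\<close>

context dvf_algebra
begin

lemma left_free: "left_module A (free_module A B)"
  by (rule A.A.left_module_free_module)

lemma free_hom_add:
  assumes "h \<in> left_hom A (free_module A B) (free_module A B')"
    "f \<in> carrier (free_module A B)" "g \<in> carrier (free_module A B)"
  shows "h (\<lambda>b. f b \<oplus>\<^bsub>A\<^esub> g b) = (\<lambda>b. h f b \<oplus>\<^bsub>A\<^esub> h g b)"
  using left_hom_add[OF assms] by simp

lemma free_hom_zero:
  assumes "h \<in> left_hom A (free_module A B) (free_module A B')"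
  shows "h (\<lambda>_. \<zero>\<^bsub>A\<^esub>) = (\<lambda>_. \<zero>\<^bsub>A\<^esub>)"
  using left_hom_zero[OF assms left_module.axioms(2)[OF left_free] left_module.axioms(2)[OF left_free]] by simp

lemma free_hom_diff:
  assumes h: "h \<in> left_hom A (free_module A B) (free_module A B')"
    and f: "f \<in> carrier (free_module A B)" "g \<in> carrier (free_module A B)"
  shows "h (\<lambda>b. f b \<ominus>\<^bsub>A\<^esub> g b) = (\<lambda>b. h f b \<ominus>\<^bsub>A\<^esub> h g b)"
  using left_hom_minus[OF h left_module.axioms(2)[OF left_free] left_module.axioms(2)[OF left_free] f]
  unfolding A.A.free_module_minus[OF f(2)] A.A.free_module_minus[OF left_hom_closed[OF h f(2)]] .

lemma free_add_closed:
  "\<lbrakk>f \<in> carrier (free_module A B); g \<in> carrier (free_module A B)\<rbrakk> \<Longrightarrow>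
    (\<lambda>b. f b \<oplus>\<^bsub>A\<^esub> g b) \<in> carrier (free_module A B)"
  using abelian_monoid.a_closed[OF abelian_group.axioms(1)[OF left_module.axioms(2)[OF left_free[of B]]], of f g] by simp

lemma free_zero_closed: "(\<lambda>_. \<zero>\<^bsub>A\<^esub>) \<in> carrier (free_module A B)"
  by (simp add: free_module_carrier)

lemma free_diff_closed:
  assumes "f \<in> carrier (free_module A B)" "g \<in> carrier (free_module A B)"
  shows "(\<lambda>b. f b \<ominus>\<^bsub>A\<^esub> g b) \<in> carrier (free_module A B)"
  using abelian_group.minus_closed[OF left_module.axioms(2)[OF left_free[of B]] assms]
  unfolding A.A.free_module_minus[OF assms(2)] .

lemma free_closed_value: "f \<in> carrier (free_module A B) \<Longrightarrow> f b \<in> carrier A"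
  by (simp add: free_module_carrier)

lemma sup_norm_zero: "sup_norm (\<lambda>_. \<zero>\<^bsub>A\<^esub>) = 0"
  using normed_leftD(2)[OF normed_left_free_module] by simp

lemma sup_norm_add:
  "\<lbrakk>f \<in> carrier (free_module A B); g \<in> carrier (free_module A B)\<rbrakk> \<Longrightarrow>
    sup_norm (\<lambda>b. f b \<oplus>\<^bsub>A\<^esub> g b) \<le> max (sup_norm f) (sup_norm g)"
  using normed_leftD(4)[OF normed_left_free_module, of f B g] by simp

lemma sup_norm_diff:
  "\<lbrakk>f \<in> carrier (free_module A B); g \<in> carrier (free_module A B)\<rbrakk> \<Longrightarrow>
    sup_norm (\<lambda>b. f b \<ominus>\<^bsub>A\<^esub> g b) \<le> max (sup_norm f) (sup_norm g)"
  using norm_diff[OF normed_left_free_module, of f B g] by (simp add: A.A.free_module_minus)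

definition bounded_map :: "('n \<Rightarrow> 'm) \<Rightarrow> 'n set \<Rightarrow> ('n \<Rightarrow> real) \<Rightarrow> ('m \<Rightarrow> real) \<Rightarrow> bool"
  where "bounded_map h S \<nu> \<mu> \<longleftrightarrow> (\<exists>c>0. \<forall>x\<in>S. \<mu> (h x) \<le> c * \<nu> x)"

lemma ex_bounded_hom:
  assumes N: "normed_left N \<nu>" and c: "0 < c"
    and ex: "\<And>b. b \<in> B \<Longrightarrow> \<exists>v\<in>carrier N. Q b v \<and> \<nu> v \<le> c"
  shows "\<exists>h\<in>left_hom A (free_module A B) N. (\<forall>b\<in>B. Q b (h (basis_vector A b))) \<and>
    bounded_map h (carrier (free_module A B)) sup_norm \<nu>"
proof -
  define g where "g b = (SOME v. v \<in> carrier N \<and> Q b v \<and> \<nu> v \<le> c)" for b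
  have g: "g b \<in> carrier N" "Q b (g b)" "\<nu> (g b) \<le> c" if "b \<in> B" for b
  proof -
    have "\<exists>v. v \<in> carrier N \<and> Q b v \<and> \<nu> v \<le> c" using ex[OF that] by blast
    from someI_ex[OF this] show "g b \<in> carrier N" "Q b (g b)" "\<nu> (g b) \<le> c"
      unfolding g_def by blast+
  qed
  note Nm = normed_leftD(1)[OF N]
  let ?h = "linear_extension A N g"
  have h: "?h \<in> left_hom A (free_module A B) N"
    by (rule A.A.linear_extension_hom[OF Nm g(1)])
  have hb: "?h (basis_vector A b) = g b" if "b \<in> B" for b
    by (rule A.A.linear_extension_basis_vector[where g = g and b = b, OF Nm g(1)[OF that]])
  have "\<nu> (?h f) \<le> c * sup_norm f" if "f \<in> carrier (free_module A B)" for f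
    using c g(3) hb that by (intro bounded_on_free_module[OF N h]) simp_all
  then have "bounded_map ?h (carrier (free_module A B)) sup_norm \<nu>"
    unfolding bounded_map_def using c by blast
  then show ?thesis using h hb g(2) by (intro bexI[of _ ?h]) auto
qed

end

locale bounded_complex = normed_complex K av \<pi> p A U C d
  for K :: "('k, 'x) ring_scheme" and av :: "'k \<Rightarrow> real" and \<pi> :: 'k and p :: nat
    and A :: "('k, 'a, 'y) normed_module_scheme" and U :: "('a, 'u, 'z) normed_module_scheme"
    and C :: "int \<Rightarrow> ('a, 'c, 'w) normed_module_scheme" and d :: "int \<Rightarrow> 'c \<Rightarrow> 'c" +
  fixes top :: int
  assumes C_top: "top < i \<Longrightarrow> carrier (C i) = {\<zero>\<^bsub>C i\<^esub>}"
begin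

sublocale R: normed_resolution K av \<pi> p A U "C i" for i
  by unfold_locales (rule normed_C)

text \<open>The basis of the degree \<open>j\<close> part of the total complex of the resolutions of the \<open>C\<^sup>i\<close> with \<open>i \<ge> m\<close>.
  The \<open>s\<close>-th module of the resolution of \<open>C\<^sup>i\<close> sits in degree \<open>i - s\<close>.\<close>

definition total_basis :: "int \<Rightarrow> int \<Rightarrow> (int \<times> ('a, 'c) syzygy) set"
  where "total_basis m j = {(i, b). m \<le> i \<and> j \<le> i \<and> i \<le> top \<and>
    b \<in> resolution_basis (unit_ball A) (unit_ball (C i)) (nat (i - j))}"

abbreviation P :: "int \<Rightarrow> int \<Rightarrow> ('a, int \<times> ('a, 'c) syzygy \<Rightarrow> 'a) module"
  where "P m j \<equiv> free_module A (total_basis m j)"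

abbreviation F :: "int \<Rightarrow> int \<Rightarrow> ('a, ('a, 'c) syzygy \<Rightarrow> 'a) module"
  where "F i j \<equiv> free_module A (resolution_basis (unit_ball A) (unit_ball (C i)) (nat (i - j)))"

definition pr :: "int \<Rightarrow> (int \<times> ('a, 'c) syzygy \<Rightarrow> 'a) \<Rightarrow> (('a, 'c) syzygy \<Rightarrow> 'a)"
  where "pr i f = (\<lambda>b. f (i, b))"

definition ins :: "int \<Rightarrow> (('a, 'c) syzygy \<Rightarrow> 'a) \<Rightarrow> (int \<times> ('a, 'c) syzygy \<Rightarrow> 'a)"
  where "ins i g = (\<lambda>(i', b). if i' = i then g b else \<zero>\<^bsub>A\<^esub>)"

definition res :: "int \<Rightarrow> (int \<times> ('a, 'c) syzygy \<Rightarrow> 'a) \<Rightarrow> (int \<times> ('a, 'c) syzygy \<Rightarrow> 'a)"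
  where "res m f = (\<lambda>(i, b). if m \<le> i then f (i, b) else \<zero>\<^bsub>A\<^esub>)"

definition aug :: "int \<Rightarrow> (int \<times> ('a, 'c) syzygy \<Rightarrow> 'a) \<Rightarrow> 'c"
  where "aug j f = resolution_aug A (C j) (pr j f)"

abbreviation \<delta> :: "(('a, 'c) syzygy \<Rightarrow> 'a) \<Rightarrow> (('a, 'c) syzygy \<Rightarrow> 'a)"
  where "\<delta> \<equiv> resolution_diff A"

lemma P_mono: "m \<le> m' \<Longrightarrow> carrier (P m' j) \<subseteq> carrier (P m j)"
  by (rule free_module_mono) (auto simp: total_basis_def)

lemma P_eq: "m \<le> j \<Longrightarrow> P m j = P j j"
proof -
  assume "m \<le> j"
  then have "total_basis m j = total_basis j j" by (auto simp: total_basis_def)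
  then show ?thesis by simp
qed

lemma P_top: "\<lbrakk>top < m \<or> top < j; f \<in> carrier (P m j)\<rbrakk> \<Longrightarrow> f = (\<lambda>_. \<zero>\<^bsub>A\<^esub>)"
proof -
  assume m: "top < m \<or> top < j" and f: "f \<in> carrier (P m j)"
  have "total_basis m j = {}" using m by (auto simp: total_basis_def)
  then show ?thesis using f by (auto simp: free_module_carrier)
qed

lemma pr_closed: "f \<in> carrier (P m j) \<Longrightarrow> pr i f \<in> carrier (F i j)"
  unfolding pr_def by (rule A.A.free_module_comap[where s = "Pair i"]) (auto simp: inj_on_def total_basis_def)

lemma pr_zero: "\<lbrakk>f \<in> carrier (P m j); i < m \<or> i < j \<or> top < i\<rbrakk> \<Longrightarrow> pr i f = (\<lambda>_. \<zero>\<^bsub>A\<^esub>)"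
  by (auto simp: pr_def free_module_carrier total_basis_def fun_eq_iff)

lemma ins_closed:
  assumes "m \<le> i" "j \<le> i" "i \<le> top" "g \<in> carrier (F i j)"
  shows "ins i g \<in> carrier (P m j)"
proof -
  have "{x. ins i g x \<noteq> \<zero>\<^bsub>A\<^esub>} \<subseteq> Pair i ` {b. g b \<noteq> \<zero>\<^bsub>A\<^esub>}"
    by (auto simp: ins_def split: if_splits)
  then have "finite {x. ins i g x \<noteq> \<zero>\<^bsub>A\<^esub>}"
    by (rule finite_subset) (use assms(4) in \<open>simp add: free_module_carrier\<close>)
  then show ?thesis
    using assms unfolding free_module_carrier by (auto simp: ins_def total_basis_def)
qed

lemma res_closed:
  assumes "f \<in> carrier (P m j)"
  shows "res m' f \<in> carrier (P m' j)"
proof -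
  have "finite {x. res m' f x \<noteq> \<zero>\<^bsub>A\<^esub>}"
    by (rule finite_subset[of _ "{x. f x \<noteq> \<zero>\<^bsub>A\<^esub>}"])
      (use assms in \<open>auto simp: free_module_carrier res_def split: if_splits\<close>)
  then show ?thesis
    using assms by (auto simp: free_module_carrier res_def total_basis_def)
qed

lemma P_raise:
  assumes f: "f \<in> carrier (P m j)" and z: "pr m f = (\<lambda>_. \<zero>\<^bsub>A\<^esub>)"
  shows "f \<in> carrier (P (m + 1) j)"
proof -
  have "f (m, b) = \<zero>\<^bsub>A\<^esub>" for b using z by (simp add: pr_def fun_eq_iff)
  then have "f (i, b) = \<zero>\<^bsub>A\<^esub>" if "(i, b) \<notin> total_basis (m + 1) j" for i b
    using f that by (cases "i = m") (auto simp: free_module_carrier total_basis_def)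
  then show ?thesis using f by (auto simp: free_module_carrier)
qed

lemma split_P: "f \<in> carrier (P m j) \<Longrightarrow> f = (\<lambda>x. ins m (pr m f) x \<oplus>\<^bsub>A\<^esub> res (m + 1) f x)"
  by (auto simp: ins_def res_def pr_def free_module_carrier total_basis_def fun_eq_iff)

lemma res_id: "\<lbrakk>f \<in> carrier (P m' j); m \<le> m'\<rbrakk> \<Longrightarrow> res m f = f"
  by (force simp: res_def free_module_carrier total_basis_def fun_eq_iff)

lemma pr_ins [simp]: "pr i (ins i g) = g"
  by (simp add: pr_def ins_def)

lemma pr_hom: "pr i \<in> left_hom A (P m j) (F i j)"
  by (intro left_homI pr_closed) (simp_all add: pr_def)

lemma ins_hom: "\<lbrakk>m \<le> i; j \<le> i; i \<le> top\<rbrakk> \<Longrightarrow> ins i \<in> left_hom A (F i j) (P m j)"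
  by (intro left_homI ins_closed) (auto simp: ins_def fun_eq_iff)

lemma res_hom: "res m' \<in> left_hom A (P m j) (P m' j)"
  by (intro left_homI res_closed) (auto simp: res_def fun_eq_iff)

lemma pr_le: "f \<in> carrier (P m j) \<Longrightarrow> sup_norm (pr i f) \<le> sup_norm f"
  using sup_norm_le_iff[OF pr_closed, of f m j i "sup_norm f"] nrm_le_sup_norm[of f "total_basis m j"]
  by (simp add: pr_def)

lemma ins_le:
  "\<lbrakk>i \<le> top; j \<le> i; g \<in> carrier (F i j)\<rbrakk> \<Longrightarrow> sup_norm (ins i g) \<le> sup_norm g"
  using sup_norm_le_iff[OF ins_closed, of i i j g "sup_norm g"] nrm_le_sup_norm[of g] sup_norm_nonneg[of g]
  by (auto simp: ins_def)

lemma res_le: "f \<in> carrier (P m j) \<Longrightarrow> sup_norm (res m' f) \<le> sup_norm f"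
  using sup_norm_le_iff[OF res_closed, of f m j m' "sup_norm f"] nrm_le_sup_norm[of f "total_basis m j"]
    sup_norm_nonneg[of f "total_basis m j"] by (auto simp: res_def)

lemma aug_hom: "aug j \<in> left_hom A (P m j) (C j)"
  unfolding aug_def by (rule left_hom_comp[OF pr_hom R.aug_hom])

lemma aug_le: "f \<in> carrier (P m j) \<Longrightarrow> \<parallel>aug j f\<parallel>\<^bsub>C j\<^esub> \<le> sup_norm f"
  unfolding aug_def using R.aug_le[OF pr_closed[of f m j j]] pr_le[of f m j j] by force

lemma aug_zero:
  assumes "f \<in> carrier (P m j)" "j < m \<or> top < j"
  shows "aug j f = \<zero>\<^bsub>C j\<^esub>"
proof -
  have "pr j f = \<zero>\<^bsub>F j j\<^esub>" using pr_zero[OF assms(1), of j] assms(2) by auto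
  then show ?thesis
    unfolding aug_def
    using left_hom_zero[OF R.aug_hom[of j] left_module.axioms(2)[OF left_free] left_module.axioms(2)[OF left_C]]
    by metis
qed

lemma aug_preimage:
  assumes c: "c \<in> carrier (C j)" and m: "m \<le> j" and t: "j \<le> top"
  shows "\<exists>f\<in>carrier (P m j). aug j f = c \<and> sup_norm f \<le> 1 / q * \<parallel>c\<parallel>\<^bsub>C j\<^esub>"
proof -
  obtain g where g: "g \<in> carrier (F j j)" "resolution_aug A (C j) g = c" "sup_norm g \<le> 1 / q * \<parallel>c\<parallel>\<^bsub>C j\<^esub>"
    using R.aug_preimage[OF c] by auto
  have "ins j g \<in> carrier (P m j)" by (rule ins_closed[OF m order_refl t g(1)])
  moreover have "sup_norm (ins j g) \<le> sup_norm g" by (rule ins_le[OF t order_refl g(1)])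
  ultimately show ?thesis using g by (intro bexI[of _ "ins j g"]) (auto simp: aug_def)
qed

text \<open>A bounded differential on the total complex that lifts \<open>d\<close> along the augmentations, and respects
  the filtration by the submodules \<open>P i\<close>, with the differential of the resolution of \<open>C\<^sup>i\<close> on the \<open>i\<close>-th
  graded piece. The resolution of \<open>C\<^sup>i\<close> ends in degree \<open>i\<close>, hence the restriction to \<open>j < i\<close>.\<close>

definition twisted :: "(int \<Rightarrow> (int \<times> ('a, 'c) syzygy \<Rightarrow> 'a) \<Rightarrow> (int \<times> ('a, 'c) syzygy \<Rightarrow> 'a)) \<Rightarrow> int \<Rightarrow> bool"
  where "twisted D m \<longleftrightarrow> (\<forall>j.
    D j \<in> left_hom A (P m j) (P m (j + 1)) \<and>
    bounded_map (D j) (carrier (P m j)) sup_norm sup_norm \<and>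
    (\<forall>f\<in>carrier (P m j). D (j + 1) (D j f) = (\<lambda>_. \<zero>\<^bsub>A\<^esub>)) \<and>
    (m \<le> j \<longrightarrow> (\<forall>f\<in>carrier (P m j). aug (j + 1) (D j f) = d j (aug j f))) \<and>
    (\<forall>i\<ge>m. \<forall>f\<in>carrier (P i j). D j f \<in> carrier (P i (j + 1)) \<and>
      (j < i \<longrightarrow> pr i (D j f) = \<delta> (pr i f))))"

lemma twistedD:
  assumes "twisted D m"
  shows "D j \<in> left_hom A (P m j) (P m (j + 1))"
    and "\<exists>c>0. \<forall>f\<in>carrier (P m j). sup_norm (D j f) \<le> c * sup_norm f"
    and "f \<in> carrier (P m j) \<Longrightarrow> D (j + 1) (D j f) = (\<lambda>_. \<zero>\<^bsub>A\<^esub>)"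
    and "\<lbrakk>m \<le> j; f \<in> carrier (P m j)\<rbrakk> \<Longrightarrow> aug (j + 1) (D j f) = d j (aug j f)"
    and "\<lbrakk>m \<le> i; f \<in> carrier (P i j)\<rbrakk> \<Longrightarrow> D j f \<in> carrier (P i (j + 1))"
    and "\<lbrakk>m \<le> i; f \<in> carrier (P i j); j < i\<rbrakk> \<Longrightarrow> pr i (D j f) = \<delta> (pr i f)"
  using assms unfolding twisted_def bounded_map_def by blast+

lemma twisted_hom:
  assumes D: "twisted D m" and i: "m \<le> i"
  shows "D j \<in> left_hom A (P i j) (P i (j + 1))"
  using twistedD(1)[OF D, of j] twistedD(5)[OF D i] P_mono[OF i, of j]
  by (auto simp: left_hom_def subset_iff)

lemma delta_hom: "j < i \<Longrightarrow> \<delta> \<in> left_hom A (F i j) (F i (j + 1))"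
proof -
  assume "j < i"
  then have "nat (i - j) = Suc (nat (i - (j + 1)))" by simp
  then show ?thesis using R.diff_hom[of i "nat (i - (j + 1))"] by simp
qed

lemma delta_preimage:
  assumes "j \<le> i" "g \<in> carrier (F i j)"
    and "if j = i then resolution_aug A (C i) g = \<zero>\<^bsub>C i\<^esub> else \<delta> g = (\<lambda>_. \<zero>\<^bsub>A\<^esub>)"
  shows "\<exists>h\<in>carrier (F i (j - 1)). \<delta> h = g \<and> sup_norm h \<le> 1 / q * sup_norm g"
proof -
  have "nat (i - (j - 1)) = Suc (nat (i - j))" using assms(1) by simp
  moreover have "R.cycle i (nat (i - j)) g"
    using assms(1,3) unfolding R.cycle_def by (auto split: if_splits)
  ultimately show ?thesis using R.preimage[OF assms(2)] by simp
qed

text \<open>Descending induction on \<open>i\<close>. The component of the cycle \<open>f\<close> in the resolution of \<open>C\<^sup>i\<close> is a cycle of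
  this resolution; subtracting the boundary of a preimage \<open>h\<close> leaves a cycle in the next submodule of
  the filtration.\<close>

lemma twisted_exact:
  assumes D: "twisted D m" and i: "m \<le> i" and j: "j \<le> i"
  shows "\<exists>c>0. \<forall>f\<in>carrier (P i j). D j f = (\<lambda>_. \<zero>\<^bsub>A\<^esub>) \<longrightarrow> (j = i \<longrightarrow> aug j f = \<zero>\<^bsub>C j\<^esub>) \<longrightarrow>
    (\<exists>g\<in>carrier (P i (j - 1)). D (j - 1) g = f \<and> sup_norm g \<le> c * sup_norm f)"
proof -
  let ?S = "\<lambda>i. \<exists>c>0. \<forall>f\<in>carrier (P i j). D j f = (\<lambda>_. \<zero>\<^bsub>A\<^esub>) \<longrightarrow> (j = i \<longrightarrow> aug j f = \<zero>\<^bsub>C j\<^esub>) \<longrightarrow>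
    (\<exists>g\<in>carrier (P i (j - 1)). D (j - 1) g = f \<and> sup_norm g \<le> c * sup_norm f)"
  have above: "?S i" if "top < i" "m \<le> i" for i
  proof (intro exI[of _ "1::real"] conjI ballI impI)
    fix f assume "f \<in> carrier (P i j)"
    then have "f = (\<lambda>_. \<zero>\<^bsub>A\<^esub>)" using P_top[of i j f] that(1) by simp
    then show "\<exists>g\<in>carrier (P i (j - 1)). D (j - 1) g = f \<and> sup_norm g \<le> 1 * sup_norm f"
      using free_hom_zero[OF twisted_hom[OF D that(2), of "j - 1"]] free_zero_closed
      by (intro bexI[of _ "\<lambda>_. \<zero>\<^bsub>A\<^esub>"]) simp_all
  qed simp
  have descend: "?S i" if IH: "?S (i + 1)" and i: "m \<le> i" "i \<le> top" "j \<le> i" for i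
  proof -
    obtain c where c: "c > 0" "\<And>f. \<lbrakk>f \<in> carrier (P (i + 1) j); D j f = (\<lambda>_. \<zero>\<^bsub>A\<^esub>)\<rbrakk> \<Longrightarrow>
      \<exists>g\<in>carrier (P (i + 1) (j - 1)). D (j - 1) g = f \<and> sup_norm g \<le> c * sup_norm f"
      using IH i(3) by auto
    obtain b where b: "b > 0" "\<And>f. f \<in> carrier (P m (j - 1)) \<Longrightarrow> sup_norm (D (j - 1) f) \<le> b * sup_norm f"
      using twistedD(2)[OF D, of "j - 1"] by blast
    have Dh: "D (j - 1) \<in> left_hom A (P i (j - 1)) (P i j)" using twisted_hom[OF D i(1), of "j - 1"] by simp
    define c' where "c' = max (1 / q) (c * max 1 (b / q))"
    have c': "c' > 0" using q by (simp add: c'_def less_max_iff_disj)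
    show ?thesis
    proof (intro exI[of _ c'] conjI ballI impI c')
      fix f assume f: "f \<in> carrier (P i j)" and Df: "D j f = (\<lambda>_. \<zero>\<^bsub>A\<^esub>)" and augf: "j = i \<longrightarrow> aug j f = \<zero>\<^bsub>C j\<^esub>"
      have "if j = i then resolution_aug A (C i) (pr i f) = \<zero>\<^bsub>C i\<^esub> else \<delta> (pr i f) = (\<lambda>_. \<zero>\<^bsub>A\<^esub>)"
      proof (cases "j = i")
        case True
        then show ?thesis using augf by (simp add: aug_def)
      next
        case False
        then have "\<delta> (pr i f) = pr i (D j f)" using twistedD(6)[OF D i(1) f] i(3) by simp
        then show ?thesis using False Df by (simp add: pr_def)
      qed
      from delta_preimage[OF i(3) pr_closed[OF f] this]
      obtain h where h: "h \<in> carrier (F i (j - 1))" "\<delta> h = pr i f" "sup_norm h \<le> 1 / q * sup_norm (pr i f)" by blast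
      have ji: "j - 1 \<le> i" using i(3) by simp
      let ?g = "ins i h"
      have g: "?g \<in> carrier (P i (j - 1))" by (rule ins_closed[OF order_refl ji i(2) h(1)])
      have g_le: "sup_norm ?g \<le> 1 / q * sup_norm f"
        using ins_le[OF i(2) ji h(1)] h(3) mult_left_mono[OF pr_le[OF f, of i], of "1 / q"] q by simp
      have Dg: "D (j - 1) ?g \<in> carrier (P i j)" by (rule left_hom_closed[OF Dh g])
      let ?f = "\<lambda>x. f x \<ominus>\<^bsub>A\<^esub> D (j - 1) ?g x"
      have f': "?f \<in> carrier (P i j)" by (rule free_diff_closed[OF f Dg])
      have "pr i ?f = (\<lambda>_. \<zero>\<^bsub>A\<^esub>)"
      proof -
        have "pr i (D (j - 1) ?g) = pr i f" using twistedD(6)[OF D i(1) g] i(3) h(2) by simp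
        then have "D (j - 1) ?g (i, x) = f (i, x)" for x by (simp add: pr_def fun_eq_iff)
        then show ?thesis
          using free_closed_value[OF f] by (simp add: pr_def fun_eq_iff A.minus_eq A.r_neg)
      qed
      then have f1: "?f \<in> carrier (P (i + 1) j)" by (rule P_raise[OF f'])
      have "D j ?f = (\<lambda>x. D j f x \<ominus>\<^bsub>A\<^esub> D j (D (j - 1) ?g) x)"
        by (rule free_hom_diff[OF twisted_hom[OF D i(1)] f Dg])
      moreover have "D j (D (j - 1) ?g) = (\<lambda>_. \<zero>\<^bsub>A\<^esub>)"
        using twistedD(3)[OF D, of ?g "j - 1"] g P_mono[OF i(1)] by auto
      ultimately have "D j ?f = (\<lambda>_. \<zero>\<^bsub>A\<^esub>)"
        using Df by (simp add: A.minus_eq A.r_neg)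
      from c(2)[OF f1 this] obtain g2 where g2: "g2 \<in> carrier (P (i + 1) (j - 1))" "D (j - 1) g2 = ?f"
        "sup_norm g2 \<le> c * sup_norm ?f" by blast
      have g2': "g2 \<in> carrier (P i (j - 1))" using g2(1) P_mono[of i "i + 1" "j - 1"] by auto
      let ?G = "\<lambda>x. ?g x \<oplus>\<^bsub>A\<^esub> g2 x"
      have G: "?G \<in> carrier (P i (j - 1))" by (rule free_add_closed[OF g g2'])
      have "D (j - 1) ?G = (\<lambda>x. D (j - 1) ?g x \<oplus>\<^bsub>A\<^esub> D (j - 1) g2 x)"
        by (rule free_hom_add[OF Dh g g2'])
      also have "\<dots> = f"
        using free_closed_value[OF f] free_closed_value[OF Dg]
        by (simp add: g2(2) fun_eq_iff A.minus_eq A.a_lcomm[of "D (j - 1) ?g _"] A.r_neg)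
      finally have DG: "D (j - 1) ?G = f" .
      have "sup_norm (D (j - 1) ?g) \<le> b / q * sup_norm f"
      proof -
        have "sup_norm (D (j - 1) ?g) \<le> b * sup_norm ?g" using b(2) g P_mono[OF i(1)] by blast
        also have "\<dots> \<le> b * (1 / q * sup_norm f)" using g_le b(1) by (intro mult_left_mono) auto
        finally show ?thesis by simp
      qed
      then have "sup_norm ?f \<le> max 1 (b / q) * sup_norm f"
        using sup_norm_diff[OF f Dg] sup_norm_nonneg[OF f]
        by (simp add: max_mult_distrib_right)
      then have "sup_norm g2 \<le> c * (max 1 (b / q) * sup_norm f)"
        using c(1) by (intro order_trans[OF g2(3)] mult_left_mono) simp_all
      then have "sup_norm g2 \<le> (c * max 1 (b / q)) * sup_norm f" by (simp only: mult.assoc)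
      also have "\<dots> \<le> c' * sup_norm f"
        using sup_norm_nonneg[OF f] unfolding c'_def by (intro mult_right_mono max.cobounded2)
      finally have "sup_norm g2 \<le> c' * sup_norm f" .
      moreover have "1 / q * sup_norm f \<le> c' * sup_norm f"
        using sup_norm_nonneg[OF f] unfolding c'_def by (intro mult_right_mono max.cobounded1)
      ultimately have "max (sup_norm ?g) (sup_norm g2) \<le> c' * sup_norm f"
        using g_le by simp
      then have "sup_norm ?G \<le> c' * sup_norm f"
        using sup_norm_add[OF g g2'] by linarith
      then show "\<exists>g\<in>carrier (P i (j - 1)). D (j - 1) g = f \<and> sup_norm g \<le> c' * sup_norm f"
        using G DG by blast
    qed
  qed
  show ?thesis
  proof (cases "top < i")
    case True
    then show ?thesis using above i by blast
  next
    case False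
    then have "i \<le> top + 1" by simp
    then have "m \<le> i \<longrightarrow> j \<le> i \<longrightarrow> ?S i"
    proof (induction rule: int_le_induct)
      case base
      then show ?case using above by simp
    next
      case (step i)
      show ?case
      proof (intro impI)
        assume i': "m \<le> i - 1" "j \<le> i - 1"
        then have "?S i" using step(2) by simp
        then show "?S (i - 1)" using descend[of "i - 1"] i' step(1) by simp
      qed
    qed
    then show ?thesis using i j by blast
  qed
qed

end

section \<open>Construction of the twisted differential\<close>

lemma le_scaled: "\<lbrakk>y \<le> c * x; x \<le> 1; 0 < c\<rbrakk> \<Longrightarrow> y \<le> (c :: real)"
  by (meson mult_left_le less_imp_le order_trans)

context dvf_algebra
begin

lemma free_uminus_closed: "f \<in> carrier (free_module A B) \<Longrightarrow> (\<lambda>b. \<ominus>\<^bsub>A\<^esub> f b) \<in> carrier (free_module A B)"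
  using abelian_group.a_inv_closed[OF left_module.axioms(2)[OF left_free[of B]], of f]
  by (simp add: A.A.free_module_uminus)

lemma sup_norm_uminus: "f \<in> carrier (free_module A B) \<Longrightarrow> sup_norm (\<lambda>b. \<ominus>\<^bsub>A\<^esub> f b) = sup_norm f"
  using norm_uminus[OF normed_left_free_module, of f B] by (simp add: A.A.free_module_uminus)

lemma free_hom_uminus:
  assumes h: "h \<in> left_hom A (free_module A B) (free_module A B')" and f: "f \<in> carrier (free_module A B)"
  shows "h (\<lambda>b. \<ominus>\<^bsub>A\<^esub> f b) = (\<lambda>b. \<ominus>\<^bsub>A\<^esub> h f b)"
  using left_hom_uminus[OF h left_module.axioms(2)[OF left_free] left_module.axioms(2)[OF left_free] f]
  by (simp only: A.A.free_module_uminus[OF f] A.A.free_module_uminus[OF left_hom_closed[OF h f]])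

lemma uminus_hom: "(\<lambda>f b. \<ominus>\<^bsub>A\<^esub> f b) \<in> left_hom A (free_module A B) (free_module A B)"
  by (intro left_homI free_uminus_closed) (auto simp: free_module_carrier A.minus_add A.a_comm A.r_minus)

lemma free_zero_hom: "(\<lambda>_ _. \<zero>\<^bsub>A\<^esub>) \<in> left_hom A N (free_module A B)"
  by (intro left_homI) (auto simp: free_zero_closed)

lemma free_sum_hom:
  assumes h: "h \<in> left_hom A N (free_module A B)" and k: "k \<in> left_hom A N (free_module A B)"
  shows "(\<lambda>f b. h f b \<oplus>\<^bsub>A\<^esub> k f b) \<in> left_hom A N (free_module A B)"
proof (intro left_homI free_add_closed)
  fix x assume x: "x \<in> carrier N"
  show "h x \<in> carrier (free_module A B)" "k x \<in> carrier (free_module A B)"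
    using left_hom_closed[OF h x] left_hom_closed[OF k x] .
  then have v: "h x b \<in> carrier A" "k x b \<in> carrier A" for b by (auto simp: free_module_carrier)
  show "(\<lambda>b. h (x \<oplus>\<^bsub>N\<^esub> y) b \<oplus>\<^bsub>A\<^esub> k (x \<oplus>\<^bsub>N\<^esub> y) b) =
      (\<lambda>b. h x b \<oplus>\<^bsub>A\<^esub> k x b) \<oplus>\<^bsub>free_module A B\<^esub> (\<lambda>b. h y b \<oplus>\<^bsub>A\<^esub> k y b)" if y: "y \<in> carrier N" for y
  proof -
    have w: "h y b \<in> carrier A" "k y b \<in> carrier A" for b
      using left_hom_closed[OF h y] left_hom_closed[OF k y] by (auto simp: free_module_carrier)
    show ?thesis
      using v w by (simp add: left_hom_add[OF h x y] left_hom_add[OF k x y] A.a_ac)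
  qed
  show "(\<lambda>b. h (a \<odot>\<^bsub>N\<^esub> x) b \<oplus>\<^bsub>A\<^esub> k (a \<odot>\<^bsub>N\<^esub> x) b) = a \<odot>\<^bsub>free_module A B\<^esub> (\<lambda>b. h x b \<oplus>\<^bsub>A\<^esub> k x b)"
    if a: "a \<in> carrier A" for a
    using a v by (simp add: left_hom_act[OF h a x] left_hom_act[OF k a x] A.r_distr)
qed

lemma bounded_map_comp:
  assumes h: "bounded_map h S \<nu> \<mu>" and k: "bounded_map k T \<mu> \<rho>" and "\<And>x. x \<in> S \<Longrightarrow> h x \<in> T"
  shows "bounded_map (\<lambda>x. k (h x)) S \<nu> \<rho>"
proof -
  obtain b c where b: "b > 0" "\<forall>x\<in>S. \<mu> (h x) \<le> b * \<nu> x" and c: "c > 0" "\<forall>x\<in>T. \<rho> (k x) \<le> c * \<mu> x"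
    using h k by (auto simp: bounded_map_def)
  have "\<rho> (k (h x)) \<le> c * b * \<nu> x" if "x \<in> S" for x
  proof -
    have "\<rho> (k (h x)) \<le> c * \<mu> (h x)" using c(2) assms(3)[OF that] by blast
    also have "\<dots> \<le> c * (b * \<nu> x)" using b(2) c(1) that by (intro mult_left_mono) auto
    finally show ?thesis by (simp add: mult.assoc)
  qed
  moreover have "c * b > 0" using b c by simp
  ultimately show ?thesis unfolding bounded_map_def by blast
qed

lemma bounded_map_sum:
  assumes h: "bounded_map h S \<nu> sup_norm" and k: "bounded_map k S \<nu> sup_norm"
    and hB: "\<And>x. x \<in> S \<Longrightarrow> h x \<in> carrier (free_module A B)" and kB: "\<And>x. x \<in> S \<Longrightarrow> k x \<in> carrier (free_module A B)"
    and \<nu>: "\<And>x. x \<in> S \<Longrightarrow> 0 \<le> \<nu> x"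
  shows "bounded_map (\<lambda>x b. h x b \<oplus>\<^bsub>A\<^esub> k x b) S \<nu> sup_norm"
proof -
  obtain b c where b: "b > 0" "\<forall>x\<in>S. sup_norm (h x) \<le> b * \<nu> x" and c: "c > 0" "\<forall>x\<in>S. sup_norm (k x) \<le> c * \<nu> x"
    using h k by (auto simp: bounded_map_def)
  have "sup_norm (\<lambda>b. h x b \<oplus>\<^bsub>A\<^esub> k x b) \<le> max b c * \<nu> x" if x: "x \<in> S" for x
  proof -
    have "sup_norm (\<lambda>b. h x b \<oplus>\<^bsub>A\<^esub> k x b) \<le> max (sup_norm (h x)) (sup_norm (k x))"
      by (rule sup_norm_add[OF hB[OF x] kB[OF x]])
    also have "\<dots> \<le> max (b * \<nu> x) (c * \<nu> x)" using b(2) c(2) x by (intro max.mono) auto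
    finally show ?thesis using \<nu>[OF x] by (simp add: max_mult_distrib_right)
  qed
  moreover have "max b c > 0" using b by simp
  ultimately show ?thesis unfolding bounded_map_def by blast
qed

lemma bounded_mapI: "\<lbrakk>0 < c; \<And>x. x \<in> S \<Longrightarrow> \<mu> (h x) \<le> c * \<nu> x\<rbrakk> \<Longrightarrow> bounded_map h S \<nu> \<mu>"
  unfolding bounded_map_def by blast

end

context bounded_complex
begin

lemma delta_le: "\<lbrakk>j < i; g \<in> carrier (F i j)\<rbrakk> \<Longrightarrow> sup_norm (\<delta> g) \<le> sup_norm g"
proof -
  assume "j < i" "g \<in> carrier (F i j)"
  moreover from this have "nat (i - j) = Suc (nat (i - (j + 1)))" by simp
  ultimately show ?thesis using R.diff_le[of g i "nat (i - (j + 1))"] by simp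
qed

lemma delta_delta: "\<lbrakk>j + 1 < i; g \<in> carrier (F i j)\<rbrakk> \<Longrightarrow> \<delta> (\<delta> g) = (\<lambda>_. \<zero>\<^bsub>A\<^esub>)"
proof -
  assume "j + 1 < i" "g \<in> carrier (F i j)"
  moreover from this have "nat (i - j) = Suc (Suc (nat (i - (j + 2))))" by simp
  ultimately show ?thesis using R.diff_diff[of g i "nat (i - (j + 2))"] by simp
qed

lemma aug_delta: "g \<in> carrier (F i (i - 1)) \<Longrightarrow> resolution_aug A (C i) (\<delta> g) = \<zero>\<^bsub>C i\<^esub>"
  using R.aug_diff[of g i] by simp

text \<open>The component \<open>\<psi>\<close> of the twisted differential that leaves the resolution of \<open>C\<^sup>m\<close> is, up to sign, a
  chain map into the complex that is already there, which lifts \<open>d m\<close>. It is constructed step by step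
  along the resolution, on basis vectors, from \<open>twisted_exact\<close>; the images of basis vectors are
  uniformly bounded, so \<open>\<psi>\<close> is bounded.\<close>

lemma ex_connecting:
  assumes D: "twisted D (m + 1)"
  shows "\<exists>\<psi>. (\<forall>j\<le>m. \<psi> j \<in> left_hom A (F m j) (P (m + 1) (j + 1)) \<and>
      bounded_map (\<psi> j) (carrier (F m j)) sup_norm sup_norm) \<and>
    (\<forall>j<m. \<forall>g\<in>carrier (F m j). D (j + 1) (\<psi> j g) = (\<lambda>x. \<ominus>\<^bsub>A\<^esub> \<psi> (j + 1) (\<delta> g) x)) \<and>
    (\<forall>g\<in>carrier (F m m). D (m + 1) (\<psi> m g) = (\<lambda>_. \<zero>\<^bsub>A\<^esub>) \<and>
      aug (m + 1) (\<psi> m g) = d m (resolution_aug A (C m) g))"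
proof -
  let ?G = "\<lambda>s. F m (m - int s)"
  \<comment> \<open>The map in step \<open>s\<close>. The last two conditions say that it takes cycles (for \<open>s = 0\<close>, all elements) to
    cycles, which is what the next step needs; for \<open>s = 0\<close> it must also lift \<open>d m\<close>.\<close>
  define ok where "ok s \<phi> \<longleftrightarrow> \<phi> \<in> left_hom A (?G s) (P (m + 1) (m - int s + 1)) \<and>
      bounded_map \<phi> (carrier (?G s)) sup_norm sup_norm \<and>
      (s = 0 \<longrightarrow> (\<forall>g\<in>carrier (?G s). D (m + 1) (\<phi> g) = (\<lambda>_. \<zero>\<^bsub>A\<^esub>) \<and>
        aug (m + 1) (\<phi> g) = d m (resolution_aug A (C m) g))) \<and>
      (s \<noteq> 0 \<longrightarrow> (\<forall>g\<in>carrier (?G s). \<delta> g = (\<lambda>_. \<zero>\<^bsub>A\<^esub>) \<longrightarrow> D (m - int s + 1) (\<phi> g) = (\<lambda>_. \<zero>\<^bsub>A\<^esub>)))"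
    for s \<phi>
  define link where "link s \<phi> \<phi>' \<longleftrightarrow>
    (\<forall>g\<in>carrier (?G (Suc s)). D (m - int s) (\<phi>' g) = (\<lambda>x. \<ominus>\<^bsub>A\<^esub> \<phi> (\<delta> g) x))" for s \<phi> \<phi>'
  have base: "\<exists>\<phi>. ok 0 \<phi>"
  proof -
    obtain cd where cd: "cd > 0" "\<forall>x\<in>carrier (C m). \<parallel>d m x\<parallel>\<^bsub>C (m + 1)\<^esub> \<le> cd * \<parallel>x\<parallel>\<^bsub>C m\<^esub>"
      using d_bounded by blast
    obtain b1 where b1: "b1 > 0" "\<forall>f\<in>carrier (P (m + 1) (m + 1)). sup_norm (D (m + 1) f) \<le> b1 * sup_norm f"
      using twistedD(2)[OF D] by blast
    obtain c1 where c1: "c1 > 0" "\<And>f. \<lbrakk>f \<in> carrier (P (m + 2) (m + 2)); D (m + 2) f = (\<lambda>_. \<zero>\<^bsub>A\<^esub>);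
        aug (m + 2) f = \<zero>\<^bsub>C (m + 2)\<^esub>\<rbrakk> \<Longrightarrow>
        \<exists>g\<in>carrier (P (m + 2) (m + 1)). D (m + 1) g = f \<and> sup_norm g \<le> c1 * sup_norm f"
    proof -
      have "m + 2 - 1 = m + 1" by simp
      from twisted_exact[OF D, of "m + 2" "m + 2", unfolded this] show thesis using that by auto
    qed
    define c where "c = max 1 (c1 * b1) * (cd / q)"
    have c: "c > 0" using cd(1) q by (simp add: c_def less_max_iff_disj)
    have "\<exists>v\<in>carrier (P (m + 1) (m + 1)). (D (m + 1) v = (\<lambda>_. \<zero>\<^bsub>A\<^esub>) \<and>
        aug (m + 1) v = d m (resolution_aug A (C m) (basis_vector A b))) \<and> sup_norm v \<le> c"
      if b: "b \<in> R.basis m (nat (m - m))" for b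
    proof -
      have bv: "basis_vector A b \<in> carrier (F m m)" by (rule A.A.basis_vector_closed[OF b])
      let ?a = "resolution_aug A (C m) (basis_vector A b)"
      have a: "?a \<in> carrier (C m)" by (rule left_hom_closed[OF R.aug_hom bv])
      let ?z = "d m ?a"
      have z: "?z \<in> carrier (C (m + 1))" by (rule left_hom_closed[OF d a])
      have "\<parallel>?a\<parallel>\<^bsub>C m\<^esub> \<le> 1"
        using R.aug_le[OF bv] sup_norm_basis_vector[OF b] by linarith
      then have z_le: "\<parallel>?z\<parallel>\<^bsub>C (m + 1)\<^esub> \<le> cd"
        using cd a by (blast intro: le_scaled)
      show ?thesis
      proof (cases "m + 1 \<le> top")
        case False
        then have "?z = \<zero>\<^bsub>C (m + 1)\<^esub>" using z C_top[of "m + 1"] by simp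
        moreover have "aug (m + 1) (\<lambda>_. \<zero>\<^bsub>A\<^esub>) = \<zero>\<^bsub>C (m + 1)\<^esub>"
          using aug_zero[OF free_zero_closed, of "m + 1"] False by simp
        moreover have "D (m + 1) (\<lambda>_. \<zero>\<^bsub>A\<^esub>) = (\<lambda>_. \<zero>\<^bsub>A\<^esub>)"
          by (rule free_hom_zero[OF twistedD(1)[OF D]])
        ultimately show ?thesis
          using c free_zero_closed by (intro bexI[of _ "\<lambda>_. \<zero>\<^bsub>A\<^esub>"]) (simp_all add: sup_norm_zero)
      next
        case True
        \<comment> \<open>A lift \<open>X\<close> of \<open>d m\<close> applied to the augmentation need not be a cycle. Its boundary maps to \<open>0\<close> in
          \<open>C (m + 2)\<close>, so it is the boundary of some \<open>Y\<close> in \<open>P (m + 2)\<close>, and \<open>Y\<close> has augmentation \<open>0\<close> in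
          degree \<open>m + 1\<close>.\<close>
        obtain X where X: "X \<in> carrier (P (m + 1) (m + 1))" "aug (m + 1) X = ?z"
          "sup_norm X \<le> 1 / q * \<parallel>?z\<parallel>\<^bsub>C (m + 1)\<^esub>"
          using aug_preimage[OF z order_refl True] by blast
        have X_le: "sup_norm X \<le> cd / q"
          using X(3) mult_left_mono[OF z_le, of "1 / q"] q by simp
        let ?W = "D (m + 1) X"
        have "?W \<in> carrier (P (m + 1) (m + 1 + 1))" by (rule twistedD(5)[OF D order_refl X(1)])
        then have W: "?W \<in> carrier (P (m + 2) (m + 2))"
          using P_eq[of "m + 1" "m + 2"] by (simp add: add.assoc)
        have "D (m + 2) ?W = (\<lambda>_. \<zero>\<^bsub>A\<^esub>)"
          using twistedD(3)[OF D X(1)] by (simp add: add.assoc)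
        moreover have "aug (m + 2) ?W = \<zero>\<^bsub>C (m + 2)\<^esub>"
          using twistedD(4)[OF D order_refl X(1)] X(2) d_d[OF a] by (simp add: add.assoc)
        ultimately obtain Y where Y: "Y \<in> carrier (P (m + 2) (m + 1))" "D (m + 1) Y = ?W"
          "sup_norm Y \<le> c1 * sup_norm ?W"
          using c1(2)[OF W] by blast
        have Y1: "Y \<in> carrier (P (m + 1) (m + 1))" using Y(1) P_mono[of "m + 1" "m + 2" "m + 1"] by auto
        let ?v = "\<lambda>x. X x \<ominus>\<^bsub>A\<^esub> Y x"
        have v: "?v \<in> carrier (P (m + 1) (m + 1))" by (rule free_diff_closed[OF X(1) Y1])
        have WA: "?W x \<in> carrier A" for x by (rule free_closed_value[OF W])
        have "D (m + 1) ?v = (\<lambda>x. ?W x \<ominus>\<^bsub>A\<^esub> ?W x)"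
          using free_hom_diff[OF twistedD(1)[OF D] X(1) Y1] Y(2) by simp
        then have "D (m + 1) ?v = (\<lambda>_. \<zero>\<^bsub>A\<^esub>)"
          using WA by (simp add: A.minus_eq A.r_neg)
        moreover have "aug (m + 1) ?v = ?z"
        proof -
          interpret N: left_module A "C (m + 1)" by (rule left_C)
          have "aug (m + 1) (X \<ominus>\<^bsub>P (m + 1) (m + 1)\<^esub> Y) = aug (m + 1) X \<ominus>\<^bsub>C (m + 1)\<^esub> aug (m + 1) Y"
            by (rule left_hom_minus[OF aug_hom left_module.axioms(2)[OF left_free]
                  N.M.abelian_group_axioms X(1) Y1])
          also have "aug (m + 1) Y = \<zero>\<^bsub>C (m + 1)\<^esub>" using aug_zero[OF Y(1)] by simp
          also have "aug (m + 1) X \<ominus>\<^bsub>C (m + 1)\<^esub> \<zero>\<^bsub>C (m + 1)\<^esub> = ?z"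
            using z X(2) N.M.add.inv_one by (simp add: N.M.minus_eq)
          finally show ?thesis by (simp only: A.A.free_module_minus[OF Y1])
        qed
        moreover have "sup_norm ?v \<le> c"
        proof -
          have "sup_norm Y \<le> c1 * (b1 * sup_norm X)"
            using Y(3) b1(2) X(1) c1(1) by (meson mult_left_mono less_imp_le order_trans)
          also have "\<dots> \<le> c1 * b1 * (cd / q)"
            using X_le b1(1) c1(1) by (simp add: mult.assoc mult_left_mono del: times_divide_eq_right)
          finally have Y_le: "sup_norm Y \<le> c1 * b1 * (cd / q)" .
          have pos: "0 \<le> cd / q" using cd(1) q by simp
          have "sup_norm X \<le> c"
            using X_le mult_right_mono[OF max.cobounded1[of 1 "c1 * b1"] pos] unfolding c_def by linarith
          moreover have "sup_norm Y \<le> c"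
            using Y_le mult_right_mono[OF max.cobounded2[of "c1 * b1" 1] pos] unfolding c_def by linarith
          ultimately have "max (sup_norm X) (sup_norm Y) \<le> c" by simp
          then show ?thesis using sup_norm_diff[OF X(1) Y1] by linarith
        qed
        ultimately show ?thesis using v by blast
      qed
    qed
    note ex_v = this
    have "\<exists>\<phi>\<in>left_hom A (F m m) (P (m + 1) (m + 1)).
      (\<forall>b\<in>R.basis m (nat (m - m)). D (m + 1) (\<phi> (basis_vector A b)) = (\<lambda>_. \<zero>\<^bsub>A\<^esub>) \<and>
        aug (m + 1) (\<phi> (basis_vector A b)) = d m (resolution_aug A (C m) (basis_vector A b))) \<and>
      bounded_map \<phi> (carrier (F m m)) sup_norm sup_norm"
      by (rule ex_bounded_hom[OF normed_left_free_module c]) (rule ex_v)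
    then obtain \<phi> where \<phi>h: "\<phi> \<in> left_hom A (F m m) (P (m + 1) (m + 1))"
      and \<phi>b: "\<forall>b\<in>R.basis m (nat (m - m)). D (m + 1) (\<phi> (basis_vector A b)) = (\<lambda>_. \<zero>\<^bsub>A\<^esub>) \<and>
        aug (m + 1) (\<phi> (basis_vector A b)) = d m (resolution_aug A (C m) (basis_vector A b))"
      and \<phi>le: "bounded_map \<phi> (carrier (F m m)) sup_norm sup_norm"
      by (elim bexE conjE) (rule that)
    note \<phi> = \<phi>h conjunct1[OF bspec[OF \<phi>b]] conjunct2[OF bspec[OF \<phi>b]] \<phi>le
    have "D (m + 1) (\<phi> g) = (\<lambda>_. \<zero>\<^bsub>A\<^esub>)" if g: "g \<in> carrier (F m m)" for g
      by (rule A.A.left_hom_free_module_eq[OF left_free left_hom_comp[OF \<phi>(1) twistedD(1)[OF D]]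
            free_zero_hom \<phi>(2) g])
    moreover have "aug (m + 1) (\<phi> g) = d m (resolution_aug A (C m) g)" if g: "g \<in> carrier (F m m)" for g
      by (rule A.A.left_hom_free_module_eq[OF left_C left_hom_comp[OF \<phi>(1) aug_hom]
            left_hom_comp[OF R.aug_hom d] \<phi>(3) g])
    ultimately have main: "\<forall>g\<in>carrier (F m m). D (m + 1) (\<phi> g) = (\<lambda>_. \<zero>\<^bsub>A\<^esub>) \<and>
        aug (m + 1) (\<phi> g) = d m (resolution_aug A (C m) g)"
      by (intro ballI conjI)
    have e: "m - int 0 = m" by simp
    have "ok 0 \<phi>"
      unfolding ok_def e
      by (rule conjI[OF \<phi>(1) conjI[OF \<phi>(4) conjI[OF impI[OF main]]]]) (rule impI, erule notE, rule refl)
    then show ?thesis by blast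
  qed
  have step: "\<exists>\<phi>'. ok (Suc s) \<phi>' \<and> link s \<phi> \<phi>'" if \<phi>: "ok s \<phi>" for s \<phi>
  proof -
    let ?j = "m - int s"
    have \<phi>h: "\<phi> \<in> left_hom A (?G s) (P (m + 1) (?j + 1))" using \<phi> by (simp add: ok_def)
    obtain c\<phi> where c\<phi>: "c\<phi> > 0" "\<forall>g\<in>carrier (?G s). sup_norm (\<phi> g) \<le> c\<phi> * sup_norm g"
      using \<phi> by (auto simp: ok_def bounded_map_def)
    have e: "m - int (Suc s) = ?j - 1" by simp
    have \<delta>h: "\<delta> \<in> left_hom A (?G (Suc s)) (?G s)" using delta_hom[of "?j - 1" m] by (simp add: algebra_simps)
    obtain c1 where c1: "c1 > 0" "\<And>f. \<lbrakk>f \<in> carrier (P (m + 1) (?j + 1)); D (?j + 1) f = (\<lambda>_. \<zero>\<^bsub>A\<^esub>);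
        ?j + 1 = m + 1 \<longrightarrow> aug (?j + 1) f = \<zero>\<^bsub>C (?j + 1)\<^esub>\<rbrakk> \<Longrightarrow>
        \<exists>g\<in>carrier (P (m + 1) ?j). D ?j g = f \<and> sup_norm g \<le> c1 * sup_norm f"
      using twisted_exact[OF D, of "m + 1" "?j + 1"] by auto
    have Dj: "D ?j \<in> left_hom A (P (m + 1) ?j) (P (m + 1) (?j + 1))" by (rule twistedD(1)[OF D])
    have "\<exists>v\<in>carrier (P (m + 1) ?j). D ?j v = (\<lambda>x. \<ominus>\<^bsub>A\<^esub> \<phi> (\<delta> (basis_vector A b)) x) \<and> sup_norm v \<le> c1 * c\<phi>"
      if b: "b \<in> R.basis m (nat (m - (m - int (Suc s))))" for b
    proof -
      have bv: "basis_vector A b \<in> carrier (?G (Suc s))" by (rule A.A.basis_vector_closed[OF b])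
      let ?g = "\<delta> (basis_vector A b)"
      have g: "?g \<in> carrier (?G s)" by (rule left_hom_closed[OF \<delta>h bv])
      have "sup_norm ?g \<le> 1"
        using delta_le[OF _ bv] sup_norm_basis_vector[OF b] by simp
      then have X_le: "sup_norm (\<phi> ?g) \<le> c\<phi>"
        using c\<phi> g by (blast intro: le_scaled)
      have X: "\<phi> ?g \<in> carrier (P (m + 1) (?j + 1))" by (rule left_hom_closed[OF \<phi>h g])
      have DX: "D (?j + 1) (\<phi> ?g) = (\<lambda>_. \<zero>\<^bsub>A\<^esub>)"
      proof (cases "s = 0")
        case True
        then show ?thesis using \<phi> g by (simp add: ok_def)
      next
        case False
        have "m - int (Suc s) + 1 < m" using False by simp
        then have "\<delta> ?g = (\<lambda>_. \<zero>\<^bsub>A\<^esub>)" using delta_delta[OF _ bv] by blast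
        then show ?thesis using \<phi> g False by (simp add: ok_def)
      qed
      have "aug (?j + 1) (\<phi> ?g) = \<zero>\<^bsub>C (?j + 1)\<^esub>" if "?j + 1 = m + 1"
      proof -
        have s: "s = 0" using that by simp
        have "basis_vector A b \<in> carrier (F m (m - 1))" using bv s by simp
        then have "resolution_aug A (C m) ?g = \<zero>\<^bsub>C m\<^esub>" by (rule aug_delta)
        then have "aug (m + 1) (\<phi> ?g) = d m \<zero>\<^bsub>C m\<^esub>" using \<phi> g s by (simp add: ok_def)
        also have "\<dots> = \<zero>\<^bsub>C (m + 1)\<^esub>"
          by (rule left_hom_zero[OF d left_module.axioms(2)[OF left_C] left_module.axioms(2)[OF left_C]])
        finally show ?thesis using s by simp
      qed
      then obtain Y where Y: "Y \<in> carrier (P (m + 1) ?j)" "D ?j Y = \<phi> ?g" "sup_norm Y \<le> c1 * sup_norm (\<phi> ?g)"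
        using c1(2)[OF X DX] by blast
      have "D ?j (\<lambda>x. \<ominus>\<^bsub>A\<^esub> Y x) = (\<lambda>x. \<ominus>\<^bsub>A\<^esub> \<phi> ?g x)"
        using free_hom_uminus[OF Dj Y(1)] Y(2) by simp
      moreover have "sup_norm (\<lambda>x. \<ominus>\<^bsub>A\<^esub> Y x) \<le> c1 * c\<phi>"
        unfolding sup_norm_uminus[OF Y(1)]
        by (rule order_trans[OF Y(3) mult_left_mono[OF X_le less_imp_le[OF c1(1)]]])
      ultimately show ?thesis using free_uminus_closed[OF Y(1)] by blast
    qed
    note ex_v = this
    have c: "0 < c1 * c\<phi>" using c1(1) c\<phi>(1) by simp
    have "\<exists>\<phi>'\<in>left_hom A (?G (Suc s)) (P (m + 1) ?j).
      (\<forall>b\<in>R.basis m (nat (m - (m - int (Suc s)))).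
        D ?j (\<phi>' (basis_vector A b)) = (\<lambda>x. \<ominus>\<^bsub>A\<^esub> \<phi> (\<delta> (basis_vector A b)) x)) \<and>
      bounded_map \<phi>' (carrier (?G (Suc s))) sup_norm sup_norm"
      by (rule ex_bounded_hom[OF normed_left_free_module c]) (rule ex_v)
    then obtain \<phi>' where \<phi>'h: "\<phi>' \<in> left_hom A (?G (Suc s)) (P (m + 1) ?j)"
      and \<phi>'b: "\<forall>b\<in>R.basis m (nat (m - (m - int (Suc s)))).
        D ?j (\<phi>' (basis_vector A b)) = (\<lambda>x. \<ominus>\<^bsub>A\<^esub> \<phi> (\<delta> (basis_vector A b)) x)"
      and \<phi>'le: "bounded_map \<phi>' (carrier (?G (Suc s))) sup_norm sup_norm"
      by (elim bexE conjE) (rule that)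
    note \<phi>' = \<phi>'h bspec[OF \<phi>'b] \<phi>'le
    have link: "D ?j (\<phi>' g) = (\<lambda>x. \<ominus>\<^bsub>A\<^esub> \<phi> (\<delta> g) x)" if g: "g \<in> carrier (?G (Suc s))" for g
      by (rule A.A.left_hom_free_module_eq[OF left_free left_hom_comp[OF \<phi>'(1) Dj]
            left_hom_comp[OF left_hom_comp[OF \<delta>h \<phi>h] uminus_hom] \<phi>'(2) g])
    have "D (m - int (Suc s) + 1) (\<phi>' g) = (\<lambda>_. \<zero>\<^bsub>A\<^esub>)"
      if g: "g \<in> carrier (?G (Suc s))" "\<delta> g = (\<lambda>_. \<zero>\<^bsub>A\<^esub>)" for g
      using link[OF g(1)] g(2) free_hom_zero[OF \<phi>h] A.A.minus_zero by simp
    then have "ok (Suc s) \<phi>'"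
      using \<phi>'(1,3) unfolding ok_def by simp
    moreover have "link s \<phi> \<phi>'" unfolding link_def using link by blast
    ultimately show ?thesis by blast
  qed
  obtain \<Phi> where \<Phi>: "\<And>s. ok s (\<Phi> s)" "\<And>s. link s (\<Phi> s) (\<Phi> (Suc s))"
    using dependent_nat_choice[of ok link, OF base step] by blast
  have j: "m - int (nat (m - j)) = j" if "j \<le> m" for j using that by simp
  show ?thesis
  proof (intro exI[of _ "\<lambda>j. \<Phi> (nat (m - j))"] conjI allI impI ballI)
    fix j assume "j \<le> m"
    then show "\<Phi> (nat (m - j)) \<in> left_hom A (F m j) (P (m + 1) (j + 1))"
      "bounded_map (\<Phi> (nat (m - j))) (carrier (F m j)) sup_norm sup_norm"
      using \<Phi>(1)[of "nat (m - j)"] unfolding ok_def j[OF \<open>j \<le> m\<close>] by blast+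
  next
    fix j g assume jm: "j < m" and g: "g \<in> carrier (F m j)"
    have s: "nat (m - j) = Suc (nat (m - (j + 1)))" using jm by simp
    have e: "m - int (nat (m - (j + 1))) = j + 1" "m - int (Suc (nat (m - (j + 1)))) = j" using jm by simp_all
    show "D (j + 1) (\<Phi> (nat (m - j)) g) = (\<lambda>x. \<ominus>\<^bsub>A\<^esub> \<Phi> (nat (m - (j + 1))) (\<delta> g) x)"
      by (rule bspec[OF \<Phi>(2)[of "nat (m - (j + 1))", unfolded link_def e, folded s] g])
  next
    fix g assume "g \<in> carrier (F m m)"
    then show "D (m + 1) (\<Phi> (nat (m - m)) g) = (\<lambda>_. \<zero>\<^bsub>A\<^esub>)"
      "aug (m + 1) (\<Phi> (nat (m - m)) g) = d m (resolution_aug A (C m) g)"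
      using \<Phi>(1)[of 0] unfolding ok_def by simp_all
  qed
qed

lemma left_hom_P_mono: "\<lbrakk>h \<in> left_hom A N (P m' j); m \<le> m'\<rbrakk> \<Longrightarrow> h \<in> left_hom A N (P m j)"
  using P_mono[of m m' j] by (auto simp: left_hom_def)

text \<open>On the new resolution the differential is \<open>\<delta> + \<psi>\<close>, on the others it is \<open>D\<close>. Its square vanishes
  because \<open>D \<psi> = - \<psi> \<delta>\<close>.\<close>

lemma twisted_extend:
  assumes D: "twisted D (m + 1)" and top: "m \<le> top"
  shows "\<exists>D'. twisted D' m"
proof -
  obtain \<psi> where \<psi>_hom: "\<And>j. j \<le> m \<Longrightarrow> \<psi> j \<in> left_hom A (F m j) (P (m + 1) (j + 1))"
    and \<psi>_bounded: "\<And>j. j \<le> m \<Longrightarrow> bounded_map (\<psi> j) (carrier (F m j)) sup_norm sup_norm"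
    and D\<psi>: "\<And>j g. \<lbrakk>j < m; g \<in> carrier (F m j)\<rbrakk> \<Longrightarrow> D (j + 1) (\<psi> j g) = (\<lambda>x. \<ominus>\<^bsub>A\<^esub> \<psi> (j + 1) (\<delta> g) x)"
    and D\<psi>m: "\<And>g. g \<in> carrier (F m m) \<Longrightarrow> D (m + 1) (\<psi> m g) = (\<lambda>_. \<zero>\<^bsub>A\<^esub>)"
    and aug\<psi>: "\<And>g. g \<in> carrier (F m m) \<Longrightarrow> aug (m + 1) (\<psi> m g) = d m (resolution_aug A (C m) g)"
    using ex_connecting[OF D] by blast
  \<comment> \<open>The part of the differential that stays in the new resolution; its target is \<open>0\<close> from degree \<open>m + 1\<close>
    on.\<close>
  define T where "T j f = (if j < m then ins m (\<delta> (pr m f)) else (\<lambda>_. \<zero>\<^bsub>A\<^esub>))" for j f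
  define S where "S j f = (\<lambda>x. \<psi> j (pr m f) x \<oplus>\<^bsub>A\<^esub> D j (res (m + 1) f) x)" for j f
  define D' where "D' j f = (if j \<le> m then (\<lambda>x. T j f x \<oplus>\<^bsub>A\<^esub> S j f x) else D j f)" for j f
  have T_hom: "T j \<in> left_hom A (P m j) (P m (j + 1))" if "j \<le> m" for j
  proof (cases "j < m")
    case True
    then have "(\<lambda>f. ins m (\<delta> (pr m f))) \<in> left_hom A (P m j) (P m (j + 1))"
      using top by (intro left_hom_comp[OF left_hom_comp[OF pr_hom delta_hom[OF True]] ins_hom]) auto
    then show ?thesis using True by (simp add: T_def[abs_def])
  next
    case False
    then show ?thesis using free_zero_hom by (simp add: T_def[abs_def])
  qed
  have S1: "(\<lambda>f. \<psi> j (pr m f)) \<in> left_hom A (P m j) (P (m + 1) (j + 1))" if "j \<le> m" for j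
    by (rule left_hom_comp[OF pr_hom \<psi>_hom[OF that]])
  have S2: "(\<lambda>f. D j (res (m + 1) f)) \<in> left_hom A (P m j) (P (m + 1) (j + 1))" for j
    by (rule left_hom_comp[OF res_hom twistedD(1)[OF D]])
  have S_hom: "S j \<in> left_hom A (P m j) (P (m + 1) (j + 1))" if "j \<le> m" for j
    unfolding S_def[abs_def] by (rule free_sum_hom[OF S1[OF that] S2])
  have S_hom': "S j \<in> left_hom A (P m j) (P m (j + 1))" if "j \<le> m" for j
    by (rule left_hom_P_mono[OF S_hom[OF that]]) simp
  have D'_le: "D' j = (\<lambda>f x. T j f x \<oplus>\<^bsub>A\<^esub> S j f x)" if "j \<le> m" for j
    using that by (simp add: D'_def[abs_def])
  have P_above: "P m j = P (m + 1) j" if "m < j" for j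
    using P_eq[of m j] P_eq[of "m + 1" j] that by simp
  have D'_gt: "D' j = D j" if "m < j" for j
    using that by (simp add: D'_def[abs_def])
  have hom: "D' j \<in> left_hom A (P m j) (P m (j + 1))" for j
  proof (cases "j \<le> m")
    case True
    then show ?thesis unfolding D'_le[OF True] by (intro free_sum_hom T_hom S_hom')
  next
    case False
    then show ?thesis using twistedD(1)[OF D, of j] P_above[of j] P_above[of "j + 1"] D'_gt[of j] by simp
  qed
  have bounded: "bounded_map (D' j) (carrier (P m j)) sup_norm sup_norm" for j
  proof (cases "j \<le> m")
    case True
    have T: "bounded_map (T j) (carrier (P m j)) sup_norm sup_norm"
    proof (rule bounded_mapI[of 1])
      fix f assume f: "f \<in> carrier (P m j)"
      show "sup_norm (T j f) \<le> 1 * sup_norm f"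
      proof (cases "j < m")
        case True
        note g = pr_closed[OF f, of m]
        have "sup_norm (ins m (\<delta> (pr m f))) \<le> sup_norm (\<delta> (pr m f))"
          using True top by (intro ins_le[of m "j + 1"] left_hom_closed[OF delta_hom[OF True] g]) auto
        then show ?thesis
          using delta_le[OF True g] pr_le[OF f, of m] True by (simp add: T_def)
      qed (use f in \<open>simp add: T_def sup_norm_zero sup_norm_nonneg\<close>)
    qed simp
    have pr: "bounded_map (pr m) (carrier (P m j)) sup_norm sup_norm"
      by (rule bounded_mapI[of 1]) (use pr_le in auto)
    have res: "bounded_map (res (m + 1)) (carrier (P m j)) sup_norm sup_norm"
      by (rule bounded_mapI[of 1]) (use res_le in auto)
    have Dj: "bounded_map (D j) (carrier (P (m + 1) j)) sup_norm sup_norm"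
      using D by (simp add: twisted_def)
    have S: "bounded_map (S j) (carrier (P m j)) sup_norm sup_norm"
      unfolding S_def[abs_def]
      by (rule bounded_map_sum[OF bounded_map_comp[OF pr \<psi>_bounded[OF True] pr_closed]
            bounded_map_comp[OF res Dj res_closed] left_hom_closed[OF S1[OF True]] left_hom_closed[OF S2]
            sup_norm_nonneg])
    show ?thesis
      unfolding D'_le[OF True]
      by (rule bounded_map_sum[OF T S left_hom_closed[OF T_hom[OF True]] left_hom_closed[OF S_hom'[OF True]]
            sup_norm_nonneg])
  next
    case False
    then show ?thesis using D P_above[of j] D'_gt[of j] by (simp add: twisted_def)
  qed
  have T_low: "T j f = (\<lambda>_. \<zero>\<^bsub>A\<^esub>)" if "f \<in> carrier (P (m + 1) j)" for j f
  proof (cases "j < m")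
    case True
    have "pr m f = (\<lambda>_. \<zero>\<^bsub>A\<^esub>)" using pr_zero[OF that, of m] by simp
    then have "\<delta> (pr m f) = (\<lambda>_. \<zero>\<^bsub>A\<^esub>)" using free_hom_zero[OF delta_hom[OF True]] by simp
    then show ?thesis by (auto simp: T_def ins_def)
  qed (simp add: T_def)
  have D'_low: "D' j f = D j f" if f: "f \<in> carrier (P (m + 1) j)" for j f
  proof (cases "j \<le> m")
    case True
    have "pr m f = (\<lambda>_. \<zero>\<^bsub>A\<^esub>)" using pr_zero[OF f, of m] by simp
    then have "\<psi> j (pr m f) = (\<lambda>_. \<zero>\<^bsub>A\<^esub>)" using free_hom_zero[OF \<psi>_hom[OF True]] by simp
    moreover have "res (m + 1) f = f" by (rule res_id[OF f order_refl])
    moreover have "D j f x \<in> carrier A" for x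
      by (rule free_closed_value[OF twistedD(5)[OF D order_refl f]])
    ultimately show ?thesis by (simp add: D'_le[OF True] T_low[OF f] S_def)
  qed (simp add: D'_def)
  have pr_D': "pr m (D' j f) = \<delta> (pr m f)" if f: "f \<in> carrier (P m j)" and j: "j < m" for j f
  proof -
    have "pr m (S j f) = (\<lambda>_. \<zero>\<^bsub>A\<^esub>)"
      using pr_zero[OF left_hom_closed[OF S_hom[of j] f], of m] j by simp
    then have "S j f (m, x) = \<zero>\<^bsub>A\<^esub>" for x by (simp add: pr_def fun_eq_iff)
    moreover have "\<delta> (pr m f) x \<in> carrier A" for x
      by (rule free_closed_value[OF left_hom_closed[OF delta_hom[OF j] pr_closed[OF f]]])
    moreover have "T j f (m, x) = \<delta> (pr m f) x" for x using j by (simp add: T_def ins_def)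
    moreover have "D' j f (m, x) = T j f (m, x) \<oplus>\<^bsub>A\<^esub> S j f (m, x)" for x using j by (simp add: D'_le)
    ultimately have "D' j f (m, x) = \<delta> (pr m f) x" for x by simp
    then show ?thesis by (simp only: pr_def[of m "D' j f"])
  qed
  have res_D': "res (m + 1) (D' j f) = S j f" if f: "f \<in> carrier (P m j)" and j: "j \<le> m" for j f
  proof -
    have S: "S j f \<in> carrier (P (m + 1) (j + 1))" by (rule left_hom_closed[OF S_hom[OF j] f])
    have "T j f (i, x) = \<zero>\<^bsub>A\<^esub>" if "m + 1 \<le> i" for i x
      using that by (simp add: T_def ins_def)
    moreover have "S j f (i, x) = \<zero>\<^bsub>A\<^esub>" if "\<not> m + 1 \<le> i" for i x
      using S that by (simp add: free_module_carrier total_basis_def)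
    ultimately show ?thesis
      using free_closed_value[OF S] by (auto simp: D'_le[OF j] res_def fun_eq_iff)
  qed
  have DS: "D (j + 1) (S j f) = (\<lambda>x. D (j + 1) (\<psi> j (pr m f)) x)"
    if f: "f \<in> carrier (P m j)" and j: "j \<le> m" for j f
  proof -
    have \<psi>: "\<psi> j (pr m f) \<in> carrier (P (m + 1) (j + 1))" by (rule left_hom_closed[OF S1[OF j] f])
    have Df: "D j (res (m + 1) f) \<in> carrier (P (m + 1) (j + 1))" by (rule left_hom_closed[OF S2 f])
    have "D (j + 1) (S j f) = (\<lambda>x. D (j + 1) (\<psi> j (pr m f)) x \<oplus>\<^bsub>A\<^esub> D (j + 1) (D j (res (m + 1) f)) x)"
      unfolding S_def by (rule free_hom_add[OF twistedD(1)[OF D] \<psi> Df])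
    also have "D (j + 1) (D j (res (m + 1) f)) = (\<lambda>_. \<zero>\<^bsub>A\<^esub>)"
      by (rule twistedD(3)[OF D res_closed[OF f]])
    finally show ?thesis
      using free_closed_value[OF left_hom_closed[OF twistedD(1)[OF D] \<psi>]] by simp
  qed
  have square: "D' (j + 1) (D' j f) = (\<lambda>_. \<zero>\<^bsub>A\<^esub>)" if f: "f \<in> carrier (P m j)" for j f
  proof -
    consider "j < m" | "j = m" | "m < j" by linarith
    then show ?thesis
    proof cases
      case 1
      note g = pr_closed[OF f, of m]
      have dg: "\<delta> (pr m f) \<in> carrier (F m (j + 1))" by (rule left_hom_closed[OF delta_hom[OF 1] g])
      let ?y = "D' j f"
      have "T (j + 1) ?y = (\<lambda>_. \<zero>\<^bsub>A\<^esub>)"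
      proof (cases "j + 1 < m")
        case True
        have "T (j + 1) ?y = ins m (\<delta> (pr m ?y))" using True by (simp only: T_def if_True)
        also have "\<dots> = ins m (\<lambda>_. \<zero>\<^bsub>A\<^esub>)" by (simp only: pr_D'[OF f 1] delta_delta[OF True g])
        finally show ?thesis by (simp add: ins_def fun_eq_iff)
      qed (simp add: T_def)
      moreover have "S (j + 1) ?y = (\<lambda>x. \<psi> (j + 1) (\<delta> (pr m f)) x \<oplus>\<^bsub>A\<^esub> D (j + 1) (S j f) x)"
        using res_D'[OF f] pr_D'[OF f 1] 1 by (simp add: S_def[of "j + 1"])
      moreover have "D (j + 1) (S j f) = (\<lambda>x. \<ominus>\<^bsub>A\<^esub> \<psi> (j + 1) (\<delta> (pr m f)) x)"
        using DS[OF f] D\<psi>[OF 1 g] 1 by simp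
      moreover have "\<psi> (j + 1) (\<delta> (pr m f)) x \<in> carrier A" for x
        using left_hom_closed[OF \<psi>_hom[of "j + 1"] dg, THEN free_closed_value] 1 by simp
      ultimately show ?thesis using 1 by (simp add: D'_le[of "j + 1"] A.r_neg)
    next
      case 2
      note g = pr_closed[OF f, of m]
      have Sf: "S j f \<in> carrier (P (m + 1) (j + 1))" using left_hom_closed[OF S_hom f] 2 by simp
      have "D' j f = S j f"
        using 2 free_closed_value[OF Sf] by (simp add: D'_le T_def)
      then show ?thesis
        using 2 DS[OF f] D\<psi>m[of "pr m f"] g D'_gt[of "j + 1"] by simp
    next
      case 3
      then show ?thesis
        using f twistedD(3)[OF D, of f j] P_above[OF 3] D'_gt[of j] D'_gt[of "j + 1"] by simp
    qed
  qed
  have aug: "aug (j + 1) (D' j f) = d j (aug j f)" if j: "m \<le> j" and f: "f \<in> carrier (P m j)" for j f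
  proof (cases "j = m")
    case False
    then show ?thesis
      using f twistedD(4)[OF D, of j f] P_above[of j] D'_gt[of j] j by simp
  next
    case True
    interpret N: left_module A "C (m + 1)" by (rule left_C)
    note g = pr_closed[OF f, of m, unfolded True]
    have Sf: "S j f \<in> carrier (P (m + 1) (j + 1))" using left_hom_closed[OF S_hom f] True by simp
    have \<psi>: "\<psi> m (pr m f) \<in> carrier (P (m + 1) (m + 1))" by (rule left_hom_closed[OF \<psi>_hom[OF order_refl] g])
    have rf: "res (m + 1) f \<in> carrier (P (m + 1) m)" using res_closed[OF f] True by simp
    have Df: "D m (res (m + 1) f) \<in> carrier (P (m + 1) (m + 1))" by (rule twistedD(5)[OF D order_refl rf])
    have "D' j f = S j f"
      using True free_closed_value[OF Sf] by (simp add: D'_le T_def)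
    then have "aug (m + 1) (D' m f) = aug (m + 1) (\<psi> m (pr m f) \<oplus>\<^bsub>P (m + 1) (m + 1)\<^esub> D m (res (m + 1) f))"
      using True by (simp add: S_def)
    also have "\<dots> = aug (m + 1) (\<psi> m (pr m f)) \<oplus>\<^bsub>C (m + 1)\<^esub> aug (m + 1) (D m (res (m + 1) f))"
      by (rule left_hom_add[OF aug_hom \<psi> Df])
    also have "aug (m + 1) (D m (res (m + 1) f)) = \<zero>\<^bsub>C (m + 1)\<^esub>"
    proof -
      have "pr (m + 1) (D m (res (m + 1) f)) = \<delta> (pr (m + 1) (res (m + 1) f))"
        by (rule twistedD(6)[OF D order_refl rf]) simp
      then show ?thesis
        using aug_delta[of "pr (m + 1) (res (m + 1) f)" "m + 1"] pr_closed[OF rf, of "m + 1"]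
        by (simp add: aug_def)
    qed
    finally show ?thesis
      using aug\<psi>[OF g] left_hom_closed[OF aug_hom \<psi>] True by (simp add: aug_def[of m])
  qed
  have filtered: "D' j f \<in> carrier (P i (j + 1)) \<and> (j < i \<longrightarrow> pr i (D' j f) = \<delta> (pr i f))"
    if i: "m \<le> i" and f: "f \<in> carrier (P i j)" for i j f
  proof (cases "i = m")
    case True
    then show ?thesis using left_hom_closed[OF hom] pr_D' f by blast
  next
    case False
    then have i': "m + 1 \<le> i" using i by simp
    have "f \<in> carrier (P (m + 1) j)" using f P_mono[OF i'] by blast
    then have "D' j f = D j f" by (rule D'_low)
    then show ?thesis using twistedD(5,6)[OF D i' f] by simp
  qed
  have "twisted D' m"
    unfolding twisted_def using hom bounded square aug filtered by blast
  then show ?thesis by blast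
qed

text \<open>For \<open>m = top + 1\<close> the total complex is zero; the resolutions are added one at a time from there
  downwards.\<close>

lemma ex_twisted: "m \<le> top + 1 \<Longrightarrow> \<exists>D. twisted D m"
proof (induction rule: int_le_induct)
  case base
  have z: "f = (\<lambda>_. \<zero>\<^bsub>A\<^esub>)" if "top + 1 \<le> i" "f \<in> carrier (P i j)" for i j f
    using P_top[of i j f] that by simp
  interpret N: left_module A "C i" for i by (rule left_C)
  have d0: "d j \<zero>\<^bsub>C j\<^esub> = \<zero>\<^bsub>C (j + 1)\<^esub>" for j
    by (rule left_hom_zero[OF d left_module.axioms(2)[OF left_C] left_module.axioms(2)[OF left_C]])
  have "aug j f = \<zero>\<^bsub>C j\<^esub>" if "top + 1 \<le> j" "f \<in> carrier (P (top + 1) j)" for j f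
    using aug_zero[OF that(2)] that(1) by simp
  moreover have "aug j (\<lambda>_. \<zero>\<^bsub>A\<^esub>) = \<zero>\<^bsub>C j\<^esub>" if "top + 1 \<le> j" for j
    using aug_zero[OF free_zero_closed, of j] that by simp
  moreover have "\<delta> (pr i (\<lambda>_. \<zero>\<^bsub>A\<^esub>)) = (\<lambda>_. \<zero>\<^bsub>A\<^esub>)" if "j < i" for i j
    using free_hom_zero[OF delta_hom[OF that]] by (simp add: pr_def)
  moreover have "bounded_map (\<lambda>_ _. \<zero>\<^bsub>A\<^esub>) (carrier (P (top + 1) j)) sup_norm sup_norm" for j
    by (rule bounded_mapI[of 1]) (simp_all add: sup_norm_zero sup_norm_nonneg)
  ultimately have "twisted (\<lambda>_ _ _. \<zero>\<^bsub>A\<^esub>) (top + 1)"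
    unfolding twisted_def
    by (intro allI conjI ballI impI free_zero_hom free_zero_closed)
      (use z d0 in \<open>auto simp: pr_def dest: z\<close>)
  then show ?case by blast
next
  case (step i)
  then obtain D where "twisted D (i - 1 + 1)" by auto
  then show ?case using twisted_extend[of D "i - 1"] step(1) by simp
qed

end

section \<open>Exactness of the tensored total complex\<close>

context bounded_complex
begin

text \<open>Lifting a preimage under \<open>d\<close> of the augmentation of a cycle reduces the claim to cycles with
  augmentation \<open>0\<close>, for which \<open>twisted_exact\<close> applies. The lift lies in degree \<open>j - 1\<close>, so the resolution
  of \<open>C (j - 1)\<close> must be part of the complex; this is the hypothesis \<open>m < j\<close>.\<close>

lemma P_preimage:
  assumes D: "twisted D m" and j: "m < j"
  shows "\<exists>c>0. \<forall>f\<in>carrier (P m j). D j f = (\<lambda>_. \<zero>\<^bsub>A\<^esub>) \<longrightarrow>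
    (\<exists>g\<in>carrier (P m (j - 1)). D (j - 1) g = f \<and> sup_norm g \<le> c * sup_norm f)"
proof (cases "top < j")
  case True
  show ?thesis
  proof (intro exI[of _ "1::real"] conjI ballI impI)
    fix f assume "f \<in> carrier (P m j)"
    then have "f = (\<lambda>_. \<zero>\<^bsub>A\<^esub>)" using P_top[of m j f] True by simp
    then show "\<exists>g\<in>carrier (P m (j - 1)). D (j - 1) g = f \<and> sup_norm g \<le> 1 * sup_norm f"
      using free_hom_zero[OF twistedD(1)[OF D, of "j - 1"]] free_zero_closed
      by (intro bexI[of _ "\<lambda>_. \<zero>\<^bsub>A\<^esub>"]) simp_all
  qed simp
next
  case False
  have mj: "m \<le> j" "m \<le> j - 1" "j - 1 \<le> top" using j False by simp_all
  obtain cd where cd: "cd > 0" "\<And>x. \<lbrakk>x \<in> carrier (C j); d j x = \<zero>\<^bsub>C (j + 1)\<^esub>\<rbrakk> \<Longrightarrow>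
    \<exists>y\<in>carrier (C (j - 1)). d (j - 1) y = x \<and> \<parallel>y\<parallel>\<^bsub>C (j - 1)\<^esub> \<le> cd * \<parallel>x\<parallel>\<^bsub>C j\<^esub>"
    using ex_preimage by blast
  obtain b where b: "b > 0" "\<And>f. f \<in> carrier (P m (j - 1)) \<Longrightarrow> sup_norm (D (j - 1) f) \<le> b * sup_norm f"
    using twistedD(2)[OF D, of "j - 1"] by blast
  obtain c2 where c2: "c2 > 0" "\<And>f. \<lbrakk>f \<in> carrier (P j j); D j f = (\<lambda>_. \<zero>\<^bsub>A\<^esub>); aug j f = \<zero>\<^bsub>C j\<^esub>\<rbrakk> \<Longrightarrow>
      \<exists>g\<in>carrier (P j (j - 1)). D (j - 1) g = f \<and> sup_norm g \<le> c2 * sup_norm f"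
    using twisted_exact[OF D mj(1) order_refl] by blast
  have Dh: "D (j - 1) \<in> left_hom A (P m (j - 1)) (P m j)" using twistedD(1)[OF D, of "j - 1"] by simp
  define c1 where "c1 = 1 / q * cd"
  have c1: "c1 > 0" using cd(1) q by (simp add: c1_def)
  define c where "c = max c1 (c2 * max 1 (b * c1))"
  have c: "c > 0" using c1 by (simp add: c_def less_max_iff_disj)
  show ?thesis
  proof (intro exI[of _ c] conjI ballI impI c)
    fix f assume f: "f \<in> carrier (P m j)" and Df: "D j f = (\<lambda>_. \<zero>\<^bsub>A\<^esub>)"
    note f0 = sup_norm_nonneg[OF f]
    have a: "aug j f \<in> carrier (C j)" by (rule left_hom_closed[OF aug_hom f])
    have "d j (aug j f) = aug (j + 1) (\<lambda>_. \<zero>\<^bsub>A\<^esub>)" using twistedD(4)[OF D mj(1) f] Df by simp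
    also have "\<dots> = \<zero>\<^bsub>C (j + 1)\<^esub>"
      using left_hom_zero[OF aug_hom[of "j + 1" m] left_module.axioms(2)[OF left_free] left_module.axioms(2)[OF left_C]]
      by simp
    finally obtain y where y: "y \<in> carrier (C (j - 1))" "d (j - 1) y = aug j f"
      "\<parallel>y\<parallel>\<^bsub>C (j - 1)\<^esub> \<le> cd * \<parallel>aug j f\<parallel>\<^bsub>C j\<^esub>"
      using cd(2)[OF a] by blast
    obtain Y where Y: "Y \<in> carrier (P m (j - 1))" "aug (j - 1) Y = y"
      "sup_norm Y \<le> 1 / q * \<parallel>y\<parallel>\<^bsub>C (j - 1)\<^esub>"
      using aug_preimage[OF y(1) mj(2,3)] by blast
    have "\<parallel>y\<parallel>\<^bsub>C (j - 1)\<^esub> \<le> cd * sup_norm f"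
      by (rule order_trans[OF y(3) mult_left_mono[OF aug_le[OF f] less_imp_le[OF cd(1)]]])
    then have "1 / q * \<parallel>y\<parallel>\<^bsub>C (j - 1)\<^esub> \<le> 1 / q * (cd * sup_norm f)"
      using q by (intro mult_left_mono) simp_all
    then have Y_le: "sup_norm Y \<le> c1 * sup_norm f"
      using Y(3) unfolding c1_def mult.assoc by (rule order_trans[rotated])
    have DY: "D (j - 1) Y \<in> carrier (P m j)" by (rule left_hom_closed[OF Dh Y(1)])
    have "sup_norm (D (j - 1) Y) \<le> b * (c1 * sup_norm f)"
      by (rule order_trans[OF b(2)[OF Y(1)] mult_left_mono[OF Y_le less_imp_le[OF b(1)]]])
    then have DY_le: "sup_norm (D (j - 1) Y) \<le> b * c1 * sup_norm f" by (simp only: mult.assoc)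
    let ?f = "\<lambda>x. f x \<ominus>\<^bsub>A\<^esub> D (j - 1) Y x"
    have f': "?f \<in> carrier (P m j)" by (rule free_diff_closed[OF f DY])
    have "sup_norm ?f \<le> max (sup_norm f) (sup_norm (D (j - 1) Y))" by (rule sup_norm_diff[OF f DY])
    also have "\<dots> \<le> max (1 * sup_norm f) (b * c1 * sup_norm f)" using DY_le by (intro max.mono) simp_all
    also have "\<dots> = max 1 (b * c1) * sup_norm f" using f0 by (simp only: max_mult_distrib_right if_True)
    finally have f'_le: "sup_norm ?f \<le> max 1 (b * c1) * sup_norm f" .
    have "D j ?f = (\<lambda>x. D j f x \<ominus>\<^bsub>A\<^esub> D j (D (j - 1) Y) x)"
      by (rule free_hom_diff[OF twistedD(1)[OF D] f DY])
    moreover have "D j (D (j - 1) Y) = (\<lambda>_. \<zero>\<^bsub>A\<^esub>)"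
      using twistedD(3)[OF D Y(1)] by simp
    ultimately have Df': "D j ?f = (\<lambda>_. \<zero>\<^bsub>A\<^esub>)"
      using Df by (simp add: A.minus_eq A.r_neg)
    have "aug j ?f = \<zero>\<^bsub>C j\<^esub>"
    proof -
      interpret N: left_module A "C j" by (rule left_C)
      have "aug j (f \<ominus>\<^bsub>P m j\<^esub> D (j - 1) Y) = aug j f \<ominus>\<^bsub>C j\<^esub> aug j (D (j - 1) Y)"
        by (rule left_hom_minus[OF aug_hom left_module.axioms(2)[OF left_free] N.M.abelian_group_axioms f DY])
      also have "aug j (D (j - 1) Y) = aug j f"
        using twistedD(4)[OF D mj(2) Y(1)] y(2) Y(2) by simp
      also have "aug j f \<ominus>\<^bsub>C j\<^esub> aug j f = \<zero>\<^bsub>C j\<^esub>" using a by (simp add: N.M.minus_eq N.M.r_neg)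
      finally show ?thesis by (simp only: A.A.free_module_minus[OF DY])
    qed
    moreover have "?f \<in> carrier (P j j)" using f' unfolding P_eq[OF mj(1)] .
    ultimately obtain g where g: "g \<in> carrier (P j (j - 1))" "D (j - 1) g = ?f" "sup_norm g \<le> c2 * sup_norm ?f"
      using c2(2)[of ?f] Df' by blast
    have g': "g \<in> carrier (P m (j - 1))" using g(1) P_mono[OF mj(1)] by blast
    have "sup_norm g \<le> c2 * (max 1 (b * c1) * sup_norm f)"
      by (rule order_trans[OF g(3) mult_left_mono[OF f'_le less_imp_le[OF c2(1)]]])
    also have "\<dots> = c2 * max 1 (b * c1) * sup_norm f" by (simp only: mult.assoc)
    also have "\<dots> \<le> c * sup_norm f" unfolding c_def by (intro mult_right_mono max.cobounded2 f0)
    finally have g_le: "sup_norm g \<le> c * sup_norm f" .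
    have "c1 * sup_norm f \<le> c * sup_norm f" unfolding c_def by (intro mult_right_mono max.cobounded1 f0)
    then have Yc: "sup_norm Y \<le> c * sup_norm f" using Y_le by linarith
    let ?G = "\<lambda>x. Y x \<oplus>\<^bsub>A\<^esub> g x"
    have "D (j - 1) ?G = (\<lambda>x. D (j - 1) Y x \<oplus>\<^bsub>A\<^esub> D (j - 1) g x)"
      by (rule free_hom_add[OF Dh Y(1) g'])
    also have "\<dots> = f"
      using free_closed_value[OF f] free_closed_value[OF DY]
      by (simp add: g(2) fun_eq_iff A.minus_eq A.a_lcomm[of "D (j - 1) Y _"] A.r_neg)
    finally have "D (j - 1) ?G = f" .
    moreover have "sup_norm ?G \<le> c * sup_norm f"
      using sup_norm_add[OF Y(1) g'] Yc g_le by linarith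
    ultimately show "\<exists>g\<in>carrier (P m (j - 1)). D (j - 1) g = f \<and> sup_norm g \<le> c * sup_norm f"
      using free_add_closed[OF Y(1) g'] by blast
  qed
qed

text \<open>The identity in degree \<open>j\<close> is \<open>D h + h' D\<close>.\<close>

definition contraction where
  "contraction D m j h h' \<longleftrightarrow> h \<in> left_hom A (P m j) (P m (j - 1)) \<and>
    h' \<in> left_hom A (P m (j + 1)) (P m j) \<and>
    bounded_map h (carrier (P m j)) sup_norm sup_norm \<and>
    (\<forall>f\<in>carrier (P m j). (\<lambda>x. D (j - 1) (h f) x \<oplus>\<^bsub>A\<^esub> h' (D j f) x) = f)"

text \<open>On a basis vector \<open>e\<close> of degree \<open>j\<close>, the element \<open>e - h (D e)\<close> is a cycle. A bounded choice of
  preimages of these cycles defines \<open>k\<close>.\<close>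

lemma contraction_step:
  assumes D: "twisted D m" and j: "m < j" and con: "contraction D m (j + 1) h h'"
  shows "\<exists>k. contraction D m j k h"
proof -
  have h: "h \<in> left_hom A (P m (j + 1)) (P m j)"
    and h': "h' \<in> left_hom A (P m (j + 1 + 1)) (P m (j + 1))"
    and hb: "bounded_map h (carrier (P m (j + 1))) sup_norm sup_norm"
    and eq: "\<And>f. f \<in> carrier (P m (j + 1)) \<Longrightarrow> (\<lambda>x. D j (h f) x \<oplus>\<^bsub>A\<^esub> h' (D (j + 1) f) x) = f"
    using con unfolding contraction_def by simp_all
  obtain c1 where c1: "c1 > 0" "\<And>f. \<lbrakk>f \<in> carrier (P m j); D j f = (\<lambda>_. \<zero>\<^bsub>A\<^esub>)\<rbrakk> \<Longrightarrow>
    \<exists>g\<in>carrier (P m (j - 1)). D (j - 1) g = f \<and> sup_norm g \<le> c1 * sup_norm f"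
    using P_preimage[OF D j] by blast
  note Dj = twistedD(1)[OF D, of j]
  have Dj1: "D (j - 1) \<in> left_hom A (P m (j - 1)) (P m j)" using twistedD(1)[OF D, of "j - 1"] by simp
  have hD: "(\<lambda>f. h (D j f)) \<in> left_hom A (P m j) (P m j)" by (rule left_hom_comp[OF Dj h])
  have Db: "bounded_map (D j) (carrier (P m j)) sup_norm sup_norm"
    using twistedD(2)[OF D, of j] by (simp add: bounded_map_def)
  obtain c2 where c2: "c2 > 0" "\<forall>f\<in>carrier (P m j). sup_norm (h (D j f)) \<le> c2 * sup_norm f"
    using bounded_map_comp[OF Db hb left_hom_closed[OF Dj]] unfolding bounded_map_def by blast
  define c where "c = c1 * max 1 c2"
  have c: "c > 0" using c1(1) by (simp add: c_def less_max_iff_disj)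
  have ex: "\<exists>v\<in>carrier (P m (j - 1)). D (j - 1) v = (\<lambda>x. basis_vector A b x \<ominus>\<^bsub>A\<^esub> h (D j (basis_vector A b)) x) \<and>
    sup_norm v \<le> c" if b: "b \<in> total_basis m j" for b
  proof -
    let ?e = "basis_vector A b"
    have e: "?e \<in> carrier (P m j)" by (rule A.A.basis_vector_closed[OF b])
    have e1: "sup_norm ?e \<le> 1" by (rule sup_norm_basis_vector[OF b])
    have De: "D j ?e \<in> carrier (P m (j + 1))" by (rule left_hom_closed[OF Dj e])
    have k: "h (D j ?e) \<in> carrier (P m j)" by (rule left_hom_closed[OF h De])
    let ?v = "\<lambda>x. ?e x \<ominus>\<^bsub>A\<^esub> h (D j ?e) x"
    have v: "?v \<in> carrier (P m j)" by (rule free_diff_closed[OF e k])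
    have "D (j + 1) (D j ?e) = (\<lambda>_. \<zero>\<^bsub>A\<^esub>)" by (rule twistedD(3)[OF D e])
    then have h'0: "h' (D (j + 1) (D j ?e)) = (\<lambda>_. \<zero>\<^bsub>A\<^esub>)" using free_hom_zero[OF h'] by simp
    have Dk: "D j (h (D j ?e)) x \<in> carrier A" for x
      by (rule free_closed_value[OF left_hom_closed[OF Dj k]])
    have Dke: "D j (h (D j ?e)) = D j ?e"
      using eq[OF De] Dk by (simp add: h'0)
    have "D j ?v = (\<lambda>x. D j ?e x \<ominus>\<^bsub>A\<^esub> D j (h (D j ?e)) x)"
      by (rule free_hom_diff[OF Dj e k])
    then have Dv: "D j ?v = (\<lambda>_. \<zero>\<^bsub>A\<^esub>)"
      unfolding Dke using free_closed_value[OF De] by (simp add: A.minus_eq A.r_neg)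
    have "sup_norm (h (D j ?e)) \<le> c2" using c2(2) e by (intro le_scaled[OF _ e1 c2(1)]) blast
    then have v_le: "sup_norm ?v \<le> max 1 c2"
      using sup_norm_diff[OF e k] e1 by linarith
    obtain w where w: "w \<in> carrier (P m (j - 1))" "D (j - 1) w = ?v" "sup_norm w \<le> c1 * sup_norm ?v"
      using c1(2)[OF v Dv] by blast
    have "sup_norm w \<le> c"
      unfolding c_def by (rule order_trans[OF w(3) mult_left_mono[OF v_le less_imp_le[OF c1(1)]]])
    then show ?thesis using w by blast
  qed
  have "\<exists>k\<in>left_hom A (P m j) (P m (j - 1)).
    (\<forall>b\<in>total_basis m j. D (j - 1) (k (basis_vector A b)) =
      (\<lambda>x. basis_vector A b x \<ominus>\<^bsub>A\<^esub> h (D j (basis_vector A b)) x)) \<and>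
    bounded_map k (carrier (P m j)) sup_norm sup_norm"
    by (rule ex_bounded_hom[OF normed_left_free_module c]) (rule ex)
  then obtain k where k: "k \<in> left_hom A (P m j) (P m (j - 1))"
    and kb: "\<forall>b\<in>total_basis m j. D (j - 1) (k (basis_vector A b)) =
      (\<lambda>x. basis_vector A b x \<ominus>\<^bsub>A\<^esub> h (D j (basis_vector A b)) x)"
    and k_le: "bounded_map k (carrier (P m j)) sup_norm sup_norm"
    by (elim bexE conjE) (rule that)
  have "(\<lambda>x. D (j - 1) (k f) x \<oplus>\<^bsub>A\<^esub> h (D j f) x) = f" if f: "f \<in> carrier (P m j)" for f
  proof (rule A.A.left_hom_free_module_eq[OF left_free free_sum_hom[OF left_hom_comp[OF k Dj1] hD] _ _ f])
    show "(\<lambda>f. f) \<in> left_hom A (P m j) (P m j)" by (rule left_homI) simp_all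
    fix b assume b: "b \<in> total_basis m j"
    have e: "basis_vector A b \<in> carrier (P m j)" by (rule A.A.basis_vector_closed[OF b])
    note v = free_closed_value[OF e] free_closed_value[OF left_hom_closed[OF hD e]]
    show "(\<lambda>x. D (j - 1) (k (basis_vector A b)) x \<oplus>\<^bsub>A\<^esub> h (D j (basis_vector A b)) x) = basis_vector A b"
      unfolding bspec[OF kb b] using v by (simp add: A.minus_eq A.a_assoc A.l_neg)
  qed
  then have "contraction D m j k h"
    unfolding contraction_def by (intro conjI ballI k h k_le)
  then show ?thesis by (rule exI[of _ k])
qed

lemma ex_contraction:
  assumes D: "twisted D m" and j: "m < j"
  shows "\<exists>h h'. contraction D m j h h'"
proof -
  have above: "\<exists>h h'. contraction D m j h h'" if "top < j" for j
  proof -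
    have D0: "D (j - 1) (\<lambda>_. \<zero>\<^bsub>A\<^esub>) = (\<lambda>_. \<zero>\<^bsub>A\<^esub>)" by (rule free_hom_zero[OF twistedD(1)[OF D]])
    have eq: "(\<lambda>x. D (j - 1) (\<lambda>_. \<zero>\<^bsub>A\<^esub>) x \<oplus>\<^bsub>A\<^esub> \<zero>\<^bsub>A\<^esub>) = f" if "f \<in> carrier (P m j)" for f
    proof -
      have "f = (\<lambda>_. \<zero>\<^bsub>A\<^esub>)" using P_top[OF _ that] \<open>top < j\<close> by simp
      then show ?thesis by (simp add: D0)
    qed
    have bd: "bounded_map (\<lambda>_ _. \<zero>\<^bsub>A\<^esub>) (carrier (P m j)) sup_norm sup_norm"
      by (rule bounded_mapI[of 1]) (simp_all add: sup_norm_zero sup_norm_nonneg)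
    have "contraction D m j (\<lambda>_ _. \<zero>\<^bsub>A\<^esub>) (\<lambda>_ _. \<zero>\<^bsub>A\<^esub>)"
      unfolding contraction_def by (intro conjI ballI free_zero_hom bd eq)
    then show ?thesis by (intro exI)
  qed
  show ?thesis
  proof (cases "top < j")
    case False
    then have "j \<le> top + 1" by simp
    then have "m < j \<longrightarrow> (\<exists>h h'. contraction D m j h h')"
    proof (induction rule: int_le_induct)
      case base
      then show ?case using above by simp
    next
      case (step i)
      show ?case
      proof
        assume i: "m < i - 1"
        then have "\<exists>h h'. contraction D m (i - 1 + 1) h h'" using step by simp
        then obtain h h' where "contraction D m (i - 1 + 1) h h'" by (elim exE)
        from contraction_step[OF D i this] show "\<exists>h h'. contraction D m (i - 1) h h'" by (elim exE) (intro exI)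
      qed
    qed
    then show ?thesis using j by simp
  qed (rule above)
qed

lemma P_incl_hom: "m \<le> m' \<Longrightarrow> (\<lambda>f. f) \<in> left_hom A (P m' j) (P m j)"
  using P_mono[of m m' j] by (intro left_homI) auto

lemma P_incl_frags: "\<lbrakk>x \<in> tensor_frags U (P m' j); m \<le> m'\<rbrakk> \<Longrightarrow> x \<in> tensor_frags U (P m j)"
  by (rule tensor_frags_mono[OF _ order_refl P_mono])

lemma P_incl_rel: "\<lbrakk>x \<in> rel (P m' j); m \<le> m'\<rbrakk> \<Longrightarrow> x \<in> rel (P m j)"
  using frag_map_rel[OF left_free left_free P_incl_hom, of m m' x j]
    frag_map_ident[OF rel_frags[OF left_free], of x _ "\<lambda>f. f"] by simp

lemma P_incl_bounded:
  assumes "x \<in> tensor_frags U (P m' j)" "bounded_by (P m' j) sup_norm x r" "m \<le> m'"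
  shows "bounded_by (P m j) sup_norm x r"
  using bounded_by_frag_map[OF left_free left_free P_incl_hom[OF assms(3)] assms(2), where \<nu>' = sup_norm and c = 1]
    frag_map_ident[OF assms(1), of "\<lambda>f. f"] by simp

end

text \<open>The hypotheses under which the tensored resolutions are strictly exact.\<close>

locale torsion_bounded_complex = bounded_complex K av \<pi> p A U C d top
  for K :: "('k, 'x) ring_scheme" and av :: "'k \<Rightarrow> real" and \<pi> :: 'k and p :: nat
    and A :: "('k, 'a, 'y) normed_module_scheme" and U :: "('a, 'u, 'z) normed_module_scheme"
    and C :: "int \<Rightarrow> ('a, 'c, 'w) normed_module_scheme" and d :: "int \<Rightarrow> 'c \<Rightarrow> 'c" and top :: int +
  assumes flat_U: "flat_right_module TYPE(('a, 'c) syzygy) A U"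
    and bounded_Tor: "bounded_torsion K \<pi> (Tor (unit_ball A) (unit_ball U) (unit_ball (C i)) s)"
begin

lemma tensor_delta_preimage:
  assumes j: "j \<le> i"
  shows "\<exists>c>0. \<forall>x\<in>tensor_frags U (F i j). \<forall>r>0. bounded_by (F i j) sup_norm x r \<longrightarrow>
    (if j = i then frag_map (resolution_aug A (C i)) x \<in> rel (C i) else frag_map \<delta> x \<in> rel (F i (j + 1))) \<longrightarrow>
    (\<exists>y\<in>tensor_frags U (F i (j - 1)). x - frag_map \<delta> y \<in> rel (F i j) \<and>
      bounded_by (F i (j - 1)) sup_norm y (c * r))"
proof -
  have s: "nat (i - (j - 1)) = Suc (nat (i - j))" using j by simp
  have cyc: "R.tensor_cycle i (nat (i - j)) x \<longleftrightarrow>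
    (if j = i then frag_map (resolution_aug A (C i)) x \<in> rel (C i) else frag_map \<delta> x \<in> rel (F i (j + 1)))" for x
  proof -
    have "nat (i - j) = 0 \<longleftrightarrow> j = i" "nat (i - j) - 1 = nat (i - (j + 1))" using j by auto
    then show ?thesis unfolding R.tensor_cycle_def by (simp only:)
  qed
  show ?thesis
    using R.strict_tensor_resolution[OF flat_U bounded_Tor, of i "nat (i - j)"] unfolding cyc s .
qed

text \<open>The analogue of \<open>twisted_exact\<close> after tensoring with \<open>U\<close>, by the same induction. Relations now have
  to be restricted to the next submodule of the filtration, which is done by the projection
  \<open>res (i + 1)\<close>.\<close>

lemma tensor_twisted_exact:
  assumes D: "twisted D m" and i: "m \<le> i" and j: "j \<le> i"
  shows "\<exists>c>0. \<forall>x\<in>tensor_frags U (P i j). \<forall>r>0. bounded_by (P i j) sup_norm x r \<longrightarrow>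
    frag_map (D j) x \<in> rel (P i (j + 1)) \<longrightarrow> (j = i \<longrightarrow> frag_map (aug j) x \<in> rel (C j)) \<longrightarrow>
    (\<exists>y\<in>tensor_frags U (P i (j - 1)). x - frag_map (D (j - 1)) y \<in> rel (P i j) \<and>
      bounded_by (P i (j - 1)) sup_norm y (c * r))"
proof -
  let ?S = "\<lambda>i. \<exists>c>0. \<forall>x\<in>tensor_frags U (P i j). \<forall>r>0. bounded_by (P i j) sup_norm x r \<longrightarrow>
    frag_map (D j) x \<in> rel (P i (j + 1)) \<longrightarrow> (j = i \<longrightarrow> frag_map (aug j) x \<in> rel (C j)) \<longrightarrow>
    (\<exists>y\<in>tensor_frags U (P i (j - 1)). x - frag_map (D (j - 1)) y \<in> rel (P i j) \<and>
      bounded_by (P i (j - 1)) sup_norm y (c * r))"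
  have above: "?S i" if "top < i" for i
  proof (intro exI[of _ "1::real"] conjI ballI allI impI)
    fix x r assume x: "x \<in> tensor_frags U (P i j)" and "0 < (r :: real)"
    have "f = \<zero>\<^bsub>P i j\<^esub>" if "f \<in> carrier (P i j)" for f
      using P_top[of i j f] \<open>top < i\<close> that by simp
    then have "frag_map (\<lambda>f. f) x \<in> rel (P i j)" by (rule frag_map_zero[OF left_free x])
    then have "x \<in> rel (P i j)" using frag_map_ident[OF x, of "\<lambda>f. f"] by simp
    then show "\<exists>y\<in>tensor_frags U (P i (j - 1)). x - frag_map (D (j - 1)) y \<in> rel (P i j) \<and>
      bounded_by (P i (j - 1)) sup_norm y (1 * r)"
      by (intro bexI[of _ 0] conjI bounded_by_zero) simp_all
  qed simp
  have descend: "?S i" if IH: "?S (i + 1)" and i: "m \<le> i" "i \<le> top" "j \<le> i" for i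
  proof -
    have ji: "j - 1 \<le> i" "j \<noteq> i + 1" using i(3) by simp_all
    obtain c2 where c2: "c2 > 0" "\<And>x r. \<lbrakk>x \<in> tensor_frags U (P (i + 1) j); 0 < r;
        bounded_by (P (i + 1) j) sup_norm x r; frag_map (D j) x \<in> rel (P (i + 1) (j + 1))\<rbrakk> \<Longrightarrow>
      \<exists>y\<in>tensor_frags U (P (i + 1) (j - 1)). x - frag_map (D (j - 1)) y \<in> rel (P (i + 1) j) \<and>
        bounded_by (P (i + 1) (j - 1)) sup_norm y (c2 * r)"
      using IH ji(2) by blast
    obtain c0 where c0: "c0 > 0" "\<And>x r. \<lbrakk>x \<in> tensor_frags U (F i j); 0 < r; bounded_by (F i j) sup_norm x r;
        if j = i then frag_map (resolution_aug A (C i)) x \<in> rel (C i) else frag_map \<delta> x \<in> rel (F i (j + 1))\<rbrakk> \<Longrightarrow>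
      \<exists>y\<in>tensor_frags U (F i (j - 1)). x - frag_map \<delta> y \<in> rel (F i j) \<and>
        bounded_by (F i (j - 1)) sup_norm y (c0 * r)"
      using tensor_delta_preimage[OF i(3)] by blast
    obtain b where b: "b > 0" "\<And>f. f \<in> carrier (P m (j - 1)) \<Longrightarrow> sup_norm (D (j - 1) f) \<le> b * sup_norm f"
      using twistedD(2)[OF D, of "j - 1"] by blast
    note Dh = twisted_hom[OF D i(1), of j]
    have Dh1: "D (j - 1) \<in> left_hom A (P i (j - 1)) (P i j)" using twisted_hom[OF D i(1), of "j - 1"] by simp
    have ins: "ins i \<in> left_hom A (F i (j - 1)) (P i (j - 1))" by (rule ins_hom[OF order_refl ji(1) i(2)])
    have ins': "ins i \<in> left_hom A (F i j) (P i j)" by (rule ins_hom[OF order_refl i(3) i(2)])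
    define c1 where "c1 = max 1 (b * c0)"
    have c1: "c1 > 0" by (simp add: c1_def less_max_iff_disj)
    define c where "c = max c0 (c2 * c1)"
    have c: "c > 0" using c0(1) by (simp add: c_def less_max_iff_disj)
    have "\<exists>y\<in>tensor_frags U (P i (j - 1)). x - frag_map (D (j - 1)) y \<in> rel (P i j) \<and>
        bounded_by (P i (j - 1)) sup_norm y (c * r)"
      if x: "x \<in> tensor_frags U (P i j)" and r: "0 < r" and xr: "bounded_by (P i j) sup_norm x r"
        and Dx: "frag_map (D j) x \<in> rel (P i (j + 1))" and ax: "j = i \<longrightarrow> frag_map (aug j) x \<in> rel (C j)" for x r
    proof -
      define x1 where "x1 = frag_map (pr i) x"
      have x1: "x1 \<in> tensor_frags U (F i j)" unfolding x1_def by (rule frag_map_closed[OF x pr_closed])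
      have x1r: "bounded_by (F i j) sup_norm x1 r"
        unfolding x1_def using bounded_by_frag_map[OF left_free left_free pr_hom xr, where \<nu>' = sup_norm and c = 1] pr_le by simp
      have "if j = i then frag_map (resolution_aug A (C i)) x1 \<in> rel (C i) else frag_map \<delta> x1 \<in> rel (F i (j + 1))"
      proof (cases "j = i")
        case True
        have "frag_map (resolution_aug A (C i)) x1 = frag_map (aug i) x"
          unfolding x1_def frag_map_comp aug_def ..
        then show ?thesis using ax True by simp
      next
        case False
        have "frag_map \<delta> x1 = frag_map (pr i) (frag_map (D j) x)"
          unfolding x1_def frag_map_comp
          by (rule frag_map_cong[OF x]) (use twistedD(6)[OF D i(1)] i(3) False in simp)
        also have "\<dots> \<in> rel (F i (j + 1))" by (rule frag_map_rel[OF left_free left_free pr_hom Dx])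
        finally show ?thesis using False by simp
      qed
      from c0(2)[OF x1 r x1r this] obtain h where h: "h \<in> tensor_frags U (F i (j - 1))"
        "x1 - frag_map \<delta> h \<in> rel (F i j)" "bounded_by (F i (j - 1)) sup_norm h (c0 * r)" by blast
      define y1 where "y1 = frag_map (ins i) h"
      have y1: "y1 \<in> tensor_frags U (P i (j - 1))"
        unfolding y1_def by (rule frag_map_closed[OF h(1) left_hom_closed[OF ins]])
      have y1r: "bounded_by (P i (j - 1)) sup_norm y1 (c0 * r)"
        unfolding y1_def using bounded_by_frag_map[OF left_free left_free ins h(3), where \<nu>' = sup_norm and c = 1] ins_le[OF i(2) ji(1)] by simp
      define x2 where "x2 = x - frag_map (D (j - 1)) y1"
      have Dy1: "frag_map (D (j - 1)) y1 \<in> tensor_frags U (P i j)"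
        by (rule frag_map_closed[OF y1 left_hom_closed[OF Dh1]])
      have x2: "x2 \<in> tensor_frags U (P i j)" unfolding x2_def by (rule tensor_frags_diff[OF x Dy1])
      have "bounded_by (P i j) sup_norm (frag_map (D (j - 1)) y1) (b * (c0 * r))"
        by (rule bounded_by_frag_map[OF left_free left_free Dh1 y1r])
          (use b P_mono[OF i(1), of "j - 1"] in auto)
      then have "bounded_by (P i j) sup_norm x2 (max r (b * (c0 * r)))"
        unfolding x2_def by (rule bounded_by_diff[OF left_free xr])
      then have x2r: "bounded_by (P i j) sup_norm x2 (c1 * r)"
        using r by (simp add: c1_def max_mult_distrib_right mult.assoc)
      have "frag_map (pr i) (frag_map (D (j - 1)) y1) = frag_map \<delta> h"
        unfolding y1_def frag_map_comp
      proof (rule frag_map_cong[OF h(1)])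
        fix g assume g: "g \<in> carrier (F i (j - 1))"
        show "pr i (D (j - 1) (ins i g)) = \<delta> g"
          using twistedD(6)[OF D i(1) left_hom_closed[OF ins g]] i(3) by simp
      qed
      then have pr_x2: "frag_map (pr i) x2 \<in> rel (F i j)"
        using h(2) by (simp add: x2_def x1_def)
      have Dx2: "frag_map (D j) x2 \<in> rel (P i (j + 1))"
      proof -
        have "frag_map (\<lambda>f. D j (D (j - 1) f)) y1 \<in> rel (P i (j + 1))"
          using twistedD(3)[OF D, of _ "j - 1"] P_mono[OF i(1), of "j - 1"]
          by (intro frag_map_zero[OF left_free y1]) auto
        then show ?thesis
          unfolding x2_def frag_map_diff frag_map_comp by (rule rel_diff[OF left_free Dx])
      qed
      define x3 where "x3 = frag_map (res (i + 1)) x2"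
      have x3: "x3 \<in> tensor_frags U (P (i + 1) j)" unfolding x3_def by (rule frag_map_closed[OF x2 res_closed])
      have x3r: "bounded_by (P (i + 1) j) sup_norm x3 (c1 * r)"
        unfolding x3_def using bounded_by_frag_map[OF left_free left_free res_hom x2r, where \<nu>' = sup_norm and c = 1] res_le by simp
      \<comment> \<open>The two sides differ by the component in the resolution of \<open>C i\<close>, which is zero in the tensor
        product.\<close>
      have x23: "x2 - x3 \<in> rel (P i j)"
      proof -
        have "frag_map (\<lambda>f. ins i (pr i f) \<oplus>\<^bsub>P i j\<^esub> res (i + 1) f) x2 = x2"
          by (rule frag_map_ident[OF x2]) (simp add: split_P[symmetric])
        moreover have "res (i + 1) f \<in> carrier (P i j)" if "f \<in> carrier (P i j)" for f
          using res_closed[OF that] P_mono[of i "i + 1" j] by auto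
        ultimately have "x2 - (frag_map (\<lambda>f. ins i (pr i f)) x2 + x3) \<in> rel (P i j)"
          unfolding x3_def
          using frag_map_sum[where f = "\<lambda>f. ins i (pr i f)" and g = "res (i + 1)",
              OF left_free x2 left_hom_closed[OF left_hom_comp[OF pr_hom ins']]]
          by simp
        moreover have "frag_map (\<lambda>f. ins i (pr i f)) x2 \<in> rel (P i j)"
          using frag_map_rel[OF left_free left_free ins' pr_x2] by (simp only: frag_map_comp)
        ultimately have "x2 - (frag_map (\<lambda>f. ins i (pr i f)) x2 + x3) + frag_map (\<lambda>f. ins i (pr i f)) x2 \<in> rel (P i j)"
          by (rule rel_add)
        then show ?thesis by (simp add: algebra_simps)
      qed
      have "frag_map (D j) x3 \<in> rel (P i (j + 1))"
        using frag_map_rel[OF left_free left_free Dh x23] rel_cong[OF left_free, of "frag_map (D j) x2" "frag_map (D j) x3"] Dx2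
        by simp
      then have "frag_map (res (i + 1)) (frag_map (D j) x3) \<in> rel (P (i + 1) (j + 1))"
        by (rule frag_map_rel[OF left_free left_free res_hom])
      moreover have "frag_map (res (i + 1)) (frag_map (D j) x3) = frag_map (D j) x3"
      proof (rule frag_map_ident)
        have i1: "m \<le> i + 1" using i(1) by simp
        show "frag_map (D j) x3 \<in> tensor_frags U (P (i + 1) (j + 1))"
          by (rule frag_map_closed[OF x3 twistedD(5)[OF D i1]])
      qed (rule res_id[OF _ order_refl])
      ultimately have Dx3: "frag_map (D j) x3 \<in> rel (P (i + 1) (j + 1))" by simp
      have "0 < c1 * r" using c1 r by simp
      from c2(2)[OF x3 this x3r Dx3] obtain y2 where y2: "y2 \<in> tensor_frags U (P (i + 1) (j - 1))"
        "x3 - frag_map (D (j - 1)) y2 \<in> rel (P (i + 1) j)"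
        "bounded_by (P (i + 1) (j - 1)) sup_norm y2 (c2 * (c1 * r))" by blast
      have le: "i \<le> i + 1" by simp
      have y2': "y2 \<in> tensor_frags U (P i (j - 1))" by (rule P_incl_frags[OF y2(1) le])
      have "x2 - frag_map (D (j - 1)) y2 \<in> rel (P i j)"
        by (rule rel_trans[OF x23 P_incl_rel[OF y2(2) le]])
      then have "x - frag_map (D (j - 1)) (y1 + y2) \<in> rel (P i j)"
        by (simp add: x2_def algebra_simps)
      moreover have "bounded_by (P i (j - 1)) sup_norm (y1 + y2) (c * r)"
      proof (rule bounded_by_mono[OF bounded_by_add[OF y1r P_incl_bounded[OF y2(1,3) le]]])
        show "max (c0 * r) (c2 * (c1 * r)) \<le> c * r"
          using r by (simp add: c_def max_mult_distrib_right mult.assoc)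
      qed
      ultimately show ?thesis using tensor_frags_add[OF y1 y2'] by blast
    qed
    then show ?thesis using c by blast
  qed
  show ?thesis
  proof (cases "top < i")
    case True
    then show ?thesis by (rule above)
  next
    case False
    then have "i \<le> top + 1" by simp
    then have "m \<le> i \<longrightarrow> j \<le> i \<longrightarrow> ?S i"
    proof (induction rule: int_le_induct)
      case base
      have "top < top + 1" by simp
      from above[OF this] show ?case by (intro impI)
    next
      case (step i)
      show ?case
      proof (intro impI)
        assume i': "m \<le> i - 1" "j \<le> i - 1"
        have "m \<le> i" "j \<le> i" "i - 1 + 1 = i" using i' by simp_all
        then have "?S (i - 1 + 1)" using step(2) by (simp only: simp_thms)
        moreover have "i - 1 \<le> top" using step(1) by simp
        ultimately show "?S (i - 1)" using i' by (rule_tac descend)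
      qed
    qed
    then show ?thesis using i j by (simp only: simp_thms)
  qed
qed

text \<open>A cycle of \<open>U \<otimes> C\<^sup>j\<close> is lifted to a cycle of \<open>U \<otimes> P\<^sup>j\<close>, where the contraction makes it a boundary.\<close>

lemma strictly_exact: "strictly_exact_at j"
proof (cases "top < j")
  case True
  have "\<exists>y\<in>tensor_frags U (C (j - 1)). x - frag_map (d (j - 1)) y \<in> rel (C j) \<and>
      bounded_by (C (j - 1)) (nrm (C (j - 1))) y (1 * r)"
    if x: "x \<in> tensor_frags U (C j)" for x and r :: real
  proof -
    have "n = \<zero>\<^bsub>C j\<^esub>" if "n \<in> carrier (C j)" for n using C_top[OF True] that by simp
    then have "frag_map (\<lambda>f. f) x \<in> rel (C j)" by (rule frag_map_zero[OF left_C x])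
    then have "x \<in> rel (C j)" using frag_map_ident[OF x, of "\<lambda>f. f"] by simp
    then show ?thesis by (intro bexI[of _ 0] conjI bounded_by_zero) simp_all
  qed
  then show ?thesis unfolding strictly_exact_at_def by (intro exI[of _ "1::real"]) simp
next
  case False
  \<comment> \<open>The contraction has values in degree \<open>j - 1\<close>, which must still augment onto \<open>C (j - 1)\<close>.\<close>
  define m where "m = j - 1"
  have mj: "m \<le> j" "m < j" "m \<le> j - 1" "m \<le> j + 1" "j \<le> top" using False by (simp_all add: m_def)
  have "m \<le> top + 1" using mj by simp
  then obtain D where D: "twisted D m" using ex_twisted by blast
  obtain h h' where con: "contraction D m j h h'" using ex_contraction[OF D mj(2)] by (elim exE)
  have h: "h \<in> left_hom A (P m j) (P m (j - 1))" and h': "h' \<in> left_hom A (P m (j + 1)) (P m j)"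
    and eq: "\<And>f. f \<in> carrier (P m j) \<Longrightarrow> (\<lambda>x. D (j - 1) (h f) x \<oplus>\<^bsub>A\<^esub> h' (D j f) x) = f"
    using con unfolding contraction_def by simp_all
  obtain ch where ch: "ch > 0" "\<And>f. f \<in> carrier (P m j) \<Longrightarrow> sup_norm (h f) \<le> ch * sup_norm f"
    using con unfolding contraction_def bounded_map_def by blast
  obtain b where b: "b > 0" "\<And>f. f \<in> carrier (P m j) \<Longrightarrow> sup_norm (D j f) \<le> b * sup_norm f"
    using twistedD(2)[OF D, of j] by blast
  have P1: "P m (j + 1) = P (j + 1) (j + 1)" by (rule P_eq[OF mj(4)])
  obtain c2 where c2: "c2 > 0" "\<And>x r. \<lbrakk>x \<in> tensor_frags U (P (j + 1) (j + 1)); 0 < r;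
      bounded_by (P (j + 1) (j + 1)) sup_norm x r; frag_map (D (j + 1)) x \<in> rel (P (j + 1) (j + 1 + 1));
      frag_map (aug (j + 1)) x \<in> rel (C (j + 1))\<rbrakk> \<Longrightarrow>
    \<exists>y\<in>tensor_frags U (P (j + 1) j). x - frag_map (D j) y \<in> rel (P (j + 1) (j + 1)) \<and>
      bounded_by (P (j + 1) j) sup_norm y (c2 * r)"
  proof -
    have "j + 1 - 1 = j" by simp
    from tensor_twisted_exact[OF D mj(4) order_refl, unfolded this] show thesis using that by blast
  qed
  note Dj = twistedD(1)[OF D, of j]
  have Dj1: "D (j - 1) \<in> left_hom A (P m (j - 1)) (P m j)" using twistedD(1)[OF D, of "j - 1"] by simp
  have "\<forall>c. \<exists>f. c \<in> carrier (C j) \<longrightarrow> f \<in> carrier (P m j) \<and> aug j f = c \<and> sup_norm f \<le> 1 / q * \<parallel>c\<parallel>\<^bsub>C j\<^esub>"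
    using aug_preimage[OF _ mj(1,5)] by blast
  then obtain l where l: "\<And>c. c \<in> carrier (C j) \<Longrightarrow>
    l c \<in> carrier (P m j) \<and> aug j (l c) = c \<and> sup_norm (l c) \<le> 1 / q * \<parallel>c\<parallel>\<^bsub>C j\<^esub>"
    by (elim choice[THEN exE]) blast
  define c where "c = ch * max (1 / q) (c2 * (b * (1 / q)))"
  have c: "c > 0" using ch(1) q by (simp add: c_def less_max_iff_disj)
  have "\<exists>y\<in>tensor_frags U (C (j - 1)). x - frag_map (d (j - 1)) y \<in> rel (C j) \<and>
      bounded_by (C (j - 1)) (nrm (C (j - 1))) y (c * r)"
    if x: "x \<in> tensor_frags U (C j)" and r: "0 < r" and xr: "bounded_by (C j) (nrm (C j)) x r"
      and dx: "frag_map (d j) x \<in> rel (C (j + 1))" for x r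
  proof -
    obtain x' where x': "x' \<in> tensor_frags U (C j)" "x - x' \<in> rel (C j)" "frag_bounded U (nrm (C j)) x' r"
      using xr by (auto simp: tensor_bounded_def)
    have dx': "frag_map (d j) x' \<in> rel (C (j + 1))"
      using frag_map_rel[OF left_C left_C d x'(2)] rel_cong[OF left_C, of "frag_map (d j) x" "frag_map (d j) x'"] dx by simp
    define X0 where "X0 = frag_map l x'"
    have X0: "X0 \<in> tensor_frags U (P m j)" unfolding X0_def by (rule frag_map_closed[OF x'(1)]) (use l in blast)
    have "frag_bounded U sup_norm X0 (1 / q * r)"
      unfolding X0_def by (rule frag_bounded_frag_map[OF x'(1,3)]) (use l q in auto)
    then have X0r: "bounded_by (P m j) sup_norm X0 (1 / q * r)" by (rule bounded_by_frag[OF X0])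
    have aX0: "frag_map (aug j) X0 = x'"
      unfolding X0_def frag_map_comp by (rule frag_map_ident[OF x'(1)]) (use l in blast)
    define W where "W = frag_map (D j) X0"
    have W: "W \<in> tensor_frags U (P (j + 1) (j + 1))"
      unfolding W_def P1[symmetric] by (rule frag_map_closed[OF X0 left_hom_closed[OF Dj]])
    have Wr: "bounded_by (P (j + 1) (j + 1)) sup_norm W (b * (1 / q * r))"
      unfolding W_def P1[symmetric]
      by (rule bounded_by_frag_map[OF left_free left_free Dj X0r]) (use b in auto)
    have DW: "frag_map (D (j + 1)) W \<in> rel (P (j + 1) (j + 1 + 1))"
      unfolding W_def frag_map_comp using twistedD(3)[OF D]
      by (intro frag_map_zero[OF left_free X0]) simp
    have "frag_map (aug (j + 1)) W = frag_map (d j) (frag_map (aug j) X0)"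
      unfolding W_def frag_map_comp by (rule frag_map_cong[OF X0 twistedD(4)[OF D mj(1)]])
    then have aW: "frag_map (aug (j + 1)) W \<in> rel (C (j + 1))" using dx' aX0 by simp
    have pos: "0 < b * (1 / q * r)" using b(1) q r by simp
    from c2(2)[OF W pos Wr DW aW] obtain Y where Y: "Y \<in> tensor_frags U (P (j + 1) j)"
      "W - frag_map (D j) Y \<in> rel (P (j + 1) (j + 1))"
      "bounded_by (P (j + 1) j) sup_norm Y (c2 * (b * (1 / q * r)))" by blast
    have Y': "Y \<in> tensor_frags U (P m j)" by (rule P_incl_frags[OF Y(1) mj(4)])
    \<comment> \<open>The correction \<open>Y\<close> makes \<open>X\<close> a cycle; as it lies in \<open>P (j + 1)\<close>, it has augmentation \<open>0\<close> in degree \<open>j\<close>.\<close>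
    define X where "X = X0 - Y"
    have X: "X \<in> tensor_frags U (P m j)" unfolding X_def by (rule tensor_frags_diff[OF X0 Y'])
    have Xr: "bounded_by (P m j) sup_norm X (max (1 / q * r) (c2 * (b * (1 / q * r))))"
      unfolding X_def by (rule bounded_by_diff[OF left_free X0r P_incl_bounded[OF Y(1,3) mj(4)]])
    have DX: "frag_map (D j) X \<in> rel (P m (j + 1))"
      using Y(2) unfolding P1 by (simp add: X_def W_def)
    have XhX: "X - frag_map (D (j - 1)) (frag_map h X) \<in> rel (P m j)"
    proof -
      have "frag_map (\<lambda>f. D (j - 1) (h f) \<oplus>\<^bsub>P m j\<^esub> h' (D j f)) X = X"
        by (rule frag_map_ident[OF X]) (simp add: eq)
      then have "X - (frag_map (\<lambda>f. D (j - 1) (h f)) X + frag_map (\<lambda>f. h' (D j f)) X) \<in> rel (P m j)"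
        using frag_map_sum[where f = "\<lambda>f. D (j - 1) (h f)" and g = "\<lambda>f. h' (D j f)",
            OF left_free X left_hom_closed[OF left_hom_comp[OF h Dj1]] left_hom_closed[OF left_hom_comp[OF Dj h']]]
        by simp
      moreover have "frag_map (\<lambda>f. h' (D j f)) X \<in> rel (P m j)"
        using frag_map_rel[OF left_free left_free h' DX] by (simp only: frag_map_comp)
      ultimately have "X - (frag_map (\<lambda>f. D (j - 1) (h f)) X + frag_map (\<lambda>f. h' (D j f)) X) +
          frag_map (\<lambda>f. h' (D j f)) X \<in> rel (P m j)"
        by (rule rel_add)
      then show ?thesis by (simp add: frag_map_comp algebra_simps)
    qed
    have hX: "frag_map h X \<in> tensor_frags U (P m (j - 1))" by (rule frag_map_closed[OF X left_hom_closed[OF h]])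
    have hXr: "bounded_by (P m (j - 1)) sup_norm (frag_map h X) (c * r)"
    proof -
      have "max (1 / q * r) (c2 * (b * (1 / q * r))) = max (1 / q) (c2 * (b * (1 / q))) * r"
        using r by (simp only: max_mult_distrib_right less_imp_le if_True mult.assoc)
      then show ?thesis
        using bounded_by_frag_map[OF left_free left_free h Xr, where \<nu>' = sup_norm and c = ch] ch
        by (simp add: c_def mult.assoc)
    qed
    define y where "y = frag_map (aug (j - 1)) (frag_map h X)"
    have y: "y \<in> tensor_frags U (C (j - 1))"
      unfolding y_def by (rule frag_map_closed[OF hX left_hom_closed[OF aug_hom]])
    have yr: "bounded_by (C (j - 1)) (nrm (C (j - 1))) y (c * r)"
      unfolding y_def using bounded_by_frag_map[OF left_free left_C aug_hom hXr, where \<nu>' = "nrm (C (j - 1))" and c = 1] aug_le by simp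
    have "frag_map (d (j - 1)) y = frag_map (aug j) (frag_map (D (j - 1)) (frag_map h X))"
      unfolding y_def frag_map_comp[of "d (j - 1)"] frag_map_comp[of "aug j" "D (j - 1)"]
      by (rule frag_map_cong[OF hX]) (use twistedD(4)[OF D mj(3)] in simp)
    then have 1: "frag_map (aug j) X - frag_map (d (j - 1)) y \<in> rel (C j)"
      using frag_map_rel[OF left_free left_C aug_hom XhX] by simp
    have "frag_map (aug j) Y \<in> rel (C j)"
      by (rule frag_map_zero[OF left_C Y(1)]) (use aug_zero in auto)
    then have 2: "x' - frag_map (aug j) X \<in> rel (C j)" using aX0 by (simp add: X_def)
    have "x - frag_map (d (j - 1)) y \<in> rel (C j)"
      by (rule rel_trans[OF x'(2) rel_trans[OF 2 1]])
    then show ?thesis using y yr by blast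
  qed
  then show ?thesis unfolding strictly_exact_at_def using c by blast
qed

end

section \<open>Exactness of the completed tensor products\<close>

theorem proposition1p3:
  fixes K :: "'k ring" and av :: "'k \<Rightarrow> real" and \<pi> :: 'k and p :: nat
    and A :: "('k, 'a) normed_module"
    and U :: "('a, 'u) normed_module"
    and C :: "int \<Rightarrow> ('a, 'c) normed_module"
    and d :: "int \<Rightarrow> 'c \<Rightarrow> 'c"
  assumes "mixed_char_dvf K av \<pi> p"
    and "normed_algebra K av A"
    and "normed_right_module K av A U"
    and "flat_right_module TYPE(('a, 'c) syzygy) A U"
    and "\<And>i. normed_left_module K av A (C i)"
    and "\<And>i. d i \<in> bounded_left_hom A (C i) (C (i + 1))"
    and "\<And>i. strict_map (C i) (C (i + 1)) (d i)"
    and "exact_cochain C d"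
    and "bounded_above_cochain C"
  shows "(flat_right_module TYPE(('a, 'c) syzygy) (unit_ball A) (unit_ball U) \<longrightarrow>
      exact_cochain (\<lambda>i. completed_tensor A U (C i))
        (\<lambda>i. completed_tensor_map A U (C (i + 1)) (d i))) \<and>
    ((\<forall>s i. bounded_torsion K \<pi> (Tor (unit_ball A) (unit_ball U) (unit_ball (C i)) s)) \<longrightarrow>
      exact_cochain (\<lambda>i. completed_tensor A U (C i))
        (\<lambda>i. completed_tensor_map A U (C (i + 1)) (d i)))"
proof -
  interpret normed_complex K av \<pi> p A U C d
    by (intro normed_complex.intro dvf_right_module.intro dvf_algebra.intro
        normed_complex_axioms.intro dvf_right_module_axioms.intro assms(1-3,5-8))
  obtain top where top: "\<And>i. top < i \<Longrightarrow> carrier (C i) = {\<zero>\<^bsub>C i\<^esub>}"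
    using assms(9) by (auto simp: bounded_above_cochain_def)
  have bounded: "bounded_complex K av \<pi> p A U C d top"
    by (intro bounded_complex.intro bounded_complex_axioms.intro normed_complex_axioms top)
  show ?thesis
  proof (intro conjI impI exact_completed_tensor)
    fix i
    assume "flat_right_module TYPE(('a, 'c) syzygy) (unit_ball A) (unit_ball U)"
    \<comment> \<open>The universe type of the flatness hypothesis contains \<open>C i\<close> by way of \<open>Gen\<close>.\<close>
    then show "strictly_exact_at i"
      by (rule strictly_exact_of_flat_unit_ball[where j = Gen]) (simp add: inj_def)
  next
    fix i
    assume Tor: "\<forall>s i. bounded_torsion K \<pi> (Tor (unit_ball A) (unit_ball U) (unit_ball (C i)) s)"
    interpret T: torsion_bounded_complex K av \<pi> p A U C d top
      by (intro torsion_bounded_complex.intro torsion_bounded_complex_axioms.intro bounded assms(4)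
          Tor[rule_format])
    show "strictly_exact_at i" by (rule T.strictly_exact)
  qed
qed

end
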